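(* Let $\varepsilon>0$ be fixed. Then for all sufficiently large $T$, $$\int_T^{2T} J_1^m(t,G)\,dt \ll_\varepsilon T^{1+\varepsilon}$$ holds in each of the following cases: $m=1$ or $m=2$ and $T^{\varepsilon}\le G\le T$; $m=3$ and $T^{1/7+\varepsilon}\le G\le T$; $m=4$ and $T^{1/5+\varepsilon}\le G\le T$. The implied constant depends only on $\varepsilon$ (and not on $G$).
   Context: $\zeta$ denotes the Riemann zeta-function. For $k\in\mathbb N$ and $1\ll G\ll T$, $$J_k(T,G):=\frac{1}{\sqrt{\pi}\,G}\int_{-\infty}^{\infty}\bigl|\zeta(\tfrac12+iT+iu)\bigr|^{2k}e^{-(u/G)^2}\,du,$$ and $J_k^m$ denotes its $m$-th power. The notation $A\ll_\varepsilon B$ means $|A|\le C(\varepsilon)B$ for a constant $C(\varepsilon)$ depending only on $\varepsilon$. *)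

theory Defs
  imports "HOL-Analysis.Analysis"
begin

text \<open>Riemann zeta function on the half-plane Re s > 0, via the Dirichlet eta function:
  zeta s = eta s / (1 - 2^(1-s)), eta s = sum_{n>=1} (-1)^(n-1) n^(-s).
  The eta series converges (conditionally) for Re s > 0; on the critical line
  1 - 2^(1-s) is never 0, so this is the analytic continuation of zeta there.\<close>
definition dirichlet_eta :: "complex \<Rightarrow> complex" where
  "dirichlet_eta s = (\<Sum>n. (-1) ^ n / (of_nat (Suc n)) powr s)"

definition zeta :: "complex \<Rightarrow> complex" where
  "zeta s = dirichlet_eta s / (1 - 2 powr (1 - s))"

definition J :: "nat \<Rightarrow> real \<Rightarrow> real \<Rightarrow> ennreal" where
  "J k T G = ennreal (1 / (sqrt pi * G)) *
     (\<integral>\<^sup>+ u. ennreal (cmod (zeta (Complex (1/2) (T + u))) ^ (2 * k) * exp (- ((u / G)^2))) \<partial>lborel)"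

end

(* Up to an admissible error, zeta(1/2 + i tau) is the Dirichlet polynomial
   sum_{k <= n} k^(-1/2 - i tau), so J(t, G) is bounded by a Gaussian average of its squared
   modulus.  The diagonal contributes a logarithm.  A pair r, r + s with y = r/s carries the phase
   t ln(1 + 1/y) and the damping exp(-(G ln(1 + 1/y))^2 / 4); hence only y >> G T^(-delta) matters,
   and y is split into dyadic blocks [Y, 2Y).

   For s > N = 2T/Y^2 the inner sums are bounded by the Kuzmin-Landau inequality.  For s <= N the
   sum over r is compared with an integral, which leaves the integral of Psi' against the sawtooth
   sum W(y) = sum_{s <= N} (frac(s y) - 1)/s.  Splitting W = Z + U, where U is the average of W
   over an interval of length 1/N, one has int_0^1 Z^2 << L^3/N and int_0^1 U'^2 << N L^3 with
   L ~ log T: this follows from int_0^1 |W(x + v) - W(x)|^2 dx << L^3 v, a gcd sum.  After a partial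
   integration of the U-part, everything is reduced to integrals
   F(t) = int_Y^{2Y} beta(y) Q(y) e^{i t lam(y)} dy with a 1-periodic Q of small mean square and
   lam(y) = ln(1 + 1/y).

   A Gaussian weight in t and Schur's test give int_T^{2T} |F|^2 << T^{1+delta}/Y.  For the higher
   moments, the large values method of Halasz: duality on one period of Q bounds sum_k |F(t_k)| by a
   kernel, which derivative tests estimate; the resulting card_large_values of well-spaced large values yields
   the third moment when Y^7 >= T and the fourth when Y^5 >= T.  Since Y >> G T^(-delta), these are
   the conditions G >= T^(1/7 + epsilon) and G >= T^(1/5 + epsilon). *)

theory Submission
  imports Defs "HOL-Probability.Probability" "HOL-Real_Asymp.Real_Asymp"
begin

section \<open>Exponential sums and integrals\<close>

text \<open>The splitting of W balances two losses. The term of Psi' with the differentiated phase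
  has size T/Y^3, so its cofactor must be small in mean square; partial integration leaves Psi, of
  size 1/Y, but needs a differentiable cofactor. Averaging over length 1/N with N about T/Y^2 makes
  (T/Y^3)^2 / N and (1/Y)^2 N both about T/Y^4. One result about F, in which only b^2 q <= H T/Y^4
  enters, therefore serves both pieces (\<open>halasz_T\<close>). Since only mean squares of Z and
  U' are under control, F is folded onto one period before Cauchy-Schwarz.

  The exponents arise as follows. Duality at a single point gives V^2 << T/Y^3 for values of size V,
  and the set of large values has measure << (1 + T/(V^4 Y^3)) T/(Y^2 V^2). Multiplied by V^4, its
  leading term is at most T * T/Y^5; multiplied by V^3, it is at most T (T/Y^7)^(1/2). All
  logarithms are bounded by T^\<delta> with \<delta> = min(\<epsilon>, 1)/100, and at most the 18th
  power of this quantity is lost.\<close>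

lemma sin_lower: fixes x::real assumes "0 \<le> x" "x \<le> 1" shows "x / 2 \<le> sin x"
proof -
  have "\<bar>sin x - (\<Sum>k<3. sin_coeff k * x ^ k)\<bar> \<le> inverse (fact 3) * \<bar>x\<bar> ^ 3"
    using Maclaurin_sin_bound by blast
  hence "\<bar>sin x - x\<bar> \<le> x^3 / 6"
    using assms by (simp add: sin_coeff_def eval_nat_numeral fact_numeral)
  moreover have "x^3 \<le> x"
    using assms power_decreasing[of 1 3 x] by simp
  ultimately show ?thesis using assms by linarith
qed

lemma norm_cis_minus_one_ge:
  assumes "0 \<le> d" "d \<le> 1" shows "norm (cis d - 1) \<ge> d / 2"
proof -
  have "d/2 \<le> sin d" using assms by (rule sin_lower)
  also have "\<dots> = Im (cis d - 1)" by simp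
  also have "\<dots> \<le> norm (cis d - 1)" using abs_Im_le_cmod abs_le_D1 by blast
  finally show ?thesis .
qed

lemma norm_cis_diff_le: "norm (cis x - cis y) \<le> \<bar>x - y\<bar>"
proof -
  have "norm (cis x - cis y) = norm (cis y * (cis (x - y) - 1))"
    by (simp add: algebra_simps cis_mult)
  also have "\<dots> = norm (exp (\<i> * of_real (x - y)) - 1)"
    by (simp add: norm_mult cis_conv_exp)
  also have "\<dots> \<le> \<bar>x - y\<bar>"
    using iexp_approx1[of "x - y" 0] by simp
  finally show ?thesis .
qed

text \<open>Since cis (x n) = w n * (cis (x (Suc n)) - cis (x n)) with w n = 1 / (cis (d n) - 1),
  the sum telescopes up to the variation of w, and monotone differences bound that by the variation
  of 1/d. The cap 1 keeps the differences away from 2 pi, where w would blow up again.\<close>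

lemma Kuzmin_Landau:
  fixes x :: "nat \<Rightarrow> real"
  defines "d \<equiv> \<lambda>n. x (Suc n) - x n"
  assumes th: "\<theta> > 0" and d: "\<And>n. a \<le> n \<Longrightarrow> n < b \<Longrightarrow> \<theta> \<le> d n \<and> d n \<le> 1"
    and anti: "\<And>n. a \<le> n \<Longrightarrow> Suc n < b \<Longrightarrow> d (Suc n) \<le> d n"
  shows "norm (\<Sum>n\<in>{a..<b}. cis (x n)) \<le> 8 / \<theta>"
proof (cases "a < b")
  case False thus ?thesis using th by simp
next
  case True
  define w where "w = (\<lambda>n. 1 / (cis (d n) - 1))"
  have dn: "norm (cis (d n) - 1) \<ge> d n / 2" "d n > 0" if "a \<le> n" "n < b" for n
    using d[OF that] th norm_cis_minus_one_ge[of "d n"] by auto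
  have w: "norm (w n) \<le> 2 / d n" if "a \<le> n" "n < b" for n
  proof -
    have "norm (w n) = 1 / norm (cis (d n) - 1)" by (simp add: w_def norm_divide)
    also have "\<dots> \<le> 1 / (d n / 2)" using dn[OF that] by (intro divide_left_mono mult_pos_pos) auto
    finally show ?thesis by simp
  qed
  have wd: "norm (w (Suc n) - w n) \<le> 4 * (1 / d (Suc n) - 1 / d n)" if "a \<le> n" "Suc n < b" for n
  proof -
    have 1: "d n > 0" "d (Suc n) > 0" "norm (cis (d n) - 1) \<ge> d n / 2"
      "norm (cis (d (Suc n)) - 1) \<ge> d (Suc n) / 2" using dn[of n] dn[of "Suc n"] that by auto
    hence nz: "cis (d n) - 1 \<noteq> 0" "cis (d (Suc n)) - 1 \<noteq> 0" by (auto simp del: right_minus_eq)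
    have "w (Suc n) - w n = (cis (d n) - cis (d (Suc n))) / ((cis (d (Suc n)) - 1) * (cis (d n) - 1))"
      using nz unfolding w_def by (simp add: field_simps)
    hence "norm (w (Suc n) - w n) = norm (cis (d n) - cis (d (Suc n))) / (norm (cis (d (Suc n)) - 1) * norm (cis (d n) - 1))"
      by (simp add: norm_divide norm_mult)
    also have "\<dots> \<le> (d n - d (Suc n)) / ((d (Suc n) / 2) * (d n / 2))"
      using 1 anti[OF that] norm_cis_diff_le[of "d n" "d (Suc n)"]
      by (intro frac_le mult_mono mult_pos_pos) auto
    also have "\<dots> = 4 * (1 / d (Suc n) - 1 / d n)" using 1 by (simp add: field_simps)
    finally show ?thesis .
  qed
  \<comment> \<open>Subtracting the pending boundary term \<open>w (m - 1) * cis (x m)\<close> makes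
    the induction step add exactly one variation term.\<close>
  have key: "a < m \<Longrightarrow> m \<le> b \<Longrightarrow>
     norm ((\<Sum>n\<in>{a..<m}. cis (x n)) - w (m - 1) * cis (x m)) \<le> 2 / d a + 4 * (1 / d (m - 1) - 1 / d a)" for m
  proof (induction m)
    case 0 thus ?case by simp
  next
    case (Suc m)
    have step: "w m * cis (x (Suc m)) = w m * cis (x m) + cis (x m)" if "a \<le> m" "m < b" for m
    proof -
      have nz: "cis (d m) - 1 \<noteq> 0" using dn[OF that] by (auto simp del: right_minus_eq)
      have "cis (x (Suc m)) = cis (x m) * cis (d m)" by (simp add: cis_mult d_def)
      thus ?thesis using nz unfolding w_def by (simp add: field_simps)
    qed
    show ?case
    proof (cases "m = a")
      case True
      thus ?thesis using step[of m] w[of a] Suc.prems by (simp add: norm_mult)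
    next
      case False
      hence am: "a < m" "m \<le> b" using Suc.prems by auto
      have IH: "norm ((\<Sum>n\<in>{a..<m}. cis (x n)) - w (m - 1) * cis (x m)) \<le> 2 / d a + 4 * (1 / d (m - 1) - 1 / d a)"
        using Suc.IH am by blast
      have "(\<Sum>n\<in>{a..<Suc m}. cis (x n)) - w m * cis (x (Suc m)) =
         ((\<Sum>n\<in>{a..<m}. cis (x n)) - w (m - 1) * cis (x m)) - (w m - w (m-1)) * cis (x m)"
        using step[of m] am Suc.prems by (simp add: algebra_simps)
      also have "norm \<dots> \<le> (2 / d a + 4 * (1 / d (m - 1) - 1 / d a)) + norm ((w m - w (m-1)) * cis (x m))"
        using IH norm_triangle_ineq4 by (smt (verit))
      also have "norm ((w m - w (m-1)) * cis (x m)) \<le> 4 * (1 / d m - 1 / d (m-1))"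
        using wd[of "m-1"] am Suc.prems by (simp add: norm_mult)
      finally show ?thesis by simp
    qed
  qed
  have *: "1 / d (b - 1) \<le> 1 / \<theta>"
    using d[of "b-1"] dn(2)[of "b-1"] True th by (intro divide_left_mono mult_pos_pos) auto
  have "norm (\<Sum>n\<in>{a..<b}. cis (x n)) \<le> norm ((\<Sum>n\<in>{a..<b}. cis (x n)) - w (b - 1) * cis (x b)) + norm (w (b - 1) * cis (x b))"
    by (metis diff_add_cancel norm_triangle_ineq)
  also have "\<dots> \<le> 2 / d a + 4 * (1 / d (b - 1) - 1 / d a) + 2 / d (b-1)"
    using key[of b] w[of "b-1"] True Suc_leI[of a b] by (intro add_mono) (auto simp: norm_mult)
  also have "\<dots> \<le> 6 * (1 / d (b - 1))"
    using dn(2)[of a] True by (simp add: field_simps)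
  also have "\<dots> \<le> 6 * (1 / \<theta>)" using * by linarith
  also have "\<dots> \<le> 8 / \<theta>" using th by (simp add: field_simps)
  finally show ?thesis .
qed

lemma Abel_antimono:
  fixes z :: "nat \<Rightarrow> complex" and c :: "nat \<Rightarrow> real"
  assumes B: "\<And>v. v \<le> b \<Longrightarrow> norm (\<Sum>n\<in>{a..<v}. z n) \<le> B"
    and c0: "\<And>n. a \<le> n \<Longrightarrow> n < b \<Longrightarrow> 0 \<le> c n"
    and anti: "\<And>n. a \<le> n \<Longrightarrow> Suc n < b \<Longrightarrow> c (Suc n) \<le> c n" and ab: "a < b"
  shows "norm (\<Sum>n\<in>{a..<b}. of_real (c n) * z n) \<le> B * c a"
proof -
  define P where "P v = (\<Sum>n\<in>{a..<v}. z n)" for v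
  have B0: "0 \<le> B" using B[of a] ab by simp
  have "a < m \<Longrightarrow> m \<le> b \<Longrightarrow> norm ((\<Sum>n\<in>{a..<m}. of_real (c n) * z n) - of_real (c (m-1)) * P m) \<le> B * (c a - c (m-1))" for m
  proof (induction m)
    case (Suc m)
    show ?case
    proof (cases "m = a")
      case False
      hence am: "a < m" "m \<le> b" "Suc (m-1) = m" using Suc.prems by auto
      have "(\<Sum>n\<in>{a..<Suc m}. of_real (c n) * z n) - of_real (c m) * P (Suc m) =
        ((\<Sum>n\<in>{a..<m}. of_real (c n) * z n) - of_real (c (m-1)) * P m) + of_real (c (m-1) - c m) * P m"
        using am unfolding P_def by (simp add: algebra_simps)
      also have "norm \<dots> \<le> B * (c a - c (m-1)) + (c (m-1) - c m) * B"
        using Suc.IH am B[of m] anti[of "m-1"] Suc.prems unfolding P_def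
        by (intro norm_triangle_mono) (auto simp: norm_mult simp del: of_real_diff intro!: mult_left_mono)
      finally show ?thesis by (simp add: algebra_simps)
    qed (simp add: P_def)
  qed simp
  from this[of b] have "norm ((\<Sum>n\<in>{a..<b}. of_real (c n) * z n) - of_real (c (b-1)) * P b) \<le> B * (c a - c (b-1))"
    using ab by simp
  moreover have "norm (of_real (c (b-1)) * P b) \<le> c (b-1) * B"
    using B[of b] c0[of "b-1"] ab unfolding P_def by (auto simp: norm_mult intro!: mult_left_mono)
  ultimately have "norm ((\<Sum>n\<in>{a..<b}. of_real (c n) * z n) - of_real (c (b-1)) * P b + of_real (c (b-1)) * P b) \<le> B * (c a - c (b-1)) + c (b-1) * B"
    by (rule norm_triangle_mono)
  thus ?thesis by (simp add: algebra_simps)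
qed

text \<open>The decreasing weight M - c is handed to \<open>Abel_antimono\<close>; the constant M
  contributes once more, hence the factor 2.\<close>

lemma Abel_mono:
  fixes z :: "nat \<Rightarrow> complex" and c :: "nat \<Rightarrow> real"
  assumes B: "\<And>v. v \<le> b \<Longrightarrow> norm (\<Sum>n\<in>{a..<v}. z n) \<le> B"
    and c0: "\<And>n. a \<le> n \<Longrightarrow> n < b \<Longrightarrow> 0 \<le> c n \<and> c n \<le> M"
    and mono: "\<And>n. a \<le> n \<Longrightarrow> Suc n < b \<Longrightarrow> c n \<le> c (Suc n)" and ab: "a < b"
  shows "norm (\<Sum>n\<in>{a..<b}. of_real (c n) * z n) \<le> 2 * M * B"
proof -
  have B0: "0 \<le> B" using B[of a] ab by simp
  have M0: "0 \<le> M" using c0[of a] ab by force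
  have "(\<Sum>n\<in>{a..<b}. of_real (c n) * z n) = of_real M * (\<Sum>n\<in>{a..<b}. z n) - (\<Sum>n\<in>{a..<b}. of_real (M - c n) * z n)"
    by (simp add: sum_distrib_left sum_subtractf algebra_simps)
  also have "norm \<dots> \<le> M * B + B * (M - c a)"
    using Abel_antimono[OF B, where c="\<lambda>n. M - c n"] c0 mono ab B[of b] M0
    by (intro order_trans[OF norm_triangle_ineq4] add_mono) (auto simp: norm_mult intro!: mult_left_mono)
  also have "\<dots> \<le> 2 * M * B" using B0 c0[of a] ab by (simp add: algebra_simps)
  finally show ?thesis .
qed

section \<open>First and second derivative tests for oscillatory integrals\<close>

lemma has_vector_derivative_cis_comp:
  assumes "(f has_real_derivative f') (at y within S)"
  shows "((\<lambda>y. cis (f y)) has_vector_derivative (of_real f' * (\<i> * cis (f y)))) (at y within S)"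
  unfolding has_vector_derivative_complex_iff using assms
  by (auto intro!: derivative_eq_intros)

text \<open>First derivative test. The phase derivative has the form psi/(y (y + 1)) because
  \<open>lam\<close> has derivative -1/(y (y + 1)); psi is then a plain combination of the
  frequencies t and t'. Integration by parts against H = A y (y + 1)/psi costs the boundary values
  and the variation of H, and monotonicity of psi makes the variation of 1/psi exactly
  integrable.\<close>

lemma osc_first:
  fixes A A' \<psi> \<psi>' \<phi> :: "real \<Rightarrow> real"
  assumes Y: "1 \<le> Y" "Y \<le> p" "p \<le> q" "q \<le> 2 * Y"
    and A: "\<And>y. y \<in> {p..q} \<Longrightarrow> (A has_real_derivative A' y) (at y)"
    and Ab: "\<And>y. y \<in> {p..q} \<Longrightarrow> \<bar>A y\<bar> \<le> a" "\<And>y. y \<in> {p..q} \<Longrightarrow> \<bar>A' y\<bar> \<le> 2 * a / Y"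
    and psi: "\<And>y. y \<in> {p..q} \<Longrightarrow> (\<psi> has_real_derivative \<psi>' y) (at y)"
      "\<And>y. y \<in> {p..q} \<Longrightarrow> 0 \<le> \<psi>' y"
    and phi: "\<And>y. y \<in> {p..q} \<Longrightarrow> (\<phi> has_real_derivative (\<psi> y / (y * (y + 1)))) (at y)"
    and dl: "\<delta> > 0" "\<And>y. y \<in> {p..q} \<Longrightarrow> \<delta> \<le> \<bar>\<psi> y\<bar>"
  shows "norm (integral {p..q} (\<lambda>y. of_real (A y) * cis (\<phi> y))) \<le> 35 * a * Y\<^sup>2 / \<delta>"
proof -
  have a0: "0 \<le> a" using Ab(1)[of p] Y by force
  define H where "H = (\<lambda>y. A y * (y * (y + 1)) / \<psi> y)"
  define H' where "H' = (\<lambda>y. (A' y * (y * (y + 1)) + A y * (2 * y + 1)) / \<psi> y - A y * (y * (y + 1)) * \<psi>' y / (\<psi> y)\<^sup>2)"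
  have nz: "\<psi> y \<noteq> 0" if "y \<in> {p..q}" for y using dl that by force
  have H: "(H has_real_derivative H' y) (at y)" if "y \<in> {p..q}" for y
    unfolding H_def H'_def using nz[OF that]
    by (auto intro!: derivative_eq_intros A[OF that] psi(1)[OF that] simp: field_simps power2_eq_square)
  have Vd: "((\<lambda>y. of_real (H y) * cis (\<phi> y)) has_vector_derivative
       (of_real (H' y) * cis (\<phi> y) + \<i> * (of_real (A y) * cis (\<phi> y)))) (at y within {p..q})" if "y \<in> {p..q}" for y
  proof -
    have y0: "y > 0" using that Y by auto
    have "((\<lambda>y. of_real (H y) * cis (\<phi> y)) has_vector_derivative
       (of_real (H y) * (of_real (\<psi> y / (y * (y + 1))) * (\<i> * cis (\<phi> y))) + of_real (H' y) * cis (\<phi> y))) (at y within {p..q})"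
      using DERIV_subset[OF H[OF that]] DERIV_subset[OF phi[OF that]]
      by (intro has_vector_derivative_mult has_vector_derivative_cis_comp has_vector_derivative_of_real)
         (auto simp: has_real_derivative_iff_has_vector_derivative)
    moreover have "H y * (\<psi> y / (y * (y + 1))) = A y"
      using nz[OF that] y0 unfolding H_def by (simp add: divide_simps)
    hence "of_real (H y) * (of_real (\<psi> y / (y * (y + 1))) * (\<i> * cis (\<phi> y))) = \<i> * (of_real (A y) * cis (\<phi> y))"
      by (metis (no_types, opaque_lifting) mult.assoc mult.commute of_real_mult)
    ultimately show ?thesis by (simp add: add.commute)
  qed
  have i1: "((\<lambda>y. of_real (H' y) * cis (\<phi> y) + \<i> * (of_real (A y) * cis (\<phi> y))) has_integral
      (of_real (H q) * cis (\<phi> q) - of_real (H p) * cis (\<phi> p))) {p..q}"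
    using Vd Y by (intro fundamental_theorem_of_calculus) auto
  have cA: "continuous_on {p..q} A" using A by (meson DERIV_isCont continuous_at_imp_continuous_on)
  have cphi: "continuous_on {p..q} \<phi>" using phi by (meson DERIV_isCont continuous_at_imp_continuous_on)
  have "(\<lambda>y. of_real (A y) * cis (\<phi> y)) integrable_on {p..q}"
    using cA cphi by (intro integrable_continuous_interval continuous_intros) auto
  hence i2: "((\<lambda>y. of_real (A y) * cis (\<phi> y)) has_integral integral {p..q} (\<lambda>y. of_real (A y) * cis (\<phi> y))) {p..q}"
    by blast
  have i3: "((\<lambda>y. of_real (H' y) * cis (\<phi> y)) has_integral
     (of_real (H q) * cis (\<phi> q) - of_real (H p) * cis (\<phi> p) - \<i> * integral {p..q} (\<lambda>y. of_real (A y) * cis (\<phi> y)))) {p..q}"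
    using has_integral_diff[OF i1 has_integral_mult_right[OF i2, of \<i>]] by simp
  \<comment> \<open>The first term bounds the derivatives of A and of y (y + 1), with 17 = 12 + 5;
    the second can be integrated exactly, as psi'/psi^2 is the derivative of -1/psi.\<close>
  define g where "g = (\<lambda>y. 17 * a * Y / \<delta> + 6 * a * Y\<^sup>2 * (\<psi>' y / (\<psi> y)\<^sup>2))"
  have "((\<lambda>y. \<psi>' y / (\<psi> y)\<^sup>2) has_integral (- 1 / \<psi> q - - 1 / \<psi> p)) {p..q}"
    using Y nz by (intro fundamental_theorem_of_calculus)
      (auto simp: has_real_derivative_iff_has_vector_derivative[symmetric] power2_eq_square intro!: derivative_eq_intros DERIV_subset[OF psi(1)])
  from has_integral_mult_right[OF this, of "6 * a * Y\<^sup>2"]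
  have i4: "(g has_integral ((q - p) * (17 * a * Y / \<delta>) + 6 * a * Y\<^sup>2 * (1 / \<psi> p - 1 / \<psi> q))) {p..q}"
    unfolding g_def using Y has_integral_const_real[of "17 * a * Y / \<delta>" p q]
    by (intro has_integral_add) (auto simp: algebra_simps)
  have yy: "y * (y + 1) \<le> 6 * Y\<^sup>2" "2 * y + 1 \<le> 5 * Y" "0 \<le> y" if "y \<in> {p..q}" for y
  proof -
    have "y * (y + 1) \<le> (2 * Y) * (3 * Y)" using that Y by (intro mult_mono) auto
    thus "y * (y + 1) \<le> 6 * Y\<^sup>2" by (simp add: power2_eq_square)
  qed (use that Y in auto)
  have bd: "norm (of_real (H' y) * cis (\<phi> y)) \<le> g y" if y: "y \<in> {p..q}" for y
  proof -
    have y2: "\<bar>y * (y + 1)\<bar> \<le> 6 * Y\<^sup>2" "\<bar>2 * y + 1\<bar> \<le> 5 * Y" using yy[OF y] by auto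
    have "\<bar>A' y * (y * (y + 1))\<bar> \<le> 2 * a / Y * (6 * Y\<^sup>2)"
      using mult_mono[OF Ab(2)[OF y] y2(1)] a0 Y by (simp add: abs_mult)
    moreover have "\<bar>A y * (2 * y + 1)\<bar> \<le> a * (5 * Y)"
      using mult_mono[OF Ab(1)[OF y] y2(2)] a0 Y by (simp add: abs_mult)
    ultimately have "\<bar>A' y * (y * (y + 1)) + A y * (2 * y + 1)\<bar> \<le> 2 * a / Y * (6 * Y\<^sup>2) + a * (5 * Y)"
      by linarith
    also have "\<dots> = 17 * a * Y" using Y by (simp add: field_simps power2_eq_square)
    finally have 1: "\<bar>A' y * (y * (y + 1)) + A y * (2 * y + 1)\<bar> / \<bar>\<psi> y\<bar> \<le> 17 * a * Y / \<delta>"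
      using dl(1) dl(2)[OF y] a0 Y by (intro frac_le) auto
    have 2: "\<bar>A y * (y * (y + 1))\<bar> * (\<psi>' y / (\<psi> y)\<^sup>2) \<le> a * (6 * Y\<^sup>2) * (\<psi>' y / (\<psi> y)\<^sup>2)"
      using yy[OF y] Ab[OF y] a0 psi(2)[OF y] by (intro mult_right_mono) (auto simp: abs_mult intro!: mult_mono)
    have "norm (of_real (H' y) * cis (\<phi> y)) = \<bar>H' y\<bar>" by (simp add: norm_mult)
    also have "\<dots> \<le> \<bar>A' y * (y * (y + 1)) + A y * (2 * y + 1)\<bar> / \<bar>\<psi> y\<bar> + \<bar>A y * (y * (y + 1))\<bar> * (\<psi>' y / (\<psi> y)\<^sup>2)"
      unfolding H'_def using psi(2)[OF y] by (intro order_trans[OF abs_triangle_ineq4]) (simp add: abs_mult abs_divide)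
    also have "\<dots> \<le> g y" using 1 2 unfolding g_def by (simp add: mult_ac)
    finally show ?thesis .
  qed
  have inv: "\<bar>1 / \<psi> y\<bar> \<le> 1 / \<delta>" if "y \<in> {p..q}" for y
    using dl(1) dl(2)[OF that] by (auto simp: abs_divide intro!: divide_left_mono mult_pos_pos)
  \<comment> \<open>A monotone psi with |psi| >= delta has constant sign, so the difference costs
    one reciprocal instead of two.\<close>
  have same: "1 / \<psi> p - 1 / \<psi> q \<le> 1 / \<delta>"
  proof -
    have mono: "\<psi> p \<le> \<psi> y" if "y \<in> {p..q}" for y
    proof (rule DERIV_nonneg_imp_nondecreasing[of p y \<psi>])
      show "p \<le> y" using that by simp
      fix x assume "p \<le> x" "x \<le> y"
      hence "x \<in> {p..q}" using that by auto
      thus "\<exists>z. (\<psi> has_real_derivative z) (at x) \<and> 0 \<le> z" using psi by blast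
    qed
    show ?thesis
    proof (cases "\<psi> p < 0 \<and> 0 < \<psi> q")
      case True
      have "continuous_on {p..q} \<psi>" using psi by (meson DERIV_isCont continuous_at_imp_continuous_on)
      then obtain z where "p \<le> z" "z \<le> q" "\<psi> z = 0"
        using IVT'[of \<psi> p 0 q] True Y by auto
      thus ?thesis using nz[of z] by auto
    next
      case False
      hence "1 / \<psi> p \<le> 0 \<or> 0 \<le> 1 / \<psi> q" using nz[of p] nz[of q] mono[of q] Y by (auto simp: not_less)
      moreover have "\<psi> p < 0 \<Longrightarrow> \<psi> q < 0" using False nz[of q] Y by force
      ultimately show ?thesis using inv[of p] inv[of q] Y
        by (smt (verit) atLeastAtMost_iff divide_nonneg_nonneg zero_le_divide_1_iff)
    qed
  qed
  have "norm (of_real (H q) * cis (\<phi> q) - of_real (H p) * cis (\<phi> p) - \<i> * integral {p..q} (\<lambda>y. of_real (A y) * cis (\<phi> y)))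
      \<le> (q - p) * (17 * a * Y / \<delta>) + 6 * a * Y\<^sup>2 * (1 / \<psi> p - 1 / \<psi> q)"
    using integral_norm_bound_integral[OF has_integral_integrable[OF i3] has_integral_integrable[OF i4] bd]
    by (simp add: integral_unique[OF i3] integral_unique[OF i4])
  also have "\<dots> \<le> Y * (17 * a * Y / \<delta>) + 6 * a * Y\<^sup>2 * (1 / \<delta>)"
    using Y a0 dl same by (intro add_mono mult_right_mono mult_left_mono) auto
  also have "\<dots> = 23 * a * Y\<^sup>2 / \<delta>" using dl by (simp add: field_simps power2_eq_square)
  finally have m: "norm (of_real (H q) * cis (\<phi> q) - of_real (H p) * cis (\<phi> p) - \<i> * integral {p..q} (\<lambda>y. of_real (A y) * cis (\<phi> y))) \<le> 23 * a * Y\<^sup>2 / \<delta>" .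
  have Hb: "norm (of_real (H y) * cis (\<phi> y)) \<le> 6 * a * Y\<^sup>2 / \<delta>" if y: "y \<in> {p..q}" for y
  proof -
    have "norm (of_real (H y) * cis (\<phi> y)) = \<bar>A y\<bar> * (y * (y + 1)) / \<bar>\<psi> y\<bar>"
      using yy(3)[OF y] unfolding H_def by (simp add: norm_mult norm_divide abs_mult)
    also have "\<dots> \<le> a * (6 * Y\<^sup>2) / \<delta>"
      using mult_mono[OF Ab(1)[OF y] yy(1)[OF y]] yy(3)[OF y] a0 dl(1) dl(2)[OF y] by (intro frac_le) auto
    finally show ?thesis by (simp add: mult_ac)
  qed
  define I where "I = integral {p..q} (\<lambda>y. of_real (A y) * cis (\<phi> y))"
  have tri: "norm (\<i> * I) \<le> norm v + norm u + norm (v - u - \<i> * I)" for u v :: complex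
  proof -
    have "norm (v - u - (v - u - \<i> * I)) \<le> norm (v - u) + norm (v - u - \<i> * I)"
      by (rule norm_triangle_ineq4)
    moreover have "norm (v - u) \<le> norm v + norm u" by (rule norm_triangle_ineq4)
    ultimately show ?thesis by simp
  qed
  have "norm I = norm (\<i> * I)" by (simp add: norm_mult)
  \<comment> \<open>35 consists of 6 + 6 from the end points and 23 = 17 + 6 from the integral of
    g.\<close>
  also have "\<dots> \<le> 6 * a * Y\<^sup>2 / \<delta> + 6 * a * Y\<^sup>2 / \<delta> + 23 * a * Y\<^sup>2 / \<delta>"
    using Hb[of p] Hb[of q] m Y unfolding I_def
    by (intro order_trans[OF tri[unfolded I_def]] add_mono) auto
  finally show ?thesis unfolding I_def using dl by (simp add: field_simps)
qed

text \<open>Second derivative test. Since psi increases at rate at least kappa, |psi| >= kappa eta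
  outside a window of radius eta around its zero. The window is estimated trivially, the two
  remaining pieces by \<open>osc_first\<close>.\<close>

lemma osc_second:
  fixes A A' \<psi> \<psi>' \<phi> :: "real \<Rightarrow> real"
  assumes Y: "1 \<le> Y" "Y \<le> p" "p \<le> q" "q \<le> 2 * Y"
    and A: "\<And>y. y \<in> {p..q} \<Longrightarrow> (A has_real_derivative A' y) (at y)"
    and Ab: "\<And>y. y \<in> {p..q} \<Longrightarrow> \<bar>A y\<bar> \<le> a" "\<And>y. y \<in> {p..q} \<Longrightarrow> \<bar>A' y\<bar> \<le> 2 * a / Y"
    and psi: "\<And>y. y \<in> {p..q} \<Longrightarrow> (\<psi> has_real_derivative \<psi>' y) (at y)"
      "\<And>y. y \<in> {p..q} \<Longrightarrow> \<kappa> \<le> \<psi>' y"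
    and phi: "\<And>y. y \<in> {p..q} \<Longrightarrow> (\<phi> has_real_derivative (\<psi> y / (y * (y + 1)))) (at y)"
    and ka: "\<kappa> > 0"
  shows "norm (integral {p..q} (\<lambda>y. of_real (A y) * cis (\<phi> y))) \<le> 72 * a * Y / sqrt \<kappa>"
proof -
  define f where "f = (\<lambda>y. of_real (A y) * cis (\<phi> y))"
  have a0: "0 \<le> a" using Ab(1)[of p] Y by force
  have cA: "continuous_on {p..q} A" using A by (meson DERIV_isCont continuous_at_imp_continuous_on)
  have cphi: "continuous_on {p..q} \<phi>" using phi by (meson DERIV_isCont continuous_at_imp_continuous_on)
  have cpsi: "continuous_on {p..q} \<psi>" using psi by (meson DERIV_isCont continuous_at_imp_continuous_on)
  have cf: "continuous_on {p..q} f" unfolding f_def using cA cphi by (intro continuous_intros) auto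
  have intf: "f integrable_on {u..v}" if "p \<le> u" "v \<le> q" for u v
    using that by (intro integrable_continuous_interval continuous_on_subset[OF cf]) auto
  have grow: "\<kappa> * (v - u) \<le> \<psi> v - \<psi> u" if "p \<le> u" "u \<le> v" "v \<le> q" for u v
  proof -
    have "\<psi> u - \<kappa> * u \<le> \<psi> v - \<kappa> * v"
    proof (rule DERIV_nonneg_imp_nondecreasing[OF that(2)])
      fix x assume "u \<le> x" "x \<le> v"
      hence x: "x \<in> {p..q}" using that by auto
      have "((\<lambda>x. \<psi> x - \<kappa> * x) has_real_derivative (\<psi>' x - \<kappa>)) (at x)"
        by (auto intro!: derivative_eq_intros psi(1)[OF x])
      thus "\<exists>y. ((\<lambda>x. \<psi> x - \<kappa> * x) has_real_derivative y) (at x) \<and> 0 \<le> y" using psi(2)[OF x] by fastforce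
    qed
    thus ?thesis by (simp add: algebra_simps)
  qed
  \<comment> \<open>If psi does not vanish, z is the end point at which it is closest to
    zero.\<close>
  obtain z where z: "p \<le> z" "z \<le> q" "\<And>y. y \<in> {p..q} \<Longrightarrow> z < y \<Longrightarrow> \<kappa> * (y - z) \<le> \<psi> y"
    "\<And>y. y \<in> {p..q} \<Longrightarrow> y < z \<Longrightarrow> \<kappa> * (z - y) \<le> - \<psi> y"
  proof -
    consider "\<psi> p \<ge> 0" | "\<psi> q \<le> 0" | "\<psi> p \<le> 0" "\<psi> q \<ge> 0" by linarith
    thus ?thesis
    proof cases
      case 1 show ?thesis
      proof (rule that[of p])
        show "\<kappa> * (y - p) \<le> \<psi> y" if "y \<in> {p..q}" "p < y" for y using grow[of p y] 1 that by simp
      qed (use Y in auto)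
    next
      case 2 show ?thesis
      proof (rule that[of q])
        show "\<kappa> * (q - y) \<le> - \<psi> y" if "y \<in> {p..q}" "y < q" for y using grow[of y q] 2 that by simp
      qed (use Y in auto)
    next
      case 3
      then obtain z where z0: "p \<le> z" "z \<le> q" "\<psi> z = 0"
        using IVT'[of \<psi> p 0 q] Y cpsi by auto
      show ?thesis
      proof (rule that[of z])
        show "\<kappa> * (y - z) \<le> \<psi> y" if "y \<in> {p..q}" "z < y" for y using grow[of z y] z0 that by simp
        show "\<kappa> * (z - y) \<le> - \<psi> y" if "y \<in> {p..q}" "y < z" for y using grow[of y z] z0 that by simp
      qed (use z0 in auto)
    qed
  qed
  \<comment> \<open>This radius balances, up to constants, the trivial bound 2 a eta against 70 a
    Y^2/(kappa eta).\<close>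
  define \<eta> where "\<eta> = Y / sqrt \<kappa>"
  have eta: "\<eta> > 0" using Y ka unfolding \<eta>_def by auto
  define m1 where "m1 = max p (z - \<eta>)"
  define m2 where "m2 = min q (z + \<eta>)"
  have m: "p \<le> m1" "m1 \<le> m2" "m2 \<le> q" "m2 - m1 \<le> 2 * \<eta>" using z eta Y unfolding m1_def m2_def by auto
  have ke: "\<kappa> * \<eta> > 0" using ka eta by simp
  have psi0: "0 \<le> \<psi>' y" if "y \<in> {p..q}" for y using psi(2)[OF that] ka by linarith
  have b1: "norm (integral {p..m1} f) \<le> 35 * a * Y\<^sup>2 / (\<kappa> * \<eta>)"
  proof (cases "m1 = p")
    case True thus ?thesis using ke a0 Y by simp
  next
    case False
    hence m1: "m1 = z - \<eta>" "p \<le> m1" unfolding m1_def by auto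
    have "\<kappa> * \<eta> \<le> \<bar>\<psi> y\<bar>" if "y \<in> {p..m1}" for y
    proof -
      have "\<kappa> * \<eta> \<le> \<kappa> * (z - y)" using that m1 ka by (intro mult_left_mono) auto
      also have "\<dots> \<le> - \<psi> y" using z(4)[of y] that m1 eta m by auto
      finally show ?thesis by simp
    qed
    thus ?thesis unfolding f_def using m Y ke
      by (intro osc_first[where A'=A' and \<psi>=\<psi> and \<psi>'=\<psi>'] A Ab psi(1) psi0 phi) auto
  qed
  have b3: "norm (integral {m2..q} f) \<le> 35 * a * Y\<^sup>2 / (\<kappa> * \<eta>)"
  proof (cases "m2 = q")
    case True thus ?thesis using ke a0 Y by simp
  next
    case False
    hence m2: "m2 = z + \<eta>" "m2 \<le> q" unfolding m2_def by auto
    have "\<kappa> * \<eta> \<le> \<bar>\<psi> y\<bar>" if "y \<in> {m2..q}" for y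
    proof -
      have "\<kappa> * \<eta> \<le> \<kappa> * (y - z)" using that m2 ka by (intro mult_left_mono) auto
      also have "\<dots> \<le> \<psi> y" using z(3)[of y] that m2 eta m by auto
      finally show ?thesis by simp
    qed
    thus ?thesis unfolding f_def using m Y ke
      by (intro osc_first[where A'=A' and \<psi>=\<psi> and \<psi>'=\<psi>'] A Ab psi(1) psi0 phi) auto
  qed
  have "norm (integral {m1..m2} f) \<le> a * (m2 - m1)"
    using m Ab by (intro integral_bound continuous_on_subset[OF cf]) (auto simp: f_def norm_mult)
  also have "\<dots> \<le> a * (2 * \<eta>)" using m a0 by (intro mult_left_mono) auto
  finally have b2: "norm (integral {m1..m2} f) \<le> a * (2 * \<eta>)" .
  have e1: "integral {p..m1} f + integral {m1..q} f = integral {p..q} f"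
    using intf m by (intro Henstock_Kurzweil_Integration.integral_combine) auto
  have e2: "integral {m1..m2} f + integral {m2..q} f = integral {m1..q} f"
    using intf m by (intro Henstock_Kurzweil_Integration.integral_combine) auto
  have "integral {p..q} f = integral {p..m1} f + integral {m1..m2} f + integral {m2..q} f"
    by (simp only: e1[symmetric] e2[symmetric] add.assoc)
  also have "norm \<dots> \<le> 35 * a * Y\<^sup>2 / (\<kappa> * \<eta>) + a * (2 * \<eta>) + 35 * a * Y\<^sup>2 / (\<kappa> * \<eta>)"
    using b1 b2 b3 by (intro norm_triangle_mono) auto
  also have "\<dots> = 72 * a * Y / sqrt \<kappa>"
  proof -
    have "\<kappa> * \<eta> = Y * sqrt \<kappa>" unfolding \<eta>_def using ka by (simp add: field_simps)
    hence "Y\<^sup>2 / (\<kappa> * \<eta>) = Y / sqrt \<kappa>" using Y ka by (simp add: power2_eq_square)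
    hence "35 * a * Y\<^sup>2 / (\<kappa> * \<eta>) = 35 * a * (Y / sqrt \<kappa>)" by (metis times_divide_eq_right)
    thus ?thesis unfolding \<eta>_def by (simp add: algebra_simps)
  qed
  finally show ?thesis unfolding f_def .
qed

section \<open>Oscillatory kernels and duality\<close>

definition lam :: "real \<Rightarrow> real" where "lam y = ln (1 + 1 / y)"

lemma lam_deriv: "y > 0 \<Longrightarrow> (lam has_real_derivative - (1 / (y * (y + 1)))) (at y within S)"
proof -
  assume y: "y > 0"
  hence "1 + 1 / y > 0" by (simp add: add_pos_pos)
  moreover have "inverse (1 + 1 / y) * (0 + - (1 / y\<^sup>2)) = - (1 / (y * (y + 1)))"
    using y by (simp add: field_simps power2_eq_square)
  ultimately show ?thesis unfolding lam_def using y
    by (auto intro!: derivative_eq_intros simp: power2_eq_square field_simps)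
qed

lemma lam_shift_deriv: "y + l > 0 \<Longrightarrow> ((\<lambda>y. lam (y + l)) has_real_derivative - (1 / ((y + l) * (y + l + 1)))) (at y within S)"
  using DERIV_shift[of lam "- (1 / ((y + l) * (y + l + 1)))" y l] lam_deriv[of "y+l" UNIV]
  by (meson has_field_derivative_at_within)

text \<open>An amplitude of size b that varies on the scale Y of its dyadic block. The instances are
  \<open>alp\<close> with b = 2/Y and \<open>bet\<close> with b = 8 T/Y^3.\<close>

locale amp =
  fixes Y b :: real and \<beta> \<beta>' :: "real \<Rightarrow> real"
  assumes Y1: "1 \<le> Y"
    and bd: "\<And>y. y \<in> {Y..2*Y} \<Longrightarrow> (\<beta> has_real_derivative \<beta>' y) (at y)"
    and bb: "\<And>y. y \<in> {Y..2*Y} \<Longrightarrow> \<bar>\<beta> y\<bar> \<le> b"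
    and bb': "\<And>y. y \<in> {Y..2*Y} \<Longrightarrow> \<bar>\<beta>' y\<bar> \<le> b / Y"
begin

lemma b0: "0 \<le> b" using bb[of Y] Y1 by force

text \<open>The part of the correlation of the frequencies t and t' that comes from pairs of points
  at distance l; the upper limit keeps both points in the block.\<close>

definition ker :: "real \<Rightarrow> real \<Rightarrow> real \<Rightarrow> complex" where
  "ker l t t' = integral {Y..2*Y-l} (\<lambda>y. of_real (\<beta> (y + l) * \<beta> y) * cis (t * lam (y + l) - t' * lam y))"

lemma prod_deriv:
  assumes "0 \<le> l" "y \<in> {Y..2*Y-l}"
  shows "((\<lambda>y. \<beta> (y + l) * \<beta> y) has_real_derivative (\<beta>' (y + l) * \<beta> y + \<beta>' y * \<beta> (y + l))) (at y)"
    "\<bar>\<beta> (y + l) * \<beta> y\<bar> \<le> b\<^sup>2" "\<bar>\<beta>' (y + l) * \<beta> y + \<beta>' y * \<beta> (y + l)\<bar> \<le> 2 * b\<^sup>2 / Y"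
proof -
  have y: "y \<in> {Y..2*Y}" "y + l \<in> {Y..2*Y}" using assms by auto
  have "((\<lambda>y. \<beta> (y + l)) has_real_derivative \<beta>' (y + l)) (at y)"
    using bd[OF y(2)] by (simp add: DERIV_shift)
  thus "((\<lambda>y. \<beta> (y + l) * \<beta> y) has_real_derivative (\<beta>' (y + l) * \<beta> y + \<beta>' y * \<beta> (y + l))) (at y)"
    using bd[OF y(1)] by (intro DERIV_mult)
  show "\<bar>\<beta> (y + l) * \<beta> y\<bar> \<le> b\<^sup>2" unfolding abs_mult power2_eq_square
    using bb y b0 by (intro mult_mono) auto
  have "\<bar>\<beta>' (y + l) * \<beta> y\<bar> \<le> b / Y * b" "\<bar>\<beta>' y * \<beta> (y + l)\<bar> \<le> b / Y * b" unfolding abs_mult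
    using mult_mono[OF bb'[OF y(2)] bb[OF y(1)]] mult_mono[OF bb'[OF y(1)] bb[OF y(2)]] b0 Y1 by auto
  hence "\<bar>\<beta>' (y + l) * \<beta> y + \<beta>' y * \<beta> (y + l)\<bar> \<le> b / Y * b + b / Y * b" by linarith
  thus "\<bar>\<beta>' (y + l) * \<beta> y + \<beta>' y * \<beta> (y + l)\<bar> \<le> 2 * b\<^sup>2 / Y" by (simp add: power2_eq_square)
qed

lemma cont_beta: "continuous_on {Y..2*Y} \<beta>"
  using bd by (meson DERIV_isCont continuous_at_imp_continuous_on)

lemma phase_deriv:
  assumes "0 \<le> l" "y \<in> {Y..2*Y-l}"
  shows "((\<lambda>y. t * lam (y + l) - t' * lam y) has_real_derivative
     ((t' - t * (y * (y + 1) / ((y + l) * (y + l + 1)))) / (y * (y + 1)))) (at y)"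
proof -
  have y: "y > 0" "y + l > 0" using assms Y1 by auto
  have "((\<lambda>y. t * lam (y + l) - t' * lam y) has_real_derivative
     (t * - (1 / ((y + l) * (y + l + 1))) - t' * - (1 / (y * (y + 1))))) (at y)"
    by (intro derivative_intros DERIV_cmult lam_shift_deriv lam_deriv y)
  moreover have "t * - (1 / ((y + l) * (y + l + 1))) - t' * - (1 / (y * (y + 1))) =
     (t' - t * (y * (y + 1) / ((y + l) * (y + l + 1)))) / (y * (y + 1))"
    using y by (simp add: divide_simps) (simp add: algebra_simps)?
  ultimately show ?thesis by simp
qed

lemma cont_ker:
  assumes "0 \<le> l"
  shows "continuous_on {Y..2*Y-l} (\<lambda>y. of_real (\<beta> (y + l) * \<beta> y) * cis (t * lam (y + l) - t' * lam y))"
proof -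
  have "continuous_on {Y..2*Y-l} (\<lambda>y. \<beta> (y + l) * \<beta> y)"
    using prod_deriv(1)[OF assms(1)] by (meson DERIV_isCont continuous_at_imp_continuous_on)
  moreover have "continuous_on {Y..2*Y-l} (\<lambda>y. t * lam (y + l) - t' * lam y)"
    using phase_deriv[OF assms(1)] by (meson DERIV_isCont continuous_at_imp_continuous_on)
  ultimately show ?thesis by (rule continuous_on_mult[OF continuous_on_of_real continuous_on_cis])
qed

lemma ker_trivial:
  assumes "0 \<le> l" "l \<le> Y" shows "norm (ker l t t') \<le> b\<^sup>2 * Y"
proof -
  have "continuous_on {Y..2*Y-l} (\<lambda>y. of_real (\<beta> (y + l) * \<beta> y) * cis (t * lam (y + l) - t' * lam y))"
    by (rule cont_ker[OF assms(1)])
  hence "norm (ker l t t') \<le> b\<^sup>2 * (2 * Y - l - Y)"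
    unfolding ker_def using prod_deriv(2)[OF assms(1)] assms
    by (intro integral_bound) (auto simp: norm_mult simp del: of_real_mult)
  also have "\<dots> \<le> b\<^sup>2 * Y" using assms by (intro mult_left_mono) auto
  finally show ?thesis .
qed

lemma q_deriv:
  assumes "0 \<le> l" "y \<in> {Y..2*Y-l}"
  shows "((\<lambda>y. t' - t * (y * (y + 1) / ((y + l) * (y + l + 1)))) has_real_derivative
     - (t * (l * ((y + 1) * (y + l + 1) + y * (y + l)) / ((y + l) * (y + l + 1))\<^sup>2))) (at y)"
proof -
  have y: "y > 0" "y + l > 0" "y + l + 1 > 0" using assms Y1 by auto
  have nz: "(y + l) * (y + l + 1) \<noteq> 0" using y by simp
  have "((\<lambda>y. t' - t * (y * (y + 1) / ((y + l) * (y + l + 1)))) has_real_derivative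
    (0 - t * (((1 * (y + 1) + (1 + 0) * y) * ((y + l) * (y + l + 1)) - (y * (y + 1)) * ((1 + 0) * (y + l + 1) + (1 + 0 + 0) * (y + l))) / (((y + l) * (y + l + 1)) * ((y + l) * (y + l + 1)))))) (at y)"
    by (intro derivative_intros DERIV_cmult DERIV_divide DERIV_mult nz)
  moreover have "((1 * (y + 1) + (1 + 0) * y) * ((y + l) * (y + l + 1)) - (y * (y + 1)) * ((1 + 0) * (y + l + 1) + (1 + 0 + 0) * (y + l))) = l * ((y + 1) * (y + l + 1) + y * (y + l))"
    by algebra
  ultimately show ?thesis by (simp add: power2_eq_square)
qed

text \<open>For the lower bound only the product (y + 1)(y + l + 1) of the numerator is kept, and y
  + l + 1 <= 2 (y + 1) because y + l <= 2 Y <= 2 y.\<close>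

lemma q_deriv':
  assumes "0 \<le> l" "y \<in> {Y..2*Y-l}" "0 \<le> t"
  shows "((\<lambda>y. t * (y * (y + 1) / ((y + l) * (y + l + 1))) - t') has_real_derivative
     (t * (l * ((y + 1) * (y + l + 1) + y * (y + l)) / ((y + l) * (y + l + 1))\<^sup>2))) (at y)"
    "t * l / (8 * Y\<^sup>2) \<le> t * (l * ((y + 1) * (y + l + 1) + y * (y + l)) / ((y + l) * (y + l + 1))\<^sup>2)"
proof -
  show "((\<lambda>y. t * (y * (y + 1) / ((y + l) * (y + l + 1))) - t') has_real_derivative
     (t * (l * ((y + 1) * (y + l + 1) + y * (y + l)) / ((y + l) * (y + l + 1))\<^sup>2))) (at y)"
    using DERIV_minus[OF q_deriv[OF assms(1,2), of t' t]] by simp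
  have y: "y > 0" "y + l > 0" "y + l \<le> 2 * Y" "Y \<le> y" using assms Y1 by auto
  have yl: "(y + l) * (y + l) * (y + l + 1) \<le> 4 * Y\<^sup>2 * (2 * (y + 1))"
    using mult_mono[OF mult_mono[of "y+l" "2*Y" "y+l" "2*Y"], of "y + l + 1" "2 * (y + 1)"] y Y1
    by (auto simp: power2_eq_square)
  have "1 / (8 * Y\<^sup>2) = (y + 1) / (4 * Y\<^sup>2 * (2 * (y + 1)))" using y Y1 by (simp add: divide_simps)
  also have "\<dots> \<le> (y + 1) / ((y + l) * (y + l) * (y + l + 1))"
    using yl y by (intro divide_left_mono mult_pos_pos) (auto simp: Y1 power2_eq_square intro!: mult_pos_pos)
  also have "\<dots> = (y + 1) * (y + l + 1) / ((y + l) * (y + l + 1))\<^sup>2"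
    using y by (simp add: power2_eq_square)
  also have "\<dots> \<le> ((y + 1) * (y + l + 1) + y * (y + l)) / ((y + l) * (y + l + 1))\<^sup>2"
    using y by (intro divide_right_mono) auto
  finally have "t * l * (1 / (8 * Y\<^sup>2)) \<le> t * l * (((y + 1) * (y + l + 1) + y * (y + l)) / ((y + l) * (y + l + 1))\<^sup>2)"
    using assms by (intro mult_left_mono) auto
  thus "t * l / (8 * Y\<^sup>2) \<le> t * (l * ((y + 1) * (y + l + 1) + y * (y + l)) / ((y + l) * (y + l + 1))\<^sup>2)"
    by simp
qed

text \<open>Conjugation reverses the phase: the derivative tests assume an increasing psi, and t y
  (y + 1)/((y + l)(y + l + 1)) - t' increases with y for t >= 0.\<close>

lemma norm_ker:
  "norm (ker l t t') = norm (integral {Y..2*Y-l} (\<lambda>y. of_real (\<beta> (y + l) * \<beta> y) * cis (t' * lam y - t * lam (y + l))))"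
proof -
  have "cnj (ker l t t') = integral {Y..2*Y-l} (\<lambda>y. cnj (of_real (\<beta> (y + l) * \<beta> y) * cis (t * lam (y + l) - t' * lam y)))"
    unfolding ker_def by (rule Henstock_Kurzweil_Integration.integral_cnj)
  also have "\<dots> = integral {Y..2*Y-l} (\<lambda>y. of_real (\<beta> (y + l) * \<beta> y) * cis (t' * lam y - t * lam (y + l)))"
    by (simp add: cis_cnj)
  finally show ?thesis by (metis complex_mod_cnj)
qed

lemma phase_deriv':
  assumes "0 \<le> l" "y \<in> {Y..2*Y-l}"
  shows "((\<lambda>y. t' * lam y - t * lam (y + l)) has_real_derivative
     ((t * (y * (y + 1) / ((y + l) * (y + l + 1))) - t') / (y * (y + 1)))) (at y)"
  using DERIV_minus[OF phase_deriv[OF assms, of t t']] by (simp add: minus_divide_left)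

lemma ker_first:
  assumes "0 \<le> l" "l \<le> Y" "0 \<le> t" "0 < \<delta>"
    "\<And>y. y \<in> {Y..2*Y-l} \<Longrightarrow> \<delta> \<le> \<bar>t * (y * (y + 1) / ((y + l) * (y + l + 1))) - t'\<bar>"
  shows "norm (ker l t t') \<le> 35 * b\<^sup>2 * Y\<^sup>2 / \<delta>"
proof -
  have nn: "0 \<le> t * (l * ((y + 1) * (y + l + 1) + y * (y + l)) / ((y + l) * (y + l + 1))\<^sup>2)" if "y \<in> {Y..2*Y-l}" for y
    using q_deriv'(2)[OF assms(1) that assms(3)] assms by (smt (verit) divide_nonneg_nonneg mult_nonneg_nonneg zero_le_power2)
  show ?thesis unfolding norm_ker using Y1 assms
    by (intro osc_first[where A'="\<lambda>y. \<beta>' (y + l) * \<beta> y + \<beta>' y * \<beta> (y + l)"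
        and \<psi>="\<lambda>y. t * (y * (y + 1) / ((y + l) * (y + l + 1))) - t'"
        and \<psi>'="\<lambda>y. t * (l * ((y + 1) * (y + l + 1) + y * (y + l)) / ((y + l) * (y + l + 1))\<^sup>2)"] prod_deriv phase_deriv' q_deriv' nn) auto
qed

text \<open>For l = 0 the quotient in psi is 1, so psi is the constant t - t'.\<close>

lemma ker_zero: "0 \<le> t \<Longrightarrow> t \<noteq> t' \<Longrightarrow> norm (ker 0 t t') \<le> 35 * b\<^sup>2 * Y\<^sup>2 / \<bar>t - t'\<bar>"
  using Y1 by (intro ker_first) auto

text \<open>There is no stationary point: the quotient y (y + 1)/((y + l)(y + l + 1)) is at most 1 -
  l/(2 Y), which moves t times the quotient away from t by T l/(2 Y), twice the permitted distance
  of t and t'.\<close>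

lemma ker_near:
  assumes "0 < l" "l \<le> Y" "0 < T" "T \<le> t" "\<bar>t - t'\<bar> \<le> T * l / (4 * Y)"
  shows "norm (ker l t t') \<le> 140 * b\<^sup>2 * Y^3 / (T * l)"
proof -
  have "norm (ker l t t') \<le> 35 * b\<^sup>2 * Y\<^sup>2 / (T * l / (4 * Y))"
  proof (rule ker_first)
    fix y assume y: "y \<in> {Y..2*Y-l}"
    have y': "y > 0" "y + l > 0" "y + l \<le> 2 * Y" using y Y1 assms by auto
    have "l / (2 * Y) \<le> l / (y + l)" using y' assms by (intro divide_left_mono) auto
    also have "\<dots> = l * (y + l + 1) / ((y + l) * (y + l + 1))" using y' by simp
    also have "\<dots> \<le> l * (2 * y + l + 1) / ((y + l) * (y + l + 1))"
      using y' assms by (intro divide_right_mono mult_left_mono) auto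
    also have "\<dots> = 1 - y * (y + 1) / ((y + l) * (y + l + 1))"
    proof -
      have "(y + l) * (y + l + 1) \<noteq> 0" using y' by simp
      hence "1 - y * (y + 1) / ((y + l) * (y + l + 1)) = ((y + l) * (y + l + 1) - y * (y + 1)) / ((y + l) * (y + l + 1))"
        by (simp add: diff_divide_distrib)
      also have "(y + l) * (y + l + 1) - y * (y + 1) = l * (2 * y + l + 1)" by (simp add: algebra_simps)
      finally show ?thesis by simp
    qed
    finally have 1: "l / (2 * Y) \<le> 1 - y * (y + 1) / ((y + l) * (y + l + 1))" .
    have "T * (l / (2 * Y)) \<le> t * (1 - y * (y + 1) / ((y + l) * (y + l + 1)))"
      using assms 1 Y1 by (intro mult_mono) auto
    moreover have "T * (l / (2 * Y)) = 2 * (T * l / (4 * Y))" by simp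
    ultimately show "T * l / (4 * Y) \<le> \<bar>t * (y * (y + 1) / ((y + l) * (y + l + 1))) - t'\<bar>"
      using assms(5) unfolding right_diff_distrib by linarith
  qed (use assms Y1 in auto)
  also have "\<dots> = 140 * b\<^sup>2 * Y^3 / (T * l)" by (simp add: power2_eq_square power3_eq_cube)
  finally show ?thesis .
qed

text \<open>Used for t and t' further apart, where a stationary point may occur; psi grows at rate
  at least t l/(8 Y^2), which is fed into the second derivative test.\<close>

lemma ker_far:
  assumes "0 < l" "l \<le> Y" "0 < T" "T \<le> t"
  shows "norm (ker l t t') \<le> 216 * b\<^sup>2 * Y\<^sup>2 / sqrt (T * l)"
proof -
  have "norm (ker l t t') \<le> 72 * b\<^sup>2 * Y / sqrt (t * l / (8 * Y\<^sup>2))"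
    unfolding norm_ker using Y1 assms
    by (intro osc_second[where A'="\<lambda>y. \<beta>' (y + l) * \<beta> y + \<beta>' y * \<beta> (y + l)"
        and \<psi>="\<lambda>y. t * (y * (y + 1) / ((y + l) * (y + l + 1))) - t'"
        and \<psi>'="\<lambda>y. t * (l * ((y + 1) * (y + l + 1) + y * (y + l)) / ((y + l) * (y + l + 1))\<^sup>2)"] prod_deriv phase_deriv' q_deriv') auto
  \<comment> \<open>Weakening 8 to 9 makes the square root of the constant rational: 216 = 3 *
    72.\<close>
  also have "\<dots> \<le> 72 * b\<^sup>2 * Y / sqrt (T * l / (9 * Y\<^sup>2))"
  proof (intro divide_left_mono real_sqrt_le_mono mult_pos_pos)
    have "T * l / (9 * Y\<^sup>2) \<le> T * l / (8 * Y\<^sup>2)" using assms Y1 by (intro divide_left_mono) auto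
    also have "\<dots> \<le> t * l / (8 * Y\<^sup>2)" using assms by (intro divide_right_mono mult_right_mono) auto
    finally show "T * l / (9 * Y\<^sup>2) \<le> t * l / (8 * Y\<^sup>2)" .
  qed (use assms Y1 in auto)
  also have "\<dots> = 216 * b\<^sup>2 * Y\<^sup>2 / sqrt (T * l)"
    using Y1 by (simp add: real_sqrt_divide real_sqrt_mult power2_eq_square)
  finally show ?thesis .
qed

end

section \<open>Cutting integrals into unit cells, and elementary sums\<close>

lemma bounded_measurable_integrable_on:
  fixes f :: "real \<Rightarrow> 'b::euclidean_space"
  assumes "f \<in> borel_measurable borel" "\<And>x. x \<in> {a..b} \<Longrightarrow> norm (f x) \<le> B"
  shows "f integrable_on {a..b}"
proof (rule measurable_bounded_by_integrable_imp_integrable[where g="\<lambda>_. B"])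
  have "f \<in> borel_measurable lebesgue" using assms(1) by (intro borel_measurable_if_D measurable_completion) simp_all
  thus "f \<in> borel_measurable (lebesgue_on {a..b})" by (rule measurable_restrict_space1)
qed (use assms(2) in auto)

lemma integral_split_units:
  fixes f :: "real \<Rightarrow> 'b::euclidean_space"
  assumes "f integrable_on {real m..real n}" "m \<le> n"
  shows "integral {real m..real n} f = (\<Sum>j\<in>{m..<n}. integral {0..1} (\<lambda>y. f (y + real j)))"
  using assms(2,1)
proof (induction n rule: dec_induct)
  case (step n)
  have "integral {real m..real (Suc n)} f = integral {real m..real n} f + integral {real n..real (Suc n)} f"
    using step by (intro Henstock_Kurzweil_Integration.integral_combine[symmetric]) auto
  also have "integral {real n..real (Suc n)} f = integral {0..1} (\<lambda>y. f (y + real n))"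
    using integral_shift_real_ivl[of "real n" "real n" "real (Suc n)" f] by simp
  also have "f integrable_on {real m..real n}"
    using step.prems by (rule integrable_on_subinterval) auto
  hence "integral {real m..real n} f = (\<Sum>j\<in>{m..<n}. integral {0..1} (\<lambda>y. f (y + real j)))"
    by (rule step.IH)
  finally show ?case using step.hyps by simp
qed simp

lemma cis_prod_cnj: "of_real p * cis x * cnj (of_real r * cis z) = of_real (p * r) * cis (x - z)"
proof -
  have "cis (x - z) = cis x * cis (- z)" by (simp add: cis_mult)
  thus ?thesis by (simp add: cis_cnj mult_ac)
qed

lemma integral_double_sum:
  fixes f :: "'i \<Rightarrow> 'j \<Rightarrow> real \<Rightarrow> 'b::euclidean_space"
  assumes "finite A" "finite B" "\<And>i k. i \<in> A \<Longrightarrow> k \<in> B \<Longrightarrow> f i k integrable_on S"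
  shows "integral S (\<lambda>x. \<Sum>i\<in>A. \<Sum>k\<in>B. f i k x) = (\<Sum>i\<in>A. \<Sum>k\<in>B. integral S (f i k))"
proof -
  have "integral S (\<lambda>x. \<Sum>i\<in>A. \<Sum>k\<in>B. f i k x) = (\<Sum>i\<in>A. integral S (\<lambda>x. \<Sum>k\<in>B. f i k x))"
    using assms by (intro integral_sum integrable_sum) auto
  also have "\<dots> = (\<Sum>i\<in>A. \<Sum>k\<in>B. integral S (f i k))"
    using assms by (intro sum.cong refl integral_sum) auto
  finally show ?thesis .
qed

text \<open>The square is cut along its diagonals. This serves twice: for pairs of unit cells in
  \<open>K_bound\<close> and for pairs of terms of the Dirichlet polynomial in
  \<open>DP_gauss\<close>.\<close>

lemma double_sum_by_difference:
  fixes f :: "nat \<Rightarrow> nat \<Rightarrow> 'a::comm_monoid_add"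
  shows "(\<Sum>j\<in>{a..<a+n}. \<Sum>i\<in>{a..<a+n}. f j i) =
    (\<Sum>l\<in>{0..<n}. \<Sum>i\<in>{a..<a+n-l}. f (i+l) i) + (\<Sum>l\<in>{1..<n}. \<Sum>i\<in>{a..<a+n-l}. f i (i+l))"
proof -
  let ?S = "{a..<a+n}"
  let ?A = "{p \<in> ?S \<times> ?S. snd p \<le> fst p}" and ?B = "{p \<in> ?S \<times> ?S. fst p < snd p}"
  have "(\<Sum>j\<in>?S. \<Sum>i\<in>?S. f j i) = (\<Sum>p\<in>?S \<times> ?S. f (fst p) (snd p))"
    by (simp add: sum.cartesian_product case_prod_unfold)
  also have "?S \<times> ?S = ?A \<union> ?B" by auto
  also have "(\<Sum>p\<in>?A \<union> ?B. f (fst p) (snd p)) = (\<Sum>p\<in>?A. f (fst p) (snd p)) + (\<Sum>p\<in>?B. f (fst p) (snd p))"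
    by (intro sum.union_disjoint) auto
  also have "(\<Sum>p\<in>?A. f (fst p) (snd p)) = (\<Sum>p\<in>(SIGMA l:{0..<n}. {a..<a+n-l}). f (snd p + fst p) (snd p))"
    by (rule sum.reindex_bij_witness[where i="\<lambda>p. (snd p + fst p, snd p)" and j="\<lambda>p. (fst p - snd p, snd p)"]) auto
  also have "\<dots> = (\<Sum>l\<in>{0..<n}. \<Sum>i\<in>{a..<a+n-l}. f (i+l) i)"
    by (subst sum.Sigma) (auto simp: case_prod_unfold)
  also have "(\<Sum>p\<in>?B. f (fst p) (snd p)) = (\<Sum>p\<in>(SIGMA l:{1..<n}. {a..<a+n-l}). f (snd p) (snd p + fst p))"
    by (rule sum.reindex_bij_witness[where i="\<lambda>p. (snd p, snd p + fst p)" and j="\<lambda>p. (snd p - fst p, fst p)"]) auto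
  also have "\<dots> = (\<Sum>l\<in>{1..<n}. \<Sum>i\<in>{a..<a+n-l}. f i (i+l))"
    by (subst sum.Sigma) (auto simp: case_prod_unfold)
  finally show ?thesis .
qed

lemma sum_inverse_le: "(\<Sum>l\<in>{1..<n}. 1 / real l) \<le> 1 + ln (real n)" if "n \<ge> 1"
proof -
  have "(\<Sum>l\<in>{1..<Suc n}. 1 / real l) \<le> 1 + ln (real n)" using that
  proof (induction n rule: nat_induct_at_least)
    case (Suc n)
    have "ln (real n / real (Suc n)) \<le> real n / real (Suc n) - 1" using Suc.hyps by (intro ln_le_minus_one) auto
    also have "\<dots> = - (1 / real (Suc n))" by (simp add: field_simps)
    finally have "1 / real (Suc n) \<le> ln (real (Suc n)) - ln (real n)" using Suc.hyps by (simp add: ln_div)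
    thus ?case using Suc by simp
  qed simp
  moreover have "(\<Sum>l\<in>{1..<n}. 1 / real l) \<le> (\<Sum>l\<in>{1..<Suc n}. 1 / real l)" by (intro sum_mono2) auto
  ultimately show ?thesis by simp
qed

lemma sum_inverse_sqrt_le: "(\<Sum>l\<in>{1..n}. 1 / sqrt (real l)) \<le> 2 * sqrt (real n)"
proof (induction n)
  case (Suc n)
  have "1 / sqrt (real (Suc n)) \<le> 2 * (sqrt (real (Suc n)) - sqrt (real n))"
  proof -
    have s: "sqrt (real (Suc n)) > 0" by simp
    have "2 * sqrt (real (Suc n)) * sqrt (real n) \<le> real (Suc n) + real n"
      using sum_squares_ge_zero[of "sqrt (real (Suc n)) - sqrt (real n)" 0] by (simp add: algebra_simps power2_eq_square)
    hence "1 \<le> 2 * (sqrt (real (Suc n)) - sqrt (real n)) * sqrt (real (Suc n))" by (simp add: algebra_simps)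
    thus ?thesis using s by (subst divide_le_eq) (auto simp: mult_ac)
  qed
  thus ?case using Suc by simp
qed simp

text \<open>Y is an integer so that the block consists of whole periods of Q. The boundedness of Q
  is qualitative and secures integrability; the moment estimates depend on Q through the mean square
  q.\<close>

locale halasz = amp Y b \<beta> \<beta>' for Y b \<beta> \<beta>' +
  fixes Yn :: nat and Q :: "real \<Rightarrow> real" and q :: real
  assumes Yn: "Y = real Yn"
    and Qm: "Q \<in> borel_measurable borel" and Qper: "\<And>y. Q (y + 1) = Q y"
    and Qbd: "\<exists>B. \<forall>y. \<bar>Q y\<bar> \<le> B" and q: "q > 0" "integral {0..1} (\<lambda>y. (Q y)\<^sup>2) \<le> q"
begin

definition F :: "real \<Rightarrow> complex" where
  "F t = integral {Y..2*Y} (\<lambda>y. of_real (\<beta> y * Q y) * cis (t * lam y))"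

text \<open>Folding the block \<open>[Y, 2Y]\<close> onto one period of \<open>Q\<close>.\<close>

definition pp :: "real \<Rightarrow> real \<Rightarrow> complex" where
  "pp t y = (\<Sum>j\<in>{Yn..<2*Yn}. of_real (\<beta> (y + real j)) * cis (t * lam (y + real j)))"

text \<open>Entry of the Gram matrix in the large values method; Q no longer appears in it.\<close>

definition K :: "real \<Rightarrow> real \<Rightarrow> complex" where
  "K t t' = integral {0..1} (\<lambda>y. pp t y * cnj (pp t' y))"

lemma Q_shift: "Q (y + real n) = Q y"
proof (induction n)
  case (Suc n)
  have "Q (y + real (Suc n)) = Q ((y + real n) + 1)" by (simp add: algebra_simps)
  thus ?case using Suc by (simp only: Qper)
qed simp

lemma cont_unit:
  assumes "j \<in> {Yn..<2*Yn}"
  shows "continuous_on {0..1} (\<lambda>y. of_real (\<beta> (y + real j)) * cis (t * lam (y + real j)))"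
proof -
  have im: "(\<lambda>y. y + real j) ` {0..1} \<subseteq> {Y..2*Y}" using assms Yn by auto
  have "continuous_on {Y..2*Y} lam"
    using lam_deriv Y1 by (meson DERIV_isCont continuous_at_imp_continuous_on atLeastAtMost_iff less_le_trans zero_less_one)
  hence "continuous_on {Y..2*Y} (\<lambda>y. of_real (\<beta> y) * cis (t * lam y) :: complex)"
    using cont_beta by (intro continuous_intros)
  from continuous_on_compose2[OF this _ im] show ?thesis by (simp add: continuous_intros)
qed

lemma cont_pp: "continuous_on {0..1} (pp t)"
  unfolding pp_def by (intro continuous_on_sum cont_unit)

text \<open>The products of the cells j and i with j - i = l glue together to the single integral
  \<open>ker l\<close> over [Y, 2 Y - l]; pairs with j < i give conjugates with t and t'
  exchanged.\<close>

lemma K_bound: "norm (K t t') \<le> (\<Sum>l\<in>{0..<Yn}. norm (ker (real l) t t')) + (\<Sum>l\<in>{1..<Yn}. norm (ker (real l) t' t))"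
proof -
  define g where "g = (\<lambda>j i y. of_real (\<beta> (y + real j)) * cis (t * lam (y + real j)) * cnj (of_real (\<beta> (y + real i)) * cis (t' * lam (y + real i))))"
  have gi: "g j i integrable_on {0..1}" if "j \<in> {Yn..<2*Yn}" "i \<in> {Yn..<2*Yn}" for j i
    unfolding g_def by (rule integrable_continuous_interval, rule continuous_on_mult[OF cont_unit[OF that(1)] continuous_on_cnj[OF cont_unit[OF that(2)]]])
  have "K t t' = integral {0..1} (\<lambda>y. \<Sum>j\<in>{Yn..<2*Yn}. \<Sum>i\<in>{Yn..<2*Yn}. g j i y)"
    unfolding K_def pp_def g_def cnj_sum sum_product by (rule refl)
  also have "\<dots> = (\<Sum>j\<in>{Yn..<2*Yn}. \<Sum>i\<in>{Yn..<2*Yn}. integral {0..1} (g j i))"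
    by (rule integral_double_sum[OF _ _ gi]) simp_all
  also have "\<dots> = (\<Sum>l\<in>{0..<Yn}. \<Sum>i\<in>{Yn..<2*Yn-l}. integral {0..1} (g (i+l) i)) + (\<Sum>l\<in>{1..<Yn}. \<Sum>i\<in>{Yn..<2*Yn-l}. integral {0..1} (g i (i+l)))"
    using double_sum_by_difference[of "\<lambda>j i. integral {0..1} (g j i)" Yn Yn] by (simp add: mult_2)
  finally have K: "K t t' = (\<Sum>l\<in>{0..<Yn}. \<Sum>i\<in>{Yn..<2*Yn-l}. integral {0..1} (g (i+l) i)) + (\<Sum>l\<in>{1..<Yn}. \<Sum>i\<in>{Yn..<2*Yn-l}. integral {0..1} (g i (i+l)))" .
  have kk: "ker (real l) u u' = (\<Sum>i\<in>{Yn..<2*Yn-l}. integral {0..1} (\<lambda>y. of_real (\<beta> (y + real i + real l) * \<beta> (y + real i)) * cis (u * lam (y + real i + real l) - u' * lam (y + real i))))"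
    if "l < Yn" for l u u'
  proof -
    have e: "2 * Y - real l = real (2*Yn-l)" using that Yn by auto
    show ?thesis unfolding ker_def using that unfolding e unfolding Yn
      by (subst integral_split_units)
        (use integrable_continuous_interval[OF cont_ker[of "real l" u u']] in \<open>auto simp: e[symmetric] Yn\<close>)
  qed
  have k1: "(\<Sum>i\<in>{Yn..<2*Yn-l}. integral {0..1} (g (i+l) i)) = ker (real l) t t'" if "l < Yn" for l
    unfolding kk[OF that] g_def
    unfolding cis_prod_cnj by (simp add: add.assoc)
  have k2: "(\<Sum>i\<in>{Yn..<2*Yn-l}. integral {0..1} (g i (i+l))) = cnj (ker (real l) t' t)" if "l < Yn" for l
    unfolding kk[OF that] g_def cnj_sum Henstock_Kurzweil_Integration.integral_cnj
    unfolding cis_prod_cnj by (simp add: add.assoc cis_cnj mult.commute)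
  have "norm (K t t') = norm ((\<Sum>l\<in>{0..<Yn}. ker (real l) t t') + (\<Sum>l\<in>{1..<Yn}. cnj (ker (real l) t' t)))"
    unfolding K using k1 k2 by simp
  also have "\<dots> \<le> (\<Sum>l\<in>{0..<Yn}. norm (ker (real l) t t')) + (\<Sum>l\<in>{1..<Yn}. norm (cnj (ker (real l) t' t)))"
    by (rule order_trans[OF norm_triangle_ineq add_mono[OF norm_sum norm_sum]])
  finally show ?thesis by simp
qed

text \<open>The shifts covered by \<open>ker_near\<close> contribute a harmonic sum. The others
  satisfy l <= 4 Y D/T, and these few contribute a sum of l^(-1/2).\<close>

lemma ker_sum:
  assumes T: "0 < T" "T \<le> t" and D: "\<bar>t - t'\<bar> \<le> D"
  shows "(\<Sum>l\<in>{1..<Yn}. norm (ker (real l) t t')) \<le>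
    140 * b\<^sup>2 * Y^3 / T * (1 + ln Y) + 864 * b\<^sup>2 * Y\<^sup>2 * sqrt (Y * D) / T"
proof -
  \<comment> \<open>The largest shift for which the condition of \<open>ker_near\<close> may
    fail.\<close>
  define M where "M = nat \<lfloor>4 * Y * D / T\<rfloor>"
  have D0: "0 \<le> D" using D by linarith
  have "(\<Sum>l\<in>{1..<Yn}. norm (ker (real l) t t')) \<le>
     (\<Sum>l\<in>{1..<Yn}. 140 * b\<^sup>2 * Y^3 / T * (1 / real l) + (if l \<le> M then 216 * b\<^sup>2 * Y\<^sup>2 / sqrt T * (1 / sqrt (real l)) else 0))"
  proof (intro sum_mono)
    fix l assume l: "l \<in> {1..<Yn}"
    have p1: "0 \<le> 140 * b\<^sup>2 * Y^3 / T * (1 / real l)" "0 \<le> 216 * b\<^sup>2 * Y\<^sup>2 / sqrt T * (1 / sqrt (real l))"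
      using Y1 T by auto
    show "norm (ker (real l) t t') \<le> 140 * b\<^sup>2 * Y^3 / T * (1 / real l) + (if l \<le> M then 216 * b\<^sup>2 * Y\<^sup>2 / sqrt T * (1 / sqrt (real l)) else 0)"
    proof (cases "\<bar>t - t'\<bar> \<le> T * real l / (4 * Y)")
      case True
      have "norm (ker (real l) t t') \<le> 140 * b\<^sup>2 * Y^3 / (T * real l)"
        using l T True Yn by (intro ker_near) auto
      thus ?thesis using p1 by auto
    next
      case False
      hence "T * real l / (4 * Y) \<le> D" using D by linarith
      hence "real l \<le> 4 * Y * D / T" using Y1 T by (simp add: field_simps)
      hence "l \<le> M" unfolding M_def by (simp add: le_nat_floor)
      moreover have "norm (ker (real l) t t') \<le> 216 * b\<^sup>2 * Y\<^sup>2 / sqrt (T * real l)"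
        using l T Yn by (intro ker_far) auto
      ultimately show ?thesis using p1 by (auto simp: real_sqrt_mult)
    qed
  qed
  also have "\<dots> = 140 * b\<^sup>2 * Y^3 / T * (\<Sum>l\<in>{1..<Yn}. 1 / real l) + 216 * b\<^sup>2 * Y\<^sup>2 / sqrt T * (\<Sum>l\<in>{1..<Yn}\<inter>{l. l \<le> M}. 1 / sqrt (real l))"
    unfolding sum.distrib sum_distrib_left
    by (subst sum.inter_restrict) (auto intro: sum.cong)
  also have "\<dots> \<le> 140 * b\<^sup>2 * Y^3 / T * (1 + ln Y) + 216 * b\<^sup>2 * Y\<^sup>2 / sqrt T * (2 * sqrt (4 * Y * D / T))"
  proof (intro add_mono mult_left_mono)
    show "(\<Sum>l\<in>{1..<Yn}. 1 / real l) \<le> 1 + ln Y" using sum_inverse_le[of Yn] Y1 Yn by simp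
    have "(\<Sum>l\<in>{1..<Yn}\<inter>{l. l \<le> M}. 1 / sqrt (real l)) \<le> (\<Sum>l\<in>{1..M}. 1 / sqrt (real l))"
      by (intro sum_mono2) auto
    also have "\<dots> \<le> 2 * sqrt (real M)" by (rule sum_inverse_sqrt_le)
    also have "real M \<le> 4 * Y * D / T" unfolding M_def using D0 Y1 T by (intro of_nat_floor) auto
    finally show "(\<Sum>l\<in>{1..<Yn}\<inter>{l. l \<le> M}. 1 / sqrt (real l)) \<le> 2 * sqrt (4 * Y * D / T)" by simp
  qed (use T Y1 in auto)
  also have "216 * b\<^sup>2 * Y\<^sup>2 / sqrt T * (2 * sqrt (4 * Y * D / T)) = 864 * b\<^sup>2 * Y\<^sup>2 * sqrt (Y * D) / T"
    using T by (simp add: real_sqrt_divide real_sqrt_mult)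
  finally show ?thesis .
qed

lemma integrable_Q: "continuous_on {0..1} f \<Longrightarrow> (\<lambda>y. of_real (Q y) * (f y :: complex)) integrable_on {0..1}"
proof -
  assume f: "continuous_on {0..1} f"
  obtain B where B: "\<bar>Q y\<bar> \<le> B" for y using Qbd by blast
  have "compact (f ` {0..1})" using f by (intro compact_continuous_image) auto
  then obtain C where C: "\<And>y. y \<in> {0..1} \<Longrightarrow> norm (f y) \<le> C"
    using compact_imp_bounded bounded_iff by (metis imageI)
  have fm: "(\<lambda>y. indicator {0..1} y *\<^sub>R f y) \<in> borel_measurable borel"
    using borel_measurable_continuous_on_indicator[OF _ f] by simp
  have "(\<lambda>y. of_real (Q y) * (indicator {0..1} y *\<^sub>R f y)) integrable_on {0..1}"
  proof (rule bounded_measurable_integrable_on)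
    show "(\<lambda>y. of_real (Q y) * (indicator {0..1} y *\<^sub>R f y)) \<in> borel_measurable borel"
      using Qm fm by measurable
    show "norm (of_real (Q y) * (indicator {0..1} y *\<^sub>R f y)) \<le> B * C" if "y \<in> {0..1}" for y
      using B[of y] C[OF that] that by (auto simp: norm_mult intro!: mult_mono order_trans[OF _ B[of y]])
  qed
  thus ?thesis by (rule integrable_eq) auto
qed

lemma integrable_Q2: "(\<lambda>y. (Q y)\<^sup>2) integrable_on {0..1}"
proof -
  obtain B where B: "\<bar>Q y\<bar> \<le> B" for y using Qbd by blast
  have "norm ((Q y)\<^sup>2) \<le> B\<^sup>2" for y using power_mono[OF B[of y], of 2] by simp
  thus ?thesis using Qm by (intro bounded_measurable_integrable_on[where B="B\<^sup>2"]) auto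
qed

lemma integrable_block:
  assumes "continuous_on {Y..2*Y} h"
  shows "(\<lambda>y. of_real (h y * Q y) * cis (t * lam y)) integrable_on {Y..2*Y}"
proof -
  obtain B where B: "\<bar>Q y\<bar> \<le> B" for y using Qbd by blast
  have "compact (h ` {Y..2*Y})" using assms by (intro compact_continuous_image) auto
  then obtain C where C: "\<And>y. y \<in> {Y..2*Y} \<Longrightarrow> norm (h y) \<le> C"
    using compact_imp_bounded bounded_iff by (metis imageI)
  have hm: "(\<lambda>y. indicator {Y..2*Y} y *\<^sub>R h y) \<in> borel_measurable borel"
    using borel_measurable_continuous_on_indicator[OF _ assms] by simp
  have lm: "lam \<in> borel_measurable borel" unfolding lam_def by measurable
  have cm: "(\<lambda>y. cis (t * lam y)) \<in> borel_measurable borel"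
    unfolding cis_conv_exp using lm by measurable
  have "(\<lambda>y. of_real ((indicator {Y..2*Y} y *\<^sub>R h y) * Q y) * cis (t * lam y)) integrable_on {Y..2*Y}"
  proof (rule bounded_measurable_integrable_on)
    show "(\<lambda>y. of_real ((indicator {Y..2*Y} y *\<^sub>R h y) * Q y) * cis (t * lam y)) \<in> borel_measurable borel"
      using Qm hm cm by measurable
    show "norm (of_real ((indicator {Y..2*Y} y *\<^sub>R h y) * Q y) * cis (t * lam y)) \<le> C * B" if "y \<in> {Y..2*Y}" for y
      using B[of y] C[OF that] that by (auto simp: norm_mult abs_mult intro!: mult_mono order_trans[OF _ C[of y]])
  qed
  thus ?thesis by (rule integrable_eq) auto
qed

lemma F_alt: "F t = integral {0..1} (\<lambda>y. of_real (Q y) * pp t y)"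
proof -
  have ib: "(\<lambda>y. of_real (\<beta> y * Q y) * cis (t * lam y)) integrable_on {real Yn..real (2*Yn)}"
    using integrable_block[OF cont_beta] Yn by simp
  have "F t = (\<Sum>j\<in>{Yn..<2*Yn}. integral {0..1} (\<lambda>y. of_real (\<beta> (y + real j) * Q (y + real j)) * cis (t * lam (y + real j))))"
    unfolding F_def using integral_split_units[OF ib] Yn by simp
  also have "\<dots> = (\<Sum>j\<in>{Yn..<2*Yn}. integral {0..1} (\<lambda>y. of_real (Q y) * (of_real (\<beta> (y + real j)) * cis (t * lam (y + real j)))))"
    by (simp add: Q_shift mult_ac)
  also have "\<dots> = integral {0..1} (\<lambda>y. \<Sum>j\<in>{Yn..<2*Yn}. of_real (Q y) * (of_real (\<beta> (y + real j)) * cis (t * lam (y + real j))))"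
    by (intro integral_sum[symmetric] integrable_Q cont_unit) auto
  finally show ?thesis unfolding pp_def by (simp add: sum_distrib_left)
qed

text \<open>The coefficients \<open>c i\<close> align the phases of \<open>F (t i)\<close>; Cauchy-Schwarz on one period then removes \<open>Q\<close>.\<close>

lemma duality:
  assumes A: "finite A"
  shows "(\<Sum>i\<in>A. norm (F (t i)))\<^sup>2 \<le> q * (\<Sum>i\<in>A. \<Sum>k\<in>A. norm (K (t i) (t k)))"
proof -
  define S where "S = (\<Sum>i\<in>A. norm (F (t i)))"
  define M where "M = (\<Sum>i\<in>A. \<Sum>k\<in>A. norm (K (t i) (t k)))"
  have S0: "S \<ge> 0" unfolding S_def by (intro sum_nonneg) auto
  define c where "c = (\<lambda>i. cnj (sgn (F (t i))))"
  have c1: "norm (c i) \<le> 1" for i unfolding c_def by (simp add: norm_sgn)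
  define P where "P = (\<lambda>y. \<Sum>i\<in>A. c i * pp (t i) y)"
  have cP: "continuous_on {0..1} P" unfolding P_def by (intro continuous_intros cont_pp)
  have cF: "c i * F (t i) = of_real (norm (F (t i)))" for i
    unfolding c_def by (cases "F (t i) = 0") (auto simp: sgn_eq mult.commute[of "cnj _"] complex_norm_square[symmetric] power2_eq_square)
  have "of_real S = (\<Sum>i\<in>A. c i * F (t i))" unfolding S_def by (simp add: cF)
  also have "\<dots> = (\<Sum>i\<in>A. integral {0..1} (\<lambda>y. of_real (Q y) * (c i * pp (t i) y)))"
    unfolding F_alt integral_mult_right[symmetric] by (simp add: mult.left_commute)
  also have "\<dots> = integral {0..1} (\<lambda>y. of_real (Q y) * P y)"
    unfolding P_def sum_distrib_left using A
    by (intro integral_sum[symmetric] integrable_Q continuous_on_mult continuous_on_const cont_pp) auto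
  finally have SQ: "of_real S = integral {0..1} (\<lambda>y. of_real (Q y) * P y)" .
  have PP: "integral {0..1} (\<lambda>y. (norm (P y))\<^sup>2) \<le> M"
  proof -
    have i0: "(\<lambda>y. (c i * pp (t i) y) * cnj (c k * pp (t k) y)) integrable_on {0..1}" for i k
      by (intro integrable_continuous_interval continuous_intros cont_pp)
    have "of_real (integral {0..1} (\<lambda>y. (norm (P y))\<^sup>2)) = integral {0..1} (\<lambda>y. P y * cnj (P y))"
    proof -
      have "(\<lambda>y. (norm (P y))\<^sup>2) integrable_on {0..1}"
        by (intro integrable_continuous_interval continuous_intros cP)
      from integral_linear[OF this bounded_linear_of_real[where 'a=complex]]
      show ?thesis unfolding o_def complex_norm_square by (rule sym)
    qed
    also have "\<dots> = integral {0..1} (\<lambda>y. \<Sum>i\<in>A. \<Sum>k\<in>A. (c i * pp (t i) y) * cnj (c k * pp (t k) y))"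
      unfolding P_def cnj_sum sum_product by (rule refl)
    also have "\<dots> = (\<Sum>i\<in>A. \<Sum>k\<in>A. integral {0..1} (\<lambda>y. (c i * pp (t i) y) * cnj (c k * pp (t k) y)))"
      by (rule integral_double_sum[OF A A i0])
    also have "\<dots> = (\<Sum>i\<in>A. \<Sum>k\<in>A. (c i * cnj (c k)) * K (t i) (t k))"
    proof -
      have "(\<lambda>y. (c i * pp (t i) y) * cnj (c k * pp (t k) y)) = (\<lambda>y. (c i * cnj (c k)) * (pp (t i) y * cnj (pp (t k) y)))" for i k
        by (simp add: mult_ac fun_eq_iff)
      thus ?thesis unfolding K_def integral_mult_right[symmetric] by simp
    qed
    finally have "norm (of_real (integral {0..1} (\<lambda>y. (norm (P y))\<^sup>2)) :: complex) \<le> (\<Sum>i\<in>A. \<Sum>k\<in>A. norm ((c i * cnj (c k)) * K (t i) (t k)))"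
      by (simp only:) (intro order_trans[OF norm_sum] sum_mono order_refl)
    also have "\<dots> \<le> M" unfolding M_def
      using c1 by (intro sum_mono) (auto simp: norm_mult intro!: mult_left_le_one_le mult_le_one)
    finally show ?thesis by simp
  qed
  have M0: "0 \<le> M" unfolding M_def by (intro sum_nonneg) auto
  \<comment> \<open>Cauchy-Schwarz in the form of the inequality between arithmetic and geometric
    mean with a free weight x; the choice x = S / q turns it into S^2 <= q M.\<close>
  have key: "2 * S \<le> x * q + M / x" if x: "x > 0" for x
  proof -
    have i2: "(\<lambda>y. (norm (P y))\<^sup>2) integrable_on {0..1}"
      by (intro integrable_continuous_interval continuous_intros cP)
    have h: "((\<lambda>y. (1/2) * (x * (Q y)\<^sup>2 + (1/x) * (norm (P y))\<^sup>2)) has_integral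
        (1/2) * (x * integral {0..1} (\<lambda>y. (Q y)\<^sup>2) + (1/x) * integral {0..1} (\<lambda>y. (norm (P y))\<^sup>2))) {0..1}"
      by (intro has_integral_mult_right has_integral_add integrable_integral integrable_Q2 i2)
    have "S = norm (of_real S :: complex)" using S0 by simp
    also have "\<dots> \<le> integral {0..1} (\<lambda>y. (1/2) * (x * (Q y)\<^sup>2 + (1/x) * (norm (P y))\<^sup>2))"
      unfolding SQ
    proof (rule integral_norm_bound_integral)
      show "(\<lambda>y. of_real (Q y) * P y) integrable_on {0..1}" by (rule integrable_Q[OF cP])
      show "(\<lambda>y. (1/2) * (x * (Q y)\<^sup>2 + (1/x) * (norm (P y))\<^sup>2)) integrable_on {0..1}"
        using h by (rule has_integral_integrable)
      fix y :: real
      have "0 \<le> (x * \<bar>Q y\<bar> - norm (P y))\<^sup>2 / x" using x by simp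
      also have "\<dots> = x * (Q y)\<^sup>2 + (1/x) * (norm (P y))\<^sup>2 - 2 * (\<bar>Q y\<bar> * norm (P y))"
        using x by (simp add: power2_eq_square field_simps)
      finally show "norm (of_real (Q y) * P y) \<le> (1/2) * (x * (Q y)\<^sup>2 + (1/x) * (norm (P y))\<^sup>2)"
        by (simp add: norm_mult)
    qed
    also have "\<dots> = (1/2) * (x * integral {0..1} (\<lambda>y. (Q y)\<^sup>2) + (1/x) * integral {0..1} (\<lambda>y. (norm (P y))\<^sup>2))"
      using h by (rule integral_unique)
    also have "\<dots> \<le> (1/2) * (x * q + (1/x) * M)"
      using q PP x by (intro mult_left_mono add_mono) auto
    finally show ?thesis by simp
  qed
  have "S\<^sup>2 \<le> q * M"
  proof (cases "S = 0")
    case False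
    hence S: "S > 0" using S0 by simp
    have "2 * S \<le> S / q * q + M / (S / q)" using S q by (intro key) auto
    hence "S \<le> M * q / S" using S q by simp
    thus ?thesis using S by (simp add: field_simps power2_eq_square)
  qed (use M0 q in auto)
  thus ?thesis unfolding S_def M_def .
qed

lemma K_estimate:
  assumes T: "0 < T" "T \<le> t" "T \<le> t'" and D: "\<bar>t - t'\<bar> \<le> D"
  shows "norm (K t t') \<le> norm (ker 0 t t') + b\<^sup>2 * (280 * Y^3 / T * (1 + ln Y) + 1728 * Y\<^sup>2 * sqrt (Y * D) / T)"
proof -
  have n: "{0..<Yn} = insert 0 {1..<Yn}" using Yn Y1 by auto
  have "norm (K t t') \<le> norm (ker 0 t t') + (\<Sum>l\<in>{1..<Yn}. norm (ker (real l) t t')) + (\<Sum>l\<in>{1..<Yn}. norm (ker (real l) t' t))"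
    using K_bound[of t t'] unfolding n by simp
  also have "\<dots> \<le> norm (ker 0 t t') + (140 * b\<^sup>2 * Y^3 / T * (1 + ln Y) + 864 * b\<^sup>2 * Y\<^sup>2 * sqrt (Y * D) / T) +
     (140 * b\<^sup>2 * Y^3 / T * (1 + ln Y) + 864 * b\<^sup>2 * Y\<^sup>2 * sqrt (Y * D) / T)"
    using assms by (intro add_mono order_refl ker_sum) auto
  also have "\<dots> = norm (ker 0 t t') + b\<^sup>2 * (280 * Y^3 / T * (1 + ln Y) + 1728 * Y\<^sup>2 * sqrt (Y * D) / T)"
    by (simp add: algebra_simps)
  finally show ?thesis .
qed

end

section \<open>Mean square over T <= t <= 2 T by Gaussian averaging\<close>

lemma gauss_char:
  assumes "\<sigma> > 0"
  shows "(LINT u|lborel. of_real (normal_density \<mu> \<sigma> u) * cis (u * x)) = cis (\<mu> * x) * of_real (exp (- (\<sigma> * x)\<^sup>2 / 2))"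
    "integrable lborel (\<lambda>u. of_real (normal_density \<mu> \<sigma> u) * cis (u * x))"
proof -
  have m: "(\<lambda>u. cis (u * x)) \<in> borel_measurable borel" for x unfolding cis_conv_exp by measurable
  show "integrable lborel (\<lambda>u. of_real (normal_density \<mu> \<sigma> u) * cis (u * x))"
    by (rule Bochner_Integration.integrable_bound[OF integrable_normal_density[of \<sigma> \<mu>]]) (use assms m in \<open>auto simp: norm_mult\<close>)
  have "(LINT u|lborel. of_real (normal_density \<mu> \<sigma> u) * cis (u * x)) =
     \<bar>\<sigma>\<bar> *\<^sub>R (LINT u|lborel. of_real (normal_density \<mu> \<sigma> (\<mu> + \<sigma> * u)) * cis ((\<mu> + \<sigma> * u) * x))"
    using assms by (intro lborel_integral_real_affine) auto
  also have "\<dots> = (LINT u|lborel. cis (\<mu> * x) * (std_normal_density u *\<^sub>R iexp (\<sigma> * x * u)))"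
  proof -
    have "\<sigma> *\<^sub>R (of_real (normal_density \<mu> \<sigma> (\<mu> + \<sigma> * u)) * cis ((\<mu> + \<sigma> * u) * x)) = cis (\<mu> * x) * (std_normal_density u *\<^sub>R iexp (\<sigma> * x * u))" for u
    proof -
      have "\<sigma> * normal_density \<mu> \<sigma> (\<mu> + \<sigma> * u) = std_normal_density u"
        using assms by (simp add: normal_density_def real_sqrt_mult power_mult_distrib field_simps)
      moreover have "cis ((\<mu> + \<sigma> * u) * x) = cis (\<mu> * x) * iexp (\<sigma> * x * u)"
        by (simp add: cis_conv_exp algebra_simps flip: exp_add)
      ultimately show ?thesis
        by (metis (no_types, lifting) mult.left_commute mult_scaleR_left of_real_mult scaleR_conv_of_real)
    qed
    thus ?thesis using assms by (simp flip: integral_scaleR_right)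
  qed
  also have "\<dots> = cis (\<mu> * x) * (LINT u|lborel. std_normal_density u *\<^sub>R iexp (\<sigma> * x * u))"
    by (rule integral_mult_right_zero)
  also have "(LINT u|lborel. std_normal_density u *\<^sub>R iexp (\<sigma> * x * u)) = char std_normal_distribution (\<sigma> * x)"
    unfolding char_def by (subst integral_density) auto
  finally show "(LINT u|lborel. of_real (normal_density \<mu> \<sigma> u) * cis (u * x)) = cis (\<mu> * x) * of_real (exp (- (\<sigma> * x)\<^sup>2 / 2))"
    by (simp add: char_std_normal_distribution)
qed

lemma gauss_char':
  assumes "\<sigma> > 0"
  shows "(LINT u|density lborel (normal_density \<mu> \<sigma>). cis (u * x)) = cis (\<mu> * x) * of_real (exp (- (\<sigma> * x)\<^sup>2 / 2))"
proof -
  have m: "(\<lambda>u. cis (u * x)) \<in> borel_measurable borel" for x unfolding cis_conv_exp by measurable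
  show ?thesis using gauss_char(1)[OF assms, of \<mu> x] m
    by (subst integral_density) (auto simp: scaleR_conv_of_real)
qed

text \<open>Schur's test for the Gaussian kernel that comes from averaging over \<open>t\<close>.\<close>

lemma gauss_mean_square:
  fixes \<nu> :: "real measure" and h :: "real \<Rightarrow> real" and \<Lambda> :: "real \<Rightarrow> real"
  assumes fin: "finite_measure \<nu>" and sets: "sets \<nu> = sets (restrict_space borel S)" and S: "S \<in> sets borel"
    and h: "h \<in> borel_measurable borel" "\<And>y. \<bar>h y\<bar> \<le> B" and L: "\<Lambda> \<in> borel_measurable borel"
    and sg: "\<sigma> > 0"
    and ker: "\<And>y. y \<in> S \<Longrightarrow> (LINT z|\<nu>. exp (- (\<sigma> * (\<Lambda> y - \<Lambda> z))\<^sup>2 / 2)) \<le> C"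
  shows "(LINT t|density lborel (normal_density \<mu> \<sigma>). (norm (LINT y|\<nu>. of_real (h y) * cis (t * \<Lambda> y)))\<^sup>2) \<le> C * (LINT y|\<nu>. (h y)\<^sup>2)"
proof -
  interpret \<nu>: finite_measure \<nu> by fact
  define N where "N = density lborel (normal_density \<mu> \<sigma>)"
  interpret N: prob_space N unfolding N_def using sg by (rule prob_space_normal_density)
  interpret vv: pair_sigma_finite \<nu> \<nu> ..
  interpret vv: finite_measure "\<nu> \<Otimes>\<^sub>M \<nu>" by (rule finite_measure_pair_measure) unfold_locales
  interpret NP: pair_sigma_finite N "\<nu> \<Otimes>\<^sub>M \<nu>" ..
  interpret NPf: finite_measure "N \<Otimes>\<^sub>M (\<nu> \<Otimes>\<^sub>M \<nu>)" by (rule finite_measure_pair_measure) unfold_locales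
  have spv: "space \<nu> = S" using sets_eq_imp_space_eq[OF sets] by (simp add: space_restrict_space)
  have B0: "0 \<le> B" using h(2)[of 0] by linarith
  have mv: "f \<in> borel_measurable \<nu>" if "f \<in> borel_measurable borel" for f :: "real \<Rightarrow> 'z::topological_space"
    using measurable_restrict_space1[OF that, of S] measurable_cong_sets[OF sets refl] by blast
  have [measurable]: "h \<in> borel_measurable \<nu>" "\<Lambda> \<in> borel_measurable \<nu>" using h L mv by auto
  have [measurable]: "cis \<in> borel_measurable borel" unfolding cis_conv_exp[abs_def] by measurable
  have [measurable_cong]: "sets N = sets borel" unfolding N_def by simp
  define f where "f = (\<lambda>t p. of_real (h (fst p) * h (snd p)) * cis (t * (\<Lambda> (fst p) - \<Lambda> (snd p))))"
  have hb: "\<bar>h y * h z\<bar> \<le> B * B" for y z unfolding abs_mult using h(2) B0 by (intro mult_mono) auto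
  have i1: "integrable \<nu> (\<lambda>y. of_real (h y) * cis (t * \<Lambda> y))" for t
    by (rule \<nu>.integrable_const_bound[where B=B]) (use h(2) in \<open>auto simp: norm_mult\<close>)
  have ip: "integrable (\<nu> \<Otimes>\<^sub>M \<nu>) (f t)" for t
    unfolding f_def by (rule vv.integrable_const_bound[where B="B*B"]) (use hb in \<open>auto simp: norm_mult simp del: of_real_mult\<close>)
  have iN: "integrable (N \<Otimes>\<^sub>M (\<nu> \<Otimes>\<^sub>M \<nu>)) (case_prod f)"
    unfolding f_def by (rule NPf.integrable_const_bound[where B="B*B"]) (use hb in \<open>auto simp: norm_mult case_prod_unfold simp del: of_real_mult\<close>)
  have sq: "of_real ((norm (LINT y|\<nu>. of_real (h y) * cis (t * \<Lambda> y)))\<^sup>2) = (LINT p|(\<nu> \<Otimes>\<^sub>M \<nu>). f t p)" for t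
  proof -
    let ?I = "LINT y|\<nu>. of_real (h y) * cis (t * \<Lambda> y)"
    have "of_real ((norm ?I)\<^sup>2) = ?I * cnj ?I" by (rule complex_norm_square)
    also have "\<dots> = (LINT y|\<nu>. (of_real (h y) * cis (t * \<Lambda> y)) * cnj ?I)"
      by (rule integral_mult_left_zero[symmetric])
    also have "\<dots> = (LINT y|\<nu>. (LINT z|\<nu>. f t (y, z)))"
    proof (rule Bochner_Integration.integral_cong[OF refl])
      fix y
      have "(of_real (h y) * cis (t * \<Lambda> y)) * cnj ?I = (LINT z|\<nu>. (of_real (h y) * cis (t * \<Lambda> y)) * cnj (of_real (h z) * cis (t * \<Lambda> z)))"
        by (simp only: Bochner_Integration.integral_cnj[symmetric] integral_mult_right_zero)
      thus "(of_real (h y) * cis (t * \<Lambda> y)) * cnj ?I = (LINT z|\<nu>. f t (y, z))"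
        unfolding cis_prod_cnj f_def by (simp add: right_diff_distrib)
    qed
    also have "\<dots> = (LINT p|(\<nu> \<Otimes>\<^sub>M \<nu>). f t p)"
      using vv.integral_fst'[OF ip] .
    finally show ?thesis .
  qed
  define E where "E = (\<lambda>y z. exp (- (\<sigma> * (\<Lambda> y - \<Lambda> z))\<^sup>2 / 2))"
  have E1: "0 \<le> E y z" "E y z \<le> 1" for y z unfolding E_def by auto
  have [measurable]: "(\<lambda>p. E (fst p) (snd p)) \<in> borel_measurable (\<nu> \<Otimes>\<^sub>M \<nu>)" unfolding E_def by measurable
  have fN: "(LINT t|N. f t p) = of_real (h (fst p) * h (snd p)) * (cis (\<mu> * (\<Lambda> (fst p) - \<Lambda> (snd p))) * of_real (E (fst p) (snd p)))" for p
    unfolding f_def N_def E_def using gauss_char'[OF sg] by simp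
  have "of_real (LINT t|N. (norm (LINT y|\<nu>. of_real (h y) * cis (t * \<Lambda> y)))\<^sup>2) = (LINT t|N. (LINT p|(\<nu> \<Otimes>\<^sub>M \<nu>). f t p))"
    unfolding sq[symmetric] integral_complex_of_real ..
  also have "\<dots> = (LINT p|(\<nu> \<Otimes>\<^sub>M \<nu>). (LINT t|N. f t p))"
    by (rule NP.Fubini_integral[OF iN, symmetric])
  finally have eq: "of_real (LINT t|N. (norm (LINT y|\<nu>. of_real (h y) * cis (t * \<Lambda> y)))\<^sup>2) = (LINT p|(\<nu> \<Otimes>\<^sub>M \<nu>). (LINT t|N. f t p))" .
  have int2: "integrable (\<nu> \<Otimes>\<^sub>M \<nu>) (\<lambda>p. g (fst p) (snd p) * E (fst p) (snd p))"
    if "(\<lambda>p. g (fst p) (snd p)) \<in> borel_measurable (\<nu> \<Otimes>\<^sub>M \<nu>)" "\<And>y z. \<bar>g y z\<bar> \<le> B*B" for g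
  proof (rule vv.integrable_const_bound[where B="B*B"])
    show "AE x in (\<nu> \<Otimes>\<^sub>M \<nu>). norm (g (fst x) (snd x) * E (fst x) (snd x)) \<le> B * B"
    proof (rule AE_I2)
      fix x have "\<bar>g (fst x) (snd x)\<bar> * \<bar>E (fst x) (snd x)\<bar> \<le> (B*B) * 1"
        using that(2) E1 B0 by (intro mult_mono) auto
      thus "norm (g (fst x) (snd x) * E (fst x) (snd x)) \<le> B * B" by (simp add: abs_mult)
    qed
  qed (use that(1) in measurable)
  have hh: "\<bar>(h y)\<^sup>2\<bar> \<le> B * B" for y using hb[of y y] by (simp add: power2_eq_square)
  have j1: "integrable (\<nu> \<Otimes>\<^sub>M \<nu>) (\<lambda>p. (h (fst p))\<^sup>2 * E (fst p) (snd p))"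
    by (rule int2[of "\<lambda>y z. (h y)\<^sup>2"]) (use hh in auto)
  have j2: "integrable (\<nu> \<Otimes>\<^sub>M \<nu>) (\<lambda>p. (h (snd p))\<^sup>2 * E (fst p) (snd p))"
    by (rule int2[of "\<lambda>y z. (h z)\<^sup>2"]) (use hh in auto)
  have ih: "integrable \<nu> (\<lambda>y. (h y)\<^sup>2)"
    by (rule \<nu>.integrable_const_bound[where B="B*B"]) (use hh in auto)
  have k1: "(LINT p|(\<nu> \<Otimes>\<^sub>M \<nu>). (h (fst p))\<^sup>2 * E (fst p) (snd p)) \<le> C * (LINT y|\<nu>. (h y)\<^sup>2)"
  proof -
    have "(LINT p|(\<nu> \<Otimes>\<^sub>M \<nu>). (h (fst p))\<^sup>2 * E (fst p) (snd p)) = (LINT y|\<nu>. (LINT z|\<nu>. (h y)\<^sup>2 * E y z))"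
      using vv.integral_fst'[OF j1] by simp
    also have "\<dots> \<le> (LINT y|\<nu>. C * (h y)\<^sup>2)"
    proof (rule integral_mono)
      show "integrable \<nu> (\<lambda>y. (LINT z|\<nu>. (h y)\<^sup>2 * E y z))" using vv.integrable_fst'[OF j1] by simp
      show "(LINT z|\<nu>. (h y)\<^sup>2 * E y z) \<le> C * (h y)\<^sup>2" if "y \<in> space \<nu>" for y
        using mult_left_mono[OF ker[of y], of "(h y)\<^sup>2"] that spv unfolding E_def by (simp add: mult.commute)
    qed (use ih in auto)
    finally show ?thesis by simp
  qed
  have k2: "(LINT p|(\<nu> \<Otimes>\<^sub>M \<nu>). (h (snd p))\<^sup>2 * E (fst p) (snd p)) = (LINT p|(\<nu> \<Otimes>\<^sub>M \<nu>). (h (fst p))\<^sup>2 * E (fst p) (snd p))"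
  proof -
    have "E z y = E y z" for y z unfolding E_def by (simp add: power2_commute[of "\<Lambda> y"] power_mult_distrib)
    thus ?thesis using vv.integral_product_swap[of "\<lambda>p. (h (fst p))\<^sup>2 * E (fst p) (snd p)"] j1
      by (simp add: case_prod_unfold borel_measurable_integrable)
  qed
  have "(LINT t|N. (norm (LINT y|\<nu>. of_real (h y) * cis (t * \<Lambda> y)))\<^sup>2) = norm (LINT p|(\<nu> \<Otimes>\<^sub>M \<nu>). (LINT t|N. f t p))"
    unfolding eq[symmetric] by (simp add: integral_nonneg)
  \<comment> \<open>Here 2 |h y h z| <= (h y)^2 + (h z)^2 is used; by the symmetry of the kernel
    (\<open>k2\<close>) both squares contribute the same.\<close>
  also have "\<dots> \<le> (LINT p|(\<nu> \<Otimes>\<^sub>M \<nu>). (1/2) * ((h (fst p))\<^sup>2 * E (fst p) (snd p) + (h (snd p))\<^sup>2 * E (fst p) (snd p)))"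
  proof (rule order_trans[OF integral_norm_bound], rule integral_mono)
    show "integrable (\<nu> \<Otimes>\<^sub>M \<nu>) (\<lambda>p. norm (LINT t|N. f t p))"
      using NP.integrable_snd[OF iN] by (rule integrable_norm)
    fix p
    have "2 * (\<bar>h (fst p)\<bar> * \<bar>h (snd p)\<bar>) \<le> (h (fst p))\<^sup>2 + (h (snd p))\<^sup>2"
      using sum_squares_bound[of "\<bar>h (fst p)\<bar>" "\<bar>h (snd p)\<bar>"] by simp
    from mult_right_mono[OF this, of "E (fst p) (snd p)"]
    show "norm (LINT t|N. f t p) \<le> (1/2) * ((h (fst p))\<^sup>2 * E (fst p) (snd p) + (h (snd p))\<^sup>2 * E (fst p) (snd p))"
      unfolding fN using E1 by (simp add: norm_mult algebra_simps)
  qed (use j1 j2 in auto)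
  also have "\<dots> \<le> C * (LINT y|\<nu>. (h y)\<^sup>2)"
    using j1 j2 k1 k2 by simp
  finally show ?thesis unfolding N_def .
qed

lemma lam_measurable [measurable]: "lam \<in> borel_measurable borel"
  unfolding lam_def by measurable

lemma cis_measurable [measurable]: "cis \<in> borel_measurable borel"
  unfolding cis_conv_exp[abs_def] by measurable

text \<open>On the block y (y + 1) <= 2 Y * 3 Y, hence the derivative of \<open>lam\<close> has
  absolute value at least 1/(6 Y^2).\<close>

lemma lam_diff_ge:
  assumes "1 \<le> Y" "y \<in> {Y..2*Y}" "z \<in> {Y..2*Y}"
  shows "\<bar>y - z\<bar> / (6 * Y\<^sup>2) \<le> \<bar>lam y - lam z\<bar>"
proof -
  have main: "(v - u) / (6 * Y\<^sup>2) \<le> lam u - lam v" if uv: "Y \<le> u" "u \<le> v" "v \<le> 2 * Y" for u v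
  proof -
    have "lam v + v / (6 * Y\<^sup>2) \<le> lam u + u / (6 * Y\<^sup>2)"
    proof (rule DERIV_nonpos_imp_nonincreasing[OF uv(2)])
      fix x assume x: "u \<le> x" "x \<le> v"
      have x0: "x > 0" using x uv assms by auto
      have "x * (x + 1) \<le> (2 * Y) * (3 * Y)" using x uv assms by (intro mult_mono) auto
      hence "1 / (6 * Y\<^sup>2) \<le> 1 / (x * (x + 1))" using x0 assms by (intro divide_left_mono mult_pos_pos) (auto simp: power2_eq_square)
      moreover have "((\<lambda>x. lam x + x / (6 * Y\<^sup>2)) has_real_derivative (- (1 / (x * (x + 1))) + 1 / (6 * Y\<^sup>2))) (at x)"
        by (intro derivative_intros lam_deriv[OF x0] DERIV_cdivide)
      ultimately show "\<exists>y. ((\<lambda>x. lam x + x / (6 * Y\<^sup>2)) has_real_derivative y) (at x) \<and> y \<le> 0" by fastforce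
    qed
    thus ?thesis by (simp add: diff_divide_distrib)
  qed
  show ?thesis using main[of y z] main[of z y] assms by (cases "y \<le> z") auto
qed

context halasz begin

lemma integral_Q2_block: "integral {Y..2*Y} (\<lambda>y. (Q y)\<^sup>2) \<le> Y * q"
proof -
  obtain B where B: "\<bar>Q y\<bar> \<le> B" for y using Qbd by blast
  have "norm ((Q y)\<^sup>2) \<le> B\<^sup>2" for y using power_mono[OF B[of y], of 2] by simp
  hence "(\<lambda>y. (Q y)\<^sup>2) integrable_on {real Yn..real (2*Yn)}"
    using Qm by (intro bounded_measurable_integrable_on[where B="B\<^sup>2"]) auto
  hence "integral {Y..2*Y} (\<lambda>y. (Q y)\<^sup>2) = (\<Sum>j\<in>{Yn..<2*Yn}. integral {0..1} (\<lambda>y. (Q (y + real j))\<^sup>2))"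
    using integral_split_units[of "\<lambda>y. (Q y)\<^sup>2" Yn "2*Yn"] Yn by simp
  also have "\<dots> = Y * integral {0..1} (\<lambda>y. (Q y)\<^sup>2)" using Yn by (simp add: Q_shift)
  also have "\<dots> \<le> Y * q" using q Y1 by (intro mult_left_mono) auto
  finally show ?thesis .
qed

text \<open>The source of the continuity of F, through which F and its level sets become
  measurable.\<close>

lemma F_Lipschitz: "\<exists>L. \<forall>t t'. norm (F t - F t') \<le> L * \<bar>t - t'\<bar>"
proof -
  obtain B where B: "\<bar>Q y\<bar> \<le> B" for y using Qbd by blast
  have B0: "0 \<le> B" using B[of 0] by linarith
  have "norm (F t - F t') \<le> (Y * (b * B)) * \<bar>t - t'\<bar>" for t t'
  proof -
    have lam1: "\<bar>lam y\<bar> \<le> 1" if "y \<in> {Y..2*Y}" for y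
    proof -
      have y: "y \<ge> 1" using that Y1 by auto
      have "lam y \<le> 1 / y" unfolding lam_def using y by (intro ln_add_one_self_le_self) auto
      also have "\<dots> \<le> 1" using y by simp
      finally have "lam y \<le> 1" .
      moreover have "0 \<le> lam y" unfolding lam_def using y by simp
      ultimately show ?thesis by simp
    qed
    have d: "((\<lambda>y. of_real (\<beta> y * Q y) * cis (t * lam y) - of_real (\<beta> y * Q y) * cis (t' * lam y)) has_integral F t - F t') {Y..2*Y}"
      unfolding F_def by (intro has_integral_diff integrable_integral integrable_block cont_beta)
    have "norm (F t - F t') \<le> integral {Y..2*Y} (\<lambda>y. b * B * \<bar>t - t'\<bar>)"
      unfolding integral_unique[OF d, symmetric]
    proof (rule integral_norm_bound_integral[OF has_integral_integrable[OF d]])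
      fix y assume y: "y \<in> {Y..2*Y}"
      have "norm (of_real (\<beta> y * Q y) * cis (t * lam y) - of_real (\<beta> y * Q y) * cis (t' * lam y)) = \<bar>\<beta> y * Q y\<bar> * norm (cis (t * lam y) - cis (t' * lam y))"
        by (simp add: norm_mult abs_mult flip: right_diff_distrib)
      also have "\<dots> \<le> (b * B) * (\<bar>t - t'\<bar> * 1)"
      proof (intro mult_mono)
        show "\<bar>\<beta> y * Q y\<bar> \<le> b * B" unfolding abs_mult using bb[OF y] B b0 by (intro mult_mono) auto
        have "norm (cis (t * lam y) - cis (t' * lam y)) \<le> \<bar>t * lam y - t' * lam y\<bar>" by (rule norm_cis_diff_le)
        also have "\<dots> = \<bar>t - t'\<bar> * \<bar>lam y\<bar>" by (simp add: abs_mult flip: left_diff_distrib)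
        also have "\<dots> \<le> \<bar>t - t'\<bar> * 1" using lam1[OF y] by (intro mult_left_mono) auto
        finally show "norm (cis (t * lam y) - cis (t' * lam y)) \<le> \<bar>t - t'\<bar> * 1" .
      qed (use b0 B0 in auto)
      finally show "norm (of_real (\<beta> y * Q y) * cis (t * lam y) - of_real (\<beta> y * Q y) * cis (t' * lam y)) \<le> b * B * \<bar>t - t'\<bar>" by simp
    qed auto
    thus ?thesis using Y1 by (simp add: mult_ac)
  qed
  thus ?thesis by blast
qed

lemma F_continuous: "continuous_on UNIV F"
proof -
  obtain L where L: "\<And>t t'. norm (F t - F t') \<le> L * \<bar>t - t'\<bar>" using F_Lipschitz by blast
  have "0 \<le> L" using order_trans[OF norm_ge_zero L[of 1 0]] by simp
  hence "L-lipschitz_on UNIV F" using L by (intro lipschitz_onI) (auto simp: dist_norm)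
  thus ?thesis by (rule lipschitz_on_continuous_on)
qed

lemma F_measurable [measurable]: "F \<in> borel_measurable borel"
  using F_continuous by (rule borel_measurable_continuous_onI)

lemma F_bounded: "\<exists>M. \<forall>t. norm (F t) \<le> M"
proof -
  obtain B where B: "\<bar>Q y\<bar> \<le> B" for y using Qbd by blast
  have "norm (F t) \<le> integral {Y..2*Y} (\<lambda>y. b * B)" for t
    unfolding F_def
    by (rule integral_norm_bound_integral[OF integrable_block[OF cont_beta]])
       (auto simp: norm_mult abs_mult intro!: mult_mono bb B b0)
  thus ?thesis by blast
qed

text \<open>The normal density centred at T with deviation T/sqrt 2 is at least 1/(e sqrt pi T) on
  [T, 2 T], and the kernel that it produces has width s of order Y^2/T in y. The two powers of T
  cancel.\<close>

lemma mean_square: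
  assumes T: "T > 0"
  shows "(\<integral>\<^sup>+t\<in>{T..2*T}. ennreal ((norm (F t))\<^sup>2) \<partial>lborel) \<le> ennreal (12 * pi * exp 1 * Y^3 * b\<^sup>2 * q)"
proof -
  define h where "h = (\<lambda>y. (indicator {Y..2*Y} y *\<^sub>R \<beta> y) * Q y)"
  define \<nu> where "\<nu> = restrict_space lborel {Y..2*Y}"
  define \<sigma> where "\<sigma> = T / sqrt 2"
  \<comment> \<open>s = 6 Y^2/sigma, so that \<open>lam_diff_ge\<close> compares the kernel with a
    normal density of deviation s.\<close>
  define s where "s = sqrt 72 * Y\<^sup>2 / T"
  have sg: "\<sigma> > 0" using T unfolding \<sigma>_def by simp
  have s0: "s > 0" using T Y1 unfolding s_def by simp
  obtain B where B: "\<bar>Q y\<bar> \<le> B" for y using Qbd by blast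
  have hm: "h \<in> borel_measurable borel"
    unfolding h_def using borel_measurable_continuous_on_indicator[OF _ cont_beta] Qm by measurable
  have hb: "\<bar>h y\<bar> \<le> b * B" for y
  proof (cases "y \<in> {Y..2*Y}")
    case True
    thus ?thesis using mult_mono[OF bb[OF True] B[of y]] b0 by (simp add: h_def abs_mult)
  next
    case False
    have "0 \<le> B" using B[of 0] by linarith
    thus ?thesis using False b0 by (simp add: h_def)
  qed
  have fin: "finite_measure \<nu>" unfolding \<nu>_def using Y1 by (intro finite_measureI) (simp add: space_restrict_space emeasure_restrict_space)
  then interpret \<nu>: finite_measure \<nu> .
  have FL: "F t = (LINT y|\<nu>. of_real (h y) * cis (t * lam y))" for t
  proof -
    have i: "integrable \<nu> (\<lambda>y. of_real (h y) * cis (t * lam y))"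
      by (rule \<nu>.integrable_const_bound[where B="b*B"]) (use hb hm in \<open>auto simp: norm_mult \<nu>_def intro!: measurable_restrict_space1\<close>)
    have "(LINT y|\<nu>. of_real (h y) * cis (t * lam y)) = (LINT y:{Y..2*Y}|lborel. of_real (h y) * cis (t * lam y))"
      unfolding \<nu>_def set_lebesgue_integral_def by (subst integral_restrict_space) auto
    also have "\<dots> = integral {Y..2*Y} (\<lambda>y. of_real (h y) * cis (t * lam y))"
      using i unfolding \<nu>_def by (intro set_borel_integral_eq_integral) (auto simp: set_integrable_def integrable_restrict_space)
    also have "\<dots> = F t" unfolding F_def h_def by (intro integral_cong) auto
    finally show ?thesis by simp
  qed
  have h2: "(LINT y|\<nu>. (h y)\<^sup>2) \<le> b\<^sup>2 * (Y * q)"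
  proof -
    have hh: "norm ((h y)\<^sup>2) \<le> (b*B)\<^sup>2" for y using power_mono[OF hb[of y], of 2] by simp
    have i: "integrable \<nu> (\<lambda>y. (h y)\<^sup>2)"
      by (rule \<nu>.integrable_const_bound[where B="(b*B)\<^sup>2"]) (use hh hm in \<open>auto simp: \<nu>_def intro!: measurable_restrict_space1\<close>)
    have "(LINT y|\<nu>. (h y)\<^sup>2) = (LINT y:{Y..2*Y}|lborel. (h y)\<^sup>2)"
      unfolding \<nu>_def set_lebesgue_integral_def by (subst integral_restrict_space) auto
    also have "\<dots> = integral {Y..2*Y} (\<lambda>y. (h y)\<^sup>2)"
      using i unfolding \<nu>_def by (intro set_borel_integral_eq_integral) (auto simp: set_integrable_def integrable_restrict_space)
    also have "\<dots> \<le> integral {Y..2*Y} (\<lambda>y. b\<^sup>2 * (Q y)\<^sup>2)"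
    proof (rule integral_le)
      have "norm ((Q y)\<^sup>2) \<le> B\<^sup>2" for y using power_mono[OF B[of y], of 2] by simp
      hence "(\<lambda>y. (Q y)\<^sup>2) integrable_on {Y..2*Y}"
        using Qm by (intro bounded_measurable_integrable_on[where B="B\<^sup>2"]) auto
      thus "(\<lambda>y. b\<^sup>2 * (Q y)\<^sup>2) integrable_on {Y..2*Y}" by (rule integrable_on_mult_right)
      show "(\<lambda>y. (h y)\<^sup>2) integrable_on {Y..2*Y}"
        using hh hm by (intro bounded_measurable_integrable_on[where B="(b*B)\<^sup>2"]) auto
      fix y assume y: "y \<in> {Y..2*Y}"
      have "(\<beta> y)\<^sup>2 \<le> b\<^sup>2" using power_mono[OF bb[OF y], of 2] by simp
      thus "(h y)\<^sup>2 \<le> b\<^sup>2 * (Q y)\<^sup>2" using y by (simp add: h_def power_mult_distrib mult_right_mono)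
    qed
    also have "\<dots> \<le> b\<^sup>2 * (Y * q)" using integral_Q2_block by (simp add: mult_left_mono)
    finally show ?thesis .
  qed
  have ker: "(LINT z|\<nu>. exp (- (\<sigma> * (lam y - lam z))\<^sup>2 / 2)) \<le> sqrt (2 * pi) * s" if y: "y \<in> {Y..2*Y}" for y
  proof -
    have nd: "integrable lborel (\<lambda>z. sqrt (2 * pi) * s * normal_density y s z)" using s0 by simp
    have "(LINT z|\<nu>. exp (- (\<sigma> * (lam y - lam z))\<^sup>2 / 2)) = (LINT z|lborel. indicator {Y..2*Y} z * exp (- (\<sigma> * (lam y - lam z))\<^sup>2 / 2))"
      unfolding \<nu>_def by (subst integral_restrict_space) auto
    also have "\<dots> \<le> (LINT z|lborel. sqrt (2 * pi) * s * normal_density y s z)"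
    proof (rule integral_mono')
      fix z
      show "indicator {Y..2*Y} z * exp (- (\<sigma> * (lam y - lam z))\<^sup>2 / 2) \<le> sqrt (2 * pi) * s * normal_density y s z"
      proof (cases "z \<in> {Y..2*Y}")
        case True
        have nn: "sqrt (2 * pi) * s * normal_density y s z = exp (- (z - y)\<^sup>2 / (2 * s\<^sup>2))"
          using s0 by (simp add: normal_density_def real_sqrt_mult)
        have "\<bar>y - z\<bar> / (sqrt 2 * s) = \<sigma> * (\<bar>y - z\<bar> / (6 * Y\<^sup>2)) / sqrt 2"
        proof -
          have "sqrt 72 = 6 * sqrt 2" by (rule real_sqrt_unique) (auto simp: power_mult_distrib)
          thus ?thesis unfolding s_def \<sigma>_def using T Y1 by (simp add: field_simps)
        qed
        also have "\<dots> \<le> \<sigma> * \<bar>lam y - lam z\<bar> / sqrt 2"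
          using lam_diff_ge[OF Y1 y True] sg by (intro divide_right_mono mult_left_mono) auto
        finally have "(\<bar>y - z\<bar> / (sqrt 2 * s))\<^sup>2 \<le> (\<sigma> * \<bar>lam y - lam z\<bar> / sqrt 2)\<^sup>2"
          using s0 by (intro power_mono) auto
        hence "(z - y)\<^sup>2 / (2 * s\<^sup>2) \<le> (\<sigma> * (lam y - lam z))\<^sup>2 / 2"
          by (simp add: power_divide power_mult_distrib power2_commute[of y])
        thus ?thesis using True unfolding nn by simp
      qed (use s0 in \<open>auto intro!: mult_nonneg_nonneg normal_density_nonneg\<close>)
    qed (use nd s0 in \<open>auto simp: normal_density_nonneg\<close>)
    also have "\<dots> = sqrt (2 * pi) * s" using s0 by simp
    finally show ?thesis .
  qed
  have "(LINT t|density lborel (normal_density T \<sigma>). (norm (LINT y|\<nu>. of_real (h y) * cis (t * lam y)))\<^sup>2) \<le> sqrt (2 * pi) * s * (LINT y|\<nu>. (h y)\<^sup>2)"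
    by (rule gauss_mean_square[OF fin _ _ hm hb lam_measurable sg ker]) (auto simp: \<nu>_def sets_restrict_space)
  hence main: "(LINT t|density lborel (normal_density T \<sigma>). (norm (F t))\<^sup>2) \<le> sqrt (2 * pi) * s * (b\<^sup>2 * (Y * q))"
    unfolding FL[symmetric] using h2 s0 by (elim order_trans) (intro mult_left_mono, auto)
  obtain M where M: "\<And>t. norm (F t) \<le> M" using F_bounded by blast
  interpret N: prob_space "density lborel (normal_density T \<sigma>)" using sg by (rule prob_space_normal_density)
  have iF: "integrable (density lborel (normal_density T \<sigma>)) (\<lambda>t. (norm (F t))\<^sup>2)"
    by (rule N.integrable_const_bound[where B="M\<^sup>2"]) (use M in \<open>auto intro!: power_mono\<close>)
  define c where "c = exp 1 * sqrt pi * T"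
  have c0: "c \<ge> 0" unfolding c_def using T by simp
  have nd: "1 \<le> c * normal_density T \<sigma> t" if "t \<in> {T..2*T}" for t
  proof -
    have s2: "2 * \<sigma>\<^sup>2 = T\<^sup>2" unfolding \<sigma>_def by (simp add: power_divide)
    have s3: "2 * pi * \<sigma>\<^sup>2 = pi * T\<^sup>2" using s2 by simp
    have "(t - T)\<^sup>2 \<le> T\<^sup>2" using that T by (intro power_mono) auto
    hence "(t - T)\<^sup>2 / T\<^sup>2 \<le> 1" using T by simp
    hence "exp 1 * exp (- (t - T)\<^sup>2 / T\<^sup>2) \<ge> 1" by (simp flip: exp_add)
    moreover have "c * normal_density T \<sigma> t = exp 1 * exp (- (t - T)\<^sup>2 / T\<^sup>2)"
      unfolding normal_density_def s2 s3 c_def using T by (simp add: real_sqrt_mult)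
    ultimately show ?thesis by simp
  qed
  have "(\<integral>\<^sup>+t\<in>{T..2*T}. ennreal ((norm (F t))\<^sup>2) \<partial>lborel) \<le> (\<integral>\<^sup>+t. ennreal c * (ennreal (normal_density T \<sigma> t) * ennreal ((norm (F t))\<^sup>2)) \<partial>lborel)"
  proof (rule nn_integral_mono)
    fix t
    show "ennreal ((norm (F t))\<^sup>2) * indicator {T..2*T} t \<le> ennreal c * (ennreal (normal_density T \<sigma> t) * ennreal ((norm (F t))\<^sup>2))"
    proof (cases "t \<in> {T..2*T}")
      case True
      have "1 * (norm (F t))\<^sup>2 \<le> (c * normal_density T \<sigma> t) * (norm (F t))\<^sup>2"
        using nd[OF True] by (intro mult_right_mono) auto
      thus ?thesis using True c0 by (simp add: mult.assoc flip: ennreal_mult')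
    qed simp
  qed
  also have "\<dots> = ennreal c * (\<integral>\<^sup>+t. ennreal ((norm (F t))\<^sup>2) \<partial>density lborel (normal_density T \<sigma>))"
    by (simp add: nn_integral_cmult nn_integral_density)
  also have "(\<integral>\<^sup>+t. ennreal ((norm (F t))\<^sup>2) \<partial>density lborel (normal_density T \<sigma>)) = ennreal (LINT t|density lborel (normal_density T \<sigma>). (norm (F t))\<^sup>2)"
    by (rule nn_integral_eq_integral[OF iF]) auto
  also have "ennreal c * \<dots> = ennreal (c * (LINT t|density lborel (normal_density T \<sigma>). (norm (F t))\<^sup>2))"
    using c0 by (simp add: ennreal_mult')
  also have "\<dots> \<le> ennreal (c * (sqrt (2 * pi) * s * (b\<^sup>2 * (Y * q))))"
    using main c0 by (intro ennreal_leI mult_left_mono) auto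
  also have "c * (sqrt (2 * pi) * s * (b\<^sup>2 * (Y * q))) = 12 * pi * exp 1 * Y^3 * b\<^sup>2 * q"
  proof -
    have "sqrt 72 = 6 * sqrt 2" by (rule real_sqrt_unique) (auto simp: power_mult_distrib)
    hence "sqrt pi * sqrt (2 * pi) * sqrt 72 = 12 * pi" by (simp add: real_sqrt_mult)
    moreover have "c * (sqrt (2 * pi) * s * (b\<^sup>2 * (Y * q))) = (sqrt pi * sqrt (2 * pi) * sqrt 72) * exp 1 * Y^3 * b\<^sup>2 * q"
      unfolding c_def s_def using T by (simp add: power2_eq_square power3_eq_cube)
    ultimately show ?thesis by simp
  qed
  finally show ?thesis .
qed

end

section \<open>Moments from the large values method\<close>

lemma sum_inverse_dist_le:
  assumes "A \<subseteq> {0..n}" "k \<le> n"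
  shows "(\<Sum>i\<in>A. 1 / (1 + \<bar>real k - real i\<bar>)) \<le> 2 * (1 + ln (real (n + 2)))"
proof -
  have fin: "finite A" using assms finite_subset by blast
  have s: "(\<Sum>i\<in>B. 1 / (1 + \<bar>real k - real i\<bar>)) \<le> 1 + ln (real (n + 2))"
    if B: "finite B" "inj_on f B" "f ` B \<subseteq> {1..<n+2}" "\<And>i. i \<in> B \<Longrightarrow> 1 + \<bar>real k - real i\<bar> = real (f i)" for B and f :: "nat \<Rightarrow> nat"
  proof -
    have "(\<Sum>i\<in>B. 1 / (1 + \<bar>real k - real i\<bar>)) = (\<Sum>i\<in>B. 1 / real (f i))" using B(4) by (intro sum.cong) auto
    also have "\<dots> = (\<Sum>l\<in>f ` B. 1 / real l)" using B(2) by (simp add: sum.reindex)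
    also have "\<dots> \<le> (\<Sum>l\<in>{1..<n+2}. 1 / real l)" using B(3) by (intro sum_mono2) auto
    also have "\<dots> \<le> 1 + ln (real (n + 2))" by (rule sum_inverse_le) simp
    finally show ?thesis .
  qed
  have "A = (A \<inter> {..k}) \<union> (A \<inter> {k<..})" by auto
  hence "(\<Sum>i\<in>A. 1 / (1 + \<bar>real k - real i\<bar>)) = (\<Sum>i\<in>A \<inter> {..k}. 1 / (1 + \<bar>real k - real i\<bar>)) + (\<Sum>i\<in>A \<inter> {k<..}. 1 / (1 + \<bar>real k - real i\<bar>))"
    using fin by (metis (no_types, lifting) sum.union_disjoint disjoint_iff finite_Int IntD2 atMost_iff greaterThan_iff leD)
  also have "\<dots> \<le> (1 + ln (real (n + 2))) + (1 + ln (real (n + 2)))"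
  proof (intro add_mono)
    show "(\<Sum>i\<in>A \<inter> {..k}. 1 / (1 + \<bar>real k - real i\<bar>)) \<le> 1 + ln (real (n + 2))"
      by (rule s[of _ "\<lambda>i. Suc (k - i)"]) (use assms fin in \<open>auto simp: inj_on_def of_nat_diff\<close>)
    show "(\<Sum>i\<in>A \<inter> {k<..}. 1 / (1 + \<bar>real k - real i\<bar>)) \<le> 1 + ln (real (n + 2))"
      by (rule s[of _ "\<lambda>i. Suc (i - k)"]) (use assms fin in \<open>auto simp: inj_on_def of_nat_diff\<close>)
  qed
  finally show ?thesis by simp
qed

text \<open>The normalization b^2 q <= H T/Y^4 is the one shared by (\<open>bet\<close>,
  \<open>Z\<close>) and (\<open>alp\<close>, \<open>DU\<close>); H, L and \<Lambda> stand for powers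
  of log T. The constant 6912 = 4 * 1728 lets the stationary part of the kernel be absorbed in
  \<open>card_large_values'\<close>.\<close>

locale halasz_T = halasz +
  fixes T H L \<Lambda> :: real
  assumes T1: "1 \<le> T" and YT: "Y\<^sup>2 \<le> 2 * T" and bq: "b\<^sup>2 * q \<le> H * T / Y^4" and H1: "1 \<le> H"
    and L1: "1 \<le> L" and LY: "1 + ln Y \<le> L" and LT: "1 + ln (T + 2) \<le> L" and Lam: "6912 * H * L \<le> \<Lambda>"
begin

lemma Lam_ge: "6912 * H \<le> \<Lambda>" "1 \<le> \<Lambda>" "6912 * L \<le> \<Lambda>" "0 < \<Lambda>"
proof -
  have "H * 1 \<le> H * L" "1 * L \<le> H * L" using H1 L1 by (auto intro!: mult_left_mono mult_right_mono)
  thus "6912 * H \<le> \<Lambda>" "1 \<le> \<Lambda>" "6912 * L \<le> \<Lambda>" "0 < \<Lambda>" using Lam H1 L1 by linarith+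
qed

lemma mean_square_T: "(\<integral>\<^sup>+t\<in>{T..2*T}. ennreal ((norm (F t))\<^sup>2) \<partial>lborel) \<le> ennreal (\<Lambda> * T / Y)"
proof -
  have "12 * pi * exp 1 * Y^3 * b\<^sup>2 * q = (12 * pi * exp 1) * (Y^3 * (b\<^sup>2 * q))" by simp
  also have "\<dots> \<le> (12 * 4 * 3) * (Y^3 * (H * T / Y^4))"
    using bq Y1 q pi_less_4 exp_le by (intro mult_mono) auto
  also have "\<dots> = 144 * H * T / Y" using Y1 by (simp add: power_def field_simps eval_nat_numeral)
  also have "\<dots> \<le> \<Lambda> * T / Y" using Lam_ge(1) H1 T1 Y1 by (intro divide_right_mono mult_right_mono) auto
  finally show ?thesis using T1 by (intro order_trans[OF mean_square ennreal_leI]) auto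
qed

text \<open>Duality with a single point. With D = 0 the second derivative term disappears, and Y^2
  <= 2 T makes the remaining shifts comparable with the trivial bound b^2 Y up to a
  logarithm.\<close>

lemma F_pointwise: assumes "t \<ge> T" shows "(norm (F t))\<^sup>2 \<le> \<Lambda> * T / Y^3"
proof -
  have "norm (K t t) \<le> norm (ker 0 t t) + b\<^sup>2 * (280 * Y^3 / T * (1 + ln Y) + 1728 * Y\<^sup>2 * sqrt (Y * 0) / T)"
    using T1 assms by (intro K_estimate) auto
  also have "\<dots> \<le> b\<^sup>2 * Y + b\<^sup>2 * (280 * Y * 2 * L)"
  proof (intro add_mono mult_left_mono)
    show "norm (ker 0 t t) \<le> b\<^sup>2 * Y" using Y1 by (intro ker_trivial) auto
    have "280 * Y^3 / T = 280 * Y * (Y\<^sup>2 / T)" by (simp add: power2_eq_square power3_eq_cube)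
    also have "\<dots> \<le> 280 * Y * 2" using YT Y1 T1 by (intro mult_left_mono) (auto simp: divide_le_eq)
    finally have "280 * Y^3 / T * (1 + ln Y) \<le> 280 * Y * 2 * L" using LY Y1 by (intro mult_mono) auto
    thus "280 * Y^3 / T * (1 + ln Y) + 1728 * Y\<^sup>2 * sqrt (Y * 0) / T \<le> 280 * Y * 2 * L" by simp
  qed auto
  also have "\<dots> = b\<^sup>2 * (Y * (1 + 560 * L))" by (simp add: algebra_simps)
  finally have K: "norm (K t t) \<le> b\<^sup>2 * (Y * (1 + 560 * L))" .
  have "(norm (F t))\<^sup>2 \<le> q * norm (K t t)" using duality[of "{()}" "\<lambda>_. t"] by simp
  also have "\<dots> \<le> q * (b\<^sup>2 * (Y * (1 + 560 * L)))" using K q by (intro mult_left_mono) auto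
  also have "\<dots> = (b\<^sup>2 * q) * (Y * (1 + 560 * L))" by simp
  also have "\<dots> \<le> (H * T / Y^4) * (Y * (6912 * L))" using bq Y1 L1 H1 T1 by (intro mult_mono) auto
  also have "\<dots> = (6912 * H * L) * T / Y^3" using Y1 by (simp add: field_simps eval_nat_numeral)
  also have "\<dots> \<le> \<Lambda> * T / Y^3" using Lam T1 Y1 by (intro divide_right_mono mult_right_mono) auto
  finally show ?thesis .
qed

text \<open>Halasz' inequality with one point per cell of length Y, in a window of m cells. Y is the
  distance at which \<open>ker_zero\<close> starts to beat the trivial bound b^2 Y. The window
  limits |t i - t k| to m Y and thereby the stationary shifts.\<close>

lemma card_large_values:
  fixes t :: "nat \<Rightarrow> real" and n m a :: nat
  assumes A: "A \<subseteq> {0..n}" "A \<subseteq> {a..<a+m}" and n: "real n \<le> T"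
    and t: "\<And>k. k \<in> A \<Longrightarrow> T + real k * Y \<le> t k \<and> t k \<le> T + real (k + 1) * Y"
    and V: "0 < V" "\<And>k. k \<in> A \<Longrightarrow> V \<le> norm (F (t k))"
  shows "real (card A) * V\<^sup>2 \<le> H * T / Y^4 * (210 * Y * L + real (card A) * (280 * Y^3 / T * L + 1728 * Y\<^sup>2 * sqrt (Y * (real m * Y)) / T))"
proof (cases "A = {}")
  case True thus ?thesis using H1 T1 Y1 L1 by simp
next
  case False
  have fin: "finite A" using A finite_subset by blast
  define \<kappa> where "\<kappa> = 280 * Y^3 / T * L + 1728 * Y\<^sup>2 * sqrt (Y * (real m * Y)) / T"
  have k0: "0 \<le> \<kappa>" unfolding \<kappa>_def using Y1 T1 L1 by auto
  have kY: "0 \<le> real k * Y" for k using Y1 by simp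
  have tT: "T \<le> t k" if "k \<in> A" for k using t[OF that] kY[of k] by linarith
  have Kb: "norm (K (t i) (t k)) \<le> b\<^sup>2 * (105 * Y / (1 + \<bar>real i - real k\<bar>)) + b\<^sup>2 * \<kappa>" if ik: "i \<in> A" "k \<in> A" for i k
  proof -
    have ti: "T + real i * Y \<le> t i" "t i \<le> T + real i * Y + Y" "T + real k * Y \<le> t k" "t k \<le> T + real k * Y + Y"
      using t ik by (auto simp: algebra_simps)
    have ikm: "\<bar>real i - real k\<bar> \<le> real m - 1" using ik A by (auto simp: subset_iff abs_le_iff of_nat_diff) (smt (verit) of_nat_Suc of_nat_add of_nat_mono Suc_leI)+
    have e: "real i * Y - real k * Y = (real i - real k) * Y" by (simp add: left_diff_distrib)
    have "\<bar>t i - t k\<bar> \<le> \<bar>real i - real k\<bar> * Y + Y"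
    proof -
      have "\<bar>(real i - real k) * Y\<bar> = \<bar>real i - real k\<bar> * Y" using Y1 by (simp add: abs_mult)
      thus ?thesis using ti e by linarith
    qed
    also have "\<dots> \<le> (real m - 1) * Y + Y" using ikm Y1 by (intro add_mono mult_right_mono) auto
    finally have D: "\<bar>t i - t k\<bar> \<le> real m * Y" by (simp add: algebra_simps)
    have "norm (K (t i) (t k)) \<le> norm (ker 0 (t i) (t k)) + b\<^sup>2 * (280 * Y^3 / T * (1 + ln Y) + 1728 * Y\<^sup>2 * sqrt (Y * (real m * Y)) / T)"
      using T1 tT ik D by (intro K_estimate) auto
    also have "\<dots> \<le> norm (ker 0 (t i) (t k)) + b\<^sup>2 * \<kappa>"
      unfolding \<kappa>_def using LY Y1 T1 by (intro add_mono mult_left_mono order_refl) auto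
    finally have K1: "norm (K (t i) (t k)) \<le> norm (ker 0 (t i) (t k)) + b\<^sup>2 * \<kappa>" .
    \<comment> \<open>Points of neighbouring cells can be arbitrarily close and get the trivial
      bound. For d >= 2 the gap is at least (d - 1) Y, and d + 1 <= 3 (d - 1) gives 105 = 3 *
      35.\<close>
    have "norm (ker 0 (t i) (t k)) \<le> b\<^sup>2 * (105 * Y / (1 + \<bar>real i - real k\<bar>))"
    proof (cases "\<bar>real i - real k\<bar> \<le> 1")
      case True
      have "norm (ker 0 (t i) (t k)) \<le> b\<^sup>2 * Y" using Y1 by (intro ker_trivial) auto
      also have "b\<^sup>2 * Y \<le> b\<^sup>2 * (105 * Y / (1 + \<bar>real i - real k\<bar>))"
        using True Y1 by (intro mult_left_mono) (auto simp: field_simps)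
      finally show ?thesis .
    next
      case False
      define d where "d = \<bar>real i - real k\<bar>"
      have "k + 2 \<le> i \<or> i + 2 \<le> k"
      proof (rule ccontr)
        assume "\<not> (k + 2 \<le> i \<or> i + 2 \<le> k)"
        hence "i \<le> k + 1" "k \<le> i + 1" by auto
        hence "real i \<le> real k + 1" "real k \<le> real i + 1" by linarith+
        thus False using False by linarith
      qed
      hence "real k + 2 \<le> real i \<or> real i + 2 \<le> real k" by linarith
      hence d2: "d \<ge> 2" unfolding d_def by linarith
      have "\<bar>(real i - real k) * Y\<bar> = d * Y" using Y1 by (simp add: abs_mult d_def)
      hence "d * Y - Y \<le> \<bar>t i - t k\<bar>" using ti e by linarith
      hence dd: "(d - 1) * Y \<le> \<bar>t i - t k\<bar>" by (simp add: algebra_simps)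
      have dY: "(d - 1) * Y > 0" using d2 Y1 by simp
      have "norm (ker 0 (t i) (t k)) \<le> 35 * b\<^sup>2 * Y\<^sup>2 / \<bar>t i - t k\<bar>"
        using tT[OF ik(1)] T1 dd dY by (intro ker_zero) auto
      also have "\<dots> \<le> 35 * b\<^sup>2 * Y\<^sup>2 / ((d - 1) * Y)" using dd dY by (intro divide_left_mono) auto
      also have "\<dots> = b\<^sup>2 * (35 * Y / (d - 1))" using Y1 by (simp add: power2_eq_square)
      also have "\<dots> \<le> b\<^sup>2 * (105 * Y / (1 + d))"
        using d2 Y1 by (intro mult_left_mono) (auto simp: field_simps)
      finally show ?thesis unfolding d_def .
    qed
    with K1 show ?thesis by linarith
  qed
  define R where "R = real (card A)"
  have R0: "R > 0" unfolding R_def using False fin by (simp add: card_gt_0_iff)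
  have row: "(\<Sum>k\<in>A. norm (K (t i) (t k))) \<le> b\<^sup>2 * (210 * Y * L + R * \<kappa>)" if i: "i \<in> A" for i
  proof -
    have "(\<Sum>k\<in>A. norm (K (t i) (t k))) \<le> (\<Sum>k\<in>A. b\<^sup>2 * (105 * Y / (1 + \<bar>real i - real k\<bar>)) + b\<^sup>2 * \<kappa>)"
      using Kb i by (intro sum_mono) auto
    also have "\<dots> = b\<^sup>2 * (105 * Y) * (\<Sum>k\<in>A. 1 / (1 + \<bar>real i - real k\<bar>)) + R * (b\<^sup>2 * \<kappa>)"
      by (simp add: sum.distrib sum_distrib_left R_def)
    also have "\<dots> \<le> b\<^sup>2 * (105 * Y) * (2 * L) + R * (b\<^sup>2 * \<kappa>)"
    proof (intro add_mono order_refl mult_left_mono)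
      have "(\<Sum>k\<in>A. 1 / (1 + \<bar>real i - real k\<bar>)) \<le> 2 * (1 + ln (real (n + 2)))"
        using i A by (intro sum_inverse_dist_le) auto
      also have "\<dots> \<le> 2 * (1 + ln (T + 2))" using n by simp
      also have "\<dots> \<le> 2 * L" using LT by simp
      finally show "(\<Sum>k\<in>A. 1 / (1 + \<bar>real i - real k\<bar>)) \<le> 2 * L" .
    qed (use Y1 in auto)
    finally have "(\<Sum>k\<in>A. norm (K (t i) (t k))) \<le> b\<^sup>2 * (105 * Y) * (2 * L) + R * (b\<^sup>2 * \<kappa>)" .
    thus ?thesis by (simp add: algebra_simps)
  qed
  have "(R * V)\<^sup>2 \<le> (\<Sum>i\<in>A. norm (F (t i)))\<^sup>2"
    unfolding R_def using V by (intro power_mono) (auto intro!: sum_bounded_below)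
  also have "\<dots> \<le> q * (\<Sum>i\<in>A. \<Sum>k\<in>A. norm (K (t i) (t k)))" by (rule duality[OF fin])
  also have "\<dots> \<le> q * (\<Sum>i\<in>A. b\<^sup>2 * (210 * Y * L + R * \<kappa>))" using row q by (intro mult_left_mono sum_mono) auto
  also have "\<dots> = R * ((b\<^sup>2 * q) * (210 * Y * L + R * \<kappa>))" by (simp add: R_def)
  finally have "R * (R * V\<^sup>2) \<le> R * ((b\<^sup>2 * q) * (210 * Y * L + R * \<kappa>))" by (simp add: power2_eq_square mult_ac)
  hence "R * V\<^sup>2 \<le> (b\<^sup>2 * q) * (210 * Y * L + R * \<kappa>)" using R0 by simp
  also have "\<dots> \<le> H * T / Y^4 * (210 * Y * L + R * \<kappa>)"
    using bq k0 R0 Y1 L1 by (intro mult_right_mono) auto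
  finally show ?thesis unfolding R_def \<kappa>_def .
qed

text \<open>The window is so short that the harmonic and the stationary part of the kernel, both
  carrying the factor card A, amount to at most half of card A * V^2. They move to the left side,
  and only the part from l = 0 remains.\<close>

lemma card_large_values':
  fixes t :: "nat \<Rightarrow> real" and n m a :: nat
  assumes A: "A \<subseteq> {0..n}" "A \<subseteq> {a..<a+m}" and n: "real n \<le> T"
    and t: "\<And>k. k \<in> A \<Longrightarrow> T + real k * Y \<le> t k \<and> t k \<le> T + real (k + 1) * Y"
    and V: "0 < V" "\<And>k. k \<in> A \<Longrightarrow> V \<le> norm (F (t k))" and VL: "\<Lambda> \<le> V\<^sup>2"
    and m: "sqrt (real m) \<le> V\<^sup>2 * Y / (6912 * H)"
  shows "real (card A) \<le> \<Lambda> * T / (Y^3 * V\<^sup>2)"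
proof -
  define R where "R = real (card A)"
  have R0: "0 \<le> R" unfolding R_def by simp
  have sq: "sqrt (Y * (real m * Y)) = Y * sqrt (real m)" using Y1 by (simp add: real_sqrt_mult)
  have "R * V\<^sup>2 \<le> H * T / Y^4 * (210 * Y * L + R * (280 * Y^3 / T * L + 1728 * Y\<^sup>2 * sqrt (Y * (real m * Y)) / T))"
    unfolding R_def by (rule card_large_values[OF A n t V])
  also have "\<dots> = 210 * H * L * T / Y^3 + R * (280 * H * L / Y + 1728 * H / Y * sqrt (real m))"
    unfolding sq using Y1 T1 by (simp add: field_simps eval_nat_numeral)
  also have "\<dots> \<le> 210 * H * L * T / Y^3 + R * (V\<^sup>2 / 4 + V\<^sup>2 / 4)"
  proof (intro add_mono mult_left_mono order_refl R0)
    have "280 * H * L / Y \<le> 280 * H * L / 1" using Y1 H1 L1 by (intro divide_left_mono) auto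
    also have "\<dots> \<le> \<Lambda> / 4" using Lam H1 L1 mult_nonneg_nonneg[of H L] by linarith
    also have "\<dots> \<le> V\<^sup>2 / 4" using VL by simp
    finally show "280 * H * L / Y \<le> V\<^sup>2 / 4" .
    have "1728 * H / Y * sqrt (real m) \<le> 1728 * H / Y * (V\<^sup>2 * Y / (6912 * H))"
      using m H1 Y1 by (intro mult_left_mono) auto
    also have "\<dots> = V\<^sup>2 / 4" using H1 Y1 by (simp add: field_simps)
    finally show "1728 * H / Y * sqrt (real m) \<le> V\<^sup>2 / 4" .
  qed
  finally have "R * V\<^sup>2 \<le> 420 * H * L * T / Y^3" by simp
  also have "\<dots> \<le> \<Lambda> * T / Y^3"
  proof -
    have "420 * H * L \<le> \<Lambda>" using Lam H1 L1 mult_nonneg_nonneg[of H L] by linarith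
    thus ?thesis using T1 Y1 by (intro divide_right_mono mult_right_mono) auto
  qed
  finally have "R \<le> \<Lambda> * T / Y^3 / V\<^sup>2" using V(1) by (subst pos_le_divide_eq) auto
  thus ?thesis unfolding R_def by simp
qed

section \<open>Measure of level sets and dyadic assembly of the moments\<close>

definition lev :: "real \<Rightarrow> real set" where "lev V = {t \<in> {T..2*T}. V \<le> norm (F t)}"

lemma lev_measurable [measurable]: "lev V \<in> sets borel"
  unfolding lev_def by measurable

text \<open>Huxley's subdivision: the cells are grouped into windows of the largest length that
  \<open>card_large_values'\<close> admits. The first factor bounds the number of windows; each
  window contains at most \<Lambda> T/(Y^3 V^2) cells of length Y that meet the level set.\<close>

lemma level_set:
  assumes V: "0 < V" "\<Lambda> \<le> V\<^sup>2"
  shows "emeasure lborel (lev V) \<le> ennreal ((1 + 4 * \<Lambda>\<^sup>2 * T / (V^4 * Y^3)) * (\<Lambda> * T / (Y\<^sup>2 * V\<^sup>2)))"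
proof -
  define n where "n = nat \<lfloor>T / Y\<rfloor>"
  have nT: "real n \<le> T / Y" unfolding n_def using T1 Y1 by (intro of_nat_floor) auto
  have TY: "T / Y \<le> T" using T1 Y1 by (simp add: divide_le_eq)
  define cell where "cell = (\<lambda>k. {T + real k * Y..T + real (k + 1) * Y})"
  define A where "A = {k \<in> {0..n}. \<exists>t\<in>cell k. t \<in> lev V}"
  have "\<forall>k\<in>A. \<exists>t. t \<in> cell k \<and> t \<in> lev V" unfolding A_def by auto
  then obtain t where t: "\<And>k. k \<in> A \<Longrightarrow> t k \<in> cell k \<and> t k \<in> lev V" by metis
  have finA: "finite A" unfolding A_def by simp
  define x where "x = V\<^sup>2 * Y / (6912 * H)"
  have "6912 * H \<le> V\<^sup>2" using Lam_ge(1) V by linarith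
  also have "\<dots> = V\<^sup>2 * 1" by simp
  also have "\<dots> \<le> V\<^sup>2 * Y" using Y1 by (intro mult_left_mono) auto
  finally have x1: "1 \<le> x" unfolding x_def using H1 by (simp add: divide_simps)
  \<comment> \<open>Since x >= 1, rounding is harmless: m lies between x^2/2 and x^2.\<close>
  define m where "m = nat \<lfloor>x\<^sup>2\<rfloor>"
  have x2: "1 \<le> x\<^sup>2" using x1 by simp
  have m1: "real m \<le> x\<^sup>2" unfolding m_def using x1 by (intro of_nat_floor) auto
  have m2: "x\<^sup>2 / 2 \<le> real m"
  proof -
    have "x\<^sup>2 - 1 \<le> real m" unfolding m_def using x2 by linarith
    moreover have "1 \<le> m" unfolding m_def using le_nat_floor[of 1 "x\<^sup>2"] x2 by simp
    hence "1 \<le> real m" by simp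
    ultimately have "x\<^sup>2 - 1 \<le> real m" "1 \<le> real m" by auto
    thus ?thesis by linarith
  qed
  have m0: "0 < m" using m2 x2 by (cases m) auto
  have sm: "sqrt (real m) \<le> x" using m1 x1 by (intro real_le_lsqrt) auto
  define J0 where "J0 = n div m"
  have cov: "A = (\<Union>j\<in>{0..J0}. A \<inter> {j*m..<j*m+m})"
  proof -
    have "k \<in> {(k div m)*m..<(k div m)*m+m}" for k
      using m0 by (auto simp: div_times_less_eq_dividend) (metis add.commute dividend_less_div_times)
    moreover have "k div m \<in> {0..J0}" if "k \<in> A" for k using that unfolding A_def J0_def by (auto intro: div_le_mono)
    ultimately show ?thesis by blast
  qed
  have "card A \<le> (\<Sum>j\<in>{0..J0}. card (A \<inter> {j*m..<j*m+m}))"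
    by (subst cov) (intro card_UN_le, auto)
  hence "real (card A) \<le> (\<Sum>j\<in>{0..J0}. real (card (A \<inter> {j*m..<j*m+m})))"
    by (metis of_nat_le_iff of_nat_sum)
  also have "\<dots> \<le> (\<Sum>j\<in>{0..J0}. \<Lambda> * T / (Y^3 * V\<^sup>2))"
  proof (intro sum_mono)
    fix j assume "j \<in> {0..J0}"
    show "real (card (A \<inter> {j*m..<j*m+m})) \<le> \<Lambda> * T / (Y^3 * V\<^sup>2)"
    proof (rule card_large_values'[where t=t and n=n and a="j*m" and m=m])
      show "T + real k * Y \<le> t k \<and> t k \<le> T + real (k + 1) * Y" if "k \<in> A \<inter> {j*m..<j*m+m}" for k
        using t[of k] that unfolding cell_def by auto
      show "V \<le> norm (F (t k))" if "k \<in> A \<inter> {j*m..<j*m+m}" for k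
        using t[of k] that unfolding lev_def by auto
      show "sqrt (real m) \<le> V\<^sup>2 * Y / (6912 * H)" using sm unfolding x_def .
    qed (use nT TY V in \<open>auto simp: A_def\<close>)
  qed
  also have "\<dots> = (1 + real J0) * (\<Lambda> * T / (Y^3 * V\<^sup>2))" by simp
  also have "\<dots> \<le> (1 + 4 * \<Lambda>\<^sup>2 * T / (V^4 * Y^3)) * (\<Lambda> * T / (Y^3 * V\<^sup>2))"
  proof (intro mult_right_mono add_left_mono)
    have "real J0 \<le> real n / real m" unfolding J0_def by (rule of_nat_div_le_of_nat)
    also have "\<dots> \<le> (T / Y) / (x\<^sup>2 / 2)" using nT m2 x2 by (intro frac_le) auto
    also have "\<dots> = 2 * (6912 * H)\<^sup>2 * T / (V^4 * Y^3)"
      unfolding x_def using H1 Y1 V by (simp add: field_simps eval_nat_numeral)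
    also have "\<dots> \<le> 4 * \<Lambda>\<^sup>2 * T / (V^4 * Y^3)"
    proof (intro divide_right_mono mult_right_mono)
      have "(6912 * H)\<^sup>2 \<le> \<Lambda>\<^sup>2" using Lam_ge(1) H1 by (intro power_mono) auto
      moreover have "0 \<le> \<Lambda>\<^sup>2" by simp
      ultimately show "2 * (6912 * H)\<^sup>2 \<le> 4 * \<Lambda>\<^sup>2" by linarith
    qed (use T1 Y1 V in auto)
    finally show "real J0 \<le> 4 * \<Lambda>\<^sup>2 * T / (V^4 * Y^3)" .
  qed (use Lam_ge T1 Y1 V in auto)
  finally have cA: "real (card A) \<le> (1 + 4 * \<Lambda>\<^sup>2 * T / (V^4 * Y^3)) * (\<Lambda> * T / (Y^3 * V\<^sup>2))" .
  have sub: "lev V \<subseteq> (\<Union>k\<in>A. cell k)"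
  proof
    fix u assume u: "u \<in> lev V"
    hence uT: "T \<le> u" "u \<le> 2 * T" unfolding lev_def by auto
    define k where "k = nat \<lfloor>(u - T) / Y\<rfloor>"
    have k1: "real k \<le> (u - T) / Y" unfolding k_def using uT Y1 by (intro of_nat_floor) auto
    have k2: "(u - T) / Y \<le> real (k + 1)" unfolding k_def using uT Y1 by (simp add: of_nat_nat) linarith
    have "(u - T) / Y \<le> T / Y" using uT Y1 by (intro divide_right_mono) auto
    hence "k \<le> n" unfolding k_def n_def by (intro nat_mono floor_mono)
    moreover have "u \<in> cell k" using k1 k2 Y1 unfolding cell_def by (simp add: field_simps)
    ultimately show "u \<in> (\<Union>k\<in>A. cell k)" using u unfolding A_def by auto
  qed
  have "emeasure lborel (lev V) \<le> emeasure lborel (\<Union>k\<in>A. cell k)"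
    using sub finA unfolding cell_def by (intro emeasure_mono) auto
  also have "\<dots> \<le> (\<Sum>k\<in>A. emeasure lborel (cell k))"
    using finA unfolding cell_def by (intro emeasure_subadditive_finite) auto
  also have "\<dots> = (\<Sum>k\<in>A. ennreal Y)"
    unfolding cell_def using Y1 by (intro sum.cong refl) (simp add: algebra_simps)
  also have "\<dots> = ennreal (real (card A) * Y)"
    using Y1 by (simp add: ennreal_mult'' ennreal_of_nat_eq_real_of_nat)
  also have "\<dots> \<le> ennreal ((1 + 4 * \<Lambda>\<^sup>2 * T / (V^4 * Y^3)) * (\<Lambda> * T / (Y^3 * V\<^sup>2)) * Y)"
    using cA Y1 by (intro ennreal_leI mult_right_mono) auto
  also have "(1 + 4 * \<Lambda>\<^sup>2 * T / (V^4 * Y^3)) * (\<Lambda> * T / (Y^3 * V\<^sup>2)) * Y = (1 + 4 * \<Lambda>\<^sup>2 * T / (V^4 * Y^3)) * (\<Lambda> * T / (Y\<^sup>2 * V\<^sup>2))"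
    using Y1 by (simp add: power2_eq_square power3_eq_cube)
  finally show ?thesis .
qed

text \<open>For p = 4 the pointwise bound V^2 <= \<Lambda> T/Y^3 turns the leading term \<Lambda> T
  V^2/Y^2 into \<Lambda>^2 T * T/Y^5. For p = 3 and V > Y it gives (V/Y^2)^2 <= \<Lambda> T/Y^7, and
  V > Y also controls the term that counts the windows.\<close>

lemma level_power:
  assumes V: "0 < V" "\<Lambda> \<le> V\<^sup>2" and p: "p = 3 \<and> T \<le> Y^7 \<or> p = 4 \<and> T \<le> Y^5"
  shows "emeasure lborel (lev V) * ennreal (V^p) \<le> ennreal (5 * \<Lambda>^3 * T)"
proof (cases "lev V = {}")
  case True thus ?thesis by simp
next
  case False
  then obtain t where "T \<le> t" "V \<le> norm (F t)" unfolding lev_def by auto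
  hence VT: "V\<^sup>2 \<le> \<Lambda> * T / Y^3"
    using order_trans[OF power_mono[of V "norm (F t)" 2] F_pointwise[of t]] V by auto
  define B where "B = (1 + 4 * \<Lambda>\<^sup>2 * T / (V^4 * Y^3)) * (\<Lambda> * T / (Y\<^sup>2 * V\<^sup>2))"
  have LL: "\<Lambda> \<le> \<Lambda>^3" "\<Lambda>\<^sup>2 \<le> \<Lambda>^3" "0 \<le> \<Lambda>^3"
    using power_increasing[of 1 3 \<Lambda>] power_increasing[of 2 3 \<Lambda>] Lam_ge by auto
  have Y0: "Y > 0" "1 \<le> Y" and T0: "T > 0" using Y1 T1 by auto
  have fin: "emeasure lborel (lev V) * ennreal (V^p) \<le> ennreal (5 * \<Lambda>^3 * T)" if "B * V^p \<le> 5 * \<Lambda>^3 * T"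
  proof -
    have "emeasure lborel (lev V) * ennreal (V^p) \<le> ennreal B * ennreal (V^p)"
      using level_set[OF V] unfolding B_def by (intro mult_right_mono) auto
    also have "\<dots> = ennreal (B * V^p)" using V by (simp add: ennreal_mult'')
    finally show ?thesis using that by (meson ennreal_leI order_trans)
  qed
  from p show ?thesis
  proof
    assume p: "p = 4 \<and> T \<le> Y^5"
    have "B * V^4 = \<Lambda> * T / Y\<^sup>2 * V\<^sup>2 + 4 * \<Lambda>^3 * T * (T / (Y^5 * V\<^sup>2))"
      unfolding B_def using V Y0 by (simp add: field_simps eval_nat_numeral)
    also have "\<dots> \<le> \<Lambda>\<^sup>2 * T + 4 * \<Lambda>^3 * T"
    proof (intro add_mono)
      have "\<Lambda> * T / Y\<^sup>2 * V\<^sup>2 \<le> \<Lambda> * T / Y\<^sup>2 * (\<Lambda> * T / Y^3)"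
        using VT Lam_ge T0 by (intro mult_left_mono) auto
      also have "\<dots> = \<Lambda>\<^sup>2 * T * (T / Y^5)" using Y0 by (simp add: field_simps eval_nat_numeral)
      also have "\<dots> \<le> \<Lambda>\<^sup>2 * T * 1" using p Y0 T0 by (intro mult_left_mono) auto
      finally show "\<Lambda> * T / Y\<^sup>2 * V\<^sup>2 \<le> \<Lambda>\<^sup>2 * T" by simp
      have "T * 1 \<le> Y^5 * V\<^sup>2" using p V Lam_ge Y0 T0 by (intro mult_mono) auto
      hence "T / (Y^5 * V\<^sup>2) \<le> 1" using Y0 V by (simp add: divide_le_eq)
      hence "4 * \<Lambda>^3 * T * (T / (Y^5 * V\<^sup>2)) \<le> 4 * \<Lambda>^3 * T * 1" using LL T0 by (intro mult_left_mono) auto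
      thus "4 * \<Lambda>^3 * T * (T / (Y^5 * V\<^sup>2)) \<le> 4 * \<Lambda>^3 * T" by simp
    qed
    also have "\<Lambda>\<^sup>2 * T + 4 * \<Lambda>^3 * T \<le> \<Lambda>^3 * T + 4 * \<Lambda>^3 * T" using LL T0 by (intro add_mono mult_right_mono) auto
    finally have "B * V^4 \<le> 5 * \<Lambda>^3 * T" by (simp add: mult_ac)
    thus ?thesis using p fin by simp
  next
    assume p: "p = 3 \<and> T \<le> Y^7"
    show ?thesis
    \<comment> \<open>For V <= Y the mean square is better: V^3 times the measure is at most V times
      the integral of |F|^2, hence at most V \<Lambda> T/Y.\<close>
    proof (cases "V \<le> Y")
      case True
      have "emeasure lborel (lev V) * ennreal (V^p) = (\<integral>\<^sup>+t. ennreal (V^3) * indicator (lev V) t \<partial>lborel)"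
        using p by (subst nn_integral_cmult_indicator) (auto simp: mult.commute)
      also have "\<dots> \<le> (\<integral>\<^sup>+t. ennreal V * (ennreal ((norm (F t))\<^sup>2) * indicator {T..2*T} t) \<partial>lborel)"
      proof (rule nn_integral_mono)
        fix t
        show "ennreal (V^3) * indicator (lev V) t \<le> ennreal V * (ennreal ((norm (F t))\<^sup>2) * indicator {T..2*T} t)"
        proof (cases "t \<in> lev V")
          case True
          hence "V * V\<^sup>2 \<le> V * (norm (F t))\<^sup>2" using V unfolding lev_def by (intro mult_left_mono power_mono) auto
          thus ?thesis using True V unfolding lev_def by (simp add: power2_eq_square power3_eq_cube mult.assoc flip: ennreal_mult')
        qed simp
      qed
      also have "\<dots> = ennreal V * (\<integral>\<^sup>+t\<in>{T..2*T}. ennreal ((norm (F t))\<^sup>2) \<partial>lborel)"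
        by (rule nn_integral_cmult) measurable
      also have "\<dots> \<le> ennreal V * ennreal (\<Lambda> * T / Y)" by (intro mult_left_mono mean_square_T) simp
      also have "\<dots> = ennreal (V * (\<Lambda> * T / Y))" using V by (intro ennreal_mult'[symmetric]) auto
      also have "\<dots> \<le> ennreal (5 * \<Lambda>^3 * T)"
      proof (rule ennreal_leI)
        have "V * (\<Lambda> * T / Y) = (V / Y) * (\<Lambda> * T)" by simp
        also have "\<dots> \<le> 1 * (\<Lambda> * T)" using True V Y0 Lam_ge T0 by (intro mult_right_mono) auto
        also have "\<dots> \<le> 5 * \<Lambda>^3 * T" using LL T0 by (simp add: mult_right_mono)
        finally show "V * (\<Lambda> * T / Y) \<le> 5 * \<Lambda>^3 * T" .
      qed
      finally show ?thesis .
    next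
      case False
      have "B * V^3 = \<Lambda> * T * (V / Y\<^sup>2) + 4 * \<Lambda>^3 * T * (T / (Y^5 * V^3))"
        unfolding B_def using V Y0 by (simp add: field_simps eval_nat_numeral)
      also have "\<dots> \<le> \<Lambda> * T * \<Lambda> + 4 * \<Lambda>^3 * T"
      proof (intro add_mono mult_left_mono)
        have "(V / Y\<^sup>2)\<^sup>2 = V\<^sup>2 / Y^4" by (simp add: power_divide)
        also have "\<dots> \<le> (\<Lambda> * T / Y^3) / Y^4" using VT Y0 by (intro divide_right_mono) auto
        also have "\<dots> = \<Lambda> * (T / Y^7)" by (simp flip: power_add)
        also have "\<dots> \<le> \<Lambda> * 1" using p Y0 Lam_ge by (intro mult_left_mono) auto
        also have "\<dots> \<le> \<Lambda>\<^sup>2" using power_increasing[of 1 2 \<Lambda>] Lam_ge by simp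
        finally show "V / Y\<^sup>2 \<le> \<Lambda>" using Lam_ge by (intro power2_le_imp_le[of "V / Y\<^sup>2" \<Lambda>]) auto
        have "T * 1 \<le> Y^7 * Y" using p Y0 T0 by (intro mult_mono) auto
        also have "\<dots> = Y^5 * Y^3" by (simp add: eval_nat_numeral)
        also have "\<dots> \<le> Y^5 * V^3" using False Y0 by (intro mult_left_mono power_mono) auto
        finally have "T / (Y^5 * V^3) \<le> 1" using Y0 V by (simp add: divide_le_eq)
        hence "4 * \<Lambda>^3 * T * (T / (Y^5 * V^3)) \<le> 4 * \<Lambda>^3 * T * 1" using LL T0 by (intro mult_left_mono) auto
        thus "4 * \<Lambda>^3 * T * (T / (Y^5 * V^3)) \<le> 4 * \<Lambda>^3 * T" by simp
      qed (use Lam_ge T0 in auto)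
      also have "\<Lambda> * T * \<Lambda> + 4 * \<Lambda>^3 * T = \<Lambda>\<^sup>2 * T + 4 * \<Lambda>^3 * T" by (simp add: power2_eq_square)
      also have "\<dots> \<le> \<Lambda>^3 * T + 4 * \<Lambda>^3 * T" using LL T0 by (intro add_mono mult_right_mono) auto
      finally have "B * V^3 \<le> 5 * \<Lambda>^3 * T" by (simp add: mult_ac)
      thus ?thesis using p fin by simp
    qed
  qed
qed

text \<open>The levels are 2^i sqrt \<Lambda> with i < Kn. Values below the first level contribute
  at most \<Lambda>^2 pointwise, and |F|^2 <= \<Lambda> T <= \<Lambda> 4^Kn excludes values above
  the last one. A level costs 80 = 2^4 * 5 times \<Lambda>^3 T, where 2^p <= 2^4 comes from the
  dyadic rounding.\<close>

lemma high_moment: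
  assumes p: "p = 3 \<and> T \<le> Y^7 \<or> p = 4 \<and> T \<le> Y^5" and Kn: "T \<le> 4 ^ Kn"
  shows "(\<integral>\<^sup>+t\<in>{T..2*T}. ennreal (norm (F t) ^ p) \<partial>lborel) \<le> ennreal (81 * (real Kn + 1) * \<Lambda>^3 * T)"
proof -
  define V where "V = (\<lambda>i::nat. 2 ^ i * sqrt \<Lambda>)"
  have V0: "0 < V i" for i unfolding V_def using Lam_ge by simp
  have V2: "\<Lambda> \<le> (V i)\<^sup>2" for i
  proof -
    have "1 * \<Lambda> \<le> (2 ^ i)\<^sup>2 * \<Lambda>" using Lam_ge by (intro mult_right_mono) auto
    thus ?thesis unfolding V_def using Lam_ge by (simp add: power_mult_distrib)
  qed
  have pw: "norm (F t) ^ p \<le> \<Lambda>\<^sup>2 + (\<Sum>i<Kn. 2 ^ p * V i ^ p * indicator (lev (V i)) t)" if t: "t \<in> {T..2*T}" for t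
  proof -
    have "(norm (F t))\<^sup>2 \<le> \<Lambda> * T / Y^3" using t by (intro F_pointwise) auto
    also have "\<dots> \<le> \<Lambda> * 4 ^ Kn / 1"
      using Kn Lam_ge T1 Y1 by (intro frac_le mult_left_mono) auto
    also have "\<dots> = (V Kn)\<^sup>2"
    proof -
      have "(4::real) ^ Kn = (2 ^ Kn)\<^sup>2" by (simp add: power2_eq_square flip: power_mult_distrib)
      thus ?thesis unfolding V_def power_mult_distrib using Lam_ge by simp
    qed
    finally have top: "norm (F t) \<le> V Kn" using V0[of Kn] by (intro power2_le_imp_le[of "norm (F t)"]) auto
    have nn: "0 \<le> 2 ^ p * V i ^ p * indicator (lev (V i)) t" for i using V0[of i] by simp
    show ?thesis
    proof (cases "norm (F t) \<le> V 0")
      case True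
      have "norm (F t) ^ p \<le> (sqrt \<Lambda>) ^ p" using True unfolding V_def by (intro power_mono) auto
      also have "\<dots> \<le> (sqrt \<Lambda>) ^ 4" using p Lam_ge by (intro power_increasing) auto
      also have "\<dots> = \<Lambda>\<^sup>2" using Lam_ge power_mult[of "sqrt \<Lambda>" 2 2] by simp
      finally have "norm (F t) ^ p \<le> \<Lambda>\<^sup>2" .
      moreover have "0 \<le> (\<Sum>i<Kn. 2 ^ p * V i ^ p * indicator (lev (V i)) t)" using nn by (intro sum_nonneg) auto
      ultimately show ?thesis by linarith
    next
      case False
      \<comment> \<open>The first level that is not exceeded; its predecessor lies below the value
        and within a factor 2 of this level.\<close>
      define i where "i = (LEAST j. norm (F t) \<le> V j)"
      have i1: "norm (F t) \<le> V i" unfolding i_def by (rule LeastI[of _ Kn], rule top)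
      have i2: "i \<le> Kn" unfolding i_def by (rule Least_le, rule top)
      have i0: "i \<noteq> 0" using False i1 by metis
      have i3: "V (i - 1) \<le> norm (F t)" using not_less_Least[of "i-1" "\<lambda>j. norm (F t) \<le> V j"] i0 unfolding i_def[symmetric] by auto
      have "V i = 2 * V (i - 1)" using i0 unfolding V_def by (cases i) auto
      hence "norm (F t) ^ p \<le> (2 * V (i - 1)) ^ p" using i1 by (intro power_mono) auto
      also have "\<dots> = 2 ^ p * V (i - 1) ^ p * indicator (lev (V (i - 1))) t"
        using i3 t by (simp add: lev_def power_mult_distrib)
      also have "\<dots> \<le> (\<Sum>i<Kn. 2 ^ p * V i ^ p * indicator (lev (V i)) t)"
        using i0 i2 nn by (intro member_le_sum[of "i-1" "{..<Kn}"]) auto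
      finally show ?thesis by (simp add: add_increasing)
    qed
  qed
  have nn: "0 \<le> 2 ^ p * V i ^ p * indicator (lev (V i)) t" for i t using V0[of i] by simp
  have "(\<integral>\<^sup>+t\<in>{T..2*T}. ennreal (norm (F t) ^ p) \<partial>lborel) \<le>
     (\<integral>\<^sup>+t. ennreal (\<Lambda>\<^sup>2) * indicator {T..2*T} t + (\<Sum>i<Kn. ennreal (2 ^ p * V i ^ p) * indicator (lev (V i)) t) \<partial>lborel)"
  proof (rule nn_integral_mono)
    fix t
    show "ennreal (norm (F t) ^ p) * indicator {T..2*T} t \<le> ennreal (\<Lambda>\<^sup>2) * indicator {T..2*T} t + (\<Sum>i<Kn. ennreal (2 ^ p * V i ^ p) * indicator (lev (V i)) t)"
    proof (cases "t \<in> {T..2*T}")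
      case True
      have "ennreal (norm (F t) ^ p) \<le> ennreal (\<Lambda>\<^sup>2 + (\<Sum>i<Kn. 2 ^ p * V i ^ p * indicator (lev (V i)) t))"
        using pw[OF True] by (rule ennreal_leI)
      also have "\<dots> = ennreal (\<Lambda>\<^sup>2) + (\<Sum>i<Kn. ennreal (2 ^ p * V i ^ p * indicator (lev (V i)) t))"
      proof -
        have "ennreal (\<Lambda>\<^sup>2 + (\<Sum>i<Kn. 2 ^ p * V i ^ p * indicator (lev (V i)) t)) = ennreal (\<Lambda>\<^sup>2) + ennreal (\<Sum>i<Kn. 2 ^ p * V i ^ p * indicator (lev (V i)) t)"
          by (intro ennreal_plus sum_nonneg nn) simp
        thus ?thesis using sum_ennreal[of "{..<Kn}", OF nn] by simp
      qed
      also have "(\<Sum>i<Kn. ennreal (2 ^ p * V i ^ p * indicator (lev (V i)) t)) = (\<Sum>i<Kn. ennreal (2 ^ p * V i ^ p) * indicator (lev (V i)) t)"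
        by (intro sum.cong refl) (simp add: indicator_def)
      finally show ?thesis using True by simp
    qed simp
  qed
  also have "\<dots> = ennreal (\<Lambda>\<^sup>2) * ennreal T + (\<Sum>i<Kn. ennreal (2 ^ p * V i ^ p) * emeasure lborel (lev (V i)))"
  proof -
    have m: "(\<lambda>t. ennreal c * indicator (lev v) t) \<in> borel_measurable lborel" for c v by measurable
    have "(\<integral>\<^sup>+t. ennreal (\<Lambda>\<^sup>2) * indicator {T..2*T} t + (\<Sum>i<Kn. ennreal (2 ^ p * V i ^ p) * indicator (lev (V i)) t) \<partial>lborel) =
      (\<integral>\<^sup>+t. ennreal (\<Lambda>\<^sup>2) * indicator {T..2*T} t \<partial>lborel) + (\<integral>\<^sup>+t. (\<Sum>i<Kn. ennreal (2 ^ p * V i ^ p) * indicator (lev (V i)) t) \<partial>lborel)"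
      by (intro nn_integral_add borel_measurable_sum m) measurable
    moreover have "(\<integral>\<^sup>+t. (\<Sum>i<Kn. ennreal (2 ^ p * V i ^ p) * indicator (lev (V i)) t) \<partial>lborel) = (\<Sum>i<Kn. (\<integral>\<^sup>+t. ennreal (2 ^ p * V i ^ p) * indicator (lev (V i)) t \<partial>lborel))"
      by (intro nn_integral_sum m)
    moreover have "(\<integral>\<^sup>+t. ennreal (\<Lambda>\<^sup>2) * indicator {T..2*T} t \<partial>lborel) = ennreal (\<Lambda>\<^sup>2) * ennreal T"
      using T1 by (subst nn_integral_cmult_indicator) auto
    moreover have "(\<integral>\<^sup>+t. ennreal c * indicator (lev v) t \<partial>lborel) = ennreal c * emeasure lborel (lev v)" for c v
      by (intro nn_integral_cmult_indicator) simp
    ultimately show ?thesis by simp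
  qed
  also have "\<dots> \<le> ennreal (\<Lambda>\<^sup>2 * T) + (\<Sum>i<Kn. ennreal (80 * \<Lambda>^3 * T))"
  proof (intro add_mono sum_mono)
    show "ennreal (\<Lambda>\<^sup>2) * ennreal T \<le> ennreal (\<Lambda>\<^sup>2 * T)" using T1 by (simp add: ennreal_mult'')
    fix i
    have "ennreal (2 ^ p * V i ^ p) * emeasure lborel (lev (V i)) = ennreal (2 ^ p) * (emeasure lborel (lev (V i)) * ennreal (V i ^ p))"
      using V0[of i] by (simp add: ennreal_mult mult_ac)
    also have "\<dots> \<le> ennreal 16 * ennreal (5 * \<Lambda>^3 * T)"
    proof (intro mult_mono ennreal_leI level_power V0 V2 p)
      have "(2::real) ^ p \<le> 2 ^ 4" using p by (intro power_increasing) auto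
      thus "(2::real) ^ p \<le> 16" by simp
    qed auto
    also have "\<dots> = ennreal (80 * \<Lambda>^3 * T)" using Lam_ge T1 by (subst ennreal_mult[symmetric]) auto
    finally show "ennreal (2 ^ p * V i ^ p) * emeasure lborel (lev (V i)) \<le> ennreal (80 * \<Lambda>^3 * T)" .
  qed
  also have "\<dots> = ennreal (\<Lambda>\<^sup>2 * T + real Kn * (80 * \<Lambda>^3 * T))"
    using Lam_ge T1 by (subst ennreal_plus) (auto simp: ennreal_mult ennreal_of_nat_eq_real_of_nat)
  also have "\<dots> \<le> ennreal (81 * (real Kn + 1) * \<Lambda>^3 * T)"
  proof (rule ennreal_leI)
    have "\<Lambda>\<^sup>2 * T \<le> \<Lambda>^3 * T" using power_increasing[of 2 3 \<Lambda>] Lam_ge T1 by (intro mult_right_mono) auto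
    moreover have "0 \<le> real Kn * (\<Lambda>^3 * T)" "0 \<le> \<Lambda>^3 * T" using Lam_ge T1 by auto
    ultimately show "\<Lambda>\<^sup>2 * T + real Kn * (80 * \<Lambda>^3 * T) \<le> 81 * (real Kn + 1) * \<Lambda>^3 * T"
      by (simp add: algebra_simps)
  qed
  finally show ?thesis .
qed

end

section \<open>The sawtooth function\<close>

lemma frac_measurable [measurable]: "(frac :: real \<Rightarrow> real) \<in> borel_measurable borel"
  unfolding frac_def[abs_def] by measurable

lemma periodic_int:
  fixes f :: "real \<Rightarrow> 'a"
  assumes per: "\<And>x. f (x + 1) = f x"
  shows "f (x + of_int k) = f x"
proof (induction k rule: int_induct[where k=0])
  case (step1 i)
  have "f (x + of_int (i + 1)) = f ((x + of_int i) + 1)" by (simp add: algebra_simps)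
  thus ?case using step1 by (simp only: per)
next
  case (step2 i)
  have "f (x + of_int i) = f ((x + of_int (i - 1)) + 1)" by (simp add: algebra_simps)
  thus ?case using step2 by (simp only: per)
qed simp

lemma integral_periodic_shift:
  fixes f :: "real \<Rightarrow> real"
  assumes per: "\<And>x. f (x + 1) = f x" and m: "f \<in> borel_measurable borel" and B: "\<And>x. \<bar>f x\<bar> \<le> B"
  shows "integral {0..1} (\<lambda>x. f (x + c)) = integral {0..1} f"
proof -
  have int: "f integrable_on {a..b}" for a b using m B by (intro bounded_measurable_integrable_on[where B=B]) auto
  define d where "d = frac c"
  have d: "0 \<le> d" "d < 1" unfolding d_def by (auto simp: frac_lt_1)
  have "f (x + c) = f (x + d)" for x
    using periodic_int[of f "x + d" "\<lfloor>c\<rfloor>", OF per] unfolding d_def frac_def by (simp add: algebra_simps)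
  hence "integral {0..1} (\<lambda>x. f (x + c)) = integral {0..1} (\<lambda>x. f (x + d))" by simp
  also have "\<dots> = integral {d..1 + d} f" using integral_shift_real_ivl[of d d "1+d" f] by simp
  also have "\<dots> = integral {d..1} f + integral {1..1 + d} f"
    using int d by (intro Henstock_Kurzweil_Integration.integral_combine[symmetric]) auto
  also have "integral {1..1 + d} f = integral {0..d} (\<lambda>x. f (x + 1))"
    using integral_shift_real_ivl[of 1 1 "1+d" f] by simp
  also have "\<dots> = integral {0..d} f" by (simp add: per)
  also have "integral {d..1} f + integral {0..d} f = integral {0..1} f"
    using Henstock_Kurzweil_Integration.integral_combine[of 0 d 1 f] int d by simp
  finally show ?thesis .
qed

lemma integral_periodic_mult:
  fixes f :: "real \<Rightarrow> real"
  assumes per: "\<And>x. f (x + 1) = f x" and m: "f \<in> borel_measurable borel" and B: "\<And>x. \<bar>f x\<bar> \<le> B"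
    and n: "0 < n"
  shows "integral {0..1} (\<lambda>x. f (real n * x)) = integral {0..1} f"
proof -
  have int: "f integrable_on {a..b}" for a b using m B by (intro bounded_measurable_integrable_on[where B=B]) auto
  have "integral {real 0..real n} f = (\<Sum>j\<in>{0..<n}. integral {0..1} (\<lambda>y. f (y + real j)))"
    using int by (intro integral_split_units) auto
  also have "\<dots> = (\<Sum>j\<in>{0..<n}. integral {0..1} f)"
    using integral_periodic_shift[OF per m B] by simp
  finally have s: "integral {0..real n} f = real n * integral {0..1} f" by simp
  have "(f has_integral integral {0..real n} f) (cbox 0 (real n))" using int by (simp add: integrable_integral)
  from has_integral_affinity'[OF this, of "real n" 0] n
  have "((\<lambda>x. f (real n * x)) has_integral (integral {0..real n} f / real n)) {0..1}"
    by (simp add: divide_inverse mult.commute)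
  thus ?thesis using s n by (simp add: integral_unique)
qed

text \<open>As k runs through the residues modulo m, so does n + a k with n = floor (m z); each
  fractional part is then (residue + f)/m with f = frac (m z).\<close>

lemma sum_frac_shift:
  assumes m: "0 < m" and co: "coprime a m"
  shows "(\<Sum>k<m. frac (z + real (a * k) / real m)) = frac (real m * z) + (real m - 1) / 2"
proof -
  define n where "n = \<lfloor>real m * z\<rfloor>"
  define f where "f = frac (real m * z)"
  have mz: "real m * z = of_int n + f" unfolding n_def f_def frac_def by simp
  have f: "0 \<le> f" "f < 1" unfolding f_def by (auto simp: frac_lt_1)
  define r where "r = (\<lambda>k::nat. nat ((n + int (a * k)) mod int m))"
  have rr: "frac (z + real (a * k) / real m) = (real (r k) + f) / real m" for k
  proof -
    define t where "t = n + int (a * k)"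
    have "z + real (a * k) / real m = (of_int t + f) / real m"
      using mz m unfolding t_def by (simp add: field_simps)
    also have "of_int t = (of_int (t div int m) * real m + of_int (t mod int m) :: real)"
      by (metis div_mult_mod_eq of_int_add of_int_mult of_int_of_nat_eq)
    also have "(of_int (t div int m) * real m + of_int (t mod int m) + f) / real m = of_int (t div int m) + (of_int (t mod int m) + f) / real m"
      using m by (simp add: field_simps)
    finally have 1: "z + real (a * k) / real m = of_int (t div int m) + (of_int (t mod int m) + f) / real m" .
    have t0: "0 \<le> t mod int m" "t mod int m \<le> int m - 1" using m pos_mod_bound[of "int m" t] by auto
    hence "real_of_int (t mod int m) \<le> real m - 1" "0 \<le> real_of_int (t mod int m)" by linarith+
    hence "0 \<le> (of_int (t mod int m) + f) / real m" "(of_int (t mod int m) + f) / real m < 1" using f m by auto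
    hence "frac (z + real (a * k) / real m) = (of_int (t mod int m) + f) / real m"
      unfolding 1 by (subst frac_unique_iff) auto
    thus ?thesis unfolding r_def t_def[symmetric] using t0 by simp
  qed
  have inj: "inj_on r {..<m}"
  proof (rule inj_onI)
    fix x y assume xy: "x \<in> {..<m}" "y \<in> {..<m}" "r x = r y"
    have "(n + int (a * x)) mod int m = (n + int (a * y)) mod int m"
      using xy(3) m unfolding r_def by (simp add: nat_eq_iff split: if_splits)
    hence "int m dvd (n + int (a * x)) - (n + int (a * y))" by (simp add: mod_eq_dvd_iff)
    hence "int m dvd int a * (int x - int y)" by (simp add: algebra_simps)
    moreover have "coprime (int m) (int a)" using co by (simp add: coprime_commute)
    ultimately have "int m dvd int x - int y" by (simp add: coprime_dvd_mult_right_iff)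
    moreover have "\<bar>int x - int y\<bar> < int m" using xy by auto
    ultimately show "x = y" using zdvd_imp_le[of "int m" "\<bar>int x - int y\<bar>"] by (cases "x = y") auto
  qed
  have "r ` {..<m} \<subseteq> {..<m}" using m by (auto simp: r_def nat_less_iff)
  hence img: "r ` {..<m} = {..<m}" using inj by (intro card_subset_eq) (auto simp: card_image)
  have "(\<Sum>k<m. frac (z + real (a * k) / real m)) = ((\<Sum>k<m. real (r k)) + real m * f) / real m"
    unfolding rr by (simp add: sum_divide_distrib[symmetric] sum.distrib)
  also have "(\<Sum>k<m. real (r k)) = (\<Sum>k<m. real k)"
    using sum.reindex[OF inj, of real] img by (simp add: o_def)
  also have "\<dots> = real m * (real m - 1) / 2"
    by (induction m) (auto simp: field_simps)
  also have "(real m * (real m - 1) / 2 + real m * f) / real m = f + (real m - 1) / 2"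
    using m by (simp add: field_simps)
  finally show ?thesis unfolding f_def .
qed

section \<open>Increments of the fractional part and gcd sums\<close>

definition fd :: "real \<Rightarrow> real \<Rightarrow> real" where "fd \<theta> x = frac (x + \<theta>) - frac x"

lemma fd_measurable [measurable]: "fd \<theta> \<in> borel_measurable borel"
  unfolding fd_def[abs_def] by measurable

lemma fd_bound: "\<bar>fd \<theta> x\<bar> \<le> 1"
  unfolding fd_def using frac_lt_1[of x] frac_ge_0[of x] frac_lt_1[of "x+\<theta>"] frac_ge_0[of "x+\<theta>"] by linarith

lemma frac_add_of_int: "frac (x + of_int k) = frac x"
  unfolding frac_def by simp

lemma fd_int: "fd \<theta> (x + real k) = fd \<theta> x"
proof -
  have "frac (x + real k + \<theta>) = frac (x + \<theta>)" "frac (x + real k) = frac x" for x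
    using frac_add_of_int[of "x + \<theta>" "int k"] frac_add_of_int[of x "int k"] by (simp_all add: algebra_simps)
  thus ?thesis unfolding fd_def by simp
qed

text \<open>The constant (m - 1)/2 of \<open>sum_frac_shift\<close> cancels in the increment, which
  is why increments rather than values are averaged.\<close>

lemma fd_sum:
  assumes m: "0 < m" and co: "coprime a m"
  shows "(\<Sum>k<m. fd \<theta> (z + real (a * k) / real m)) = fd (real m * \<theta>) (real m * z)"
  using sum_frac_shift[OF assms, of z] sum_frac_shift[OF assms, of "z + \<theta>"]
  unfolding fd_def by (simp add: sum_subtractf algebra_simps)

lemma fd_prod_integrable: "(\<lambda>x. fd \<theta> (c * x + d) * fd \<theta>' (c' * x + d')) integrable_on {a..b}"
proof (rule bounded_measurable_integrable_on)
  show "norm (fd \<theta> (c * x + d) * fd \<theta>' (c' * x + d')) \<le> 1 * 1" for x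
    unfolding norm_mult using fd_bound by (intro mult_mono) auto
qed measurable

text \<open>Translating x by k/b changes neither the integral nor the factor with b x, so the other
  factor may be averaged over k < b; \<open>fd_sum\<close> collapses this average, and then
  periodicity replaces b x by x.\<close>

lemma average_shifts:
  assumes ab: "0 < a" "0 < b" "coprime a b"
  shows "integral {0..1} (\<lambda>x. fd \<theta> (real a * x) * fd \<theta>' (real b * x)) =
    1 / real b * integral {0..1} (\<lambda>x. fd (real b * \<theta>) (real a * x) * fd \<theta>' x)"
proof -
  define h where "h = (\<lambda>x. fd \<theta> (real a * x) * fd \<theta>' (real b * x))"
  have hp: "h (x + 1) = h x" for x
    using fd_int[of \<theta> "real a * x" a] fd_int[of \<theta>' "real b * x" b] unfolding h_def by (simp add: algebra_simps)
  have hb: "\<bar>fd u x * fd v y\<bar> \<le> 1" for u v x y unfolding abs_mult using fd_bound by (intro mult_le_one) auto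
  have hm: "h \<in> borel_measurable borel" unfolding h_def by measurable
  have "real b * integral {0..1} h = (\<Sum>k<b. integral {0..1} (\<lambda>x. h (x + real k / real b)))"
    using integral_periodic_shift[OF hp hm, of 1] hb by (simp add: h_def)
  also have "\<dots> = (\<Sum>k<b. integral {0..1} (\<lambda>x. fd \<theta> (real a * x + real (a * k) / real b) * fd \<theta>' (real b * x)))"
  proof (intro sum.cong refl arg_cong[where f="integral {0..1}"] ext)
    fix k x
    have "real a * (x + real k / real b) = real a * x + real (a * k) / real b" "real b * (x + real k / real b) = real b * x + real k"
      using ab by (simp_all add: algebra_simps)
    thus "h (x + real k / real b) = fd \<theta> (real a * x + real (a * k) / real b) * fd \<theta>' (real b * x)"
      unfolding h_def by (simp only: fd_int)
  qed
  also have "\<dots> = integral {0..1} (\<lambda>x. \<Sum>k<b. fd \<theta> (real a * x + real (a * k) / real b) * fd \<theta>' (real b * x))"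
    using fd_prod_integrable[where d'=0] by (intro integral_sum[symmetric]) auto
  also have "\<dots> = integral {0..1} (\<lambda>x. fd (real b * \<theta>) (real a * (real b * x)) * fd \<theta>' (real b * x))"
    unfolding sum_distrib_right[symmetric] fd_sum[OF ab(2,3)] by (simp add: mult_ac)
  also have "\<dots> = integral {0..1} (\<lambda>x. fd (real b * \<theta>) (real a * x) * fd \<theta>' x)"
  proof (rule integral_periodic_mult[where f="\<lambda>x. fd (real b * \<theta>) (real a * x) * fd \<theta>' x" and B=1])
    show "fd (real b * \<theta>) (real a * (x + 1)) * fd \<theta>' (x + 1) = fd (real b * \<theta>) (real a * x) * fd \<theta>' x" for x
      using fd_int[of "real b * \<theta>" "real a * x" a] fd_int[of \<theta>' x 1] by (simp add: algebra_simps)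
  qed (use hb ab in auto)
  finally show ?thesis using ab unfolding h_def by (simp add: field_simps)
qed

text \<open>A version for increments of Franel's integral of two sawtooth functions. After the
  common factor g is removed, \<open>average_shifts\<close> is applied twice with exchanged roles,
  and both increments grow to lcm s s' * v.\<close>

lemma integral_fd_prod:
  fixes s s' :: nat and v :: real
  assumes "0 < s" "0 < s'"
  defines "g \<equiv> gcd s s'"
  shows "integral {0..1} (\<lambda>x. fd (real s * v) (real s * x) * fd (real s' * v) (real s' * x)) =
    (real g)\<^sup>2 / (real s * real s') * integral {0..1} (\<lambda>x. (fd (real (lcm s s') * v) x)\<^sup>2)"
proof -
  obtain a b where ab: "s = a * g" "s' = b * g" "coprime a b"
  proof -
    have "gcd s s' \<noteq> 0" using assms by simp
    from gcd_coprime_exists[OF this] show ?thesis using that unfolding g_def by blast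
  qed
  have g0: "0 < g" "0 < a" "0 < b" using assms(1,2) ab(1,2) by (auto intro!: Nat.gr0I)
  have hb: "\<bar>fd u x * fd v y\<bar> \<le> 1" for u v x y unfolding abs_mult using fd_bound by (intro mult_le_one) auto
  have l: "lcm s s' = a * b * g"
  proof -
    have "lcm s s' * g = s * s'" unfolding g_def by (metis mult.commute prod_gcd_lcm_nat)
    hence "lcm s s' * g = (a * b * g) * g" using ab by (simp add: mult_ac)
    thus ?thesis using g0 by simp
  qed
  define e where "e = real (lcm s s') * v"
  have eb: "real b * (real s * v) = e" and ea: "real a * (real s' * v) = e"
    unfolding e_def l unfolding ab(1,2) by simp_all
  let ?h = "\<lambda>x. fd (real s * v) (real a * x) * fd (real s' * v) (real b * x)"
  have "real s = real a * real g" "real s' = real b * real g" using ab by (metis of_nat_mult)+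
  hence "integral {0..1} (\<lambda>x. fd (real s * v) (real s * x) * fd (real s' * v) (real s' * x)) = integral {0..1} (\<lambda>x. ?h (real g * x))"
    by (simp only: mult.assoc)
  also have "\<dots> = integral {0..1} ?h"
  proof (rule integral_periodic_mult[where f="?h" and B=1])
    show "?h (x + 1) = ?h x" for x
      using fd_int[of "real s * v" "real a * x" a] fd_int[of "real s' * v" "real b * x" b] by (simp add: algebra_simps)
  qed (use hb g0 in auto)
  also have "\<dots> = 1 / real b * integral {0..1} (\<lambda>x. fd e (real a * x) * fd (real s' * v) x)"
    using average_shifts[OF g0(2,3) ab(3), of "real s * v" "real s' * v"] unfolding eb .
  also have "(\<lambda>x. fd e (real a * x) * fd (real s' * v) x) = (\<lambda>x. fd (real s' * v) (real 1 * x) * fd e (real a * x))"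
    by (simp add: mult.commute)
  also have "integral {0..1} \<dots> = 1 / real a * integral {0..1} (\<lambda>x. fd e x * fd e x)"
    using average_shifts[of 1 a "real s' * v" e] g0 unfolding ea by simp
  finally have "integral {0..1} (\<lambda>x. fd (real s * v) (real s * x) * fd (real s' * v) (real s' * x)) =
     1 / (real a * real b) * integral {0..1} (\<lambda>x. (fd e x)\<^sup>2)"
    by (simp add: power2_eq_square mult_ac)
  also have "1 / (real a * real b) = (real g)\<^sup>2 / (real s * real s')"
    using g0 \<open>real s = _\<close> \<open>real s' = _\<close> by (simp add: power2_eq_square)
  finally show ?thesis unfolding e_def .
qed

text \<open>For l < 1 the increment is l on [0, 1 - l) and l - 1 on [1 - l, 1), so the integral is l
  - l^2; for larger l the bound |fd| <= 1 suffices.\<close>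

lemma integral_fd_square:
  assumes "0 \<le> l"
  shows "integral {0..1} (\<lambda>x. (fd l x)\<^sup>2) \<le> l" "0 \<le> integral {0..1} (\<lambda>x. (fd l x)\<^sup>2)"
proof -
  have int: "(\<lambda>x. (fd l x)\<^sup>2) integrable_on {0..1}"
    using fd_prod_integrable[of l 1 0 l 1 0] by (simp add: power2_eq_square)
  show "0 \<le> integral {0..1} (\<lambda>x. (fd l x)\<^sup>2)" by (intro Henstock_Kurzweil_Integration.integral_nonneg int) auto
  show "integral {0..1} (\<lambda>x. (fd l x)\<^sup>2) \<le> l"
  proof (cases "l < 1")
    case False
    have "(fd l x)\<^sup>2 \<le> 1" for x using power_mono[OF fd_bound[of l x], of 2] by simp
    hence "integral {0..1} (\<lambda>x. (fd l x)\<^sup>2) \<le> integral {0..1} (\<lambda>x::real. 1)"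
      using int by (intro integral_le) auto
    thus ?thesis using False by simp
  next
    case True
    have fr: "frac y = y" if "0 \<le> y" "y < 1" for y :: real using that by (simp add: frac_eq)
    have fr1: "frac y = y - 1" if "1 \<le> y" "y < 2" for y :: real using that fr[of "y-1"] frac_add_of_int[of "y-1" 1] by simp
    have 1: "((\<lambda>x. (fd l x)\<^sup>2) has_integral (1 - l) * l\<^sup>2) {0..1-l}"
    proof (rule has_integral_spike_finite[of "{1-l}" _ _ "\<lambda>_. l\<^sup>2"])
      show "((\<lambda>_. l\<^sup>2) has_integral (1 - l) * l\<^sup>2) {0..1-l}" using True has_integral_const_real[of "l\<^sup>2" 0 "1-l"] by simp
      show "(fd l x)\<^sup>2 = l\<^sup>2" if "x \<in> {0..1-l} - {1-l}" for x using that assms by (simp add: fd_def fr)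
    qed auto
    have 2: "((\<lambda>x. (fd l x)\<^sup>2) has_integral l * (l-1)\<^sup>2) {1-l..1}"
    proof (rule has_integral_spike_finite[of "{1}" _ _ "\<lambda>_. (l-1)\<^sup>2"])
      show "((\<lambda>_. (l-1)\<^sup>2) has_integral l * (l-1)\<^sup>2) {1-l..1}" using assms has_integral_const_real[of "(l-1)\<^sup>2" "1-l" 1] by simp
      show "(fd l x)\<^sup>2 = (l-1)\<^sup>2" if "x \<in> {1-l..1} - {1}" for x using that assms True by (simp add: fd_def fr fr1)
    qed auto
    have "integral {0..1} (\<lambda>x. (fd l x)\<^sup>2) = (1 - l) * l\<^sup>2 + l * (l-1)\<^sup>2"
      using has_integral_combine[OF _ _ 1 2] assms True by (intro integral_unique) auto
    also have "\<dots> = l - l\<^sup>2" by (simp add: power2_eq_square algebra_simps)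
    finally show ?thesis by simp
  qed
qed

text \<open>A pair (s, s') is determined by its gcd d and the cofactors a, b, and gcd/(s s') = 1/(d
  a b): the double sum is dominated by a product of three harmonic sums.\<close>

lemma gcd_sum_le:
  assumes "1 \<le> N"
  shows "(\<Sum>s\<in>{1..N}. \<Sum>s'\<in>{1..N}. real (gcd s s') / (real s * real s')) \<le> (1 + ln (real N + 1))^3"
proof -
  define h where "h = (\<Sum>l\<in>{1..N}. 1 / real l)"
  have h: "h \<le> 1 + ln (real N + 1)"
    using sum_inverse_le[of "Suc N"] unfolding h_def by (simp add: atLeastLessThanSuc_atLeastAtMost add.commute)
  have h0: "0 \<le> h" unfolding h_def by (intro sum_nonneg) auto
  define f where "f = (\<lambda>(d, a, b). (1 / real d) * ((1 / real a) * (1 / real b)))"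
  define j where "j = (\<lambda>(s, s'). (gcd s s', s div gcd s s', s' div gcd s (s'::nat)))"
  have inj: "inj_on j ({1..N} \<times> {1..N})"
  proof (rule inj_onI)
    fix p q assume "p \<in> {1..N} \<times> {1..N}" "q \<in> {1..N} \<times> {1..N}" "j p = j q"
    moreover obtain s s' u u' where pq: "p = (s, s')" "q = (u, u')" by (cases p, cases q)
    ultimately have e: "gcd s s' = gcd u u'" "s div gcd s s' = u div gcd u u'" "s' div gcd s s' = u' div gcd u u'"
      unfolding j_def by auto
    have "s = u" using arg_cong2[OF e(2) e(1), of "times"] by simp
    moreover have "s' = u'" using arg_cong2[OF e(3) e(1), of "times"] by simp
    ultimately show "p = q" using pq by simp
  qed
  have sub: "j ` ({1..N} \<times> {1..N}) \<subseteq> {1..N} \<times> {1..N} \<times> {1..N}"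
  proof
    fix y assume "y \<in> j ` ({1..N} \<times> {1..N})"
    then obtain s s' where s: "s \<in> {1..N}" "s' \<in> {1..N}" "y = j (s, s')" by auto
    have g: "0 < gcd s s'" "gcd s s' \<le> s" "gcd s s' \<le> s'" using s by (auto intro: gcd_le1_nat gcd_le2_nat)
    have "0 < s div gcd s s'" "0 < s' div gcd s s'" using g by (auto simp: div_greater_zero_iff)
    moreover have "s div gcd s s' \<le> s" "s' div gcd s s' \<le> s'" by (rule div_le_dividend)+
    moreover have "1 \<le> s" "s \<le> N" "1 \<le> s'" "s' \<le> N" using s by auto
    ultimately have "gcd s s' \<in> {1..N}" "s div gcd s s' \<in> {1..N}" "s' div gcd s s' \<in> {1..N}"
      using g unfolding atLeastAtMost_iff by linarith+
    thus "y \<in> {1..N} \<times> {1..N} \<times> {1..N}" using s(3) unfolding j_def by (simp only: prod.case mem_Times_iff fst_conv snd_conv)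
  qed
  have "(\<Sum>s\<in>{1..N}. \<Sum>s'\<in>{1..N}. real (gcd s s') / (real s * real s')) = (\<Sum>p\<in>{1..N} \<times> {1..N}. f (j p))"
    unfolding sum.cartesian_product
  proof (intro sum.cong refl, clarify)
    fix s s' assume s: "s \<in> {1..N}" "s' \<in> {1..N}"
    have g: "gcd s s' > 0" using s by auto
    have e: "real (s div gcd s s') = real s / real (gcd s s')" "real (s' div gcd s s') = real s' / real (gcd s s')"
      by (rule real_of_nat_div, simp)+
    show "real (gcd s s') / (real s * real s') = f (j (s, s'))" unfolding f_def j_def prod.case e using g by simp
  qed
  also have "\<dots> = (\<Sum>y\<in>j ` ({1..N} \<times> {1..N}). f y)" unfolding sum.reindex[OF inj] o_def by (rule refl)
  also have "\<dots> \<le> (\<Sum>y\<in>{1..N} \<times> {1..N} \<times> {1..N}. f y)" by (intro sum_mono2 sub) (auto simp: f_def)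
  also have "\<dots> = h * (h * h)"
  proof -
    have "(\<Sum>y\<in>{1..N} \<times> {1..N} \<times> {1..N}. f y) = (\<Sum>d\<in>{1..N}. \<Sum>a\<in>{1..N}. \<Sum>b\<in>{1..N}. f (d, a, b))"
      unfolding sum.cartesian_product by (intro sum.cong refl) auto
    also have "\<dots> = (\<Sum>d\<in>{1..N}. (1 / real d) * (\<Sum>a\<in>{1..N}. (1 / real a) * h))"
      by (simp only: f_def h_def prod.case sum_distrib_left)
    also have "\<dots> = h * (h * h)"
      unfolding sum_distrib_right[symmetric] h_def[symmetric] by (rule refl)
    finally show ?thesis .
  qed
  also have "\<dots> \<le> (1 + ln (real N + 1))^3" using power_mono[OF h h0, of 3] by (simp add: power3_eq_cube mult.assoc)
  finally show ?thesis .
qed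

text \<open>The shift by -1 instead of -1/2 makes the boundary term in
  \<open>unit_sum_integral\<close> vanish at the right end of each cell and produce the summand at
  the left end, in accordance with the half-open ranges of summation.\<close>

definition W :: "nat \<Rightarrow> real \<Rightarrow> real" where
  "W N y = (\<Sum>s\<in>{1..N}. (frac (real s * y) - 1) / real s)"

lemma W_measurable [measurable]: "W N \<in> borel_measurable borel"
  unfolding W_def[abs_def] by measurable

lemma W_periodic: "W N (y + 1) = W N y"
proof -
  have "frac (real s * (y + 1)) = frac (real s * y)" for s :: nat
    using frac_add_of_int[of "real s * y" "int s"] by (simp add: algebra_simps)
  thus ?thesis unfolding W_def by simp
qed

lemma W_bound: "\<bar>W N y\<bar> \<le> 1 + ln (real N + 1)"
proof -
  have "\<bar>W N y\<bar> \<le> (\<Sum>s\<in>{1..N}. 1 / real s)"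
    unfolding W_def
  proof (intro order_trans[OF sum_abs] sum_mono)
    fix s assume "s \<in> {1..N}"
    have "\<bar>frac (real s * y) - 1\<bar> \<le> 1" using frac_lt_1[of "real s * y"] frac_ge_0[of "real s * y"] by linarith
    thus "\<bar>(frac (real s * y) - 1) / real s\<bar> \<le> 1 / real s" by (simp add: abs_divide divide_right_mono)
  qed
  also have "\<dots> \<le> 1 + ln (real N + 1)"
    using sum_inverse_le[of "Suc N"] by (simp add: atLeastLessThanSuc_atLeastAtMost add.commute)
  finally show ?thesis .
qed

text \<open>By \<open>integral_fd_prod\<close> a pair contributes at most gcd^2/(s s') * lcm * v =
  gcd * v, to be divided by s s' from the weights; the gcd sum remains. The linear dependence on v
  is what both mean squares below rest on.\<close>

lemma W_increment:
  assumes v: "0 \<le> v" and N: "1 \<le> N"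
  shows "integral {0..1} (\<lambda>y. (W N (y + v) - W N y)\<^sup>2) \<le> (1 + ln (real N + 1))^3 * v"
proof -
  have d: "W N (y + v) - W N y = (\<Sum>s\<in>{1..N}. fd (real s * v) (real s * y) / real s)" for y
    unfolding W_def fd_def by (simp add: sum_subtractf[symmetric] diff_divide_distrib[symmetric] algebra_simps)
  have i: "(\<lambda>y. (fd (real s * v) (real s * y) / real s) * (fd (real s' * v) (real s' * y) / real s')) integrable_on {0..1}"
    and e: "integral {0..1} (\<lambda>y. (fd (real s * v) (real s * y) / real s) * (fd (real s' * v) (real s' * y) / real s')) =
       1 / (real s * real s') * integral {0..1} (\<lambda>y. fd (real s * v) (real s * y) * fd (real s' * v) (real s' * y))" for s s'
  proof -
    have eq: "(\<lambda>y. (fd (real s * v) (real s * y) / real s) * (fd (real s' * v) (real s' * y) / real s')) = (\<lambda>y. 1 / (real s * real s') * (fd (real s * v) (real s * y + 0) * fd (real s' * v) (real s' * y + 0)))"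
      by (simp add: fun_eq_iff)
    show "(\<lambda>y. (fd (real s * v) (real s * y) / real s) * (fd (real s' * v) (real s' * y) / real s')) integrable_on {0..1}"
      unfolding eq by (intro integrable_on_mult_right fd_prod_integrable)
    show "integral {0..1} (\<lambda>y. (fd (real s * v) (real s * y) / real s) * (fd (real s' * v) (real s' * y) / real s')) =
       1 / (real s * real s') * integral {0..1} (\<lambda>y. fd (real s * v) (real s * y) * fd (real s' * v) (real s' * y))"
      unfolding eq integral_mult_right by simp
  qed
  have "integral {0..1} (\<lambda>y. (W N (y + v) - W N y)\<^sup>2) = integral {0..1} (\<lambda>y. \<Sum>s\<in>{1..N}. \<Sum>s'\<in>{1..N}. (fd (real s * v) (real s * y) / real s) * (fd (real s' * v) (real s' * y) / real s'))"
    unfolding d power2_eq_square sum_product by (rule refl)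
  also have "\<dots> = (\<Sum>s\<in>{1..N}. \<Sum>s'\<in>{1..N}. 1 / (real s * real s') * integral {0..1} (\<lambda>y. fd (real s * v) (real s * y) * fd (real s' * v) (real s' * y)))"
    unfolding e[symmetric] by (rule integral_double_sum[OF _ _ i]) simp_all
  also have "\<dots> \<le> (\<Sum>s\<in>{1..N}. \<Sum>s'\<in>{1..N}. real (gcd s s') / (real s * real s') * v)"
  proof (intro sum_mono)
    fix s s' assume s: "s \<in> {1..N}" "s' \<in> {1..N}"
    hence s0: "0 < s" "0 < s'" by auto
    have l: "real (gcd s s') * real (lcm s s') = real s * real s'" by (metis of_nat_mult prod_gcd_lcm_nat)
    have "integral {0..1} (\<lambda>y. fd (real s * v) (real s * y) * fd (real s' * v) (real s' * y)) \<le> (real (gcd s s'))\<^sup>2 / (real s * real s') * (real (lcm s s') * v)"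
      unfolding integral_fd_prod[OF s0] using v by (intro mult_left_mono integral_fd_square) auto
    also have "\<dots> = real (gcd s s') * (real (gcd s s') * real (lcm s s')) / (real s * real s') * v"
      by (simp add: power2_eq_square)
    also have "\<dots> = real (gcd s s') * v" unfolding l using s0 by simp
    finally have "1 / (real s * real s') * integral {0..1} (\<lambda>y. fd (real s * v) (real s * y) * fd (real s' * v) (real s' * y)) \<le> 1 / (real s * real s') * (real (gcd s s') * v)"
      using s0 by (intro mult_left_mono) auto
    thus "1 / (real s * real s') * integral {0..1} (\<lambda>y. fd (real s * v) (real s * y) * fd (real s' * v) (real s' * y)) \<le> real (gcd s s') / (real s * real s') * v" by simp
  qed
  also have "\<dots> = (\<Sum>s\<in>{1..N}. \<Sum>s'\<in>{1..N}. real (gcd s s') / (real s * real s')) * v"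
    by (simp only: sum_distrib_right)
  also have "\<dots> \<le> (1 + ln (real N + 1))^3 * v" using gcd_sum_le[OF N] v by (rule mult_right_mono)
  finally show ?thesis .
qed

text \<open>The moving average is written as an expectation, so that Jensen's inequality for squares
  follows from the nonnegativity of a variance.\<close>

definition unif :: "real \<Rightarrow> real measure" where
  "unif d = density lborel (\<lambda>x. ennreal (indicator {0..d} x / d))"

lemma sets_unif [measurable_cong, simp]: "sets (unif d) = sets borel" and space_unif [simp]: "space (unif d) = UNIV"
  unfolding unif_def by simp_all

lemma prob_space_unif: assumes "0 < d" shows "prob_space (unif d)"
proof
  have "emeasure (unif d) (space (unif d)) = (\<integral>\<^sup>+x. ennreal (1 / d) * indicator {0..d} x \<partial>lborel)"
    unfolding unif_def by (subst emeasure_density) (auto intro!: nn_integral_cong simp: indicator_def)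
  also have "\<dots> = 1" using assms by (subst nn_integral_cmult_indicator) (auto simp flip: ennreal_mult')
  finally show "emeasure (unif d) (space (unif d)) = 1" .
qed

lemma integral_unif:
  fixes f :: "real \<Rightarrow> real"
  assumes d: "0 < d" and f: "f \<in> borel_measurable borel" and B: "\<And>x. \<bar>f x\<bar> \<le> B"
  shows "(LINT x|unif d. f x) = 1 / d * integral {0..d} f" "integrable (unif d) f"
proof -
  interpret prob_space "unif d" by (rule prob_space_unif[OF d])
  have f': "f \<in> borel_measurable (unif d)" using f by measurable
  show i: "integrable (unif d) f" by (rule integrable_const_bound[where B=B]) (use B f' in auto)
  have "integrable lborel (\<lambda>x. (indicator {0..d} x / d) *\<^sub>R f x)"
    using i f d unfolding unif_def by (subst (asm) integrable_density) auto
  hence "integrable lborel (\<lambda>x. d * ((indicator {0..d} x / d) *\<^sub>R f x))" by (rule integrable_mult_right)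
  hence si: "set_integrable lborel {0..d} f" unfolding set_integrable_def using d by simp
  have "(LINT x|unif d. f x) = (LINT x|lborel. (indicator {0..d} x / d) *\<^sub>R f x)"
    unfolding unif_def using f d by (intro integral_density) auto
  also have "\<dots> = (LINT x|lborel. (1 / d) * (indicator {0..d} x *\<^sub>R f x))" by (simp add: mult_ac)
  also have "\<dots> = 1 / d * (LINT x:{0..d}|lborel. f x)" unfolding set_lebesgue_integral_def by (rule integral_mult_right_zero)
  also have "(LINT x:{0..d}|lborel. f x) = integral {0..d} f" by (rule set_borel_integral_eq_integral(2)[OF si])
  finally show "(LINT x|unif d. f x) = 1 / d * integral {0..d} f" .
qed

definition U :: "nat \<Rightarrow> real \<Rightarrow> real" where "U N y = (LINT v|unif (1 / real N). W N (y + v))"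
definition Z :: "nat \<Rightarrow> real \<Rightarrow> real" where "Z N y = W N y - U N y"

text \<open>\<open>DU\<close> is the derivative of \<open>U\<close>.\<close>

definition DU :: "nat \<Rightarrow> real \<Rightarrow> real" where "DU N y = real N * (W N (y + 1 / real N) - W N y)"

context
  fixes N :: nat assumes N: "1 \<le> N"
begin

private lemma d0: "0 < 1 / real N" using N by simp

lemma U_measurable [measurable]: "U N \<in> borel_measurable borel"
proof -
  interpret prob_space "unif (1 / real N)" by (rule prob_space_unif[OF d0])
  show ?thesis unfolding U_def[abs_def] by (rule borel_measurable_lebesgue_integral) measurable
qed

lemma Z_measurable [measurable]: "Z N \<in> borel_measurable borel"
  unfolding Z_def[abs_def] by measurable
lemma DU_measurable [measurable]: "DU N \<in> borel_measurable borel"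
  unfolding DU_def[abs_def] by measurable

lemma U_eq: "U N y = real N * integral {y..y + 1 / real N} (W N)"
proof -
  have "U N y = 1 / (1 / real N) * integral {0..1 / real N} (\<lambda>v. W N (y + v))"
    unfolding U_def by (rule integral_unif(1)[OF d0 _ W_bound]) measurable
  also have "integral {0..1 / real N} (\<lambda>v. W N (y + v)) = integral {y..y + 1 / real N} (W N)"
    using integral_shift_real_ivl[of y y "y + 1 / real N" "W N"] by (simp add: add.commute)
  finally show ?thesis by simp
qed

lemma U_bound: "\<bar>U N y\<bar> \<le> 1 + ln (real N + 1)"
proof -
  interpret prob_space "unif (1 / real N)" by (rule prob_space_unif[OF d0])
  have i: "integrable (unif (1 / real N)) (\<lambda>v. W N (y + v))" by (rule integral_unif(2)[OF d0 _ W_bound]) measurable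
  have "norm (U N y) \<le> (LINT v|unif (1 / real N). norm (W N (y + v)))" unfolding U_def by (rule integral_norm_bound)
  also have "\<dots> \<le> (LINT v|unif (1 / real N). 1 + ln (real N + 1))"
    using i W_bound by (intro integral_mono integrable_norm) auto
  finally show ?thesis using prob_space by simp
qed

lemma Z_bound: "\<bar>Z N y\<bar> \<le> 2 * (1 + ln (real N + 1))"
  unfolding Z_def mult_2 by (intro order_trans[OF abs_triangle_ineq4] add_mono W_bound U_bound)

lemma DU_bound: "\<bar>DU N y\<bar> \<le> real N * (2 * (1 + ln (real N + 1)))"
proof -
  have "\<bar>W N (y + 1 / real N) - W N y\<bar> \<le> 2 * (1 + ln (real N + 1))"
    unfolding mult_2 by (intro order_trans[OF abs_triangle_ineq4] add_mono W_bound)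
  thus ?thesis unfolding DU_def abs_mult by (intro mult_mono) auto
qed

lemma Z_periodic: "Z N (y + 1) = Z N y"
proof -
  have "W N (y + 1 + v) = W N (y + v)" for v using W_periodic[of N "y + v"] by (simp add: algebra_simps)
  thus ?thesis unfolding Z_def U_def W_periodic by simp
qed

lemma DU_periodic: "DU N (y + 1) = DU N y"
  using W_periodic[of N "y + 1 / real N"] W_periodic[of N y] unfolding DU_def by (simp add: algebra_simps)

lemma DU_square: "integral {0..1} (\<lambda>y. (DU N y)\<^sup>2) \<le> real N * (1 + ln (real N + 1))^3"
proof -
  have "integral {0..1} (\<lambda>y. (DU N y)\<^sup>2) = (real N)\<^sup>2 * integral {0..1} (\<lambda>y. (W N (y + 1 / real N) - W N y)\<^sup>2)"
    unfolding DU_def power_mult_distrib by (rule integral_mult_right)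
  also have "\<dots> \<le> (real N)\<^sup>2 * ((1 + ln (real N + 1))^3 * (1 / real N))"
    using N by (intro mult_left_mono W_increment) auto
  also have "\<dots> = real N * (1 + ln (real N + 1))^3" using N by (simp add: power2_eq_square)
  finally show ?thesis .
qed

text \<open>Z N y is the average of W N y - W N (y + v) over 0 <= v <= 1/N. The square goes inside
  the average, Fubini exchanges the integrals, and \<open>W_increment\<close> applies for each
  v.\<close>

lemma Z_square: "integral {0..1} (\<lambda>y. (Z N y)\<^sup>2) \<le> (1 + ln (real N + 1))^3 / real N"
proof -
  define L where "L = 1 + ln (real N + 1)"
  have L0: "0 \<le> L" unfolding L_def using N by simp
  define \<nu> where "\<nu> = unif (1 / real N)"
  define \<mu> where "\<mu> = unif 1"
  interpret \<nu>: prob_space \<nu> unfolding \<nu>_def by (rule prob_space_unif[OF d0])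
  interpret \<mu>: prob_space \<mu> unfolding \<mu>_def by (rule prob_space_unif) simp
  interpret p: pair_prob_space \<mu> \<nu> ..
  have [measurable_cong]: "sets \<mu> = sets borel" "sets \<nu> = sets borel" unfolding \<mu>_def \<nu>_def by simp_all
  define f where "f = (\<lambda>y v. W N y - W N (y + v))"
  have fm [measurable]: "(\<lambda>p. f (fst p) (snd p)) \<in> borel_measurable (borel \<Otimes>\<^sub>M borel)" unfolding f_def by measurable
  have fb: "\<bar>f y v\<bar> \<le> 2 * L" for y v
    unfolding f_def L_def mult_2 by (intro order_trans[OF abs_triangle_ineq4] add_mono W_bound)
  have fb2: "\<bar>(f y v)\<^sup>2\<bar> \<le> (2 * L)\<^sup>2" for y v using power_mono[OF fb[of y v], of 2] by simp
  have Zf: "Z N y = (LINT v|\<nu>. f y v)" for y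
  proof -
    have "integrable \<nu> (\<lambda>v. W N (y + v))" unfolding \<nu>_def by (rule integral_unif(2)[OF d0 _ W_bound]) measurable
    thus ?thesis unfolding f_def Z_def U_def \<nu>_def[symmetric] by (simp add: \<nu>.prob_space)
  qed
  have ip: "integrable (\<mu> \<Otimes>\<^sub>M \<nu>) (\<lambda>(y, v). (f y v)\<^sup>2)"
    by (rule p.integrable_const_bound[where B="(2 * L)\<^sup>2"]) (use fb2 in \<open>auto simp: case_prod_unfold\<close>)
  have Z2: "(Z N y)\<^sup>2 \<le> (LINT v|\<nu>. (f y v)\<^sup>2)" for y
  proof -
    have i1: "integrable \<nu> (\<lambda>v. f y v)" by (rule \<nu>.integrable_const_bound[where B="2*L"]) (use fb in \<open>auto simp: f_def\<close>)
    have i2: "integrable \<nu> (\<lambda>v. (f y v)\<^sup>2)" by (rule \<nu>.integrable_const_bound[where B="(2*L)\<^sup>2"]) (use fb2 in \<open>auto simp: f_def\<close>)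
    have "0 \<le> \<nu>.variance (\<lambda>v. f y v)" by (rule \<nu>.variance_positive)
    thus ?thesis using \<nu>.variance_eq[OF i1 i2] unfolding Zf by simp
  qed
  have "integral {0..1} (\<lambda>y. (Z N y)\<^sup>2) = (LINT y|\<mu>. (Z N y)\<^sup>2)"
  proof -
    have "\<bar>(Z N y)\<^sup>2\<bar> \<le> (2 * L)\<^sup>2" for y using power_mono[OF Z_bound[of y], of 2] unfolding L_def by simp
    thus ?thesis unfolding \<mu>_def by (subst integral_unif(1)) auto
  qed
  also have "\<dots> \<le> (LINT y|\<mu>. (LINT v|\<nu>. (f y v)\<^sup>2))"
  proof (rule integral_mono)
    have "\<bar>(Z N y)\<^sup>2\<bar> \<le> (2 * L)\<^sup>2" for y using power_mono[OF Z_bound[of y], of 2] unfolding L_def by simp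
    thus "integrable \<mu> (\<lambda>y. (Z N y)\<^sup>2)" by (intro \<mu>.integrable_const_bound[where B="(2 * L)\<^sup>2"]) auto
    show "integrable \<mu> (\<lambda>y. LINT v|\<nu>. (f y v)\<^sup>2)" using p.integrable_fst'[OF ip] by simp
  qed (rule Z2)
  also have "\<dots> = (LINT v|\<nu>. (LINT y|\<mu>. (f y v)\<^sup>2))"
    by (rule p.Fubini_integral[OF ip, symmetric])
  also have "\<dots> \<le> (LINT v|\<nu>. L^3 * (1 / real N))"
  proof (rule integral_mono_AE)
    show "integrable \<nu> (\<lambda>v. LINT y|\<mu>. (f y v)\<^sup>2)" using p.integrable_snd[OF ip] .
    have "AE v in \<nu>. v \<in> {0..1 / real N}"
      unfolding \<nu>_def unif_def by (subst AE_density) (auto simp: indicator_def)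
    moreover have "(LINT y|\<mu>. (f y v)\<^sup>2) \<le> L^3 * (1 / real N)" if v: "v \<in> {0..1 / real N}" for v
    proof -
      have "(LINT y|\<mu>. (f y v)\<^sup>2) = integral {0..1} (\<lambda>y. (W N (y + v) - W N y)\<^sup>2)"
        unfolding \<mu>_def using integral_unif(1)[of 1 "\<lambda>y. (f y v)\<^sup>2" "(2 * L)\<^sup>2"] fb2 by (simp add: f_def power2_commute)
      also have "\<dots> \<le> L^3 * v" unfolding L_def using v N by (intro W_increment) auto
      also have "\<dots> \<le> L^3 * (1 / real N)" using v L0 by (intro mult_left_mono) auto
      finally show ?thesis .
    qed
    ultimately show "AE v in \<nu>. (LINT y|\<mu>. (f y v)\<^sup>2) \<le> L^3 * (1 / real N)" by auto
  qed auto
  also have "\<dots> = L^3 / real N" by (simp add: \<nu>.prob_space)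
  finally show ?thesis unfolding L_def .
qed

lemma W_continuous:
  assumes "\<And>s. s \<in> {1..N} \<Longrightarrow> real s * y \<notin> \<int>"
  shows "isCont (W N) y"
proof -
  have "isCont (\<lambda>y. frac (real s * y)) y" if "s \<in> {1..N}" for s
    using continuous_frac[OF assms[OF that]]
    by (intro isCont_o2[where f="\<lambda>y. real s * y" and g=frac and a=y] continuous_intros)
  thus ?thesis unfolding W_def[abs_def] using N
    by (intro continuous_intros) auto
qed

text \<open>W N can jump only at fractions with denominator at most N. Hence U N is continuous, and
  differentiable off finitely many points, which is what the partial integration in
  \<open>blk_decomp\<close> requires.\<close>

lemma U_deriv:
  assumes a: "0 < a" "a \<le> b"
  shows "\<exists>S. finite S \<and> (\<forall>y\<in>{a..b} - S. (U N has_real_derivative DU N y) (at y))" "continuous_on {a..b} (U N)"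
proof -
  define P where "P = (\<lambda>u. integral {0..u} (W N))"
  have int: "W N integrable_on {u..v}" for u v
    using W_bound[of N] by (intro bounded_measurable_integrable_on) auto
  have UP: "U N y = real N * (P (y + 1 / real N) - P y)" if "0 \<le> y" for y
  proof -
    have "P y + integral {y..y + 1 / real N} (W N) = P (y + 1 / real N)"
      unfolding P_def using that int by (intro Henstock_Kurzweil_Integration.integral_combine) auto
    hence "integral {y..y + 1 / real N} (W N) = P (y + 1 / real N) - P y" by simp
    thus ?thesis unfolding U_eq by simp
  qed
  have cP: "continuous_on {0..b + 2} P" unfolding P_def by (rule indefinite_integral_continuous_1[OF int])
  have N1: "1 / real N \<le> 1" using N by simp
  have "continuous_on {a..b} (\<lambda>y. P (y + 1 / real N))"
  proof (rule continuous_on_compose2[OF cP])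
    show "(\<lambda>y. y + 1 / real N) ` {a..b} \<subseteq> {0..b + 2}"
    proof clarify
      fix y assume "y \<in> {a..b}"
      thus "y + 1 / real N \<in> {0..b + 2}" using a N1 d0 unfolding atLeastAtMost_iff by linarith
    qed
  qed (intro continuous_intros)
  moreover have "continuous_on {a..b} P" by (rule continuous_on_subset[OF cP]) (use a in auto)
  ultimately have "continuous_on {a..b} (\<lambda>y. real N * (P (y + 1 / real N) - P y))" by (intro continuous_intros)
  thus "continuous_on {a..b} (U N)" by (rule continuous_on_eq) (use UP a in auto)
  \<comment> \<open>Both ends of the averaging interval [y, y + 1/N] must avoid the jumps.\<close>
  define S where "S = (\<Union>s\<in>{1..N}. {y \<in> {a..b}. real s * y \<in> \<int>} \<union> {y \<in> {a..b}. real s * (y + 1 / real N) \<in> \<int>})"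
  have fin: "finite {y \<in> {a..b}. real s * (y + c) \<in> \<int>}" if "s \<in> {1..N}" for s c
  proof (rule finite_subset)
    show "{y \<in> {a..b}. real s * (y + c) \<in> \<int>} \<subseteq> (\<lambda>k. of_int k / real s - c) ` {\<lfloor>real s * (a + c)\<rfloor>..\<lceil>real s * (b + c)\<rceil>}"
    proof
      fix y assume y: "y \<in> {y \<in> {a..b}. real s * (y + c) \<in> \<int>}"
      then obtain k where k: "real s * (y + c) = of_int k" by (auto elim: Ints_cases)
      have "real s * (a + c) \<le> of_int k" "of_int k \<le> real s * (b + c)" unfolding k[symmetric] using y by (auto intro!: mult_left_mono)
      hence "k \<in> {\<lfloor>real s * (a + c)\<rfloor>..\<lceil>real s * (b + c)\<rceil>}" by (auto simp: floor_le_iff le_ceiling_iff)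
      moreover have "y = of_int k / real s - c" using k that by (simp add: field_simps)
      ultimately show "y \<in> (\<lambda>k. of_int k / real s - c) ` {\<lfloor>real s * (a + c)\<rfloor>..\<lceil>real s * (b + c)\<rceil>}" by blast
    qed
  qed simp
  have "finite S" unfolding S_def using fin[where c=0] fin by auto
  moreover have "(U N has_real_derivative DU N y) (at y)" if y: "y \<in> {a..b} - S" for y
  proof -
    have dP: "(P has_real_derivative W N z) (at z)" if z: "0 < z" "z < b + 2" "\<And>s. s \<in> {1..N} \<Longrightarrow> real s * z \<notin> \<int>" for z
    proof -
      have "isCont (W N) z" using z(3) by (rule W_continuous)
      hence c: "continuous (at z within ({0..b + 2} - {})) (W N)" by (rule continuous_at_imp_continuous_at_within)
      have "(P has_vector_derivative W N z) (at z within ({0..b + 2} - {}))"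
        unfolding P_def by (rule integral_has_vector_derivative_continuous_at[OF int _ _ c]) (use z in auto)
      thus ?thesis using z by (simp add: has_real_derivative_iff_has_vector_derivative at_within_Icc_at)
    qed
    have d1: "(P has_real_derivative W N y) (at y)" using y a unfolding S_def by (intro dP) auto
    have "(P has_real_derivative W N (y + 1 / real N)) (at (y + 1 / real N))"
    proof (rule dP)
      have "a \<le> y" "y \<le> b" using y by auto
      thus "0 < y + 1 / real N" "y + 1 / real N < b + 2" using a N1 d0 by linarith+
    qed (use y in \<open>auto simp: S_def\<close>)
    hence d2: "((\<lambda>y. P (y + 1 / real N)) has_real_derivative W N (y + 1 / real N)) (at y)" by (simp add: DERIV_shift)
    have "((\<lambda>y. real N * (P (y + 1 / real N) - P y)) has_real_derivative DU N y) (at y)"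
      unfolding DU_def by (intro DERIV_cmult DERIV_diff d1 d2)
    moreover have "eventually (\<lambda>y. U N y = real N * (P (y + 1 / real N) - P y)) (nhds y)"
      using y a by (intro eventually_nhds_in_open[THEN eventually_mono, of "{0<..}"]) (auto intro: UP)
    ultimately show ?thesis by (subst DERIV_cong_ev[OF refl _ refl])
  qed
  ultimately show "\<exists>S. finite S \<and> (\<forall>y\<in>{a..b} - S. (U N has_real_derivative DU N y) (at y))" by blast
qed

end

section \<open>Dyadic blocks of the off-diagonal sum\<close>

text \<open>For y = r/s the quotient \<open>alp G y / s\<close> is 1/sqrt (r (r + s)) times the
  Fourier transform of the normalized Gaussian weight at \<open>lam y\<close>.\<close>

definition alp :: "real \<Rightarrow> real \<Rightarrow> real" where
  "alp G y = exp (- (G * lam y)\<^sup>2 / 4) / sqrt (y * (y + 1))"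

definition alp' :: "real \<Rightarrow> real \<Rightarrow> real" where
  "alp' G y = alp G y * (G\<^sup>2 * lam y / (2 * (y * (y + 1))) - (2 * y + 1) / (2 * (y * (y + 1))))"

lemma lam_ge: assumes "0 < y" shows "1 / (y + 1) \<le> lam y"
proof -
  have "ln (y / (y + 1)) \<le> y / (y + 1) - 1" using assms by (intro ln_le_minus_one) auto
  also have "y / (y + 1) - 1 = - (1 / (y + 1))" using assms by (simp add: field_simps)
  finally have "1 / (y + 1) \<le> - ln (y / (y + 1))" by simp
  also have "\<dots> = ln ((y + 1) / y)" using assms by (simp add: ln_div)
  also have "(y + 1) / y = 1 + 1 / y" using assms by (simp add: field_simps)
  finally show ?thesis unfolding lam_def .
qed

lemma alp_deriv:
  assumes y: "0 < y" shows "(alp G has_real_derivative alp' G y) (at y)"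
proof -
  have yy: "0 < y * (y + 1)" using y by simp
  have "((\<lambda>y. exp (- (G * lam y)\<^sup>2 / 4)) has_real_derivative
      exp (- (G * lam y)\<^sup>2 / 4) * (G\<^sup>2 * lam y / (2 * (y * (y + 1))))) (at y)"
    by (rule derivative_eq_intros lam_deriv[OF y] refl | simp)+ (use yy in \<open>simp add: power2_eq_square divide_simps\<close>)
  moreover have "((\<lambda>y. sqrt (y * (y + 1))) has_real_derivative (2 * y + 1) / (2 * sqrt (y * (y + 1)))) (at y)"
  proof -
    have "((\<lambda>y. y * (y + 1)) has_real_derivative (2 * y + 1)) (at y)"
      by (auto intro!: derivative_eq_intros)
    from DERIV_chain2[OF DERIV_real_sqrt[OF yy] this]
    have "((\<lambda>y. sqrt (y * (y + 1))) has_real_derivative inverse (sqrt (y * (y + 1))) / 2 * (2 * y + 1)) (at y)" .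
    moreover have "inverse r / 2 * c = c / (2 * r)" for r c :: real by (cases "r = 0") (simp_all add: field_simps)
    ultimately show ?thesis by (simp only:)
  qed
  ultimately have "(alp G has_real_derivative
     (exp (- (G * lam y)\<^sup>2 / 4) * (G\<^sup>2 * lam y / (2 * (y * (y + 1)))) * sqrt (y * (y + 1)) -
       exp (- (G * lam y)\<^sup>2 / 4) * ((2 * y + 1) / (2 * sqrt (y * (y + 1))))) / (sqrt (y * (y + 1)) * sqrt (y * (y + 1)))) (at y)"
    unfolding alp_def[abs_def] using yy by (intro DERIV_divide) auto
  moreover have "(exp (- (G * lam y)\<^sup>2 / 4) * (G\<^sup>2 * lam y / (2 * (y * (y + 1)))) * sqrt (y * (y + 1)) -
       exp (- (G * lam y)\<^sup>2 / 4) * ((2 * y + 1) / (2 * sqrt (y * (y + 1))))) / (sqrt (y * (y + 1)) * sqrt (y * (y + 1))) = alp' G y"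
  proof -
    have gen: "(e * g * r - e * (h / (2 * r))) / (r * r) = e / r * (g - h / (2 * (r * r)))" if "r \<noteq> 0" for e g r h :: real
      using that by (simp add: field_simps)
    have rr: "sqrt (y * (y + 1)) * sqrt (y * (y + 1)) = y * (y + 1)" using yy by simp
    have "sqrt (y * (y + 1)) \<noteq> 0" using y by simp
    from gen[OF this, of "exp (- (G * lam y)\<^sup>2 / 4)" "G\<^sup>2 * lam y / (2 * (y * (y + 1)))" "2 * y + 1"]
    show ?thesis unfolding alp'_def alp_def by (simp only: rr)
  qed
  ultimately show ?thesis by simp
qed

lemma two_x_le_exp: "2 * x \<le> exp (x::real)"
proof (cases "0 \<le> x")
  case True
  have "1 + x + x\<^sup>2 / 2 \<le> exp x" using exp_lower_Taylor_quadratic[OF True] .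
  moreover have "0 \<le> (x - 1)\<^sup>2" by simp
  ultimately show ?thesis by (simp add: power2_eq_square algebra_simps)
next
  case False thus ?thesis by (smt (verit) exp_gt_zero)
qed

text \<open>The factor G^2 in the derivative is compensated by the Gaussian, since 2 x exp (- x) <=
  1 for x = (G lam y)^2/4. All bounds are thereby uniform in G.\<close>

lemma alp_bounds:
  assumes y: "1 \<le> y"
  shows "0 < alp G y" "alp G y \<le> 1 / y" "\<bar>alp' G y\<bar> \<le> 2 / y\<^sup>2"
proof -
  have y0: "0 < y" using y by simp
  have yy: "0 < y * (y + 1)" using y0 by simp
  show pos: "0 < alp G y" unfolding alp_def using yy by simp
  have "y = sqrt (y\<^sup>2)" using y0 by simp
  also have "\<dots> \<le> sqrt (y * (y + 1))" using y0 by (intro real_sqrt_le_mono) (simp add: power2_eq_square)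
  finally have sq: "y \<le> sqrt (y * (y + 1))" .
  show le: "alp G y \<le> 1 / y" unfolding alp_def using sq y0 by (intro frac_le) auto
  define x where "x = (G * lam y)\<^sup>2 / 4"
  have l0: "0 \<le> lam y" using lam_ge[OF y0] y0 by (smt (verit) divide_nonneg_nonneg)
  have e1: "alp G y * (2 * x) \<le> 1 / y"
  proof -
    have "2 * x * exp (- x) \<le> 1" using two_x_le_exp[of x] by (simp add: exp_minus field_simps)
    hence "(2 * x * exp (- x)) / sqrt (y * (y + 1)) \<le> 1 / y" using sq y0 by (intro frac_le) auto
    thus ?thesis unfolding alp_def x_def by (simp add: mult_ac)
  qed
  have "G\<^sup>2 * lam y / (2 * (y * (y + 1))) = G\<^sup>2 * lam y / (2 * y) * (1 / (y + 1))" by simp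
  also have "\<dots> \<le> G\<^sup>2 * lam y / (2 * y) * lam y" using lam_ge[OF y0] l0 y0 by (intro mult_left_mono) auto
  also have "\<dots> = 2 * x / y" unfolding x_def by (simp add: power2_eq_square)
  finally have g: "G\<^sup>2 * lam y / (2 * (y * (y + 1))) \<le> 2 * x / y" .
  have "alp G y * (G\<^sup>2 * lam y / (2 * (y * (y + 1)))) \<le> alp G y * (2 * x / y)" using g pos by (intro mult_left_mono) auto
  also have "\<dots> = alp G y * (2 * x) / y" by simp
  also have "\<dots> \<le> 1 / y / y" using e1 y0 by (intro divide_right_mono) auto
  finally have 1: "alp G y * (G\<^sup>2 * lam y / (2 * (y * (y + 1)))) \<le> 1 / y\<^sup>2" by (simp add: power2_eq_square)
  have "(2 * y + 1) / (2 * (y * (y + 1))) = (2 * y + 1) / (2 * (y + 1)) / y" by simp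
  also have "\<dots> \<le> 1 / y" using y0 by (intro divide_right_mono) (auto simp: divide_le_eq)
  finally have "(2 * y + 1) / (2 * (y * (y + 1))) \<le> 1 / y" .
  hence "alp G y * ((2 * y + 1) / (2 * (y * (y + 1)))) \<le> 1 / y * (1 / y)" using le pos y0 by (intro mult_mono) auto
  hence 2: "alp G y * ((2 * y + 1) / (2 * (y * (y + 1)))) \<le> 1 / y\<^sup>2" by (simp add: power2_eq_square)
  have "0 \<le> alp G y * (G\<^sup>2 * lam y / (2 * (y * (y + 1))))" "0 \<le> alp G y * ((2 * y + 1) / (2 * (y * (y + 1))))"
    using pos l0 y0 by auto
  thus "\<bar>alp' G y\<bar> \<le> 2 / y\<^sup>2" unfolding alp'_def right_diff_distrib using 1 2 by linarith
qed

text \<open>The amplitude of the part of \<open>Psi\<close> whose phase is differentiated, with \<open>2 * T\<close> in place of the factor \<open>t\<close> so that it does not depend on \<open>t\<close>; the quotient is at most 1.\<close>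

definition bet :: "real \<Rightarrow> real \<Rightarrow> real \<Rightarrow> real" where "bet T G y = 2 * T * (alp G y / (y * (y + 1)))"
definition bet' :: "real \<Rightarrow> real \<Rightarrow> real \<Rightarrow> real" where
  "bet' T G y = 2 * T * (alp' G y / (y * (y + 1)) - alp G y * (2 * y + 1) / (y * (y + 1))\<^sup>2)"

lemma amp_alp: assumes "1 \<le> Y" shows "amp Y (2 / Y) (alp G) (alp' G)"
proof
  fix y assume y: "y \<in> {Y..2*Y}"
  hence y1: "1 \<le> y" "0 < y" "Y \<le> y" using assms by auto
  show "(alp G has_real_derivative alp' G y) (at y)" using y1 by (intro alp_deriv)
  have "1 / y \<le> 2 / Y" using y1 assms by (intro frac_le) auto
  thus "\<bar>alp G y\<bar> \<le> 2 / Y" using alp_bounds[OF y1(1), of G] by linarith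
  have "2 / y\<^sup>2 \<le> 2 / Y\<^sup>2" using y1 assms by (intro divide_left_mono power_mono) auto
  thus "\<bar>alp' G y\<bar> \<le> 2 / Y / Y" using alp_bounds(3)[OF y1(1), of G] by (simp add: power2_eq_square)
qed fact

lemma amp_bet: assumes "1 \<le> Y" "0 \<le> T" shows "amp Y (8 * T / Y^3) (bet T G) (bet' T G)"
proof
  fix y assume y: "y \<in> {Y..2*Y}"
  hence y1: "1 \<le> y" "0 < y" "Y \<le> y" using assms by auto
  have yy: "0 < y * (y + 1)" using y1 by simp
  have d1: "((\<lambda>y. alp G y / (y * (y + 1))) has_real_derivative
     (alp' G y * (y * (y + 1)) - alp G y * (1 * (y + 1) + (1 + 0) * y)) / ((y * (y + 1)) * (y * (y + 1)))) (at y)"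
    by (intro DERIV_divide alp_deriv derivative_intros) (use yy y1 in auto)
  have gen: "(p * x - r * (1 * (y + 1) + (1 + 0) * y)) / (x * x) = p / x - r * (2 * y + 1) / x\<^sup>2" if "x \<noteq> 0" for p r x :: real
    using that by (simp add: diff_divide_distrib power2_eq_square)
  have "y * (y + 1) \<noteq> 0" using yy by linarith
  from DERIV_cong[OF d1 gen[OF this]] have "((\<lambda>y. alp G y / (y * (y + 1))) has_real_derivative
     (alp' G y / (y * (y + 1)) - alp G y * (2 * y + 1) / (y * (y + 1))\<^sup>2)) (at y)" .
  thus "(bet T G has_real_derivative bet' T G y) (at y)"
    unfolding bet_def[abs_def] bet'_def by (rule DERIV_cmult)
  have y2: "y\<^sup>2 \<le> y * (y + 1)" using y1 by (simp add: power2_eq_square)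
  have "alp G y / (y * (y + 1)) \<le> (1 / y) / y\<^sup>2" using alp_bounds[OF y1(1), of G] y1 y2 by (intro frac_le) auto
  also have "\<dots> = 1 / y^3" by (simp add: power2_eq_square power3_eq_cube)
  also have "\<dots> \<le> 1 / Y^3" using y1 assms by (intro frac_le power_mono) auto
  finally have "2 * T * (alp G y / (y * (y + 1))) \<le> 2 * T * (1 / Y^3)" using assms by (intro mult_left_mono) auto
  also have "\<dots> \<le> 8 * T / Y^3" using assms by (simp add: divide_right_mono)
  finally show "\<bar>bet T G y\<bar> \<le> 8 * T / Y^3" unfolding bet_def using alp_bounds(1)[OF y1(1), of G] yy assms by simp
  have "\<bar>alp' G y / (y * (y + 1))\<bar> \<le> (2 / y\<^sup>2) / y\<^sup>2"
    unfolding abs_divide using alp_bounds(3)[OF y1(1), of G] y1 y2 by (intro frac_le) auto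
  also have "\<dots> = 2 / y^4" by (simp flip: power_add)
  finally have 1: "\<bar>alp' G y / (y * (y + 1))\<bar> \<le> 2 / y^4" .
  have "alp G y * (2 * y + 1) / (y * (y + 1))\<^sup>2 = alp G y * ((2 * y + 1) / (y + 1)) / (y * (y * (y + 1)))"
    using y1 by (simp add: power2_eq_square)
  also have "\<dots> \<le> (1 / y) * 2 / (y * y\<^sup>2)"
    using alp_bounds[OF y1(1), of G] y1 y2 by (intro frac_le mult_mono) (auto simp: divide_le_eq)
  also have "\<dots> = 2 / y^4" by (simp add: power2_eq_square eval_nat_numeral)
  finally have 2: "alp G y * (2 * y + 1) / (y * (y + 1))\<^sup>2 \<le> 2 / y^4" .
  have 3: "0 \<le> alp G y * (2 * y + 1) / (y * (y + 1))\<^sup>2" using alp_bounds(1)[OF y1(1), of G] y1 by simp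
  have "\<bar>alp' G y / (y * (y + 1)) - alp G y * (2 * y + 1) / (y * (y + 1))\<^sup>2\<bar> \<le> 4 / y^4"
    using 1 2 3 by linarith
  also have "\<dots> \<le> 4 / Y^4" using y1 assms by (intro divide_left_mono power_mono) auto
  finally have "2 * T * \<bar>alp' G y / (y * (y + 1)) - alp G y * (2 * y + 1) / (y * (y + 1))\<^sup>2\<bar> \<le> 2 * T * (4 / Y^4)"
    using assms by (intro mult_left_mono) auto
  thus "\<bar>bet' T G y\<bar> \<le> 8 * T / Y^3 / Y" unfolding bet'_def abs_mult using assms by (simp add: eval_nat_numeral mult_ac)
qed fact

section \<open>Euler summation of a block\<close>

definition Psi :: "real \<Rightarrow> real \<Rightarrow> real \<Rightarrow> complex" where
  "Psi G t y = of_real (alp G y) * cis (t * lam y)"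
definition Psi' :: "real \<Rightarrow> real \<Rightarrow> real \<Rightarrow> complex" where
  "Psi' G t y = of_real (alp' G y) * cis (t * lam y) - \<i> * of_real (t * (alp G y / (y * (y + 1)))) * cis (t * lam y)"

lemma Psi_deriv:
  assumes y: "0 < y" shows "(Psi G t has_vector_derivative Psi' G t y) (at y within S)"
proof -
  have "((\<lambda>y. of_real (alp G y) * cis (t * lam y)) has_vector_derivative
       (of_real (alp G y) * (of_real (t * - (1 / (y * (y + 1)))) * (\<i> * cis (t * lam y))) + of_real (alp' G y) * cis (t * lam y))) (at y within S)"
    using DERIV_subset[OF alp_deriv[OF y, of G]] DERIV_cmult[OF lam_deriv[OF y, of S], of t]
    by (intro has_vector_derivative_mult has_vector_derivative_cis_comp has_vector_derivative_of_real)
       (auto simp: has_real_derivative_iff_has_vector_derivative)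
  moreover have "of_real (alp G y) * (of_real (t * - (1 / (y * (y + 1)))) * (\<i> * cis (t * lam y))) + of_real (alp' G y) * cis (t * lam y) = Psi' G t y"
    unfolding Psi'_def by simp
  ultimately show ?thesis unfolding Psi_def[abs_def] by simp
qed

text \<open>Euler summation with step 1/s: on the cell from n/s to (n + 1)/s the integrand is the
  derivative of Psi times (s y - n - 1)/s, a factor that is 0 at the right end and -1/s at the left
  end.\<close>

lemma unit_sum_integral:
  assumes s: "1 \<le> s" and mn: "1 \<le> m" "m \<le> n"
  shows "((\<lambda>y. Psi G t y + Psi' G t y * of_real ((frac (real s * y) - 1) / real s)) has_integral
    (\<Sum>r\<in>{m..<n}. Psi G t (real r / real s) / of_nat s)) {real m / real s..real n / real s}"
  using mn(2)
proof (induction n rule: dec_induct)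
  case base show ?case by (simp add: has_integral_refl)
next
  case (step n)
  define h where "h = (\<lambda>y. Psi G t y * of_real ((real s * y - real n - 1) / real s))"
  have s0: "real s > 0" using s by simp
  have d: "(h has_vector_derivative (Psi G t y * of_real 1 + Psi' G t y * of_real ((real s * y - real n - 1) / real s))) (at y within {real n / real s..real (Suc n) / real s})"
    if "y \<in> {real n / real s..real (Suc n) / real s}" for y
  proof -
    have "0 < real n / real s" using mn(1) step.hyps s0 by simp
    hence y0: "0 < y" using that by auto
    have "((\<lambda>y. (real s * y - real n - 1) / real s) has_real_derivative 1) (at y within {real n / real s..real (Suc n) / real s})"
      using s0 by (auto intro!: derivative_eq_intros)
    thus ?thesis unfolding h_def using Psi_deriv[OF y0]
      by (intro has_vector_derivative_mult has_vector_derivative_of_real) (auto simp: has_real_derivative_iff_has_vector_derivative)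
  qed
  have "((\<lambda>y. Psi G t y * of_real 1 + Psi' G t y * of_real ((real s * y - real n - 1) / real s)) has_integral h (real (Suc n) / real s) - h (real n / real s)) {real n / real s..real (Suc n) / real s}"
    using d s0 by (intro fundamental_theorem_of_calculus) (auto intro!: divide_right_mono)
  moreover have "h (real (Suc n) / real s) - h (real n / real s) = Psi G t (real n / real s) / of_nat s"
    unfolding h_def using s0 by simp
  ultimately have i: "((\<lambda>y. Psi G t y * of_real 1 + Psi' G t y * of_real ((real s * y - real n - 1) / real s)) has_integral Psi G t (real n / real s) / of_nat s) {real n / real s..real (Suc n) / real s}"
    by simp
  have i': "((\<lambda>y. Psi G t y + Psi' G t y * of_real ((frac (real s * y) - 1) / real s)) has_integral Psi G t (real n / real s) / of_nat s) {real n / real s..real (Suc n) / real s}"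
  proof (rule has_integral_spike_finite[OF _ _ i, of "{real (Suc n) / real s}"])
    fix y assume y: "y \<in> {real n / real s..real (Suc n) / real s} - {real (Suc n) / real s}"
    hence "real n \<le> real s * y" "real s * y < real (Suc n)" using s0 by (auto simp: field_simps)
    hence "\<lfloor>real s * y\<rfloor> = int n" by (intro floor_unique) auto
    hence "frac (real s * y) = real s * y - real n" unfolding frac_def by simp
    thus "Psi G t y + Psi' G t y * of_real ((frac (real s * y) - 1) / real s) = Psi G t y * of_real 1 + Psi' G t y * of_real ((real s * y - real n - 1) / real s)"
      by simp
  qed simp
  show ?case using has_integral_combine[OF _ _ step.IH i'] step.hyps s0 by (auto simp: divide_right_mono)
qed

definition blk :: "real \<Rightarrow> nat \<Rightarrow> nat \<Rightarrow> real \<Rightarrow> complex" where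
  "blk G Yn N t = (\<Sum>s\<in>{1..N}. \<Sum>r\<in>{s*Yn..<2*(s*Yn)}. Psi G t (real r / real s) / of_nat s)"

text \<open>Every s gives an integral over the same interval, because r/s rather than r is cut
  dyadically; this collapses the sum over s into the single function W.\<close>

lemma blk_integral:
  assumes Y: "1 \<le> Yn"
  shows "((\<lambda>y. of_nat N * Psi G t y + Psi' G t y * of_real (W N y)) has_integral blk G Yn N t) {real Yn..2 * real Yn}"
proof -
  have "((\<lambda>y. \<Sum>s\<in>{1..N}. Psi G t y + Psi' G t y * of_real ((frac (real s * y) - 1) / real s)) has_integral blk G Yn N t) {real Yn..2 * real Yn}"
    unfolding blk_def
  proof (intro has_integral_sum)
    fix s assume "s \<in> {1..N}"
    hence s: "1 \<le> s" by simp
    show "((\<lambda>y. Psi G t y + Psi' G t y * of_real ((frac (real s * y) - 1) / real s)) has_integral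
      (\<Sum>r\<in>{s*Yn..<2*(s*Yn)}. Psi G t (real r / real s) / of_nat s)) {real Yn..2 * real Yn}"
      using unit_sum_integral[OF s, of "s*Yn" "2*(s*Yn)" G t] s Y by simp
  qed simp
  moreover have "(\<Sum>s\<in>{1..N}. Psi G t y + Psi' G t y * of_real ((frac (real s * y) - 1) / real s)) = of_nat N * Psi G t y + Psi' G t y * of_real (W N y)" for y
    unfolding W_def by (simp add: sum.distrib sum_distrib_left)
  ultimately show ?thesis by simp
qed

text \<open>The integral of N * Psi is at most (2 T/Y^2)(70 Y/T) <= 140 by the first derivative
  test. In Psi' W, the part U is integrated by parts, which leaves boundary terms of at most 2 L and
  F for (\<open>alp\<close>, \<open>DU\<close>). Of the part Z, the term with \<open>alp'\<close> is
  at most 4 L trivially, and the term with the differentiated phase is F for (\<open>bet\<close>,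
  \<open>Z\<close>).\<close>

lemma blk_decomp:
  assumes T: "1 \<le> T" "T \<le> t" "t \<le> 2 * T" and Y: "1 \<le> Yn" and YT: "(real Yn)\<^sup>2 \<le> 2 * T"
    and N: "1 \<le> N" "real N \<le> 2 * T / (real Yn)\<^sup>2" and L: "1 + ln (real N + 1) \<le> L"
  shows "norm (blk G Yn N t) \<le> 140 + 6 * L + norm (halasz.F (real Yn) (bet T G) (Z N) t) + norm (halasz.F (real Yn) (alp G) (DU N) t)"
proof -
  define Y where "Y = real Yn"
  have Y1: "1 \<le> Y" unfolding Y_def using Y by simp
  have L1: "1 \<le> L" using L ln_ge_zero[of "real N + 1"] by linarith
  interpret a: amp Y "2 / Y" "alp G" "alp' G" using Y1 by (rule amp_alp)
  interpret b: amp Y "8 * T / Y^3" "bet T G" "bet' T G" using Y1 T by (intro amp_bet) auto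
  interpret F2: halasz Y "2 / Y" "alp G" "alp' G" Yn "DU N" "real N * (1 + ln (real N + 1))^3"
  proof
    show "0 < real N * (1 + ln (real N + 1))^3" using N by (auto intro!: mult_pos_pos zero_less_power add_pos_nonneg)
    show "\<exists>B. \<forall>y. \<bar>DU N y\<bar> \<le> B" using DU_bound[OF N(1)] by blast
  qed (use N DU_periodic DU_square DU_measurable Y_def in auto)
  interpret F1: halasz Y "8 * T / Y^3" "bet T G" "bet' T G" Yn "Z N" "(1 + ln (real N + 1))^3 / real N"
  proof
    show "0 < (1 + ln (real N + 1))^3 / real N" using N by (auto intro!: divide_pos_pos zero_less_power add_pos_nonneg)
    show "\<exists>B. \<forall>y. \<bar>Z N y\<bar> \<le> B" using Z_bound[OF N(1)] by blast
  qed (use N Z_periodic Z_square Z_measurable Y_def in auto)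
  have yI: "1 \<le> y" "0 < y" "Y \<le> y" if "y \<in> {Y..2*Y}" for y using that Y1 by auto
  have contPsi: "continuous_on {Y..2*Y} (Psi G t)"
    using Psi_deriv[where S=UNIV] yI by (meson continuous_at_imp_continuous_on has_vector_derivative_continuous)
  have I1: "norm (integral {Y..2*Y} (Psi G t)) \<le> 70 * Y / T"
  proof -
    have "norm (integral {Y..2*Y} (\<lambda>y. of_real (alp G y) * cis (t * lam y))) \<le> 35 * (2 / Y) * Y\<^sup>2 / T"
    proof (rule osc_first[where A'="alp' G" and \<psi>="\<lambda>_. - t" and \<psi>'="\<lambda>_. 0"])
      fix y assume y: "y \<in> {Y..2*Y}"
      show "\<bar>alp' G y\<bar> \<le> 2 * (2 / Y) / Y" using a.bb'[OF y] Y1 by (elim order_trans) (simp add: divide_right_mono)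
      show "((\<lambda>y. t * lam y) has_real_derivative - t / (y * (y + 1))) (at y)"
        using DERIV_cmult[OF lam_deriv[of y UNIV], of t] yI[OF y] by simp
    qed (use a.bd a.bb Y1 T in auto)
    also have "\<dots> = 70 * Y / T" using Y1 by (simp add: power2_eq_square)
    finally show ?thesis unfolding Psi_def[abs_def] .
  qed
  have i1: "((\<lambda>y. of_nat N * Psi G t y) has_integral of_nat N * integral {Y..2*Y} (Psi G t)) {Y..2*Y}"
    by (intro has_integral_mult_right integrable_integral integrable_continuous_interval contPsi)
  have i0: "((\<lambda>y. of_nat N * Psi G t y + Psi' G t y * of_real (W N y)) has_integral blk G Yn N t) {Y..2*Y}"
    unfolding Y_def by (rule blk_integral[OF Y])
  have i2: "((\<lambda>y. Psi' G t y * of_real (W N y)) has_integral blk G Yn N t - of_nat N * integral {Y..2*Y} (Psi G t)) {Y..2*Y}"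
    using has_integral_diff[OF i0 i1] by simp
  obtain S where S: "finite S" "\<And>y. y \<in> {Y..2*Y} - S \<Longrightarrow> (U N has_real_derivative DU N y) (at y)"
    using U_deriv(1)[OF N(1), of Y "2*Y"] Y1 by auto
  have contU: "continuous_on {Y..2*Y} (U N)" using U_deriv(2)[OF N(1), of Y "2*Y"] Y1 by auto
  have PU: "((\<lambda>y. Psi G t y * of_real (DU N y) + Psi' G t y * of_real (U N y)) has_integral
      Psi G t (2*Y) * of_real (U N (2*Y)) - Psi G t Y * of_real (U N Y)) {Y..2*Y}"
  proof (rule fundamental_theorem_of_calculus_interior_strong[OF S(1)])
    fix y assume y: "y \<in> {Y<..<2*Y} - S"
    hence "(U N has_real_derivative DU N y) (at y)" by (intro S(2)) auto
    thus "((\<lambda>y. Psi G t y * of_real (U N y)) has_vector_derivative (Psi G t y * of_real (DU N y) + Psi' G t y * of_real (U N y))) (at y)"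
      using y Y1 by (intro has_vector_derivative_mult has_vector_derivative_of_real Psi_deriv)
         (auto simp: has_real_derivative_iff_has_vector_derivative)
  qed (use Y1 contU contPsi in \<open>auto intro!: continuous_on_mult continuous_on_of_real\<close>)
  have F2i: "((\<lambda>y. of_real (alp G y * DU N y) * cis (t * lam y)) has_integral F2.F t) {Y..2*Y}"
    unfolding F2.F_def by (rule integrable_integral[OF F2.integrable_block[OF a.cont_beta]])
  have F1i: "((\<lambda>y. of_real (bet T G y * Z N y) * cis (t * lam y)) has_integral F1.F t) {Y..2*Y}"
    unfolding F1.F_def by (rule integrable_integral[OF F1.integrable_block[OF b.cont_beta]])
  define D where "D = Psi G t (2*Y) * of_real (U N (2*Y)) - Psi G t Y * of_real (U N Y)"
  \<comment> \<open>The combination is chosen so that only the trivially bounded term with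
    \<open>alp'\<close> survives in the integrand; the factor t/(2 T), at most 1, restores the t
    that \<open>bet\<close> omits.\<close>
  have tot: "((\<lambda>y. Psi' G t y * of_real (W N y) - (Psi G t y * of_real (DU N y) + Psi' G t y * of_real (U N y))
       + of_real (alp G y * DU N y) * cis (t * lam y) + \<i> * of_real (t / (2 * T)) * (of_real (bet T G y * Z N y) * cis (t * lam y)))
     has_integral (blk G Yn N t - of_nat N * integral {Y..2*Y} (Psi G t) - D + F2.F t + \<i> * of_real (t / (2 * T)) * F1.F t)) {Y..2*Y}"
    unfolding D_def by (intro has_integral_add has_integral_diff has_integral_mult_right i2 PU F2i F1i)
  have eq: "Psi' G t y * of_real (W N y) - (Psi G t y * of_real (DU N y) + Psi' G t y * of_real (U N y))
       + of_real (alp G y * DU N y) * cis (t * lam y) + \<i> * of_real (t / (2 * T)) * (of_real (bet T G y * Z N y) * cis (t * lam y))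
     = of_real (alp' G y * Z N y) * cis (t * lam y)" for y
  proof -
    have "t / (2 * T) * (bet T G y * Z N y) = t * (alp G y / (y * (y + 1))) * Z N y" unfolding bet_def using T by simp
    hence "\<i> * of_real (t / (2 * T)) * (of_real (bet T G y * Z N y) * cis (t * lam y)) = \<i> * of_real (t * (alp G y / (y * (y + 1))) * Z N y) * cis (t * lam y)"
      by (metis (no_types, lifting) mult.assoc of_real_mult)
    note b = this
    have w: "W N y = Z N y + U N y" unfolding Z_def by simp
    have alg: "(a' * c - \<i> * b * c) * (z + u) - (a * c * d + (a' * c - \<i> * b * c) * u) + a * d * c + \<i> * (b * z) * c = a' * z * c"
      for a a' b c d z u :: complex by (simp add: algebra_simps)
    show ?thesis
      unfolding b unfolding Psi_def Psi'_def w of_real_add of_real_mult[of _ "Z N y"] of_real_mult[of _ "DU N y"]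
      by (rule alg)
  qed
  have e0: "((\<lambda>y. of_real (alp' G y * Z N y) * cis (t * lam y)) has_integral (blk G Yn N t - of_nat N * integral {Y..2*Y} (Psi G t) - D + F2.F t + \<i> * of_real (t / (2 * T)) * F1.F t)) {Y..2*Y}"
    using tot unfolding eq .
  have "norm (blk G Yn N t - of_nat N * integral {Y..2*Y} (Psi G t) - D + F2.F t + \<i> * of_real (t / (2 * T)) * F1.F t) \<le> integral {Y..2*Y} (\<lambda>y. 4 * L / Y)"
    unfolding integral_unique[OF e0, symmetric]
  proof (rule integral_norm_bound_integral[OF has_integral_integrable[OF e0]])
    fix y assume y: "y \<in> {Y..2*Y}"
    have "2 * (1 + ln (real N + 1)) \<le> 2 * L" using L by (intro mult_left_mono) auto
    hence z: "\<bar>Z N y\<bar> \<le> 2 * L" by (rule order_trans[OF Z_bound[OF N(1)]])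
    have "\<bar>alp' G y\<bar> * \<bar>Z N y\<bar> \<le> (2 / Y / Y) * (2 * L)" using z a.bb'[OF y] Y1 by (intro mult_mono) auto
    also have "\<dots> = 4 * L / Y * (1 / Y)" by simp
    also have "\<dots> \<le> 4 * L / Y * 1" using Y1 L1 by (intro mult_left_mono) auto
    finally show "norm (of_real (alp' G y * Z N y) * cis (t * lam y)) \<le> 4 * L / Y" by (simp add: norm_mult abs_mult)
  qed (rule integrable_const_ivl)
  also have "\<dots> = 4 * L" using Y1 by simp
  finally have e1: "norm (blk G Yn N t - of_nat N * integral {Y..2*Y} (Psi G t) - D + F2.F t + \<i> * of_real (t / (2 * T)) * F1.F t) \<le> 4 * L" .
  have Db: "norm (Psi G t y * of_real (U N y)) \<le> L" if "y \<in> {Y..2*Y}" for y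
  proof -
    have y: "1 \<le> y" using yI[OF that] by simp
    have "1 / y \<le> 1" using y by simp
    hence "alp G y \<le> 1" "0 \<le> alp G y" using alp_bounds[OF y, of G] by linarith+
    moreover have "\<bar>U N y\<bar> \<le> L" by (rule order_trans[OF U_bound[OF N(1)] L])
    ultimately have "\<bar>alp G y\<bar> * \<bar>U N y\<bar> \<le> 1 * L" by (intro mult_mono) auto
    thus ?thesis unfolding Psi_def by (simp add: norm_mult)
  qed
  have D: "norm D \<le> L + L" unfolding D_def using Db[of Y] Db[of "2*Y"] Y1
    by (intro order_trans[OF norm_triangle_ineq4] add_mono) auto
  have NI: "norm (of_nat N * integral {Y..2*Y} (Psi G t)) \<le> 140"
  proof -
    have "norm (of_nat N * integral {Y..2*Y} (Psi G t)) \<le> (2 * T / Y\<^sup>2) * (70 * Y / T)"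
      unfolding norm_mult norm_of_nat using N(2) I1 T unfolding Y_def[symmetric] by (intro mult_mono) auto
    also have "\<dots> = 140 / Y" using T Y1 by (simp add: power2_eq_square)
    also have "\<dots> \<le> 140 / 1" using Y1 by (intro divide_left_mono) auto
    finally show ?thesis by simp
  qed
  have F1: "norm (\<i> * of_real (t / (2 * T)) * F1.F t) \<le> norm (F1.F t)"
  proof -
    have "\<bar>t / (2 * T)\<bar> \<le> 1" using T by auto
    thus ?thesis by (simp only: norm_mult norm_ii norm_of_real mult_1) (intro mult_left_le_one_le, auto)
  qed
  have tri: "norm x \<le> norm (x - n - d + f + g) + norm n + norm d + norm f + norm g" for x n d f g :: complex
  proof -
    have "x = (x - n - d + f + g) + n + d - f - g" by simp
    hence "norm x \<le> norm ((x - n - d + f + g) + n + d - f) + norm g" using norm_triangle_ineq4 by metis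
    moreover have "norm ((x - n - d + f + g) + n + d - f) \<le> norm ((x - n - d + f + g) + n + d) + norm f" by (rule norm_triangle_ineq4)
    moreover have "norm ((x - n - d + f + g) + n + d) \<le> norm ((x - n - d + f + g) + n) + norm d" by (rule norm_triangle_ineq)
    moreover have "norm ((x - n - d + f + g) + n) \<le> norm (x - n - d + f + g) + norm n" by (rule norm_triangle_ineq)
    ultimately show ?thesis by linarith
  qed
  show ?thesis
    using tri[of "blk G Yn N t" "of_nat N * integral {Y..2*Y} (Psi G t)" D "F2.F t" "\<i> * of_real (t / (2 * T)) * F1.F t"] e1 D NI F1
    unfolding Y_def[symmetric] by linarith
qed

text \<open>With N between T/Y^2 and 2 T/Y^2 the products b^2 q are at most (8 T/Y^3)^2 L^3 Y^2/T =
  64 L^3 T/Y^4 and (2/Y)^2 (2 T/Y^2) L^3 = 8 L^3 T/Y^4, so H = 64 L^3 fits both.\<close>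

lemma halasz_T_pair:
  assumes T: "1 \<le> T" and Y: "1 \<le> Yn" and YT: "(real Yn)\<^sup>2 \<le> 2 * T"
    and N: "N = nat \<lfloor>2 * T / (real Yn)\<^sup>2\<rfloor>" and L: "L = 1 + ln (2 * T + 2)"
  shows "1 \<le> N" "real N \<le> 2 * T / (real Yn)\<^sup>2" "1 + ln (real N + 1) \<le> L"
    "halasz_T (real Yn) (8 * T / (real Yn)^3) (bet T G) (bet' T G) Yn (Z N) ((1 + ln (real N + 1))^3 / real N) T (64 * L^3) L (6912 * (64 * L^3) * L)"
    "halasz_T (real Yn) (2 / real Yn) (alp G) (alp' G) Yn (DU N) (real N * (1 + ln (real N + 1))^3) T (64 * L^3) L (6912 * (64 * L^3) * L)"
proof -
  define Y where "Y = real Yn"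
  have Y1: "1 \<le> Y" unfolding Y_def using Y by simp
  have x1: "1 \<le> 2 * T / Y\<^sup>2" using YT Y1 T unfolding Y_def by (simp add: divide_simps)
  show N1: "1 \<le> N" unfolding N Y_def[symmetric] using le_nat_floor[of 1 "2 * T / Y\<^sup>2"] x1 by simp
  show N2: "real N \<le> 2 * T / (real Yn)\<^sup>2" unfolding N using T by (intro of_nat_floor) auto
  \<comment> \<open>Y^2 <= 2 T makes 2 T/Y^2 at least 1, and rounding down then loses at most a
    factor 2.\<close>
  have N3: "T / Y\<^sup>2 \<le> real N"
  proof -
    have "2 * T / Y\<^sup>2 - 1 \<le> real N" unfolding N Y_def[symmetric] using x1 by linarith
    moreover have "1 \<le> real N" using N1 by simp
    moreover have "2 * T / Y\<^sup>2 = T / Y\<^sup>2 + T / Y\<^sup>2" by simp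
    ultimately show ?thesis by linarith
  qed
  have "2 * T / Y\<^sup>2 \<le> 2 * T / 1" using T Y1 by (intro divide_left_mono) auto
  hence N4: "real N \<le> 2 * T" using N2 unfolding Y_def by simp
  have l: "ln (real N + 1) \<le> ln (2 * T + 2)" using N4 T by (intro ln_mono) auto
  thus N5: "1 + ln (real N + 1) \<le> L" unfolding L by simp
  have l0: "0 \<le> ln (real N + 1)" by simp
  have L1: "1 \<le> L" using N5 l0 by linarith
  have L3: "(1 + ln (real N + 1))^3 \<le> L^3" using N5 l0 by (intro power_mono) auto
  have L3': "0 < (1 + ln (real N + 1))^3" using l0 by (intro zero_less_power) linarith
  have "Y * 1 \<le> Y * Y" using Y1 by (intro mult_left_mono) auto
  hence "Y \<le> 2 * T + 2" using YT unfolding Y_def[symmetric] power2_eq_square by linarith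
  hence LY: "1 + ln Y \<le> L" unfolding L using Y1 by simp
  have LT: "1 + ln (T + 2) \<le> L" unfolding L using T by simp
  have H1: "1 \<le> 64 * L^3" using one_le_power[OF L1, of 3] by linarith
  have a: "amp Y (2 / Y) (alp G) (alp' G)" using Y1 by (rule amp_alp)
  have b: "amp Y (8 * T / Y^3) (bet T G) (bet' T G)" using Y1 T by (intro amp_bet) auto
  have q2: "0 < real N * (1 + ln (real N + 1))^3" using N1 L3' by simp
  have q1: "0 < (1 + ln (real N + 1))^3 / real N" using N1 L3' by simp
  have B2: "\<exists>B. \<forall>y. \<bar>DU N y\<bar> \<le> B" using DU_bound[OF N1] by blast
  have B1: "\<exists>B. \<forall>y. \<bar>Z N y\<bar> \<le> B" using Z_bound[OF N1] by blast
  have bq2: "(2 / Y)\<^sup>2 * (real N * (1 + ln (real N + 1))^3) \<le> 64 * L^3 * T / Y^4"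
  proof -
    have "(2 / Y)\<^sup>2 * (real N * (1 + ln (real N + 1))^3) \<le> (2 / Y)\<^sup>2 * (2 * T / Y\<^sup>2 * L^3)"
      using N2 L3 L3' T unfolding Y_def[symmetric] by (intro mult_left_mono mult_mono) auto
    also have "\<dots> = 8 * L^3 * T / Y^4" by (simp add: power_divide eval_nat_numeral mult_ac)
    also have "\<dots> \<le> 64 * L^3 * T / Y^4" using L1 T Y1 by (intro divide_right_mono mult_right_mono) auto
    finally show ?thesis .
  qed
  have bq1: "(8 * T / Y^3)\<^sup>2 * ((1 + ln (real N + 1))^3 / real N) \<le> 64 * L^3 * T / Y^4"
  proof -
    have "(1 + ln (real N + 1))^3 / real N \<le> L^3 / (T / Y\<^sup>2)"
      using L3 L3' L1 N3 T Y1 by (intro frac_le) auto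
    hence "(8 * T / Y^3)\<^sup>2 * ((1 + ln (real N + 1))^3 / real N) \<le> (8 * T / Y^3)\<^sup>2 * (L^3 / (T / Y\<^sup>2))"
      by (intro mult_left_mono) auto
    also have "\<dots> = 64 * L^3 * T / Y^4" using T Y1 by (simp add: field_simps eval_nat_numeral)
    finally show ?thesis .
  qed
  show "halasz_T (real Yn) (8 * T / (real Yn)^3) (bet T G) (bet' T G) Yn (Z N) ((1 + ln (real N + 1))^3 / real N) T (64 * L^3) L (6912 * (64 * L^3) * L)"
    unfolding Y_def[symmetric] halasz_T_def halasz_def halasz_axioms_def halasz_T_axioms_def
    using b Y_def Z_measurable[OF N1] Z_periodic[OF N1] B1 q1 Z_square[OF N1] T YT bq1 H1 L1 LY LT by simp
  show "halasz_T (real Yn) (2 / real Yn) (alp G) (alp' G) Yn (DU N) (real N * (1 + ln (real N + 1))^3) T (64 * L^3) L (6912 * (64 * L^3) * L)"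
    unfolding Y_def[symmetric] halasz_T_def halasz_def halasz_axioms_def halasz_T_axioms_def
    using a Y_def DU_measurable[OF N1] DU_periodic[OF N1] B2 q2 DU_square[OF N1] T YT bq2 H1 L1 LY LT by simp
qed

section \<open>Approximation of zeta on the critical line\<close>

definition pt :: "real \<Rightarrow> nat \<Rightarrow> complex" where
  "pt \<tau> k = of_real (1 / sqrt (real k)) * cis (- \<tau> * ln (real k))"

definition DP :: "nat \<Rightarrow> real \<Rightarrow> complex" where
  "DP n \<tau> = (\<Sum>k\<in>{1..n}. pt \<tau> k)"

lemma powr_half_line: "0 < x \<Longrightarrow> of_real x powr (- Complex (1/2) \<tau>) = of_real (1 / sqrt x) * cis (- \<tau> * ln x)"
proof -
  assume x: "0 < x"
  have "of_real x powr (- Complex (1/2) \<tau>) = exp (- Complex (1/2) \<tau> * of_real (ln x))"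
    using x by (simp add: powr_def Ln_of_real)
  also have "- Complex (1/2) \<tau> * of_real (ln x) = of_real (- (ln x / 2)) + \<i> * of_real (- \<tau> * ln x)"
    by (simp add: complex_eq_iff)
  also have "exp \<dots> = of_real (exp (- (ln x / 2))) * cis (- \<tau> * ln x)"
    unfolding exp_add cis_conv_exp exp_of_real ..
  also have "exp (- (ln x / 2)) = 1 / sqrt x"
    using x by (simp add: exp_minus inverse_eq_divide ln_sqrt[symmetric])
  finally show ?thesis .
qed

lemma pt_powr: "1 \<le> k \<Longrightarrow> pt \<tau> k = 1 / (of_nat k powr Complex (1/2) \<tau>)"
  using powr_half_line[of "real k" \<tau>] unfolding pt_def by (simp add: powr_minus inverse_eq_divide)

lemma norm_pt: "norm (pt \<tau> k) = 1 / sqrt (real k)"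
  unfolding pt_def by (simp add: norm_mult norm_divide)

lemma inverse_three_halves_telescope:
  assumes "1 \<le> k" shows "1 / (real k * sqrt (real k)) \<le> 6 * (1 / sqrt (real k) - 1 / sqrt (real (Suc k)))"
proof -
  define x where "x = sqrt (real k)"
  define y where "y = sqrt (real (Suc k))"
  have x0: "0 < x" unfolding x_def using assms by simp
  have xy: "x < y" unfolding x_def y_def by simp
  have x2: "x * x = real k" "y * y = real k + 1" unfolding x_def y_def by simp_all
  have "y * y \<le> (2 * x) * (2 * x)" using x2 assms by simp
  hence y2: "y \<le> 2 * x" using x0 by (intro power2_le_imp_le[of y "2 * x"]) (auto simp: power2_eq_square)
  have "(y - x) * (y + x) = 1" using x2 by (simp add: algebra_simps)
  hence d: "y - x = 1 / (y + x)" using x0 xy by (simp add: field_simps)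
  have "1 / x - 1 / y = (y - x) / (x * y)" using x0 xy by (simp add: field_simps)
  also have "\<dots> = 1 / ((y + x) * (x * y))" unfolding d by simp
  finally have e: "1 / x - 1 / y = 1 / ((y + x) * (x * y))" .
  have "(y + x) * (x * y) \<le> (3 * x) * (x * (2 * x))" using y2 x0 xy by (intro mult_mono) auto
  also have "\<dots> = 6 * (real k * x)" unfolding x2(1)[symmetric] by simp
  finally have "1 / (6 * (real k * x)) \<le> 1 / ((y + x) * (x * y))" using x0 xy by (intro divide_left_mono mult_pos_pos) (use assms in auto)
  hence "6 * (1 / (6 * (real k * x))) \<le> 6 * (1 / x - 1 / y)" unfolding e by (rule mult_left_mono) simp
  thus ?thesis unfolding x_def[symmetric] y_def[symmetric] by simp
qed

text \<open>An antiderivative of \<open>u powr (- s)\<close> for \<open>s = Complex (1/2) \<tau>\<close>.\<close>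

definition HH :: "real \<Rightarrow> real \<Rightarrow> complex" where
  "HH \<tau> u = of_real u powr (1 - Complex (1/2) \<tau>) / (1 - Complex (1/2) \<tau>)"

lemma one_minus_half_line: "norm (1 - Complex (1/2) \<tau>) \<ge> 1/2" "norm (1 - Complex (1/2) \<tau>) \<ge> \<bar>\<tau>\<bar>" "1 - Complex (1/2) \<tau> \<noteq> 0"
proof -
  show "norm (1 - Complex (1/2) \<tau>) \<ge> 1/2" using abs_Re_le_cmod[of "1 - Complex (1/2) \<tau>"] by simp
  show "norm (1 - Complex (1/2) \<tau>) \<ge> \<bar>\<tau>\<bar>" using abs_Im_le_cmod[of "1 - Complex (1/2) \<tau>"] by simp
  show "1 - Complex (1/2) \<tau> \<noteq> 0" by (simp add: complex_eq_iff)
qed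

lemma norm_HH: "0 < u \<Longrightarrow> norm (HH \<tau> u) = sqrt u / norm (1 - Complex (1/2) \<tau>)"
proof -
  assume u: "0 < u"
  have "norm (of_real u powr (1 - Complex (1/2) \<tau>)) = u powr (1/2)"
    using u by (simp add: norm_powr_real_powr)
  thus ?thesis unfolding HH_def using u by (simp add: norm_divide powr_half_sqrt)
qed

lemma vector_differentiable_bound:
  fixes f :: "real \<Rightarrow> 'b::real_normed_vector"
  assumes "convex S" "\<And>x. x \<in> S \<Longrightarrow> (f has_vector_derivative f' x) (at x within S)"
    "\<And>x. x \<in> S \<Longrightarrow> norm (f' x) \<le> B" "x \<in> S" "y \<in> S"
  shows "norm (f x - f y) \<le> B * norm (x - y)"
proof (rule differentiable_bound[OF assms(1) _ _ assms(4,5)])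
  fix x assume x: "x \<in> S"
  show "(f has_derivative (\<lambda>h. h *\<^sub>R f' x)) (at x within S)"
    using assms(2)[OF x] by (simp add: has_vector_derivative_def)
  show "onorm (\<lambda>h. h *\<^sub>R f' x) \<le> B"
    using assms(3)[OF x] by (intro onorm_le) (simp add: mult.commute[of B] mult_left_mono)
qed

lemma powr_half_line_deriv:
  fixes z :: complex
  assumes "0 < u"
  shows "((\<lambda>u. of_real u powr z) has_vector_derivative z * of_real u powr (z - 1)) (at u within S)"
proof -
  have "((\<lambda>w::complex. w powr z) has_field_derivative (z * of_real u powr (z - 1))) (at (of_real u))"
    using assms by (intro has_field_derivative_powr) auto
  from has_vector_derivative_real_field[OF this] show ?thesis by (rule has_vector_derivative_at_within)
qed

text \<open>The mean value inequality is applied twice: to u^(-s) on the cell, and to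
  \<open>HH\<close> minus a linear function, whose derivative has just been bounded.\<close>

lemma zeta_increment:
  assumes k: "1 \<le> k"
  shows "norm (pt \<tau> (Suc k) - (HH \<tau> (real (Suc k)) - HH \<tau> (real k))) \<le> norm (Complex (1/2) \<tau>) * (1 / (real k * sqrt (real k)))"
proof -
  define s where "s = Complex (1/2) \<tau>"
  define M where "M = norm s * (1 / (real k * sqrt (real k)))"
  have k0: "0 < real k" using k by simp
  have d1: "((\<lambda>u. of_real u powr (- s)) has_vector_derivative (- s) * of_real u powr (- s - 1)) (at u within {real k..real (Suc k)})"
    if "u \<in> {real k..real (Suc k)}" for u
    using powr_half_line_deriv[of u "- s"] that k0 by simp
  have b1: "norm (of_real v powr (- s) - of_real (real (Suc k)) powr (- s)) \<le> M" if v: "v \<in> {real k..real (Suc k)}" for v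
  proof -
    have "norm (of_real v powr (- s) - of_real (real (Suc k)) powr (- s)) \<le> M * norm (v - real (Suc k))"
    proof (rule vector_differentiable_bound[OF _ d1])
      fix u assume u: "u \<in> {real k..real (Suc k)}"
      have u0: "0 < u" "real k \<le> u" using u k0 by auto
      have "norm (of_real u powr (- s - 1) :: complex) = u powr (- 3/2)"
        using u0 unfolding s_def by (simp add: norm_powr_real_powr)
      also have "\<dots> \<le> real k powr (- 3/2)" using u0 k0 by (intro powr_mono2') auto
      also have "\<dots> = 1 / (real k * sqrt (real k))"
      proof -
        have "real k powr (- 3/2) = real k powr (- 1) * real k powr (- (1/2))" by (subst powr_add[symmetric]) simp
        thus ?thesis using k0 by (simp add: powr_minus powr_half_sqrt field_simps)
      qed
      finally have "norm s * norm (of_real u powr (- s - 1) :: complex) \<le> norm s * (1 / (real k * sqrt (real k)))"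
        by (intro mult_left_mono) auto
      thus "norm (- s * of_real u powr (- s - 1)) \<le> M" unfolding M_def norm_mult norm_minus_cancel .
    qed (use v k0 in auto)
    also have "\<dots> \<le> M * 1" using v unfolding M_def by (intro mult_left_mono) auto
    finally show ?thesis by simp
  qed
  define f where "f = (\<lambda>u. HH \<tau> u - of_real u * of_real (real (Suc k)) powr (- s))"
  have d2: "(f has_vector_derivative (of_real u powr (- s) - of_real (real (Suc k)) powr (- s))) (at u within {real k..real (Suc k)})"
    if "u \<in> {real k..real (Suc k)}" for u
  proof -
    have "((\<lambda>u. of_real u powr (1 - s)) has_vector_derivative (1 - s) * of_real u powr (1 - s - 1)) (at u within {real k..real (Suc k)})"
      using powr_half_line_deriv[of u "1 - s"] that k0 by simp
    from has_vector_derivative_mult_left[OF this, of "1 / (1 - s)"]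
    have "(HH \<tau> has_vector_derivative of_real u powr (- s)) (at u within {real k..real (Suc k)})"
      using one_minus_half_line(3)[of \<tau>] unfolding HH_def[abs_def] s_def[symmetric] by simp
    moreover have "((\<lambda>u. of_real u * of_real (real (Suc k)) powr (- s)) has_vector_derivative of_real 1 * of_real (real (Suc k)) powr (- s)) (at u within {real k..real (Suc k)})"
      by (intro has_vector_derivative_mult_left has_vector_derivative_of_real) simp
    ultimately show ?thesis unfolding f_def by (intro has_vector_derivative_diff) auto
  qed
  have "norm (f (real k) - f (real (Suc k))) \<le> M * norm (real k - real (Suc k))"
    by (rule vector_differentiable_bound[OF _ d2 b1]) auto
  also have "f (real k) - f (real (Suc k)) = pt \<tau> (Suc k) - (HH \<tau> (real (Suc k)) - HH \<tau> (real k))"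
  proof -
    define p where "p = of_real (real (Suc k)) powr (- s)"
    have "pt \<tau> (Suc k) = p" unfolding p_def s_def pt_def using powr_half_line[of "real (Suc k)" \<tau>] by simp
    thus ?thesis unfolding f_def p_def[symmetric] by (simp add: algebra_simps)
  qed
  finally show ?thesis unfolding M_def s_def by simp
qed

lemma DP_Suc: "DP (Suc n) \<tau> = DP n \<tau> + pt \<tau> (Suc n)"
  unfolding DP_def by simp

lemma DP_HH_cauchy:
  assumes "1 \<le> n" "n \<le> m"
  shows "norm ((DP m \<tau> - HH \<tau> (real m)) - (DP n \<tau> - HH \<tau> (real n))) \<le> norm (Complex (1/2) \<tau>) * (6 * (1 / sqrt (real n) - 1 / sqrt (real m)))"
  using assms(2)
proof (induction m rule: dec_induct)
  case (step m)
  have m1: "1 \<le> m" using step assms by simp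
  have "norm (pt \<tau> (Suc m) - (HH \<tau> (real (Suc m)) - HH \<tau> (real m))) \<le> norm (Complex (1/2) \<tau>) * (6 * (1 / sqrt (real m) - 1 / sqrt (real (Suc m))))"
    by (rule order_trans[OF zeta_increment[OF m1]]) (intro mult_left_mono inverse_three_halves_telescope m1, simp)
  from norm_triangle_mono[OF step.IH this]
  show ?case unfolding DP_Suc by (simp add: algebra_simps)
qed simp

text \<open>The value of zeta given by Euler summation of the divergent Dirichlet series, identified with the eta quotient in \<open>zeta_eq_cz\<close>.\<close>

definition cz :: "real \<Rightarrow> complex" where "cz \<tau> = lim (\<lambda>n. DP n \<tau> - HH \<tau> (real n))"

lemma cz_limit: "(\<lambda>n. DP n \<tau> - HH \<tau> (real n)) \<longlonglongrightarrow> cz \<tau>"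
proof -
  define E where "E = (\<lambda>n. DP n \<tau> - HH \<tau> (real n))"
  define C where "C = 6 * norm (Complex (1/2) \<tau>) + 1"
  have C0: "0 < C" unfolding C_def by (simp add: add_nonneg_pos)
  have bd: "norm (E m - E n) \<le> C / sqrt (real n)" if "1 \<le> n" "n \<le> m" for m n
  proof -
    have "norm (E m - E n) \<le> norm (Complex (1/2) \<tau>) * (6 * (1 / sqrt (real n) - 1 / sqrt (real m)))"
      unfolding E_def by (rule DP_HH_cauchy[OF that])
    also have "\<dots> \<le> norm (Complex (1/2) \<tau>) * (6 * (1 / sqrt (real n)))" by (intro mult_left_mono) auto
    also have "\<dots> = (6 * norm (Complex (1/2) \<tau>)) / sqrt (real n)" by simp
    also have "\<dots> \<le> C / sqrt (real n)" unfolding C_def by (intro divide_right_mono) auto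
    finally show ?thesis .
  qed
  have "Cauchy E"
  proof (rule CauchyI')
    fix e :: real assume e: "0 < e"
    obtain M :: nat where M: "(C / e)\<^sup>2 < real M" using reals_Archimedean2 by blast
    show "\<exists>M. \<forall>m\<ge>M. \<forall>n>m. dist (E m) (E n) < e"
    proof (intro exI[of _ "Suc M"] allI impI)
      fix m n assume mn: "m \<ge> Suc M" "n > m"
      have "(C / e)\<^sup>2 < real m" using M mn by simp
      hence "sqrt ((C / e)\<^sup>2) < sqrt (real m)" by (rule real_sqrt_less_mono)
      hence "C / e < sqrt (real m)" using C0 e by simp
      hence "C / sqrt (real m) < e" using e mn by (simp add: field_simps)
      thus "dist (E m) (E n) < e" using bd[of m n] mn by (simp add: dist_norm norm_minus_commute)
    qed
  qed
  hence "convergent E" by (rule Cauchy_convergent)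
  thus ?thesis unfolding cz_def E_def by (simp add: convergent_LIMSEQ_iff)
qed

text \<open>The limit of \<open>DP_HH_cauchy\<close> for m to infinity gives the second term; the
  first is the size of \<open>HH\<close> itself.\<close>

lemma cz_approx:
  assumes n: "1 \<le> n"
  shows "norm (cz \<tau> - DP n \<tau>) \<le> sqrt (real n) / norm (1 - Complex (1/2) \<tau>) + 6 * norm (Complex (1/2) \<tau>) / sqrt (real n)"
proof -
  have "(\<lambda>m. norm ((DP m \<tau> - HH \<tau> (real m)) - (DP n \<tau> - HH \<tau> (real n)))) \<longlonglongrightarrow> norm (cz \<tau> - (DP n \<tau> - HH \<tau> (real n)))"
    by (intro tendsto_intros cz_limit)
  moreover have "eventually (\<lambda>m. norm ((DP m \<tau> - HH \<tau> (real m)) - (DP n \<tau> - HH \<tau> (real n))) \<le> 6 * norm (Complex (1/2) \<tau>) / sqrt (real n)) sequentially"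
    using eventually_ge_at_top[of n]
  proof eventually_elim
    case (elim m)
    have "norm ((DP m \<tau> - HH \<tau> (real m)) - (DP n \<tau> - HH \<tau> (real n))) \<le> norm (Complex (1/2) \<tau>) * (6 * (1 / sqrt (real n) - 1 / sqrt (real m)))"
      by (rule DP_HH_cauchy[OF n elim])
    also have "\<dots> \<le> norm (Complex (1/2) \<tau>) * (6 * (1 / sqrt (real n)))" by (intro mult_left_mono) auto
    also have "\<dots> = 6 * norm (Complex (1/2) \<tau>) / sqrt (real n)" by simp
    finally show ?case .
  qed
  ultimately have 1: "norm (cz \<tau> - (DP n \<tau> - HH \<tau> (real n))) \<le> 6 * norm (Complex (1/2) \<tau>) / sqrt (real n)"
    by (intro tendsto_upperbound) auto
  have "norm (cz \<tau> - DP n \<tau>) \<le> norm (cz \<tau> - (DP n \<tau> - HH \<tau> (real n))) + norm (HH \<tau> (real n))"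
    using norm_triangle_ineq4[of "cz \<tau> - (DP n \<tau> - HH \<tau> (real n))" "HH \<tau> (real n)"] by (simp add: algebra_simps)
  thus ?thesis using 1 norm_HH[of "real n" \<tau>] n by simp
qed

text \<open>Subtracting twice the terms of even index from all terms produces the alternating signs,
  and the even terms up to 2 n are 2^(-s) times the terms up to n.\<close>

lemma eta_partial:
  "(\<Sum>k<2*n. (-1) ^ k / (of_nat (Suc k)) powr Complex (1/2) \<tau>) = DP (2*n) \<tau> - 2 powr (1 - Complex (1/2) \<tau>) * DP n \<tau>"
proof (induction n)
  case 0 show ?case by (simp add: DP_def)
next
  case (Suc n)
  define s where "s = Complex (1/2) \<tau>"
  have "2 powr (1 - s) * pt \<tau> (Suc n) = 2 * (1 / (of_nat (2 * Suc n) powr s))"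
  proof -
    have "(of_nat (2 * Suc n) :: complex) = of_real 2 * of_real (real (Suc n))" by simp
    also have "\<dots> powr s = of_real 2 powr s * of_real (real (Suc n)) powr s"
      by (rule powr_times_real) auto
    finally have "(of_nat (2 * Suc n) :: complex) powr s = 2 powr s * of_nat (Suc n) powr s" by simp
    moreover have "(2::complex) powr (1 - s) = 2 / 2 powr s" by (simp add: powr_diff)
    ultimately show ?thesis unfolding pt_powr[of "Suc n", simplified, folded s_def] using pt_powr[of "Suc n" \<tau>] by (simp add: s_def)
  qed
  moreover have "pt \<tau> (2 * Suc n) = 1 / (of_nat (2 * Suc n) powr s)" "pt \<tau> (Suc (2*n)) = 1 / (of_nat (Suc (2*n)) powr s)"
    unfolding s_def by (intro pt_powr; simp)+
  moreover have "DP (2 * Suc n) \<tau> = DP (2 * n) \<tau> + pt \<tau> (Suc (2*n)) + pt \<tau> (2 * Suc n)" by (simp add: DP_Suc)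
  moreover have "(\<Sum>k<2 * Suc n. (-1) ^ k / (of_nat (Suc k)) powr s) = (\<Sum>k<2*n. (-1) ^ k / (of_nat (Suc k)) powr s) + 1 / of_nat (Suc (2*n)) powr s - 1 / (of_nat (2 * Suc n) powr s)"
    by simp
  ultimately show ?case using Suc.IH unfolding s_def[symmetric] DP_Suc[of n] distrib_left by (simp only:) (simp add: algebra_simps)
qed

text \<open>The power has absolute value sqrt 2.\<close>

lemma two_powr_ne_one: "1 - 2 powr (1 - Complex (1/2) \<tau>) \<noteq> 0"
proof
  assume "1 - 2 powr (1 - Complex (1/2) \<tau>) = 0"
  hence "norm (2 powr (1 - Complex (1/2) \<tau>)) = norm (1::complex)" by simp
  moreover have "norm (of_real 2 powr (1 - Complex (1/2) \<tau>)) = 2 powr (1/2)" by (subst norm_powr_real_powr) auto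
  ultimately have "(2::real) powr (1/2) = 1" by simp
  thus False using powr_half_sqrt[of 2] by simp
qed

text \<open>HH at 2 n is 2^(1 - s) times HH at n, so the divergent parts cancel in
  \<open>eta_partial\<close> and the even partial sums converge; the odd ones follow because the
  terms tend to 0.\<close>

lemma zeta_eq_cz: "zeta (Complex (1/2) \<tau>) = cz \<tau>"
proof -
  define s where "s = Complex (1/2) \<tau>"
  define a where "a = (\<lambda>k. (-1) ^ k / (of_nat (Suc k)) powr s :: complex)"
  define l where "l = (1 - 2 powr (1 - s)) * cz \<tau>"
  have E: "(\<lambda>n. DP n \<tau> - HH \<tau> (real n)) \<longlonglongrightarrow> cz \<tau>" by (rule cz_limit)
  have ev: "(\<lambda>n. \<Sum>k<2*n. a k) \<longlonglongrightarrow> l"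
  proof -
    have sub: "filterlim (\<lambda>n::nat. 2 * n) sequentially sequentially"
      by (rule filterlim_subseq) (auto simp: strict_mono_def)
    have "(\<lambda>n. (DP (2*n) \<tau> - HH \<tau> (real (2*n))) - 2 powr (1 - s) * (DP n \<tau> - HH \<tau> (real n))) \<longlonglongrightarrow> cz \<tau> - 2 powr (1 - s) * cz \<tau>"
      by (intro tendsto_intros E filterlim_compose[OF E sub])
    moreover have "(\<lambda>n. (DP (2*n) \<tau> - HH \<tau> (real (2*n))) - 2 powr (1 - s) * (DP n \<tau> - HH \<tau> (real n))) = (\<lambda>n. \<Sum>k<2*n. a k)"
    proof
      fix n
      have "of_real (real (2 * n)) powr (1 - s) = 2 powr (1 - s) * of_real (real n) powr (1 - s)"
        using powr_times_real[of 2 "of_nat n" "1 - s"] by simp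
      hence "HH \<tau> (real (2*n)) = 2 powr (1 - s) * HH \<tau> (real n)" unfolding HH_def s_def by simp
      thus "(DP (2*n) \<tau> - HH \<tau> (real (2*n))) - 2 powr (1 - s) * (DP n \<tau> - HH \<tau> (real n)) = (\<Sum>k<2*n. a k)"
        using eta_partial[of \<tau> n, folded s_def] unfolding a_def by (simp add: algebra_simps)
    qed
    ultimately show ?thesis unfolding l_def by (simp add: algebra_simps)
  qed
  have a0: "a \<longlonglongrightarrow> 0"
  proof (rule Lim_null_comparison)
    show "eventually (\<lambda>k. norm (a k) \<le> 1 / sqrt (real (Suc k))) sequentially"
      using pt_powr[of "Suc _" \<tau>] norm_pt[of \<tau> "Suc _"] unfolding a_def s_def
      by (intro always_eventually allI) (simp add: norm_divide norm_mult norm_power)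
    show "(\<lambda>k. 1 / sqrt (real (Suc k))) \<longlonglongrightarrow> 0"
      by (rule tendsto_divide_0[OF tendsto_const]) (intro filterlim_at_top_imp_at_infinity filterlim_compose[OF sqrt_at_top] filterlim_compose[OF filterlim_real_sequentially filterlim_Suc])
  qed
  have "a sums l"
    unfolding sums_def
  proof (rule LIMSEQ_I)
    fix e :: real assume e: "0 < e"
    obtain N1 where N1: "\<And>n. n \<ge> N1 \<Longrightarrow> norm ((\<Sum>k<2*n. a k) - l) < e / 2" using LIMSEQ_D[OF ev, of "e/2"] e by auto
    obtain N2 where N2: "\<And>n. n \<ge> N2 \<Longrightarrow> norm (a n) < e / 2" using LIMSEQ_D[OF a0, of "e/2"] e by auto
    show "\<exists>no. \<forall>n\<ge>no. norm ((\<Sum>k<n. a k) - l) < e"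
    proof (intro exI[of _ "2 * (N1 + N2) + 1"] allI impI)
      fix n assume n: "n \<ge> 2 * (N1 + N2) + 1"
      define m where "m = n div 2"
      have m: "m \<ge> N1" "2 * m \<ge> N2" "n = 2 * m \<or> n = Suc (2 * m)" using n unfolding m_def by auto
      from m(3) show "norm ((\<Sum>k<n. a k) - l) < e"
      proof
        assume "n = 2 * m" thus ?thesis using N1[OF m(1)] e by simp
      next
        assume nn: "n = Suc (2 * m)"
        have "(\<Sum>k<n. a k) - l = ((\<Sum>k<2*m. a k) - l) + a (2*m)" unfolding nn by simp
        hence "norm ((\<Sum>k<n. a k) - l) \<le> norm ((\<Sum>k<2*m. a k) - l) + norm (a (2*m))" by (metis norm_triangle_ineq)
        thus ?thesis using N1[OF m(1)] N2[OF m(2)] by linarith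
      qed
    qed
  qed
  hence "dirichlet_eta s = l" unfolding dirichlet_eta_def a_def by (simp add: sums_iff)
  thus ?thesis unfolding zeta_def l_def s_def using two_powr_ne_one[of \<tau>] by simp
qed

section \<open>Shortening the Dirichlet polynomial\<close>

lemma log_step:
  assumes "1 \<le> k"
  shows "1 / (2 * real k) \<le> ln (real (Suc k)) - ln (real k)" "ln (real (Suc k)) - ln (real k) \<le> 1 / real k"
proof -
  have e: "ln (real (Suc k)) - ln (real k) = ln (1 + 1 / real k)"
  proof -
    have "ln (real (Suc k)) - ln (real k) = ln (real (Suc k) / real k)" using assms by (simp add: ln_div del: of_nat_Suc)
    also have "real (Suc k) / real k = 1 + 1 / real k" using assms by (simp add: field_simps)
    finally show ?thesis .
  qed
  show "ln (real (Suc k)) - ln (real k) \<le> 1 / real k" unfolding e by (rule ln_add_one_self_le_self) simp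
  have "ln (real k / real (Suc k)) \<le> real k / real (Suc k) - 1" using assms by (intro ln_le_minus_one) auto
  also have "\<dots> = - (1 / real (Suc k))" using assms by (simp add: field_simps)
  finally have "1 / real (Suc k) \<le> ln (real (Suc k)) - ln (real k)" using assms by (simp add: ln_div)
  moreover have "1 / (2 * real k) \<le> 1 / real (Suc k)" using assms by (intro divide_left_mono) auto
  ultimately show "1 / (2 * real k) \<le> ln (real (Suc k)) - ln (real k)" by linarith
qed

lemma log_step_antimono:
  assumes "1 \<le> k" shows "ln (real (Suc (Suc k))) - ln (real (Suc k)) \<le> ln (real (Suc k)) - ln (real k)"
proof -
  have "ln (real (Suc (Suc k)) * real k) \<le> ln (real (Suc k) * real (Suc k))"
  proof (rule ln_le_cancel_iff[THEN iffD2])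
    show "0 < real (Suc (Suc k)) * real k" "0 < real (Suc k) * real (Suc k)" using assms by simp_all
    show "real (Suc (Suc k)) * real k \<le> real (Suc k) * real (Suc k)" by (simp add: algebra_simps)
  qed
  thus ?thesis using assms by (simp add: ln_mult del: of_nat_Suc)
qed

text \<open>Beyond t the phase t ln k advances by at most 1 per step, so Kuzmin-Landau bounds the
  unweighted sums up to v by 16 v/t; partial summation inserts the weights k^(-1/2).\<close>

lemma zeta_sum_short:
  assumes t: "1 \<le> t" and n: "t \<le> real n" "1 \<le> n" "n \<le> m"
  shows "norm (DP m t - DP n t) \<le> 64 * sqrt (real m) / t"
proof -
  define P where "P = (\<lambda>v. \<Sum>k\<in>{Suc n..<v}. cis (t * ln (real k)))"
  have P: "norm (P v) \<le> 16 * real v / t" for v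
  proof (cases "Suc n < v")
    case False thus ?thesis using t unfolding P_def by simp
  next
    case True
    have "norm (P v) \<le> 8 / (t / (2 * real v))"
      unfolding P_def
    proof (rule Kuzmin_Landau)
      show "0 < t / (2 * real v)" using t True by simp
      fix k assume k: "Suc n \<le> k" "k < v"
      have e: "t * ln (real (Suc k)) - t * ln (real k) = t * (ln (real (Suc k)) - ln (real k))" by (simp add: algebra_simps)
      have "t * (1 / (2 * real v)) \<le> t * (1 / (2 * real k))" using k t by (intro mult_left_mono divide_left_mono) auto
      also have "\<dots> \<le> t * (ln (real (Suc k)) - ln (real k))" using k t by (intro mult_left_mono log_step) auto
      finally have 1: "t / (2 * real v) \<le> t * (ln (real (Suc k)) - ln (real k))" by simp
      have "t * (ln (real (Suc k)) - ln (real k)) \<le> t * (1 / real k)" using k t by (intro mult_left_mono log_step) auto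
      also have "\<dots> \<le> 1" using k t n by (simp add: divide_le_eq)
      finally show "t / (2 * real v) \<le> t * ln (real (Suc k)) - t * ln (real k) \<and> t * ln (real (Suc k)) - t * ln (real k) \<le> 1"
        unfolding e using 1 by simp
    next
      fix k assume k: "Suc n \<le> k" "Suc k < v"
      have "t * (ln (real (Suc (Suc k))) - ln (real (Suc k))) \<le> t * (ln (real (Suc k)) - ln (real k))"
        using k t by (intro mult_left_mono log_step_antimono) auto
      thus "t * ln (real (Suc (Suc k))) - t * ln (real (Suc k)) \<le> t * ln (real (Suc k)) - t * ln (real k)"
        by (simp add: algebra_simps)
    qed
    thus ?thesis by simp
  qed
  \<comment> \<open>The bound for P v grows with v, so each difference of weights is kept and paired
    with its own bound.\<close>
  have abel: "(\<Sum>k\<in>{Suc n..<Suc m}. of_real (1 / sqrt (real k)) * cis (t * ln (real k))) =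
     of_real (1 / sqrt (real m)) * P (Suc m) + (\<Sum>k\<in>{Suc n..<m}. of_real (1 / sqrt (real k) - 1 / sqrt (real (Suc k))) * P (Suc k))"
    using n(3)
  proof (induction m rule: dec_induct)
    case base thus ?case by (simp add: P_def)
  next
    case (step m)
    show ?case
    proof (cases "m = n")
      case True thus ?thesis by (simp add: P_def)
    next
      case False
      hence m: "Suc n \<le> m" using step.hyps by simp
      define c where "c = (\<lambda>k. of_real (1 / sqrt (real k)) :: complex)"
      have "P (Suc (Suc m)) = P (Suc m) + cis (t * ln (real (Suc m)))" unfolding P_def using m by simp
      thus ?thesis using step.IH m unfolding of_real_diff c_def[symmetric] by (simp add: algebra_simps)
    qed
  qed
  \<comment> \<open>With x = sqrt k and y = sqrt (k + 1) the claim reduces to y (y - x) <=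
    1.\<close>
  have step: "(1 / sqrt (real k) - 1 / sqrt (real (Suc k))) * (16 * real (Suc k) / t) \<le> 16 / t * (1 / sqrt (real k))" if k: "1 \<le> k" for k
  proof -
    define x where "x = sqrt (real k)"
    define y where "y = sqrt (real (Suc k))"
    have x0: "0 < x" "x \<le> y" unfolding x_def y_def using k by simp_all
    have y2: "real (Suc k) = y * y" and x2: "real k = x * x" unfolding x_def y_def by simp_all
    have "y * (y - x) * (x + x) \<le> y * (y - x) * (y + x)" using x0 by (intro mult_left_mono) auto
    also have "\<dots> = y * (y * y - x * x)" by (simp add: algebra_simps)
    also have "\<dots> = y" using y2 x2 by simp
    also have "\<dots> \<le> 2 * x"
    proof (rule power2_le_imp_le)
      have "y * y \<le> 4 * (x * x)" using y2 x2 k by simp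
      thus "y\<^sup>2 \<le> (2 * x)\<^sup>2" by (simp add: power2_eq_square)
    qed (use x0 in auto)
    finally have "y * (y - x) * 2 * x \<le> 2 * x" by (simp add: algebra_simps)
    hence yx: "y * (y - x) \<le> 1" using x0 by simp
    have "(1 / x - 1 / y) * (y * y) = y * (y - x) / x" using x0 by (simp add: field_simps)
    also have "\<dots> \<le> 1 / x" using yx x0 by (intro divide_right_mono) auto
    finally have "(1 / x - 1 / y) * (y * y) * (16 / t) \<le> 1 / x * (16 / t)" using t by (intro mult_right_mono) auto
    thus ?thesis unfolding x_def[symmetric] y_def[symmetric] unfolding y2 by (simp add: mult_ac)
  qed
  have m1: "1 \<le> m" using n by simp
  have s1: "norm (of_real (1 / sqrt (real m)) * P (Suc m)) \<le> 32 * sqrt (real m) / t"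
  proof -
    have "norm (of_real (1 / sqrt (real m)) * P (Suc m)) \<le> 1 / sqrt (real m) * (16 * real (Suc m) / t)"
      unfolding norm_mult norm_of_real using P[of "Suc m"] by (intro mult_mono) auto
    also have "\<dots> \<le> 1 / sqrt (real m) * (16 * (2 * real m) / t)" using m1 t by (intro mult_left_mono divide_right_mono) auto
    also have "\<dots> = 32 * (real m / sqrt (real m)) / t" by simp
    also have "\<dots> = 32 * sqrt (real m) / t" by (simp add: real_div_sqrt)
    finally show ?thesis .
  qed
  have s2: "norm (\<Sum>k\<in>{Suc n..<m}. of_real (1 / sqrt (real k) - 1 / sqrt (real (Suc k))) * P (Suc k)) \<le> 32 * sqrt (real m) / t"
  proof -
    have "norm (\<Sum>k\<in>{Suc n..<m}. of_real (1 / sqrt (real k) - 1 / sqrt (real (Suc k))) * P (Suc k)) \<le> (\<Sum>k\<in>{Suc n..<m}. 16 / t * (1 / sqrt (real k)))"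
    proof (intro sum_norm_le)
      fix k assume "k \<in> {Suc n..<m}"
      hence k: "1 \<le> k" using n by simp
      have d0: "0 \<le> 1 / sqrt (real k) - 1 / sqrt (real (Suc k))" using k by (simp add: divide_left_mono)
      have "norm (of_real (1 / sqrt (real k) - 1 / sqrt (real (Suc k))) * P (Suc k)) = (1 / sqrt (real k) - 1 / sqrt (real (Suc k))) * norm (P (Suc k))"
        unfolding norm_mult norm_of_real using d0 by simp
      also have "\<dots> \<le> (1 / sqrt (real k) - 1 / sqrt (real (Suc k))) * (16 * real (Suc k) / t)"
        using P[of "Suc k"] d0 by (intro mult_left_mono) auto
      also have "\<dots> \<le> 16 / t * (1 / sqrt (real k))" by (rule step[OF k])
      finally show "norm (of_real (1 / sqrt (real k) - 1 / sqrt (real (Suc k))) * P (Suc k)) \<le> 16 / t * (1 / sqrt (real k))" .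
    qed
    also have "\<dots> = 16 / t * (\<Sum>k\<in>{Suc n..<m}. 1 / sqrt (real k))" by (simp only: sum_distrib_left)
    also have "\<dots> \<le> 16 / t * (2 * sqrt (real m))"
    proof (intro mult_left_mono)
      have "(\<Sum>k\<in>{Suc n..<m}. 1 / sqrt (real k)) \<le> (\<Sum>k\<in>{1..m}. 1 / sqrt (real k))" by (intro sum_mono2) auto
      also have "\<dots> \<le> 2 * sqrt (real m)" by (rule sum_inverse_sqrt_le)
      finally show "(\<Sum>k\<in>{Suc n..<m}. 1 / sqrt (real k)) \<le> 2 * sqrt (real m)" .
    qed (use t in auto)
    finally show ?thesis by simp
  qed
  have "DP m t - DP n t = (\<Sum>k\<in>{Suc n..<Suc m}. pt t k)"
  proof -
    have "{1..m} = {1..n} \<union> {Suc n..<Suc m}" using n by auto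
    hence "DP m t = DP n t + (\<Sum>k\<in>{Suc n..<Suc m}. pt t k)" unfolding DP_def by (simp only:) (intro sum.union_disjoint, auto)
    thus ?thesis by simp
  qed
  also have "\<dots> = cnj (\<Sum>k\<in>{Suc n..<Suc m}. of_real (1 / sqrt (real k)) * cis (t * ln (real k)))"
    unfolding pt_def cnj_sum by (simp add: cis_cnj)
  finally have "norm (DP m t - DP n t) = norm (\<Sum>k\<in>{Suc n..<Suc m}. of_real (1 / sqrt (real k)) * cis (t * ln (real k)))"
    by (simp only: complex_mod_cnj)
  also have "\<dots> \<le> 32 * sqrt (real m) / t + 32 * sqrt (real m) / t" unfolding abel by (rule norm_triangle_mono[OF s1 s2])
  finally show ?thesis by simp
qed

lemma cnj_DP: "cnj (DP n t) = DP n (- t)"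
  unfolding DP_def pt_def cnj_sum by (simp add: cis_cnj)

text \<open>The Gaussian average runs over the whole line, so every \<tau> needs a bound. For
  |\<tau>| <= n and \<tau>^2 <= n, \<open>cz_approx\<close> applies directly, and its term sqrt n/|1
  - s| is large near \<tau> = 0. For |\<tau>| <= n < \<tau>^2 it is applied to a longer polynomial,
  which \<open>zeta_sum_short\<close> compares with DP n. For |\<tau>| > n the bound is crude and
  will be paid for by the Gaussian.\<close>

lemma zeta_approx:
  assumes n: "1 \<le> n"
  shows "(norm (zeta (Complex (1/2) \<tau>) - DP n \<tau>))\<^sup>2 \<le> 30000 + 8 * real n / (1/4 + \<tau>\<^sup>2) + (if real n < \<bar>\<tau>\<bar> then 100 * \<tau>\<^sup>2 else 0)"
proof -
  define a where "a = norm (1 - Complex (1/2) \<tau>)"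
  have a2: "a\<^sup>2 = 1/4 + \<tau>\<^sup>2" unfolding a_def by (simp add: cmod_def power2_eq_square)
  have a0: "1/2 \<le> a" "\<bar>\<tau>\<bar> \<le> a" unfolding a_def by (rule one_minus_half_line)+
  have s: "norm (Complex (1/2) \<tau>) = a" unfolding a_def by (simp add: cmod_def power2_eq_square)
  have at: "a \<le> \<bar>\<tau>\<bar> + 1/2"
  proof (rule power2_le_imp_le)
    have "(\<bar>\<tau>\<bar> + 1/2)\<^sup>2 = \<tau>\<^sup>2 + \<bar>\<tau>\<bar> + 1/4" by (simp add: power2_sum power_divide)
    thus "a\<^sup>2 \<le> (\<bar>\<tau>\<bar> + 1/2)\<^sup>2" unfolding a2 by simp
  qed simp
  have ap: "norm (zeta (Complex (1/2) \<tau>) - DP k \<tau>) \<le> sqrt (real k) / a + 6 * a / sqrt (real k)" if "1 \<le> k" for k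
    unfolding zeta_eq_cz using cz_approx[OF that, of \<tau>] unfolding s a_def[symmetric] .
  have n0: "0 < sqrt (real n)" "1 \<le> sqrt (real n)" using n by auto
  have q0: "0 \<le> 8 * real n / (1/4 + \<tau>\<^sup>2)" by (simp add: add_nonneg_nonneg)
  consider "real n < \<bar>\<tau>\<bar>" | "\<bar>\<tau>\<bar> \<le> real n" "\<tau>\<^sup>2 \<le> real n" | "\<bar>\<tau>\<bar> \<le> real n" "real n < \<tau>\<^sup>2" by linarith
  thus ?thesis
  proof cases
    case 1
    have t1: "1 \<le> \<bar>\<tau>\<bar>" using 1 n by linarith
    have "sqrt (real n) \<le> real n" using n by (intro real_le_lsqrt) (auto simp: power2_eq_square)
    hence "sqrt (real n) / a \<le> 1" using 1 a0 by (simp add: divide_le_eq)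
    moreover have "6 * a / sqrt (real n) \<le> 6 * a / 1" using n0 a0 by (intro divide_left_mono) auto
    ultimately have "norm (zeta (Complex (1/2) \<tau>) - DP n \<tau>) \<le> 10 * \<bar>\<tau>\<bar>" using ap[OF n] at t1 by linarith
    from power_mono[OF this, of 2] have "(norm (zeta (Complex (1/2) \<tau>) - DP n \<tau>))\<^sup>2 \<le> 100 * \<tau>\<^sup>2" by (simp add: power_mult_distrib)
    moreover have "(if real n < \<bar>\<tau>\<bar> then 100 * \<tau>\<^sup>2 else 0) = 100 * \<tau>\<^sup>2" using 1 by simp
    ultimately show ?thesis using q0 by linarith
  next
    case 2
    have "\<bar>\<tau>\<bar> \<le> sqrt (real n)" using 2 by (simp add: real_le_rsqrt)
    hence "a \<le> 3/2 * sqrt (real n)" using at n0 by linarith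
    hence "6 * a / sqrt (real n) \<le> 9" using n0 by (simp add: divide_le_eq)
    hence "norm (zeta (Complex (1/2) \<tau>) - DP n \<tau>) \<le> sqrt (real n) / a + 9" using ap[OF n] by linarith
    from power_mono[OF this, of 2] have "(norm (zeta (Complex (1/2) \<tau>) - DP n \<tau>))\<^sup>2 \<le> (sqrt (real n) / a + 9)\<^sup>2" by simp
    also have "\<dots> \<le> 2 * (sqrt (real n) / a)\<^sup>2 + 2 * 9\<^sup>2"
      using sum_squares_bound[of "sqrt (real n) / a" 9] by (simp add: power2_sum)
    also have "(sqrt (real n) / a)\<^sup>2 = real n / (1/4 + \<tau>\<^sup>2)" by (simp add: power_divide a2)
    finally have "(norm (zeta (Complex (1/2) \<tau>) - DP n \<tau>))\<^sup>2 \<le> 2 * (real n / (1/4 + \<tau>\<^sup>2)) + 162" by simp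
    moreover have "8 * real n / (1/4 + \<tau>\<^sup>2) = 8 * (real n / (1/4 + \<tau>\<^sup>2))" by simp
    moreover have "(if real n < \<bar>\<tau>\<bar> then 100 * \<tau>\<^sup>2 else 0) = 0" using 2 by simp
    ultimately show ?thesis using q0 by (simp only:)
  next
    case 3
    have t1: "1 \<le> \<bar>\<tau>\<bar>"
    proof (rule ccontr)
      assume "\<not> 1 \<le> \<bar>\<tau>\<bar>"
      hence "\<bar>\<tau>\<bar> * \<bar>\<tau>\<bar> \<le> 1 * 1" by (intro mult_mono) auto
      thus False using 3 n by (simp add: power2_eq_square)
    qed
    \<comment> \<open>At length about \<tau>^2 both error terms of \<open>cz_approx\<close> are
      bounded.\<close>
    define m where "m = nat \<lceil>\<tau>\<^sup>2\<rceil>"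
    have mt: "\<tau>\<^sup>2 \<le> real m" unfolding m_def by linarith
    have tt1: "1 \<le> \<tau>\<^sup>2" using t1 by (metis one_le_power power2_abs)
    have mt2: "real m \<le> 4 * \<tau>\<^sup>2" unfolding m_def using tt1 by linarith
    have mn: "n \<le> m" using mt 3 by linarith
    have sm: "sqrt (real m) \<le> 2 * \<bar>\<tau>\<bar>" "\<bar>\<tau>\<bar> \<le> sqrt (real m)"
      using mt mt2 by (auto intro!: real_le_lsqrt real_le_rsqrt simp: power_mult_distrib)
    have "sqrt (real m) / a \<le> 2" using sm a0 t1 by (simp add: divide_le_eq)
    moreover have "6 * a / sqrt (real m) \<le> 9" using sm at t1 by (simp add: divide_le_eq)
    ultimately have 4: "norm (zeta (Complex (1/2) \<tau>) - DP m \<tau>) \<le> 11" using ap[of m] mn n by linarith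
    have "norm (DP m \<bar>\<tau>\<bar> - DP n \<bar>\<tau>\<bar>) \<le> 64 * sqrt (real m) / \<bar>\<tau>\<bar>" using t1 3 n mn by (intro zeta_sum_short) auto
    also have "\<dots> \<le> 128" using sm t1 by (simp add: divide_le_eq)
    finally have "norm (DP m \<bar>\<tau>\<bar> - DP n \<bar>\<tau>\<bar>) \<le> 128" .
    moreover have "norm (DP m \<bar>\<tau>\<bar> - DP n \<bar>\<tau>\<bar>) = norm (DP m \<tau> - DP n \<tau>)"
      by (cases "0 \<le> \<tau>") (auto simp: cnj_DP[symmetric] simp flip: complex_cnj_diff)
    ultimately have 5: "norm (DP m \<tau> - DP n \<tau>) \<le> 128" by simp
    have "norm ((zeta (Complex (1/2) \<tau>) - DP m \<tau>) + (DP m \<tau> - DP n \<tau>)) \<le> 11 + 128" using 4 5 by (rule norm_triangle_mono)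
    hence "norm (zeta (Complex (1/2) \<tau>) - DP n \<tau>) \<le> 139" by simp
    from power_mono[OF this, of 2] have "(norm (zeta (Complex (1/2) \<tau>) - DP n \<tau>))\<^sup>2 \<le> 19321" by simp
    moreover have "(if real n < \<bar>\<tau>\<bar> then 100 * \<tau>\<^sup>2 else 0) = 0" using 3 by simp
    ultimately show ?thesis using q0 by linarith
  qed
qed

section \<open>The smoothed mean square\<close>

lemma log_ratio_deriv_bounds:
  fixes r s :: nat assumes "1 \<le> r" "1 \<le> s"
  defines "z \<equiv> real s / (real r * (real r + real s + 1))"
  shows "lam (real r / real s) - lam (real (Suc r) / real s) = ln (1 + z)" "z / 2 \<le> ln (1 + z)" "ln (1 + z) \<le> z"
proof -
  have r0: "0 < real r" "0 < real s" using assms by auto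
  have "lam (real r / real s) - lam (real (Suc r) / real s) = ln ((real r + real s) / real r) - ln ((real r + 1 + real s) / (real r + 1))"
    unfolding lam_def using r0 by (simp add: field_simps)
  also have "\<dots> = ln (((real r + real s) / real r) / ((real r + 1 + real s) / (real r + 1)))"
  proof -
    have "(real r + real s) / real r \<noteq> 0" "(real r + 1 + real s) / (real r + 1) \<noteq> 0" "0 < (real r + real s) / real r" "0 < (real r + 1 + real s) / (real r + 1)"
      using r0 by (simp_all add: add_pos_pos add_eq_0_iff)
    thus ?thesis by (intro ln_divide_pos[symmetric])
  qed
  also have "((real r + real s) / real r) / ((real r + 1 + real s) / (real r + 1)) = 1 + z"
  proof -
    have nz: "real r + 1 + real s \<noteq> 0" "real r + real s + 1 \<noteq> 0" "real r + 1 \<noteq> 0" using r0 by linarith+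
    have "((real r + real s) / real r) / ((real r + 1 + real s) / (real r + 1)) = ((real r + real s) * (real r + 1)) / (real r * (real r + real s + 1))"
      by (simp add: add_ac)
    also have "(real r + real s) * (real r + 1) = real r * (real r + real s + 1) + real s" by (simp add: algebra_simps)
    also have "(real r * (real r + real s + 1) + real s) / (real r * (real r + real s + 1)) = 1 + z"
      unfolding z_def using r0 nz by (simp add: add_divide_distrib)
    finally show ?thesis .
  qed
  finally show "lam (real r / real s) - lam (real (Suc r) / real s) = ln (1 + z)" .
  have z0: "0 \<le> z" unfolding z_def using r0 by simp
  show "ln (1 + z) \<le> z" using z0 by (rule ln_add_one_self_le_self)
  have "real s \<le> real r * (real r + real s + 1)"
    using r0 assms mult_mono[of 1 "real r" "real s" "real r + real s + 1"] by simp
  hence z1: "z \<le> 1" unfolding z_def using r0 by (simp add: divide_le_eq)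
  have "ln (1 / (1 + z)) \<le> 1 / (1 + z) - 1" using z0 by (intro ln_le_minus_one) auto
  also have "\<dots> = - (z / (1 + z))" using z0 by (simp add: field_simps)
  finally have "z / (1 + z) \<le> ln (1 + z)" using z0 by (simp add: ln_div)
  moreover have "z / 2 \<le> z / (1 + z)" using z0 z1 by (intro divide_left_mono) auto
  ultimately show "z / 2 \<le> ln (1 + z)" by linarith
qed

lemma lam_antimono: "0 < x \<Longrightarrow> x \<le> y \<Longrightarrow> lam y \<le> lam x"
  unfolding lam_def by (intro ln_mono) (auto intro!: divide_left_mono add_pos_nonneg)

lemma lam_nonneg: "0 < x \<Longrightarrow> 0 \<le> lam x"
  unfolding lam_def by simp

text \<open>For s >= 2 T/Y^2 the phase increments are at most 1 and at least T/(16 s Y^2), so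
  Kuzmin-Landau gives 128 s Y^2/T. The weight is the product of the Gaussian factor, increasing in
  r, and of 1/sqrt (r (r + s)), decreasing and at most 1/(s Y); they are removed one after the
  other. An upper limit b below 2 s Y covers blocks truncated by r + s <= n.\<close>

lemma block_tail:
  fixes s Yn b :: nat
  assumes T: "1 \<le> T" "T \<le> t" "t \<le> 2 * T" and Y: "1 \<le> Yn" and s: "1 \<le> s" "2 * T / (real Yn)\<^sup>2 \<le> real s"
    and b: "b \<le> 2 * (s * Yn)"
  shows "norm (\<Sum>r\<in>{s*Yn..<b}. Psi G t (real r / real s) / of_nat s) \<le> 256 * real Yn / T"
proof (cases "s * Yn < b")
  case False thus ?thesis using T by simp
next
  case ab: True
  define a where "a = s * Yn"
  define Y where "Y = real Yn"
  have Y1: "1 \<le> Y" unfolding Y_def using Y by simp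
  have ra: "real a = real s * Y" unfolding a_def Y_def by simp
  have s0: "1 \<le> real s" using s by simp
  have rr: "real s * Y \<le> real r" "real r \<le> 2 * (real s * Y)" "1 \<le> r" if "a \<le> r" "r < b" for r
  proof -
    show "real s * Y \<le> real r" using that ra by (metis of_nat_le_iff)
    have "real r \<le> real (2 * (s * Yn))" using that b by (subst of_nat_le_iff) linarith
    thus "real r \<le> 2 * (real s * Y)" unfolding Y_def by simp
    have "1 \<le> a" unfolding a_def using s Y by simp
    thus "1 \<le> r" using that by simp
  qed
  define B where "B = 128 * (real s * Y\<^sup>2) / T"
  have B0: "0 \<le> B" unfolding B_def using T by simp
  have KLb: "norm (\<Sum>r\<in>{a..<v}. cis (t * lam (real r / real s))) \<le> B" if v: "v \<le> b" for v
  proof -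
    \<comment> \<open>\<open>lam\<close> decreases, so the sum is conjugated to make the increments
      positive.\<close>
    have "norm (\<Sum>r\<in>{a..<v}. cis (- (t * lam (real r / real s)))) \<le> 8 / (T / (16 * (real s * Y\<^sup>2)))"
    proof (rule Kuzmin_Landau)
      show "0 < T / (16 * (real s * Y\<^sup>2))" using T s0 Y1 by simp
      fix r assume r: "a \<le> r" "r < v"
      hence r': "real s * Y \<le> real r" "real r \<le> 2 * (real s * Y)" "1 \<le> r" using rr[of r] v by auto
      define z where "z = real s / (real r * (real r + real s + 1))"
      have e: "- (t * lam (real (Suc r) / real s)) - - (t * lam (real r / real s)) = t * ln (1 + z)"
        using log_ratio_deriv_bounds(1)[OF r'(3) s(1)] unfolding z_def by (simp add: algebra_simps)
      have z: "z / 2 \<le> ln (1 + z)" "ln (1 + z) \<le> z" using log_ratio_deriv_bounds(2,3)[OF r'(3) s(1)] unfolding z_def by auto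
      have sY: "real s * 1 \<le> real s * Y" using Y1 s0 by (intro mult_left_mono) auto
      have "real r * (real r + real s + 1) \<le> (2 * (real s * Y)) * (4 * (real s * Y))"
      proof (intro mult_mono)
        have "1 \<le> real s * Y" using sY s0 by linarith
        thus "real r + real s + 1 \<le> 4 * (real s * Y)" using r'(2) sY by linarith
      qed (use r' in auto)
      hence "real s / ((2 * (real s * Y)) * (4 * (real s * Y))) \<le> z"
        unfolding z_def using r' s0 Y1 by (intro divide_left_mono mult_pos_pos) auto
      moreover have "real s / ((2 * (real s * Y)) * (4 * (real s * Y))) = 1 / (8 * (real s * Y\<^sup>2))"
        using s0 by (simp add: power2_eq_square)
      ultimately have zl: "1 / (8 * (real s * Y\<^sup>2)) \<le> z" by simp
      have "T * (1 / (8 * (real s * Y\<^sup>2)) / 2) \<le> t * ln (1 + z)"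
        using zl z T s0 Y1 by (intro mult_mono) auto
      hence 1: "T / (16 * (real s * Y\<^sup>2)) \<le> t * ln (1 + z)" by simp
      have "(real s * Y) * (real s * Y) \<le> real r * (real r + real s + 1)" using r' s0 Y1 by (intro mult_mono) auto
      hence "z \<le> real s / ((real s * Y) * (real s * Y))"
        unfolding z_def using r' s0 Y1 by (intro divide_left_mono mult_pos_pos) auto
      also have "\<dots> = 1 / (real s * Y\<^sup>2)" using s0 by (simp add: power2_eq_square)
      finally have "t * ln (1 + z) \<le> (2 * T) * (1 / (real s * Y\<^sup>2))" using z T zl by (intro mult_mono) auto
      also have "\<dots> \<le> 1"
      proof -
        have "2 * T \<le> real s * Y\<^sup>2" using s(2) Y1 unfolding Y_def[symmetric] by (simp add: divide_le_eq)
        thus ?thesis using s0 Y1 by (simp add: divide_le_eq)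
      qed
      finally have 2: "t * ln (1 + z) \<le> 1" .
      show "T / (16 * (real s * Y\<^sup>2)) \<le> - (t * lam (real (Suc r) / real s)) - - (t * lam (real r / real s)) \<and>
        - (t * lam (real (Suc r) / real s)) - - (t * lam (real r / real s)) \<le> 1" unfolding e using 1 2 by simp
    next
      fix r assume r: "a \<le> r" "Suc r < v"
      have r1: "1 \<le> r" using rr[of r] r v by auto
      define z where "z = (\<lambda>r. real s / (real r * (real r + real s + 1)))"
      have e: "- (t * lam (real (Suc r) / real s)) - - (t * lam (real r / real s)) = t * ln (1 + z r)" if "1 \<le> r" for r
        using log_ratio_deriv_bounds(1)[OF that s(1)] unfolding z_def by (simp add: algebra_simps)
      have "z (Suc r) \<le> z r" unfolding z_def using r1 s0 by (intro divide_left_mono mult_mono mult_pos_pos) auto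
      moreover have "0 \<le> z (Suc r)" unfolding z_def by simp
      ultimately have "ln (1 + z (Suc r)) \<le> ln (1 + z r)" by (intro ln_mono) auto
      hence "t * ln (1 + z (Suc r)) \<le> t * ln (1 + z r)" using T by (intro mult_left_mono) auto
      thus "- (t * lam (real (Suc (Suc r)) / real s)) - - (t * lam (real (Suc r) / real s)) \<le>
        - (t * lam (real (Suc r) / real s)) - - (t * lam (real r / real s))"
        using e[of r] e[of "Suc r"] r1 by simp
    qed
    also have "8 / (T / (16 * (real s * Y\<^sup>2))) = B" unfolding B_def by simp
    also have "(\<Sum>r\<in>{a..<v}. cis (- (t * lam (real r / real s)))) = cnj (\<Sum>r\<in>{a..<v}. cis (t * lam (real r / real s)))"
      unfolding cnj_sum cis_cnj by (rule refl)
    finally show ?thesis by (simp only: complex_mod_cnj)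
  qed
  define ee where "ee = (\<lambda>r. exp (- (G * lam (real r / real s))\<^sup>2 / 4))"
  have ee: "norm (\<Sum>r\<in>{a..<v}. of_real (ee r) * cis (t * lam (real r / real s))) \<le> 2 * 1 * B" if v: "v \<le> b" for v
  proof (cases "a < v")
    case False thus ?thesis using B0 by simp
  next
    case True
    show ?thesis
    proof (rule Abel_mono[OF KLb _ _ True])
      fix r assume r: "a \<le> r" "Suc r < v"
      have p: "0 < real r / real s" using rr(3)[of r] r v s0 by simp
      have l: "lam (real (Suc r) / real s) \<le> lam (real r / real s)" using p by (intro lam_antimono divide_right_mono) auto
      have l0: "0 \<le> lam (real (Suc r) / real s)" using s0 by (intro lam_nonneg) simp
      have "(G * lam (real (Suc r) / real s))\<^sup>2 \<le> (G * lam (real r / real s))\<^sup>2"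
        unfolding power_mult_distrib using l l0 by (intro mult_left_mono power_mono) auto
      thus "ee r \<le> ee (Suc r)" unfolding ee_def by simp
    qed (use v in \<open>auto simp: ee_def\<close>)
  qed
  define w where "w = (\<lambda>r. 1 / sqrt (real r * (real r + real s)))"
  have tm: "Psi G t (real r / real s) / of_nat s = of_real (w r) * (of_real (ee r) * cis (t * lam (real r / real s)))" if "a \<le> r" "r < b" for r
  proof -
    have "real r / real s * (real r / real s + 1) = real r * (real r + real s) / (real s)\<^sup>2"
      using s0 by (simp add: field_simps power2_eq_square)
    hence "sqrt (real r / real s * (real r / real s + 1)) = sqrt (real r * (real r + real s)) / real s"
      using s0 by (simp add: real_sqrt_divide)
    hence "alp G (real r / real s) / real s = w r * ee r" unfolding alp_def w_def ee_def using s0 by simp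
    hence "of_real (alp G (real r / real s)) / of_nat s = (of_real (w r) * of_real (ee r) :: complex)"
      by (metis of_real_divide of_real_mult of_real_of_nat_eq)
    thus ?thesis unfolding Psi_def by (simp add: mult.assoc[symmetric] flip: times_divide_eq_left)
  qed
  have "norm (\<Sum>r\<in>{a..<b}. of_real (w r) * (of_real (ee r) * cis (t * lam (real r / real s)))) \<le> (2 * 1 * B) * w a"
  proof (rule Abel_antimono[OF ee])
    show "0 \<le> w n" for n unfolding w_def by simp
    fix r assume r: "a \<le> r" "Suc r < b"
    have "1 \<le> r" using rr(3)[of r] r by simp
    thus "w (Suc r) \<le> w r" unfolding w_def using s0 by (intro divide_left_mono real_sqrt_le_mono mult_mono mult_pos_pos real_sqrt_gt_zero) auto
  qed (use ab a_def in auto)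
  also have "w a \<le> 1 / (real s * Y)"
  proof -
    have "real s * Y = sqrt ((real s * Y)\<^sup>2)" using s0 Y1 by simp
    also have "\<dots> \<le> sqrt (real a * (real a + real s))" unfolding ra using s0 Y1 by (intro real_sqrt_le_mono) (simp add: power2_eq_square)
    finally show ?thesis unfolding w_def using s0 Y1 by (intro divide_left_mono mult_pos_pos) (auto simp: ra intro!: mult_pos_pos add_pos_pos)
  qed
  hence "(2 * 1 * B) * w a \<le> (2 * 1 * B) * (1 / (real s * Y))" using B0 by (intro mult_left_mono) auto
  also have "(2 * 1 * B) * (1 / (real s * Y)) = 256 * Y / T" unfolding B_def using s0 Y1 by (simp add: power2_eq_square)
  finally have fin: "norm (\<Sum>r\<in>{a..<b}. of_real (w r) * (of_real (ee r) * cis (t * lam (real r / real s)))) \<le> 256 * Y / T"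
    by simp
  have "(\<Sum>r\<in>{s*Yn..<b}. Psi G t (real r / real s) / of_nat s) = (\<Sum>r\<in>{a..<b}. of_real (w r) * (of_real (ee r) * cis (t * lam (real r / real s))))"
    unfolding a_def[symmetric] by (intro sum.cong refl tm) auto
  thus ?thesis using fin unfolding Y_def by simp
qed

text \<open>The pairs \<open>r\<close>, \<open>r + s\<close> in the expanded square: the summand depends on \<open>r\<close> essentially through \<open>r / s\<close> only.\<close>

definition offdiag :: "nat \<Rightarrow> real \<Rightarrow> real \<Rightarrow> complex" where
  "offdiag n G t = (\<Sum>s\<in>{1..<n}. \<Sum>r\<in>{1..<n+1-s}. Psi G t (real r / real s) / of_nat s)"

text \<open>For 4^i > 2 T the value is 0: the sawtooth does not enter, and \<open>block_tail\<close>
  covers every s.\<close>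

definition blk_len :: "real \<Rightarrow> nat \<Rightarrow> nat" where "blk_len T i = nat \<lfloor>2 * T / (2 ^ i)\<^sup>2\<rfloor>"

lemma split_dyadic:
  fixes f :: "nat \<Rightarrow> complex"
  assumes "i0 \<le> I"
  shows "(\<Sum>r\<in>{a..<min (s * 2 ^ I) b}. f r) = (\<Sum>r\<in>{a..<min (s * 2 ^ i0) b}. f r) + (\<Sum>i\<in>{i0..<I}. \<Sum>r\<in>{max a (s * 2 ^ i)..<min (2 * (s * 2 ^ i)) b}. f r)"
  using assms
proof (induction I rule: dec_induct)
  case (step I)
  have "{a..<min (s * 2 ^ Suc I) b} = {a..<min (s * 2 ^ I) b} \<union> {max a (s * 2 ^ I)..<min (2 * (s * 2 ^ I)) b}" by auto
  moreover have "{a..<min (s * 2 ^ I) b} \<inter> {max a (s * 2 ^ I)..<min (2 * (s * 2 ^ I)) b} = {}" by auto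
  ultimately have "(\<Sum>r\<in>{a..<min (s * 2 ^ Suc I) b}. f r) = (\<Sum>r\<in>{a..<min (s * 2 ^ I) b}. f r) + (\<Sum>r\<in>{max a (s * 2 ^ I)..<min (2 * (s * 2 ^ I)) b}. f r)"
    by (simp add: sum.union_disjoint)
  thus ?case using step by (simp add: add.assoc)
qed simp

text \<open>Ratios r/s below 2^i0 are suppressed by the Gaussian, since \<open>lam\<close> is at
  least 1/(2 * 2^i0) there. The condition 6 T <= n guarantees that for s up to
  \<open>blk_len\<close> no block is truncated: s Y <= 2 T, so 2 s Y + s <= 6 T.\<close>

lemma offdiag_bound:
  assumes T: "1 \<le> T" "T \<le> t" "t \<le> 2 * T" and n: "6 * T \<le> real n" "n \<le> 2 ^ I" and i0: "i0 \<le> I"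
  shows "norm (offdiag n G t) \<le> (real n)\<^sup>2 * exp (- G\<^sup>2 / (16 * (2 ^ i0)\<^sup>2)) +
    (\<Sum>i\<in>{i0..<I}. 256 * real n / T + norm (blk G (2 ^ i) (blk_len T i) t))"
proof -
  define f where "f = (\<lambda>s r. Psi G t (real r / real s) / (of_nat s :: complex))"
  define R where "R = (\<lambda>i s. \<Sum>r\<in>{s * 2 ^ i..<min (2 * (s * 2 ^ i)) (n + 1 - s)}. f s r)"
  define small where "small = (\<lambda>s. \<Sum>r\<in>{1..<min (s * 2 ^ i0) (n + 1 - s)}. f s r)"
  have inner: "(\<Sum>r\<in>{1..<n+1-s}. f s r) = small s + (\<Sum>i\<in>{i0..<I}. R i s)" if s: "s \<in> {1..<n}" for s
  proof -
    have "1 * 2 ^ I \<le> s * 2 ^ I" using s by (intro mult_right_mono) auto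
    moreover have "n + 1 - s \<le> n" using s by auto
    ultimately have "n + 1 - s \<le> s * 2 ^ I" using n(2) by linarith
    hence "min (s * 2 ^ I) (n + 1 - s) = n + 1 - s" by (rule min_absorb2)
    moreover have "max 1 (s * 2 ^ i) = s * 2 ^ i" for i using s by (simp add: max_def)
    ultimately show ?thesis using split_dyadic[OF i0, of "f s" 1 s "n + 1 - s"] unfolding R_def small_def by simp
  qed
  have "offdiag n G t = (\<Sum>s\<in>{1..<n}. small s) + (\<Sum>s\<in>{1..<n}. \<Sum>i\<in>{i0..<I}. R i s)"
  proof -
    have "offdiag n G t = (\<Sum>s\<in>{1..<n}. \<Sum>r\<in>{1..<n+1-s}. f s r)" unfolding offdiag_def f_def by (rule refl)
    also have "\<dots> = (\<Sum>s\<in>{1..<n}. small s + (\<Sum>i\<in>{i0..<I}. R i s))" by (rule sum.cong[OF refl inner])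
    finally show ?thesis by (simp only: sum.distrib)
  qed
  also have "(\<Sum>s\<in>{1..<n}. \<Sum>i\<in>{i0..<I}. R i s) = (\<Sum>i\<in>{i0..<I}. \<Sum>s\<in>{1..<n}. R i s)" by (rule sum.swap)
  finally have S: "offdiag n G t = (\<Sum>s\<in>{1..<n}. small s) + (\<Sum>i\<in>{i0..<I}. \<Sum>s\<in>{1..<n}. R i s)" .
  have sm: "norm (\<Sum>s\<in>{1..<n}. small s) \<le> (real n)\<^sup>2 * exp (- G\<^sup>2 / (16 * (2 ^ i0)\<^sup>2))"
  proof -
    define E where "E = exp (- G\<^sup>2 / (16 * (2 ^ i0)\<^sup>2))"
    have fE: "norm (f s r) \<le> E" if s: "1 \<le> s" and r: "1 \<le> r" "r < s * 2 ^ i0" for s r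
    proof -
      have p: "0 < real r / real s" using s r by simp
      have "real r \<le> real (s * 2 ^ i0)" using r(2) by (subst of_nat_le_iff) simp
      hence y: "real r / real s \<le> 2 ^ i0" using s by (simp add: divide_le_eq mult.commute)
      have two: "(1::real) \<le> 2 ^ i0" by simp
      have "1 / (2 * 2 ^ i0) \<le> 1 / ((2::real) ^ i0 + 1)" using two by (intro divide_left_mono) (auto intro!: mult_pos_pos add_pos_pos)
      also have "\<dots> \<le> lam (2 ^ i0)" by (rule lam_ge) simp
      also have "\<dots> \<le> lam (real r / real s)" using p y by (rule lam_antimono)
      finally have l: "1 / (2 * 2 ^ i0) \<le> lam (real r / real s)" .
      have "G\<^sup>2 / (16 * (2 ^ i0)\<^sup>2) = G\<^sup>2 * (1 / (2 * 2 ^ i0))\<^sup>2 / 4" by (simp add: power_mult_distrib power_divide)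
      also have "\<dots> \<le> G\<^sup>2 * (lam (real r / real s))\<^sup>2 / 4" using l by (intro divide_right_mono mult_left_mono power_mono) auto
      finally have "exp (- (G * lam (real r / real s))\<^sup>2 / 4) \<le> E" unfolding E_def by (simp add: power_mult_distrib)
      moreover have "1 \<le> real s * sqrt (real r / real s * (real r / real s + 1))"
      proof -
        have "1 \<le> real r * (real r + real s)" using s r mult_mono[of 1 "real r" 1 "real r + real s"] by simp
        also have "\<dots> = (real s)\<^sup>2 * (real r / real s * (real r / real s + 1))" using s by (simp add: field_simps power2_eq_square)
        finally have "sqrt 1 \<le> sqrt ((real s)\<^sup>2 * (real r / real s * (real r / real s + 1)))" by (rule real_sqrt_le_mono)
        moreover have "sqrt ((real s)\<^sup>2 * x) = real s * sqrt x" for x by (simp add: real_sqrt_mult)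
        ultimately show ?thesis by (simp only: real_sqrt_one)
      qed
      moreover have "norm (f s r) = exp (- (G * lam (real r / real s))\<^sup>2 / 4) / (real s * sqrt (real r / real s * (real r / real s + 1)))"
        unfolding f_def Psi_def alp_def using p by (simp add: norm_divide norm_mult)
      ultimately show ?thesis
        using frac_le[of E "exp (- (G * lam (real r / real s))\<^sup>2 / 4)" 1 "real s * sqrt (real r / real s * (real r / real s + 1))"]
        by (simp add: E_def)
    qed
    have "norm (small s) \<le> real n * E" if s: "s \<in> {1..<n}" for s
    proof -
      have "norm (small s) \<le> (\<Sum>r\<in>{1..<min (s * 2 ^ i0) (n + 1 - s)}. E)"
        unfolding small_def by (intro sum_norm_le fE) (use s in auto)
      also have "\<dots> = real (card {1..<min (s * 2 ^ i0) (n + 1 - s)}) * E" by simp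
      also have "\<dots> \<le> real n * E" unfolding E_def using s by (intro mult_right_mono) auto
      finally show ?thesis .
    qed
    hence "norm (\<Sum>s\<in>{1..<n}. small s) \<le> (\<Sum>s\<in>{1..<n}. real n * E)" by (intro sum_norm_le) auto
    also have "\<dots> = real (n - 1) * (real n * E)" by simp
    also have "\<dots> \<le> real n * (real n * E)" unfolding E_def by (intro mult_right_mono) auto
    finally show ?thesis unfolding E_def by (simp add: power2_eq_square mult.assoc)
  qed
  have bl: "norm (\<Sum>s\<in>{1..<n}. R i s) \<le> 256 * real n / T + norm (blk G (2 ^ i) (blk_len T i) t)" for i
  proof -
    define N where "N = blk_len T i"
    define Y where "Y = (2::real) ^ i"
    have Y1: "1 \<le> Y" unfolding Y_def by simp
    have NT: "real N \<le> 2 * T / Y\<^sup>2" unfolding N_def blk_len_def Y_def using T by (intro of_nat_floor) auto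
    have "2 * T / Y\<^sup>2 \<le> 2 * T / 1" using T Y1 by (intro divide_left_mono) auto
    hence "real N \<le> 2 * T" using NT by simp
    hence Nn: "N < n" using n T by linarith
    have full: "R i s = (\<Sum>r\<in>{s * 2 ^ i..<2 * (s * 2 ^ i)}. f s r)" if s: "s \<in> {1..N}" for s
    proof -
      have sY: "real s \<le> real s * Y" using Y1 by (simp add: mult_le_cancel_left1)
      have "real s * Y \<le> (2 * T / Y\<^sup>2) * Y" using s NT Y1 by (intro mult_right_mono) auto
      also have "\<dots> = 2 * T / Y" using Y1 by (simp add: power2_eq_square)
      also have "\<dots> \<le> 2 * T / 1" using T Y1 by (intro divide_left_mono) auto
      finally have "real s * Y \<le> 2 * T" by simp
      hence "2 * (real s * Y) + real s \<le> real n" using sY n by linarith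
      hence "real (2 * (s * 2 ^ i) + s) \<le> real n" unfolding Y_def by simp
      hence "2 * (s * 2 ^ i) + s \<le> n" by (subst (asm) of_nat_le_iff)
      hence "min (2 * (s * 2 ^ i)) (n + 1 - s) = 2 * (s * 2 ^ i)" by auto
      thus ?thesis unfolding R_def by simp
    qed
    have tail: "norm (R i s) \<le> (if s * 2 ^ i \<le> n then 256 * Y / T else 0)" if s: "s \<in> {N+1..<n}" for s
    proof (cases "s * 2 ^ i \<le> n")
      case True
      have "2 * T / Y\<^sup>2 < real N + 1" unfolding N_def blk_len_def Y_def[symmetric] using T by linarith
      hence "2 * T / Y\<^sup>2 \<le> real s" using s by simp
      hence "norm (\<Sum>r\<in>{s * 2 ^ i..<min (2 * (s * 2 ^ i)) (n + 1 - s)}. Psi G t (real r / real s) / of_nat s) \<le> 256 * real (2 ^ i) / T"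
        using s T unfolding Y_def by (intro block_tail) auto
      thus ?thesis using True unfolding R_def f_def Y_def by simp
    next
      case False
      hence "R i s = 0" unfolding R_def by simp
      thus ?thesis using False by simp
    qed
    have "(\<Sum>s\<in>{1..<n}. R i s) = (\<Sum>s\<in>{1..N}. R i s) + (\<Sum>s\<in>{N+1..<n}. R i s)"
    proof -
      have "{1..<n} = {1..N} \<union> {N+1..<n}" using Nn by auto
      thus ?thesis by (simp only:) (intro sum.union_disjoint, auto)
    qed
    also have "(\<Sum>s\<in>{1..N}. R i s) = blk G (2 ^ i) (blk_len T i) t"
    proof -
      have "(\<Sum>s\<in>{1..N}. R i s) = (\<Sum>s\<in>{1..N}. \<Sum>r\<in>{s * 2 ^ i..<2 * (s * 2 ^ i)}. f s r)"
        by (rule sum.cong[OF refl full])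
      thus ?thesis unfolding blk_def N_def[symmetric] f_def .
    qed
    finally have e: "(\<Sum>s\<in>{1..<n}. R i s) = blk G (2 ^ i) (blk_len T i) t + (\<Sum>s\<in>{N+1..<n}. R i s)" .
    \<comment> \<open>A block is empty unless s * 2^i <= n, so at most n/Y values of s share the
      bound 256 Y/T.\<close>
    have "norm (\<Sum>s\<in>{N+1..<n}. R i s) \<le> (\<Sum>s\<in>{N+1..<n}. if s * 2 ^ i \<le> n then 256 * Y / T else 0)"
      using tail by (intro sum_norm_le) auto
    also have "\<dots> \<le> (\<Sum>s\<in>{1..n div 2 ^ i}. 256 * Y / T)"
    proof -
      have "(\<Sum>s\<in>{N+1..<n}. if s * 2 ^ i \<le> n then 256 * Y / T else 0) = (\<Sum>s\<in>{s\<in>{N+1..<n}. s * 2 ^ i \<le> n}. 256 * Y / T)"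
        by (rule sum.inter_filter[symmetric]) simp
      also have "\<dots> \<le> (\<Sum>s\<in>{1..n div 2 ^ i}. 256 * Y / T)"
        using T Y1 by (intro sum_mono2) (auto simp: less_eq_div_iff_mult_less_eq)
      finally show ?thesis .
    qed
    also have "\<dots> = real (n div 2 ^ i) * (256 * Y / T)" by simp
    also have "\<dots> \<le> (real n / Y) * (256 * Y / T)"
    proof (intro mult_right_mono)
      have "real (n div 2 ^ i) \<le> real n / real (2 ^ i)" by (rule of_nat_div_le_of_nat)
      thus "real (n div 2 ^ i) \<le> real n / Y" unfolding Y_def by simp
    qed (use T Y1 in auto)
    also have "\<dots> = 256 * real n / T" using Y1 by simp
    finally have "norm (\<Sum>s\<in>{N+1..<n}. R i s) \<le> 256 * real n / T" .
    thus ?thesis unfolding e by (intro order_trans[OF norm_triangle_ineq]) simp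
  qed
  have "norm (offdiag n G t) \<le> norm (\<Sum>s\<in>{1..<n}. small s) + norm (\<Sum>i\<in>{i0..<I}. \<Sum>s\<in>{1..<n}. R i s)"
    unfolding S by (rule norm_triangle_ineq)
  also have "\<dots> \<le> (real n)\<^sup>2 * exp (- G\<^sup>2 / (16 * (2 ^ i0)\<^sup>2)) + (\<Sum>i\<in>{i0..<I}. 256 * real n / T + norm (blk G (2 ^ i) (blk_len T i) t))"
    using bl by (intro add_mono sm sum_norm_le) auto
  finally show ?thesis .
qed

text \<open>The deviation G/sqrt 2 reproduces the weight of J. Pairs are ordered by the difference
  of their indices: difference 0 gives a harmonic sum, the positive and negative differences give
  \<open>offdiag\<close> and its conjugate.\<close>

lemma DP_gauss:
  assumes G: "0 < G"
  shows "integrable (density lborel (normal_density 0 (G / sqrt 2))) (\<lambda>u. (norm (DP n (t + u)))\<^sup>2)"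
    "(LINT u|density lborel (normal_density 0 (G / sqrt 2)). (norm (DP n (t + u)))\<^sup>2) \<le> 1 + ln (real n + 1) + 2 * norm (offdiag n G t)"
proof -
  define \<sigma> where "\<sigma> = G / sqrt 2"
  define M where "M = density lborel (normal_density 0 \<sigma>)"
  have sg: "0 < \<sigma>" unfolding \<sigma>_def using G by simp
  interpret M: prob_space M unfolding M_def using sg by (rule prob_space_normal_density)
  have [measurable_cong]: "sets M = sets borel" unfolding M_def by simp
  define g where "g = (\<lambda>k j u. pt (t + u) k * cnj (pt (t + u) j))"
  define c where "c = (\<lambda>k j. of_real (1 / sqrt (real k) * (1 / sqrt (real j))) * (cis (t * (ln (real j) - ln (real k))) * of_real (exp (- (\<sigma> * (ln (real j) - ln (real k)))\<^sup>2 / 2))) :: complex)"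
  have gf: "g k j u = of_real (1 / sqrt (real k) * (1 / sqrt (real j))) * (cis (t * (ln (real j) - ln (real k))) * cis (u * (ln (real j) - ln (real k))))" for k j u
  proof -
    have "g k j u = of_real (1 / sqrt (real k) * (1 / sqrt (real j))) * cis (- (t + u) * ln (real k) - - (t + u) * ln (real j))"
      unfolding g_def pt_def by (rule cis_prod_cnj)
    also have "- (t + u) * ln (real k) - - (t + u) * ln (real j) = t * (ln (real j) - ln (real k)) + u * (ln (real j) - ln (real k))"
      by (simp add: algebra_simps)
    finally show ?thesis by (simp only: cis_mult)
  qed
  have gi: "integrable M (g k j)" for k j
    unfolding gf[abs_def] by (rule M.integrable_const_bound[where B="norm (of_real (1 / sqrt (real k) * (1 / sqrt (real j))) :: complex)"])
      (auto simp: norm_mult norm_divide)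
  have gc: "(LINT u|M. g k j u) = c k j" for k j
    unfolding gf c_def M_def using gauss_char'[OF sg, of 0 "ln (real j) - ln (real k)"] by simp
  have sq: "of_real ((norm (DP n (t + u)))\<^sup>2) = (\<Sum>k\<in>{1..n}. \<Sum>j\<in>{1..n}. g k j u)" for u
    unfolding complex_norm_square DP_def cnj_sum sum_product g_def ..
  have iS: "integrable M (\<lambda>u. \<Sum>k\<in>{1..n}. \<Sum>j\<in>{1..n}. g k j u)"
    using gi by (intro Bochner_Integration.integrable_sum) auto
  have "integrable M (\<lambda>u. Re (of_real ((norm (DP n (t + u)))\<^sup>2)))" unfolding sq using iS by (rule integrable_Re)
  thus int: "integrable (density lborel (normal_density 0 (G / sqrt 2))) (\<lambda>u. (norm (DP n (t + u)))\<^sup>2)"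
    unfolding M_def \<sigma>_def by simp
  have "of_real (LINT u|M. (norm (DP n (t + u)))\<^sup>2) = (LINT u|M. (\<Sum>k\<in>{1..n}. \<Sum>j\<in>{1..n}. g k j u))"
    unfolding sq[symmetric] integral_complex_of_real ..
  also have "\<dots> = (\<Sum>k\<in>{1..n}. LINT u|M. (\<Sum>j\<in>{1..n}. g k j u))"
    using gi by (intro Bochner_Integration.integral_sum) auto
  also have "\<dots> = (\<Sum>k\<in>{1..n}. \<Sum>j\<in>{1..n}. LINT u|M. g k j u)"
    using gi by (intro sum.cong refl Bochner_Integration.integral_sum) auto
  also have "\<dots> = (\<Sum>k\<in>{1..<1+n}. \<Sum>j\<in>{1..<1+n}. c k j)"
    unfolding gc by (simp add: atLeastLessThanSuc_atLeastAtMost)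
  also have "\<dots> = (\<Sum>l\<in>{0..<n}. \<Sum>i\<in>{1..<1+n-l}. c (i+l) i) + (\<Sum>l\<in>{1..<n}. \<Sum>i\<in>{1..<1+n-l}. c i (i+l))"
    by (rule double_sum_by_difference)
  finally have A: "of_real (LINT u|M. (norm (DP n (t + u)))\<^sup>2) = (\<Sum>l\<in>{0..<n}. \<Sum>i\<in>{1..<1+n-l}. c (i+l) i) + (\<Sum>l\<in>{1..<n}. \<Sum>i\<in>{1..<1+n-l}. c i (i+l))" .
  have cPsi: "c i (i + l) = Psi G t (real i / real l) / of_nat l" if i: "1 \<le> i" and l: "1 \<le> l" for i l
  proof -
    have i0: "0 < real i" "0 < real l" using i l by auto
    have "ln (real (i + l)) - ln (real i) = ln (real (i + l) / real i)" using i0 by (intro ln_divide_pos[symmetric]) auto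
    also have "real (i + l) / real i = 1 + 1 / (real i / real l)" using i0 by (simp add: field_simps)
    finally have lg: "ln (real (i + l)) - ln (real i) = lam (real i / real l)" unfolding lam_def .
    have ex: "(\<sigma> * x)\<^sup>2 / 2 = (G * x)\<^sup>2 / 4" for x unfolding \<sigma>_def by (simp add: power_mult_distrib power_divide)
    have "real i / real l * (real i / real l + 1) = real i * real (i + l) / (real l)\<^sup>2"
      using i0 by (simp add: field_simps power2_eq_square)
    hence "sqrt (real i / real l * (real i / real l + 1)) = sqrt (real i) * sqrt (real (i + l)) / real l"
      using i0 by (simp only: real_sqrt_divide real_sqrt_mult real_sqrt_abs abs_of_pos)
    hence al: "alp G (real i / real l) / real l = 1 / sqrt (real i) * (1 / sqrt (real (i + l))) * exp (- (G * lam (real i / real l))\<^sup>2 / 4)"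
      unfolding alp_def using i0 by (simp del: of_nat_add)
    have "c i (i + l) = of_real (1 / sqrt (real i) * (1 / sqrt (real (i + l))) * exp (- (G * lam (real i / real l))\<^sup>2 / 4)) * cis (t * lam (real i / real l))"
      unfolding c_def lg minus_divide_left[symmetric] ex by (simp del: of_nat_add)
    also have "\<dots> = of_real (alp G (real i / real l) / real l) * cis (t * lam (real i / real l))" unfolding al ..
    finally show ?thesis unfolding Psi_def by simp
  qed
  have ccnj: "c k j = cnj (c j k)" for k j
  proof -
    have "(\<sigma> * (ln (real j) - ln (real k)))\<^sup>2 = (\<sigma> * (ln (real k) - ln (real j)))\<^sup>2" by (simp add: power_mult_distrib power2_commute)
    moreover have "cis (t * (ln (real j) - ln (real k))) = cnj (cis (t * (ln (real k) - ln (real j))))" by (simp add: cis_cnj algebra_simps)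
    ultimately show ?thesis unfolding c_def by (simp add: mult_ac)
  qed
  have s2: "(\<Sum>l\<in>{1..<n}. \<Sum>i\<in>{1..<1+n-l}. c i (i+l)) = offdiag n G t"
    unfolding offdiag_def using cPsi by (intro sum.cong) auto
  have s1: "(\<Sum>l\<in>{1..<n}. \<Sum>i\<in>{1..<1+n-l}. c (i+l) i) = cnj (offdiag n G t)"
    unfolding s2[symmetric] cnj_sum by (intro sum.cong refl ccnj)
  have s0: "norm (\<Sum>i\<in>{1..<1+n}. c i i) \<le> 1 + ln (real n + 1)"
  proof -
    have cii: "norm (c i i) = 1 / real i" for i
    proof -
      have "1 / sqrt (real i) * (1 / sqrt (real i)) = 1 / real i" by simp
      hence "c i i = of_real (1 / real i)" unfolding c_def by (simp only: diff_self) simp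
      thus ?thesis by (simp add: norm_divide)
    qed
    have "norm (\<Sum>i\<in>{1..<1+n}. c i i) \<le> (\<Sum>i\<in>{1..<1+n}. 1 / real i)"
      by (intro sum_norm_le) (simp add: cii)
    also have "\<dots> \<le> 1 + ln (real (1 + n))" by (rule sum_inverse_le) simp
    finally show ?thesis by (simp add: add.commute)
  qed
  have A': "norm (of_real (LINT u|M. (norm (DP n (t + u)))\<^sup>2) :: complex) \<le> (1 + ln (real n + 1)) + norm (offdiag n G t) + norm (offdiag n G t)"
  proof (cases "n = 0")
    case True thus ?thesis by (simp add: DP_def)
  next
    case False
    hence "{0..<n} = insert 0 {1..<n}" by auto
    hence "(\<Sum>l\<in>{0..<n}. \<Sum>i\<in>{1..<1+n-l}. c (i+l) i) = (\<Sum>i\<in>{1..<1+n}. c i i) + cnj (offdiag n G t)"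
      using s1 by simp
    hence "of_real (LINT u|M. (norm (DP n (t + u)))\<^sup>2) = (\<Sum>i\<in>{1..<1+n}. c i i) + cnj (offdiag n G t) + offdiag n G t"
      unfolding A s2 by simp
    hence "norm (of_real (LINT u|M. (norm (DP n (t + u)))\<^sup>2) :: complex) = norm ((\<Sum>i\<in>{1..<1+n}. c i i) + cnj (offdiag n G t) + offdiag n G t)" by simp
    also have "\<dots> \<le> norm (\<Sum>i\<in>{1..<1+n}. c i i) + norm (cnj (offdiag n G t)) + norm (offdiag n G t)"
      by (intro order_trans[OF norm_triangle_ineq] add_right_mono norm_triangle_ineq)
    finally show ?thesis using s0 unfolding complex_mod_cnj by linarith
  qed
  have "(LINT u|M. (norm (DP n (t + u)))\<^sup>2) \<le> norm (of_real (LINT u|M. (norm (DP n (t + u)))\<^sup>2) :: complex)" by simp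
  thus "(LINT u|density lborel (normal_density 0 (G / sqrt 2)). (norm (DP n (t + u)))\<^sup>2) \<le> 1 + ln (real n + 1) + 2 * norm (offdiag n G t)"
    using A' unfolding M_def \<sigma>_def by linarith
qed

lemma cauchy_kernel_integral: "(\<integral>\<^sup>+u. ennreal (1 / (1/4 + (t + u)\<^sup>2)) \<partial>lborel) \<le> ennreal (4 * pi)"
proof -
  have "(\<integral>\<^sup>+u. ennreal (1 / (1/4 + (t + u)\<^sup>2)) \<partial>lborel) = (\<integral>\<^sup>+x. ennreal (1 / (1/4 + x\<^sup>2)) \<partial>lborel)"
    using nn_integral_real_affine[of "\<lambda>x. ennreal (1 / (1/4 + x\<^sup>2))" 1 t] by simp
  also have "\<dots> \<le> (\<integral>\<^sup>+x. ennreal 4 * ennreal (inverse (1 + x\<^sup>2)) \<partial>lborel)"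
  proof (intro nn_integral_mono)
    fix x :: real
    have "1 / (1/4 + x\<^sup>2) \<le> 1 / ((1 + x\<^sup>2) / 4)" by (intro divide_left_mono) (auto intro!: mult_pos_pos add_pos_nonneg)
    also have "1 / ((1 + x\<^sup>2) / 4) = 4 * inverse (1 + x\<^sup>2)" by (simp only: divide_inverse inverse_mult_distrib inverse_inverse_eq mult_1 mult.commute)
    finally have "ennreal (1 / (1/4 + x\<^sup>2)) \<le> ennreal (4 * inverse (1 + x\<^sup>2))" by (rule ennreal_leI)
    also have "\<dots> = ennreal 4 * ennreal (inverse (1 + x\<^sup>2))" by (rule ennreal_mult') simp
    finally show "ennreal (1 / (1/4 + x\<^sup>2)) \<le> ennreal 4 * ennreal (inverse (1 + x\<^sup>2))" .
  qed
  also have "\<dots> = ennreal 4 * (\<integral>\<^sup>+x. ennreal (inverse (1 + x\<^sup>2)) \<partial>lborel)" by (rule nn_integral_cmult) simp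
  also have "(\<integral>\<^sup>+x. ennreal (inverse (1 + x\<^sup>2)) \<partial>lborel) = ennreal pi"
  proof -
    have i: "integrable lborel (\<lambda>x::real. inverse (1 + x\<^sup>2))" using integrable_inverse_1_plus_square by (simp add: set_integrable_def)
    have "(LINT x|lborel. inverse (1 + x\<^sup>2)) = pi" using LBINT_inverse_1_plus_square
      by (simp add: interval_lebesgue_integral_def set_lebesgue_integral_def)
    thus ?thesis using nn_integral_eq_integral[OF i] by simp
  qed
  also have "ennreal 4 * ennreal pi = ennreal (4 * pi)" by (rule ennreal_mult'[symmetric]) simp
  finally show ?thesis .
qed

text \<open>|zeta|^2 is at most twice |DP|^2 plus twice the squared error, and the three error terms
  of \<open>zeta_approx\<close> are averaged separately. Besides the constant these are w, with its
  peak where t + u is near 0, and v, supported on |t + u| > n; the peak and the support lie at |u|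
  >= T/2 and |u| >= n/2, where the Gaussian compensates.\<close>

lemma J_le:
  assumes T: "1 \<le> T" "T \<le> t" "t \<le> 2 * T" and G: "0 < G" and n: "4 * T \<le> real n"
  shows "J 1 t G \<le> ennreal (2 * (1 + ln (real n + 1) + 2 * norm (offdiag n G t)) + 60000 + 480 * real n / T + 6400 * G\<^sup>2 * exp (- (real n)\<^sup>2 / (8 * G\<^sup>2)))"
proof -
  define \<sigma> where "\<sigma> = G / sqrt 2"
  define nd where "nd = normal_density 0 \<sigma>"
  define E where "E = exp (- (real n)\<^sup>2 / (8 * G\<^sup>2))"
  have sg: "0 < \<sigma>" unfolding \<sigma>_def using G by simp
  have n1: "1 \<le> n" using n T by linarith
  have s2: "2 * \<sigma>\<^sup>2 = G\<^sup>2" unfolding \<sigma>_def by (simp add: power_divide)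
  have s3: "2 * pi * \<sigma>\<^sup>2 = pi * G\<^sup>2" using s2 by simp
  have ndf: "nd u = 1 / (sqrt pi * G) * exp (- ((u / G)\<^sup>2))" for u
    unfolding nd_def normal_density_def s2 s3 using G by (simp add: real_sqrt_mult power_divide)
  have nd0: "0 \<le> nd u" for u unfolding ndf using G by simp
  have [measurable]: "nd \<in> borel_measurable borel" unfolding nd_def by measurable
  have nd1: "(\<integral>\<^sup>+u. ennreal (nd u) \<partial>lborel) = 1"
  proof -
    interpret N: prob_space "density lborel nd" unfolding nd_def using sg by (rule prob_space_normal_density)
    have "emeasure (density lborel nd) UNIV = 1" using N.emeasure_space_1 by simp
    thus ?thesis by (subst (asm) emeasure_density) auto
  qed
  define d where "d = (\<lambda>u. (norm (DP n (t + u)))\<^sup>2)"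
  have dm [measurable]: "d \<in> borel_measurable borel"
    unfolding d_def DP_def pt_def by measurable
  define w where "w = (\<lambda>u. 1 / (1/4 + (t + u)\<^sup>2))"
  define v where "v = (\<lambda>u. if real n < \<bar>t + u\<bar> then (t + u)\<^sup>2 else 0)"
  have [measurable]: "w \<in> borel_measurable borel" "v \<in> borel_measurable borel" unfolding w_def v_def by measurable
  have w0: "0 \<le> w u" for u unfolding w_def by (simp add: add_nonneg_nonneg)
  have v0: "0 \<le> v u" for u unfolding v_def by simp
  have d0: "0 \<le> d u" for u unfolding d_def by simp
  have zb: "(norm (zeta (Complex (1/2) (t + u))))\<^sup>2 \<le> 2 * d u + 60000 + 16 * real n * w u + 200 * v u" for u
  proof -
    define z where "z = zeta (Complex (1/2) (t + u))"
    have za: "(norm (z - DP n (t + u)))\<^sup>2 \<le> 30000 + 8 * real n * w u + 100 * v u"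
      using zeta_approx[OF n1, of "t + u"] unfolding z_def w_def v_def by (simp split: if_splits)
    have "norm z \<le> norm (DP n (t + u)) + norm (z - DP n (t + u))" using norm_triangle_sub[of z "DP n (t + u)"] by simp
    from power_mono[OF this, of 2] have "(norm z)\<^sup>2 \<le> (norm (DP n (t + u)) + norm (z - DP n (t + u)))\<^sup>2" by simp
    also have "\<dots> \<le> 2 * d u + 2 * (norm (z - DP n (t + u)))\<^sup>2"
      unfolding d_def using sum_squares_bound[of "norm (DP n (t + u))" "norm (z - DP n (t + u))"] by (simp add: power2_sum)
    finally show ?thesis using za unfolding z_def by linarith
  qed
  \<comment> \<open>Near the peak of w one has |u| >= T/2, and there the normal density is at most
    2/T whatever G is, because x exp (- x^2) <= 1 for x = T/(2 G).\<close>
  have ndw: "nd u * w u \<le> 4 / T * nd u + 2 / T * w u" for u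
  proof (cases "T / 2 \<le> \<bar>t + u\<bar>")
    case True
    have "(T / 2)\<^sup>2 \<le> \<bar>t + u\<bar>\<^sup>2" using True T by (intro power_mono) auto
    hence "T * T / 4 \<le> (t + u)\<^sup>2" by (simp add: power2_eq_square)
    moreover have "T * 1 \<le> T * T" using T by (intro mult_left_mono) auto
    ultimately have "T / 4 \<le> 1/4 + (t + u)\<^sup>2" by linarith
    hence "w u \<le> 1 / (T / 4)" unfolding w_def using T by (intro divide_left_mono mult_pos_pos) auto
    hence "nd u * w u \<le> nd u * (4 / T)" using nd0[of u] by (intro mult_left_mono) auto
    moreover have "0 \<le> 2 / T * w u" using w0[of u] T by simp
    ultimately show ?thesis by (simp add: mult.commute)
  next
    case False
    hence u: "T / 2 \<le> \<bar>u\<bar>" using T by linarith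
    define x where "x = T / (2 * G)"
    have "x \<le> \<bar>u / G\<bar>" unfolding x_def using u G by (simp add: abs_divide field_simps)
    moreover have x0: "0 \<le> x" unfolding x_def using T G by simp
    ultimately have "x\<^sup>2 \<le> \<bar>u / G\<bar>\<^sup>2" by (rule power_mono)
    hence "x\<^sup>2 \<le> (u / G)\<^sup>2" by (simp only: power2_abs)
    hence ex: "exp (- ((u / G)\<^sup>2)) \<le> exp (- x\<^sup>2)" by simp
    have "x \<le> 1 + x\<^sup>2" using sum_squares_bound[of x 1] x0 by simp
    also have "\<dots> \<le> exp (x\<^sup>2)" by (rule exp_ge_add_one_self)
    finally have xe: "x * exp (- x\<^sup>2) \<le> 1" by (simp add: exp_minus divide_simps)
    have "1 * G \<le> sqrt pi * G" using G pi_ge_two by (intro mult_right_mono) (auto simp: real_le_rsqrt)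
    hence "1 / (sqrt pi * G) \<le> 1 / G" using G by (intro divide_left_mono) auto
    hence "nd u \<le> 1 / G * exp (- x\<^sup>2)" unfolding ndf using ex G by (intro mult_mono) auto
    also have "\<dots> = 2 / T * (x * exp (- x\<^sup>2))" unfolding x_def using T G by simp
    also have "\<dots> \<le> 2 / T * 1" using xe T by (intro mult_left_mono) auto
    finally have "nd u * w u \<le> 2 / T * w u" using w0[of u] by (intro mult_right_mono) auto
    moreover have "0 \<le> 4 / T * nd u" using nd0[of u] T by simp
    ultimately show ?thesis by simp
  qed
  define nd2 where "nd2 = normal_density 0 (sqrt 2 * G)"
  have nd2f: "nd2 u = 1 / (2 * sqrt pi * G) * exp (- (u\<^sup>2 / (4 * G\<^sup>2)))" for u
  proof -
    have a: "2 * pi * (sqrt 2 * G)\<^sup>2 = 2\<^sup>2 * pi * G\<^sup>2" "2 * (sqrt 2 * G)\<^sup>2 = 4 * G\<^sup>2" by (simp_all add: power_mult_distrib)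
    show ?thesis unfolding nd2_def normal_density_def a using G by (simp add: real_sqrt_mult)
  qed
  have [measurable]: "nd2 \<in> borel_measurable borel" unfolding nd2_def by measurable
  have nd21: "(\<integral>\<^sup>+u. ennreal (nd2 u) \<partial>lborel) = 1"
  proof -
    interpret N: prob_space "density lborel nd2" unfolding nd2_def using G by (intro prob_space_normal_density) simp
    have "emeasure (density lborel nd2) UNIV = 1" using N.emeasure_space_1 by simp
    thus ?thesis by (subst (asm) emeasure_density) auto
  qed
  have E0: "0 \<le> 32 * G\<^sup>2 * E" unfolding E_def by simp
  \<comment> \<open>With y = u^2/(4 G^2) the weight is exp (- 4 y): one factor exp (- y) absorbs (t
    + u)^2, the factor exp (- 2 y) yields E, and the last exp (- y) is left as the wider density
    \<open>nd2\<close>.\<close>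
  have ndv: "nd u * v u \<le> 32 * G\<^sup>2 * E * nd2 u" for u
  proof (cases "real n < \<bar>t + u\<bar>")
    case False
    have "0 \<le> nd2 u" unfolding nd2f using G by simp
    thus ?thesis using False E0 unfolding v_def by simp
  next
    case True
    have u1: "\<bar>t + u\<bar> \<le> 2 * \<bar>u\<bar>" "real n / 2 \<le> \<bar>u\<bar>" using True n T by linarith+
    define y where "y = u\<^sup>2 / (4 * G\<^sup>2)"
    have "\<bar>t + u\<bar>\<^sup>2 \<le> (2 * \<bar>u\<bar>)\<^sup>2" using u1 by (intro power_mono) auto
    hence "(t + u)\<^sup>2 \<le> 16 * G\<^sup>2 * y" unfolding y_def using G by (simp add: power_mult_distrib)
    hence "(t + u)\<^sup>2 * exp (- y) \<le> 16 * G\<^sup>2 * y * exp (- y)" by (rule mult_right_mono) simp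
    also have "\<dots> = 16 * G\<^sup>2 * (y * exp (- y))" by (rule mult.assoc)
    also have "\<dots> \<le> 16 * G\<^sup>2 * 1"
    proof (intro mult_left_mono)
      have "y \<le> exp y" using exp_ge_add_one_self[of y] by linarith
      thus "y * exp (- y) \<le> 1" by (simp add: exp_minus divide_simps)
    qed simp
    finally have a: "(t + u)\<^sup>2 * exp (- y) \<le> 16 * G\<^sup>2" by simp
    have "(real n / 2)\<^sup>2 \<le> \<bar>u\<bar>\<^sup>2" using u1 by (intro power_mono) auto
    hence "(real n)\<^sup>2 / (8 * G\<^sup>2) \<le> 2 * y" unfolding y_def using G by (simp add: power_divide field_simps)
    hence b: "exp (- (2 * y)) \<le> E" unfolding E_def by simp
    have "exp (- ((u / G)\<^sup>2)) = exp (- y) * exp (- (2 * y)) * exp (- y)"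
      unfolding y_def using G by (simp add: power_divide flip: exp_add)
    hence "nd u * v u = (1 / (sqrt pi * G)) * (((t + u)\<^sup>2 * exp (- y)) * exp (- (2 * y)) * exp (- y))"
      unfolding ndf v_def using True by simp
    also have "\<dots> \<le> (1 / (sqrt pi * G)) * ((16 * G\<^sup>2) * E * exp (- y))"
      by (rule mult_left_mono, rule mult_right_mono, rule mult_mono[OF a b]) (use G in auto)
    also have "\<dots> = 32 * G\<^sup>2 * E * nd2 u" unfolding nd2f y_def by (simp add: mult_ac)
    finally show ?thesis .
  qed
  define c where "c = 1 / (sqrt pi * G)"
  have c0: "0 \<le> c" unfolding c_def using G by simp
  have "J 1 t G \<le> ennreal c * (\<integral>\<^sup>+u. ennreal ((2 * d u + 60000 + 16 * real n * w u + 200 * v u) * exp (- ((u / G)\<^sup>2))) \<partial>lborel)"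
    unfolding J_def c_def[symmetric] using zb
    by (intro mult_left_mono nn_integral_mono ennreal_leI mult_right_mono) auto
  also have "\<dots> = (\<integral>\<^sup>+u. ennreal c * ennreal ((2 * d u + 60000 + 16 * real n * w u + 200 * v u) * exp (- ((u / G)\<^sup>2))) \<partial>lborel)"
    by (rule nn_integral_cmult[symmetric]) measurable
  also have "\<dots> \<le> (\<integral>\<^sup>+u. ennreal 2 * (ennreal (nd u) * ennreal (d u)) + (ennreal (60000 + 16 * real n * (4 / T)) * ennreal (nd u) + (ennreal (16 * real n * (2 / T)) * ennreal (w u) + ennreal (200 * (32 * G\<^sup>2 * E)) * ennreal (nd2 u))) \<partial>lborel)"
  proof (rule nn_integral_mono)
    fix u
    have "c * ((2 * d u + 60000 + 16 * real n * w u + 200 * v u) * exp (- ((u / G)\<^sup>2))) = nd u * (2 * d u + 60000 + 16 * real n * w u + 200 * v u)"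
      unfolding ndf c_def by simp
    also have "\<dots> = 2 * (nd u * d u) + (60000 * nd u + 16 * real n * (nd u * w u) + 200 * (nd u * v u))" by (simp add: algebra_simps)
    also have "\<dots> \<le> 2 * (nd u * d u) + (60000 * nd u + 16 * real n * (4 / T * nd u + 2 / T * w u) + 200 * (32 * G\<^sup>2 * E * nd2 u))"
      by (intro add_mono mult_left_mono order_refl ndw ndv) auto
    also have "\<dots> = 2 * (nd u * d u) + ((60000 + 16 * real n * (4 / T)) * nd u + (16 * real n * (2 / T) * w u + 200 * (32 * G\<^sup>2 * E) * nd2 u))"
      by (simp add: algebra_simps)
    finally have le: "c * ((2 * d u + 60000 + 16 * real n * w u + 200 * v u) * exp (- ((u / G)\<^sup>2))) \<le> \<dots>" .
    have nn: "0 \<le> nd2 u" unfolding nd2f using G by simp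
    have p: "0 \<le> 2 * (nd u * d u)" "0 \<le> (60000 + 16 * real n * (4 / T)) * nd u" "0 \<le> 16 * real n * (2 / T) * w u" "0 \<le> 200 * (32 * G\<^sup>2 * E) * nd2 u"
      using nd0[of u] d0[of u] w0[of u] nn E0 T by (auto intro!: mult_nonneg_nonneg add_nonneg_nonneg)
    have "ennreal c * ennreal ((2 * d u + 60000 + 16 * real n * w u + 200 * v u) * exp (- ((u / G)\<^sup>2))) = ennreal (c * ((2 * d u + 60000 + 16 * real n * w u + 200 * v u) * exp (- ((u / G)\<^sup>2))))"
      using c0 by (rule ennreal_mult'[symmetric])
    also have "\<dots> \<le> ennreal (2 * (nd u * d u) + ((60000 + 16 * real n * (4 / T)) * nd u + (16 * real n * (2 / T) * w u + 200 * (32 * G\<^sup>2 * E) * nd2 u)))"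
      using le by (rule ennreal_leI)
    also have "\<dots> = ennreal (2 * (nd u * d u)) + (ennreal ((60000 + 16 * real n * (4 / T)) * nd u) + (ennreal (16 * real n * (2 / T) * w u) + ennreal (200 * (32 * G\<^sup>2 * E) * nd2 u)))"
      using p by (simp only: ennreal_plus add_nonneg_nonneg)
    also have "\<dots> = ennreal 2 * (ennreal (nd u) * ennreal (d u)) + (ennreal (60000 + 16 * real n * (4 / T)) * ennreal (nd u) + (ennreal (16 * real n * (2 / T)) * ennreal (w u) + ennreal (200 * (32 * G\<^sup>2 * E)) * ennreal (nd2 u)))"
      using nd0[of u] w0[of u] nn d0[of u] by (simp only: ennreal_mult'' mult_nonneg_nonneg)
    finally show "ennreal c * ennreal ((2 * d u + 60000 + 16 * real n * w u + 200 * v u) * exp (- ((u / G)\<^sup>2))) \<le> \<dots>" .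
  qed
  also have "\<dots> = ennreal 2 * (\<integral>\<^sup>+u. ennreal (nd u) * ennreal (d u) \<partial>lborel) + (ennreal (60000 + 16 * real n * (4 / T)) * (\<integral>\<^sup>+u. ennreal (nd u) \<partial>lborel)
      + (ennreal (16 * real n * (2 / T)) * (\<integral>\<^sup>+u. ennreal (w u) \<partial>lborel) + ennreal (200 * (32 * G\<^sup>2 * E)) * (\<integral>\<^sup>+u. ennreal (nd2 u) \<partial>lborel)))"
  proof -
    have m: "(\<lambda>u. ennreal 2 * (ennreal (nd u) * ennreal (d u))) \<in> borel_measurable lborel" "(\<lambda>u. ennreal a * ennreal (nd u)) \<in> borel_measurable lborel"
      "(\<lambda>u. ennreal a * ennreal (w u)) \<in> borel_measurable lborel" "(\<lambda>u. ennreal a * ennreal (nd2 u)) \<in> borel_measurable lborel" for a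
      by measurable
    show ?thesis by (simp only: nn_integral_add m borel_measurable_add) (subst nn_integral_cmult, measurable)+
  qed
  also have "(\<integral>\<^sup>+u. ennreal (nd u) * ennreal (d u) \<partial>lborel) = ennreal (LINT u|density lborel nd. d u)"
  proof -
    have "(\<integral>\<^sup>+u. ennreal (nd u) * ennreal (d u) \<partial>lborel) = (\<integral>\<^sup>+u. ennreal (d u) \<partial>density lborel nd)"
      by (rule nn_integral_density[symmetric]) measurable
    also have "\<dots> = ennreal (LINT u|density lborel nd. d u)"
      using DP_gauss(1)[OF G, of n t] unfolding d_def nd_def \<sigma>_def by (intro nn_integral_eq_integral) auto
    finally show ?thesis .
  qed
  also have "ennreal 2 * ennreal (LINT u|density lborel nd. d u) + (ennreal (60000 + 16 * real n * (4 / T)) * (\<integral>\<^sup>+u. ennreal (nd u) \<partial>lborel)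
      + (ennreal (16 * real n * (2 / T)) * (\<integral>\<^sup>+u. ennreal (w u) \<partial>lborel) + ennreal (200 * (32 * G\<^sup>2 * E)) * (\<integral>\<^sup>+u. ennreal (nd2 u) \<partial>lborel)))
    \<le> ennreal 2 * ennreal (1 + ln (real n + 1) + 2 * norm (offdiag n G t)) + (ennreal (60000 + 16 * real n * (4 / T)) * 1
      + (ennreal (16 * real n * (2 / T)) * ennreal (4 * pi) + ennreal (200 * (32 * G\<^sup>2 * E)) * 1))"
    unfolding nd1 nd21 w_def using DP_gauss(2)[OF G, of n t] cauchy_kernel_integral[of t]
    unfolding d_def nd_def \<sigma>_def by (intro add_mono mult_left_mono ennreal_leI) auto
  also have "\<dots> = ennreal (2 * (1 + ln (real n + 1) + 2 * norm (offdiag n G t)) + ((60000 + 16 * real n * (4 / T)) + (16 * real n * (2 / T) * (4 * pi) + 200 * (32 * G\<^sup>2 * E))))"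
  proof -
    have "0 \<le> 1 + ln (real n + 1) + 2 * norm (offdiag n G t)" using ln_ge_zero[of "real n + 1"] by simp
    hence p: "0 \<le> 2 * (1 + ln (real n + 1) + 2 * norm (offdiag n G t))" "0 \<le> 60000 + 16 * real n * (4 / T)" "0 \<le> 16 * real n * (2 / T) * (4 * pi)" "0 \<le> 200 * (32 * G\<^sup>2 * E)"
      using T E0 by auto
    have q: "ennreal 2 * ennreal (1 + ln (real n + 1) + 2 * norm (offdiag n G t)) = ennreal (2 * (1 + ln (real n + 1) + 2 * norm (offdiag n G t)))"
      "ennreal (16 * real n * (2 / T)) * ennreal (4 * pi) = ennreal (16 * real n * (2 / T) * (4 * pi))"
      by (rule ennreal_mult'[symmetric], simp) (rule ennreal_mult''[symmetric], simp)
    show ?thesis unfolding q mult_1_right using p by (simp only: ennreal_plus add_nonneg_nonneg)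
  qed
  also have "\<dots> \<le> ennreal (2 * (1 + ln (real n + 1) + 2 * norm (offdiag n G t)) + 60000 + 480 * real n / T + 6400 * G\<^sup>2 * E)"
  proof (rule ennreal_leI)
    have "16 * real n * (4 / T) + 16 * real n * (2 / T) * (4 * pi) = (real n / T) * (64 + 128 * pi)" by (simp add: algebra_simps add_divide_distrib)
    also have "\<dots> \<le> (real n / T) * 480" using pi_approx(2) T by (intro mult_left_mono) auto
    finally show "2 * (1 + ln (real n + 1) + 2 * norm (offdiag n G t)) + ((60000 + 16 * real n * (4 / T)) + (16 * real n * (2 / T) * (4 * pi) + 200 * (32 * G\<^sup>2 * E)))
      \<le> 2 * (1 + ln (real n + 1) + 2 * norm (offdiag n G t)) + 60000 + 480 * real n / T + 6400 * G\<^sup>2 * E" by simp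
  qed
  finally show ?thesis unfolding E_def .
qed

section \<open>The moments of \<open>J\<close>\<close>

lemma power_sum_le:
  fixes x :: "'a \<Rightarrow> real"
  assumes A: "finite A" "\<And>a. a \<in> A \<Longrightarrow> 0 \<le> x a" and m: "1 \<le> m"
  shows "(\<Sum>a\<in>A. x a) ^ m \<le> real (card A) ^ m * (\<Sum>a\<in>A. x a ^ m)"
proof (cases "A = {}")
  case True thus ?thesis using m by (simp add: zero_power)
next
  case False
  hence "Max (x ` A) \<in> x ` A" using A by (intro Max_in) auto
  then obtain a where a: "a \<in> A" "x a = Max (x ` A)" by auto
  have "(\<Sum>a\<in>A. x a) \<le> real (card A) * x a"
    by (rule sum_bounded_above) (use A a in auto)
  hence "(\<Sum>a\<in>A. x a) ^ m \<le> (real (card A) * x a) ^ m" using A by (intro power_mono sum_nonneg)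
  also have "\<dots> = real (card A) ^ m * x a ^ m" by (rule power_mult_distrib)
  also have "\<dots> \<le> real (card A) ^ m * (\<Sum>a\<in>A. x a ^ m)"
    using A a by (intro mult_left_mono member_le_sum) auto
  finally show ?thesis .
qed

lemma power_add_le:
  fixes x y :: real
  assumes "0 \<le> x" "0 \<le> y"
  shows "(x + y) ^ m \<le> 2 ^ m * (x ^ m + y ^ m)"
proof -
  have "(x + y) ^ m \<le> (2 * max x y) ^ m" using assms by (intro power_mono) auto
  also have "\<dots> = 2 ^ m * (max x y) ^ m" by (rule power_mult_distrib)
  also have "\<dots> \<le> 2 ^ m * (x ^ m + y ^ m)" using assms by (intro mult_left_mono) (auto simp: max_def)
  finally show ?thesis .
qed

text \<open>In 8 = 2 * 4 the factor 2 comes from \<open>power_add_le\<close> and 4 is the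
  coefficient of the sum.\<close>

lemma moment_sum_bound:
  fixes f :: "'a \<Rightarrow> real \<Rightarrow> real"
  assumes A: "finite A" and m: "1 \<le> m" and T: "0 \<le> T" and B: "0 \<le> B" and M: "0 \<le> M"
    and f0: "\<And>a t. 0 \<le> f a t" and f1 [measurable]: "\<And>a. a \<in> A \<Longrightarrow> f a \<in> borel_measurable borel"
    and g: "\<And>t. t \<in> {T..2*T} \<Longrightarrow> g t \<le> ennreal (B + 4 * (\<Sum>a\<in>A. f a t))"
    and mom: "\<And>a. a \<in> A \<Longrightarrow> (\<integral>\<^sup>+t\<in>{T..2*T}. ennreal (f a t ^ m) \<partial>lborel) \<le> ennreal M"
  shows "(\<integral>\<^sup>+t\<in>{T..2*T}. g t ^ m \<partial>lborel) \<le> ennreal (2 ^ m * B ^ m * T + 8 ^ m * real (card A) ^ m * (real (card A) * M))"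
proof -
  define c where "c = (8::real) ^ m * real (card A) ^ m"
  define d where "d = 2 ^ m * B ^ m"
  have c0: "0 \<le> c" and d0: "0 \<le> d" unfolding c_def d_def using B by auto
  have pw: "g t ^ m \<le> ennreal d + ennreal c * (\<Sum>a\<in>A. ennreal (f a t ^ m))" if t: "t \<in> {T..2*T}" for t
  proof -
    define S where "S = (\<Sum>a\<in>A. f a t)"
    have S0: "0 \<le> S" unfolding S_def using f0 by (intro sum_nonneg)
    have "(B + 4 * S) ^ m \<le> 2 ^ m * (B ^ m + (4 * S) ^ m)" using B S0 by (intro power_add_le) auto
    also have "\<dots> = d + 8 ^ m * S ^ m"
      unfolding d_def by (simp add: algebra_simps power_mult_distrib flip: power_mult_distrib[of 2 4])
    also have "\<dots> \<le> d + 8 ^ m * (real (card A) ^ m * (\<Sum>a\<in>A. f a t ^ m))"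
      unfolding S_def using A f0 m by (intro add_left_mono mult_left_mono power_sum_le) auto
    also have "\<dots> = d + c * (\<Sum>a\<in>A. f a t ^ m)" unfolding c_def by simp
    finally have le: "(B + 4 * S) ^ m \<le> d + c * (\<Sum>a\<in>A. f a t ^ m)" .
    have "g t ^ m \<le> ennreal (B + 4 * S) ^ m" using g[OF t] unfolding S_def by (intro power_mono) auto
    also have "\<dots> = ennreal ((B + 4 * S) ^ m)" using B S0 by (intro ennreal_power) auto
    also have "\<dots> \<le> ennreal (d + c * (\<Sum>a\<in>A. f a t ^ m))" using le by (rule ennreal_leI)
    also have "\<dots> = ennreal d + ennreal (c * (\<Sum>a\<in>A. f a t ^ m))"
      using c0 d0 f0 by (intro ennreal_plus mult_nonneg_nonneg sum_nonneg) auto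
    also have "ennreal (c * (\<Sum>a\<in>A. f a t ^ m)) = ennreal c * ennreal (\<Sum>a\<in>A. f a t ^ m)" using c0 by (rule ennreal_mult')
    also have "ennreal (\<Sum>a\<in>A. f a t ^ m) = (\<Sum>a\<in>A. ennreal (f a t ^ m))" using f0 by (intro sum_ennreal[symmetric]) auto
    finally show ?thesis .
  qed
  have "(\<integral>\<^sup>+t\<in>{T..2*T}. g t ^ m \<partial>lborel) \<le>
    (\<integral>\<^sup>+t. (ennreal d * indicator {T..2*T} t + ennreal c * (\<Sum>a\<in>A. ennreal (f a t ^ m) * indicator {T..2*T} t)) \<partial>lborel)"
  proof (rule nn_integral_mono)
    fix t
    show "g t ^ m * indicator {T..2*T} t \<le> ennreal d * indicator {T..2*T} t + ennreal c * (\<Sum>a\<in>A. ennreal (f a t ^ m) * indicator {T..2*T} t)"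
      using pw[of t] by (cases "t \<in> {T..2*T}") auto
  qed
  also have "\<dots> = (\<integral>\<^sup>+t. ennreal d * indicator {T..2*T} t \<partial>lborel) + (\<integral>\<^sup>+t. ennreal c * (\<Sum>a\<in>A. ennreal (f a t ^ m) * indicator {T..2*T} t) \<partial>lborel)"
    using A by (intro nn_integral_add) measurable
  also have "(\<integral>\<^sup>+t. ennreal d * indicator {T..2*T} t \<partial>lborel) = ennreal d * ennreal T"
    using T by (subst nn_integral_cmult_indicator) auto
  also have "(\<integral>\<^sup>+t. ennreal c * (\<Sum>a\<in>A. ennreal (f a t ^ m) * indicator {T..2*T} t) \<partial>lborel)
    = ennreal c * (\<integral>\<^sup>+t. (\<Sum>a\<in>A. ennreal (f a t ^ m) * indicator {T..2*T} t) \<partial>lborel)"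
    using A by (intro nn_integral_cmult) measurable
  also have "(\<integral>\<^sup>+t. (\<Sum>a\<in>A. ennreal (f a t ^ m) * indicator {T..2*T} t) \<partial>lborel) = (\<Sum>a\<in>A. \<integral>\<^sup>+t\<in>{T..2*T}. ennreal (f a t ^ m) \<partial>lborel)"
    by (intro nn_integral_sum) measurable
  also have "ennreal d * ennreal T + ennreal c * (\<Sum>a\<in>A. \<integral>\<^sup>+t\<in>{T..2*T}. ennreal (f a t ^ m) \<partial>lborel)
    \<le> ennreal d * ennreal T + ennreal c * (\<Sum>a\<in>A. ennreal M)"
    using mom by (intro add_left_mono mult_left_mono sum_mono) auto
  also have "(\<Sum>a\<in>A. ennreal M) = ennreal (real (card A) * M)"
    using M by (simp add: ennreal_mult' ennreal_of_nat_eq_real_of_nat)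
  also have "ennreal d * ennreal T + ennreal c * ennreal (real (card A) * M) = ennreal (d * T + c * (real (card A) * M))"
    using c0 d0 M T by (simp add: ennreal_plus ennreal_mult')
  finally show ?thesis unfolding c_def d_def .
qed

text \<open>The inequality x <= 1 + x^2 takes the place of Cauchy-Schwarz; the additional T is
  harmless for the first moment.\<close>

lemma set_nn_integral_le_square:
  fixes f :: "real \<Rightarrow> ennreal"
  assumes T: "0 \<le> T" and M: "0 \<le> M" and f: "(\<integral>\<^sup>+t\<in>{T..2*T}. f t ^ 2 \<partial>lborel) \<le> ennreal M"
    and fm [measurable]: "f \<in> borel_measurable borel"
  shows "(\<integral>\<^sup>+t\<in>{T..2*T}. f t \<partial>lborel) \<le> ennreal (T + M)"
proof -
  have x: "x \<le> 1 + x ^ 2" for x :: ennreal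
  proof (cases "x \<le> 1")
    case True thus ?thesis by (rule order_trans) simp
  next
    case False
    hence "x * 1 \<le> x * x" by (intro mult_left_mono) auto
    also have "\<dots> \<le> 1 + x ^ 2" by (simp add: power2_eq_square)
    finally show ?thesis by simp
  qed
  have "(\<integral>\<^sup>+t\<in>{T..2*T}. f t \<partial>lborel) \<le> (\<integral>\<^sup>+t. indicator {T..2*T} t + f t ^ 2 * indicator {T..2*T} t \<partial>lborel)"
    using x by (intro nn_integral_mono) (auto simp: indicator_def)
  also have "\<dots> = (\<integral>\<^sup>+t. indicator {T..2*T} t \<partial>lborel) + (\<integral>\<^sup>+t\<in>{T..2*T}. f t ^ 2 \<partial>lborel)"
    by (intro nn_integral_add) measurable
  also have "\<dots> \<le> ennreal T + ennreal M" using f T by (intro add_mono) auto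
  also have "\<dots> = ennreal (T + M)" using T M by (simp add: ennreal_plus)
  finally show ?thesis .
qed

lemma blk_zero: "blk G Yn 0 t = 0"
  unfolding blk_def by simp

text \<open>P stands for T^\<delta> and majorizes every logarithm as well as the number of blocks.
  Blocks with 4^i <= 2 T carry two integrals F each. For m = 1, 2 the mean square suffices at every
  Y; for m = 3, 4 \<open>high_moment\<close> requires a large Y, and it is enough to demand this of
  the smallest block 2^i0.\<close>

lemma J_moment:
  assumes T: "1 \<le> T" and P: "1 \<le> P" and G: "0 < G"
    and n: "6 * T \<le> real n" "real n \<le> 7 * T * P" "n \<le> 2 ^ I" and I: "i0 \<le> I" "real I + 1 \<le> P"
    and ln: "ln (real n + 1) \<le> P" "1 + ln (2 * T + 2) \<le> P"
    and e1: "(real n)\<^sup>2 * exp (- G\<^sup>2 / (16 * (2 ^ i0)\<^sup>2)) \<le> 1"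
    and e2: "G\<^sup>2 * exp (- (real n)\<^sup>2 / (8 * G\<^sup>2)) \<le> 1"
    and m: "m = 1 \<or> m = 2 \<or> m = 3 \<and> T \<le> (2 ^ i0) ^ 7 \<or> m = 4 \<and> T \<le> (2 ^ i0) ^ 5"
  shows "(\<integral>\<^sup>+t\<in>{T..2*T}. J 1 t G ^ m \<partial>lborel) \<le> ennreal (10 ^ 26 * P ^ 18 * T)"
proof -
  define L where "L = 1 + ln (2 * T + 2)"
  define \<Lambda> where "\<Lambda> = 6912 * (64 * L^3) * L"
  have L1: "1 \<le> L" "L \<le> P" unfolding L_def using T ln by auto
  have Lam: "1 \<le> \<Lambda>" "\<Lambda> \<le> 442368 * P ^ 4"
  proof -
    have e: "\<Lambda> = 442368 * L ^ 4" unfolding \<Lambda>_def by (simp add: eval_nat_numeral)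
    have "1 \<le> L ^ 4" using L1(1) by (rule one_le_power)
    thus "1 \<le> \<Lambda>" unfolding e by simp
    show "\<Lambda> \<le> 442368 * P ^ 4" unfolding e using L1 by (intro mult_left_mono power_mono) auto
  qed
  define Q where "Q = {i\<in>{i0..<I}. (2 ^ i)\<^sup>2 \<le> 2 * T}"
  have Qf: "finite Q" unfolding Q_def by simp
  have Qc: "real (card Q) \<le> P"
  proof -
    have "card Q \<le> card {i0..<I}" unfolding Q_def by (intro card_mono) auto
    hence "card Q \<le> I" by simp
    thus ?thesis using I by linarith
  qed
  \<comment> \<open>The Boolean selects between the pairs (\<open>bet\<close>, \<open>Z\<close>) and
    (\<open>alp\<close>, \<open>DU\<close>).\<close>
  define f where "f = (\<lambda>a t. norm (if snd a then halasz.F (2 ^ fst a) (bet T G) (Z (blk_len T (fst a))) t else halasz.F (2 ^ fst a) (alp G) (DU (blk_len T (fst a))) t))"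
  define M where "M = 81 * (real I + 1) * \<Lambda> ^ 3 * T"
  have M0: "0 \<le> M" unfolding M_def using Lam T by simp
  have TI: "T \<le> 4 ^ I"
  proof -
    have "T \<le> real n" using n T by linarith
    also have "\<dots> \<le> real (2 ^ I)" using n by (simp only: of_nat_le_iff)
    also have "\<dots> = 2 ^ I" by simp
    also have "\<dots> \<le> 4 ^ I" by (intro power_mono) auto
    finally show ?thesis .
  qed
  have hal: "f a \<in> borel_measurable borel \<and> (\<integral>\<^sup>+t\<in>{T..2*T}. ennreal (f a t ^ m) \<partial>lborel) \<le> ennreal M" if a: "a \<in> Q \<times> UNIV" for a
  proof -
    obtain i b where ab: "a = (i, b)" by (cases a)
    have i: "i0 \<le> i" "(2 ^ i)\<^sup>2 \<le> 2 * T" using a unfolding ab Q_def by auto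
    have gen: "h \<in> borel_measurable borel \<and> (\<integral>\<^sup>+t\<in>{T..2*T}. ennreal (norm (h t) ^ m) \<partial>lborel) \<le> ennreal M"
      if ht: "halasz_T (real (2 ^ i)) bb \<beta> \<beta>' (2 ^ i) \<phi> q T (64 * L^3) L (6912 * (64 * L^3) * L)" and h: "h = halasz.F (real (2 ^ i)) \<beta> \<phi>" for bb \<beta> \<beta>' \<phi> q h
    proof -
      interpret H: halasz_T "real (2 ^ i)" bb \<beta> \<beta>' "2 ^ i" \<phi> q T "64 * L^3" L "6912 * (64 * L^3) * L" by (rule ht)
      have "(\<integral>\<^sup>+t\<in>{T..2*T}. ennreal (norm (h t) ^ m) \<partial>lborel) \<le> ennreal M"
      proof (cases "m = 1 \<or> m = 2")
        case True
        have sq: "(\<integral>\<^sup>+t\<in>{T..2*T}. ennreal ((norm (h t))\<^sup>2) \<partial>lborel) \<le> ennreal (\<Lambda> * T)"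
        proof -
          have "(\<integral>\<^sup>+t\<in>{T..2*T}. ennreal ((norm (h t))\<^sup>2) \<partial>lborel) \<le> ennreal (\<Lambda> * T / real (2 ^ i))"
            unfolding h \<Lambda>_def by (rule H.mean_square_T)
          moreover have "\<Lambda> * T / real (2 ^ i) \<le> \<Lambda> * T / 1" using Lam T by (intro divide_left_mono) auto
          ultimately show ?thesis by (simp only: div_by_1) (blast intro: order_trans ennreal_leI)
        qed
        have LM: "T + \<Lambda> * T \<le> M"
        proof -
          have "T + \<Lambda> * T \<le> 81 * 1 * \<Lambda> ^ 1 * T" using Lam T mult_right_mono[of 1 \<Lambda> T] by simp
          also have "\<dots> \<le> M" unfolding M_def using Lam T by (intro mult_right_mono mult_mono power_increasing) auto
          finally show ?thesis .
        qed
        from True show ?thesis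
        proof
          assume m2: "m = 2"
          have "\<Lambda> * T \<le> M" using LM T by linarith
          thus ?thesis unfolding m2 using sq by (blast intro: order_trans ennreal_leI)
        next
          assume m1: "m = 1"
          have [measurable]: "h \<in> borel_measurable borel" unfolding h by (rule H.F_measurable)
          have "(\<integral>\<^sup>+t\<in>{T..2*T}. ennreal (norm (h t)) \<partial>lborel) \<le> ennreal (T + \<Lambda> * T)"
          proof (rule set_nn_integral_le_square)
            show "(\<integral>\<^sup>+t\<in>{T..2*T}. (ennreal (norm (h t)))\<^sup>2 \<partial>lborel) \<le> ennreal (\<Lambda> * T)"
              using sq by (simp add: ennreal_power)
          qed (use T Lam in auto)
          thus ?thesis unfolding m1 power_one_right using LM by (blast intro: order_trans ennreal_leI)
        qed
      next
        case False
        have le: "((2::real) ^ i0) ^ k \<le> (real (2 ^ i)) ^ k" for k using i by (intro power_mono) (auto intro: power_increasing)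
        have "m = 3 \<and> T \<le> (real (2 ^ i)) ^ 7 \<or> m = 4 \<and> T \<le> (real (2 ^ i)) ^ 5"
          using m False le[of 7] le[of 5] by linarith
        from H.high_moment[OF this TI] show ?thesis unfolding M_def h \<Lambda>_def .
      qed
      thus ?thesis unfolding h using H.F_measurable by blast
    qed
    note hp = halasz_T_pair[OF T, of "2 ^ i" "blk_len T i" L]
    have hp: "halasz_T (real (2 ^ i)) (8 * T / (real (2 ^ i))^3) (bet T G) (bet' T G) (2 ^ i) (Z (blk_len T i)) ((1 + ln (real (blk_len T i) + 1))^3 / real (blk_len T i)) T (64 * L^3) L (6912 * (64 * L^3) * L)"
      "halasz_T (real (2 ^ i)) (2 / real (2 ^ i)) (alp G) (alp' G) (2 ^ i) (DU (blk_len T i)) (real (blk_len T i) * (1 + ln (real (blk_len T i) + 1))^3) T (64 * L^3) L (6912 * (64 * L^3) * L)"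
      by (rule hp; use i in \<open>simp add: blk_len_def L_def\<close>)+
    show ?thesis
    proof (cases b)
      case True
      have "f a = (\<lambda>t. norm (halasz.F (real (2 ^ i)) (bet T G) (Z (blk_len T i)) t))" unfolding f_def ab using True by simp
      thus ?thesis using gen[OF hp(1) refl] by auto
    next
      case False
      have "f a = (\<lambda>t. norm (halasz.F (real (2 ^ i)) (alp G) (DU (blk_len T i)) t))" unfolding f_def ab using False by simp
      thus ?thesis using gen[OF hp(2) refl] by auto
    qed
  qed
  \<comment> \<open>The constant collects 4 * 1938 P^2 from the blocks, 60000 + 6400 from
    \<open>J_le\<close>, and terms linear in P.\<close>
  define B where "B = 100000 * P\<^sup>2"
  have Jb: "J 1 t G \<le> ennreal (B + 4 * (\<Sum>a\<in>Q \<times> UNIV. f a t))" if t: "t \<in> {T..2*T}" for t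
  proof -
    have t': "T \<le> t" "t \<le> 2 * T" using t by auto
    have nT: "real n / T \<le> 7 * P" using n T by (simp add: divide_le_eq mult_ac)
    have bl: "norm (blk G (2 ^ i) (blk_len T i) t) \<le> 146 * P + (if i \<in> Q then f (i, True) t + f (i, False) t else 0)" if i: "i \<in> {i0..<I}" for i
    proof (cases "i \<in> Q")
      case True
      hence Y: "(real (2 ^ i))\<^sup>2 \<le> 2 * T" unfolding Q_def by simp
      have Y1: "1 \<le> (2::nat) ^ i" by simp
      have NNe: "blk_len T i = nat \<lfloor>2 * T / (real (2 ^ i))\<^sup>2\<rfloor>" unfolding blk_len_def by simp
      note hp = halasz_T_pair[OF T Y1 Y NNe L_def]
      have "norm (blk G (2 ^ i) (blk_len T i) t) \<le> 140 + 6 * L + norm (halasz.F (real (2 ^ i)) (bet T G) (Z (blk_len T i)) t) + norm (halasz.F (real (2 ^ i)) (alp G) (DU (blk_len T i)) t)"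
        by (rule blk_decomp[OF T t' Y1 Y hp(1-3)])
      moreover have "f (i, True) t = norm (halasz.F (real (2 ^ i)) (bet T G) (Z (blk_len T i)) t)" "f (i, False) t = norm (halasz.F (real (2 ^ i)) (alp G) (DU (blk_len T i)) t)"
        unfolding f_def by simp_all
      ultimately show ?thesis using True L1 P by simp
    next
      case False
      hence "2 * T < (2 ^ i)\<^sup>2" using i unfolding Q_def by auto
      hence "2 * T / (2 ^ i)\<^sup>2 < 1" by simp
      hence "blk_len T i = 0" unfolding blk_len_def by simp
      thus ?thesis using False P by (simp add: blk_zero)
    qed
    have sf: "(\<Sum>i\<in>{i0..<I}. if i \<in> Q then f (i, True) t + f (i, False) t else 0) = (\<Sum>a\<in>Q \<times> UNIV. f a t)"
    proof -
      have "(\<Sum>i\<in>{i0..<I}. if i \<in> Q then f (i, True) t + f (i, False) t else 0) = (\<Sum>i\<in>{i0..<I} \<inter> Q. f (i, True) t + f (i, False) t)"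
        by (rule sum.inter_restrict[symmetric]) simp
      also have "{i0..<I} \<inter> Q = Q" unfolding Q_def by auto
      also have "(\<Sum>i\<in>Q. f (i, True) t + f (i, False) t) = (\<Sum>i\<in>Q. \<Sum>b\<in>UNIV. f (i, b) t)" by (simp add: UNIV_bool add.commute)
      also have "\<dots> = (\<Sum>a\<in>Q \<times> UNIV. f a t)" by (simp add: sum.cartesian_product)
      finally show ?thesis .
    qed
    have "norm (offdiag n G t) \<le> 1 + (\<Sum>i\<in>{i0..<I}. 256 * real n / T + norm (blk G (2 ^ i) (blk_len T i) t))"
      using offdiag_bound[OF T t' n(1,3) I(1), of G] e1 by linarith
    \<comment> \<open>1938 = 7 * 256 + 146, where 146 P bounds 140 + 6 L.\<close>
    also have "(\<Sum>i\<in>{i0..<I}. 256 * real n / T + norm (blk G (2 ^ i) (blk_len T i) t)) \<le> (\<Sum>i\<in>{i0..<I}. 1938 * P + (if i \<in> Q then f (i, True) t + f (i, False) t else 0))"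
    proof (rule sum_mono)
      fix i assume i: "i \<in> {i0..<I}"
      have "256 * real n / T \<le> 1792 * P" using nT by simp
      thus "256 * real n / T + norm (blk G (2 ^ i) (blk_len T i) t) \<le> 1938 * P + (if i \<in> Q then f (i, True) t + f (i, False) t else 0)"
        using bl[OF i] by linarith
    qed
    also have "\<dots> = real (I - i0) * (1938 * P) + (\<Sum>a\<in>Q \<times> UNIV. f a t)" unfolding sum.distrib sf by simp
    finally have S: "norm (offdiag n G t) \<le> 1 + (real (I - i0) * (1938 * P) + (\<Sum>a\<in>Q \<times> UNIV. f a t))" by simp
    have "real (I - i0) * (1938 * P) \<le> P * (1938 * P)" using I P by (intro mult_right_mono) auto
    hence S': "norm (offdiag n G t) \<le> 1 + 1938 * P\<^sup>2 + (\<Sum>a\<in>Q \<times> UNIV. f a t)" using S by (simp add: power2_eq_square)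
    have PP: "P \<le> P\<^sup>2" "1 \<le> P\<^sup>2" using P mult_mono[of 1 P 1 P] mult_left_mono[of 1 P P] by (simp_all add: power2_eq_square)
    have "480 * real n / T \<le> 3360 * P" using nT by simp
    moreover have "6400 * G\<^sup>2 * exp (- (real n)\<^sup>2 / (8 * G\<^sup>2)) \<le> 6400" using e2 by simp
    ultimately have "2 * (1 + ln (real n + 1) + 2 * norm (offdiag n G t)) + 60000 + 480 * real n / T + 6400 * G\<^sup>2 * exp (- (real n)\<^sup>2 / (8 * G\<^sup>2)) \<le> B + 4 * (\<Sum>a\<in>Q \<times> UNIV. f a t)"
      using S' ln(1) PP unfolding B_def distrib_left by linarith
    moreover have "4 * T \<le> real n" using n T by linarith
    ultimately show ?thesis using J_le[OF T t' G, of n] by (blast intro: order_trans ennreal_leI)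
  qed
  have cA: "card (Q \<times> (UNIV :: bool set)) = 2 * card Q" by (simp add: card_cartesian_product)
  have m24: "1 \<le> m" "m \<le> 4" using m by auto
  have "(\<integral>\<^sup>+t\<in>{T..2*T}. J 1 t G ^ m \<partial>lborel) \<le> ennreal (2 ^ m * B ^ m * T + 8 ^ m * real (card (Q \<times> (UNIV :: bool set))) ^ m * (real (card (Q \<times> (UNIV :: bool set))) * M))"
  proof (rule moment_sum_bound)
    show "J 1 t G \<le> ennreal (B + 4 * (\<Sum>a\<in>Q \<times> UNIV. f a t))" if "t \<in> {T..2*T}" for t by (rule Jb[OF that])
    show "0 \<le> f a t" for a t unfolding f_def by simp
    show "f a \<in> borel_measurable borel" "(\<integral>\<^sup>+t\<in>{T..2*T}. ennreal (f a t ^ m) \<partial>lborel) \<le> ennreal M" if "a \<in> Q \<times> UNIV" for a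
      using hal[OF that] by auto
  qed (use Qf m24 T M0 P in \<open>auto simp: B_def\<close>)
  \<comment> \<open>The exponent 18: M contributes P^13, and the number 2 card Q <= 2 P of functions
    enters with power m + 1 <= 5.\<close>
  also have "\<dots> \<le> ennreal (10 ^ 26 * P ^ 18 * T)"
  proof (rule ennreal_leI)
    have B1: "1 \<le> B" unfolding B_def using one_le_power[OF P, of 2] by linarith
    have "2 ^ m * B ^ m * T \<le> 2 ^ 4 * B ^ 4 * T" using m24 B1 T by (intro mult_right_mono mult_mono power_increasing) auto
    also have "\<dots> = 16 * 10 ^ 20 * P ^ 8 * T" unfolding B_def by (simp add: power_mult_distrib flip: power_mult)
    also have "\<dots> \<le> 16 * 10 ^ 20 * P ^ 18 * T" using P T by (intro mult_right_mono mult_left_mono power_increasing) auto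
    finally have a: "2 ^ m * B ^ m * T \<le> 16 * 10 ^ 20 * P ^ 18 * T" .
    have "M \<le> 81 * P * (442368 * P ^ 4) ^ 3 * T"
      unfolding M_def using I Lam T P by (intro mult_right_mono mult_mono power_mono) auto
    hence M': "M \<le> 81 * 442368 ^ 3 * P ^ 13 * T" by (simp add: power_mult_distrib eval_nat_numeral mult_ac)
    have c: "real (2 * card Q) \<le> 2 * P" using Qc by simp
    have "real (2 * card Q) ^ m \<le> (2 * P) ^ m" using c by (intro power_mono) auto
    also have "\<dots> \<le> (2 * P) ^ 4" using P m24 by (intro power_increasing) auto
    finally have c4: "real (2 * card Q) ^ m \<le> (2 * P) ^ 4" .
    have "8 ^ m * real (2 * card Q) ^ m * (real (2 * card Q) * M) \<le> 8 ^ 4 * (2 * P) ^ 4 * ((2 * P) * (81 * 442368 ^ 3 * P ^ 13 * T))"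
      using m24 c c4 M' M0 P T by (intro mult_mono power_increasing) auto
    also have "\<dots> = (8 ^ 4 * 16 * 2 * 81 * 442368 ^ 3) * P ^ 18 * T" by (simp add: power_mult_distrib eval_nat_numeral mult_ac)
    also have "\<dots> \<le> 10 ^ 25 * P ^ 18 * T" using P T by (intro mult_right_mono) auto
    finally have "8 ^ m * real (2 * card Q) ^ m * (real (2 * card Q) * M) \<le> 10 ^ 25 * P ^ 18 * T" .
    moreover have "u + v \<le> 10 ^ 26 * X" if "u \<le> 16 * 10 ^ 20 * X" "v \<le> 10 ^ 25 * X" "0 \<le> X" for u v X :: real
      using that by simp
    moreover have "0 \<le> P ^ 18 * T" using P T by simp
    ultimately show "2 ^ m * B ^ m * T + 8 ^ m * real (card (Q \<times> (UNIV :: bool set))) ^ m * (real (card (Q \<times> (UNIV :: bool set))) * M) \<le> 10 ^ 26 * P ^ 18 * T"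
      using a unfolding cA by (metis mult.assoc)
  qed
  finally show ?thesis .
qed

section \<open>Choice of the parameters\<close>

lemma eventually_powr_bounds:
  fixes \<delta> \<epsilon> :: real
  assumes d: "0 < \<delta>" "\<delta> \<le> 1/100" and e: "\<delta> < \<epsilon>"
  shows "\<forall>\<^sub>F T in at_top. 7 * T * T powr \<delta> \<le> T^3 \<and> 3 * log 2 T + 2 \<le> T powr \<delta> \<and> ln (T^3 + 1) \<le> T powr \<delta> \<and>
    1 + ln (2 * T + 2) \<le> T powr \<delta> \<and> T^6 * exp (- (T powr \<delta>)\<^sup>2 / 16) \<le> 1 \<and> 2 \<le> T powr (\<epsilon> - \<delta>) \<and> 1 \<le> T"
proof -
  \<comment> \<open>Monotonicity in the exponent reduces the first inequality to the fixed exponent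
    1/100.\<close>
  have 1: "\<forall>\<^sub>F T in at_top. 7 * T * T powr (1/100) \<le> (T::real)^3" by real_asymp
  have "\<forall>\<^sub>F T in at_top. 7 * T * T powr \<delta> \<le> T^3"
    using 1 eventually_ge_at_top[of 1]
  proof eventually_elim
    case (elim T)
    have "7 * T * T powr \<delta> \<le> 7 * T * T powr (1/100)" using elim d by (intro mult_left_mono powr_mono) auto
    thus ?case using elim by linarith
  qed
  moreover have "\<forall>\<^sub>F T in at_top. 3 * log 2 T + 2 \<le> T powr \<delta>" using d by real_asymp
  moreover have "\<forall>\<^sub>F T in at_top. ln (T^3 + 1) \<le> T powr \<delta>" using d by real_asymp
  moreover have "\<forall>\<^sub>F T in at_top. 1 + ln (2 * T + 2) \<le> T powr \<delta>" using d by real_asymp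
  moreover have "\<forall>\<^sub>F T in at_top. T^6 * exp (- (T powr \<delta>)\<^sup>2 / 16) \<le> 1" using d by real_asymp
  moreover have "\<forall>\<^sub>F T in at_top. 2 \<le> T powr (\<epsilon> - \<delta>)"
  proof -
    define a where "a = \<epsilon> - \<delta>"
    have "0 < a" using e unfolding a_def by simp
    hence "\<forall>\<^sub>F T in at_top. 2 \<le> T powr a" by real_asymp
    thus ?thesis unfolding a_def .
  qed
  moreover have "\<forall>\<^sub>F T in at_top. 1 \<le> (T::real)" by (rule eventually_ge_at_top)
  ultimately show ?thesis by eventually_elim simp
qed

text \<open>With y the smallest dyadic ratio, y > G/(2 T^\<delta>) >= T^(1/k) T^(\<epsilon> -
  \<delta>)/2; the factor 2 lost by dyadic rounding is repaid by T^(\<epsilon> - \<delta>) >=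
  2.\<close>

lemma powr_inverse_le:
  assumes T: "1 \<le> T" and k: "0 < k" and G: "T powr (1 / real k + \<epsilon>) \<le> G" and e: "2 \<le> T powr (\<epsilon> - \<delta>)"
    and i: "G / T powr \<delta> < 2 * y"
  shows "T \<le> y ^ k"
proof -
  have "T powr (1 / real k) * 2 \<le> T powr (1 / real k) * T powr (\<epsilon> - \<delta>)" using e by (intro mult_left_mono) auto
  also have "\<dots> = T powr (1 / real k + \<epsilon>) / T powr \<delta>" by (simp add: powr_diff powr_add)
  also have "\<dots> \<le> G / T powr \<delta>" using G by (intro divide_right_mono) auto
  finally have y: "T powr (1 / real k) \<le> y" using i by linarith
  have "T = (T powr (1 / real k)) ^ k" using T k by (simp add: powr_powr flip: powr_realpow)
  also have "\<dots> \<le> y ^ k" using y by (intro power_mono) auto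
  finally show ?thesis .
qed

lemma J_moment_powr:
  assumes d: "0 < \<delta>" and e: "\<delta> \<le> \<epsilon>"
    and T: "7 * T * T powr \<delta> \<le> T^3" "3 * log 2 T + 2 \<le> T powr \<delta>" "ln (T^3 + 1) \<le> T powr \<delta>"
      "1 + ln (2 * T + 2) \<le> T powr \<delta>" "T^6 * exp (- (T powr \<delta>)\<^sup>2 / 16) \<le> 1" "2 \<le> T powr (\<epsilon> - \<delta>)" "1 \<le> T"
    and G: "T powr \<epsilon> \<le> G" "G \<le> T"
    and m: "m = 1 \<or> m = 2 \<or> m = 3 \<and> T powr (1/7 + \<epsilon>) \<le> G \<or> m = 4 \<and> T powr (1/5 + \<epsilon>) \<le> G"
  shows "(\<integral>\<^sup>+t\<in>{T..2*T}. J 1 t G ^ m \<partial>lborel) \<le> ennreal (10 ^ 26 * (T powr \<delta>) ^ 18 * T)"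
proof -
  define P where "P = T powr \<delta>"
  have P1: "1 \<le> P" unfolding P_def using T(7) d by (intro ge_one_powr_ge_zero) auto
  have GP: "P \<le> G" unfolding P_def using G(1) e T(7) by (meson order_trans powr_mono)
  have G0: "0 < G" using GP P1 by linarith
  \<comment> \<open>One factor P more than \<open>offdiag_bound\<close> demands, so that n >= G P
    and the Gaussian tail beyond n is negligible even for G = T.\<close>
  define n where "n = nat \<lceil>6 * T * P\<rceil>"
  \<comment> \<open>2^I >= T^3 >= n, while I + 1 stays below P.\<close>
  define I where "I = nat \<lceil>3 * log 2 T\<rceil>"
  \<comment> \<open>The largest exponent with P * 2^i0 <= G: the smaller ratios are then damped by
    exp (- P^2/16), and G/P < 2 * 2^i0 provides the lower bound on Y.\<close>
  define i0 where "i0 = nat \<lfloor>log 2 (G / P)\<rfloor>"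
  have TP: "T * 1 \<le> T * P" using T(7) P1 by (intro mult_left_mono) auto
  have n1: "6 * T * P \<le> real n" unfolding n_def by linarith
  have n2: "real n \<le> 6 * T * P + 1"
  proof -
    have "0 \<le> 6 * T * P" using T(7) P1 by simp
    thus ?thesis unfolding n_def by linarith
  qed
  have n3: "real n \<le> 7 * T * P" using n2 TP T(7) by linarith
  have n4: "6 * T \<le> real n" using n1 TP by linarith
  have n5: "real n \<le> T ^ 3" using n3 T(1) unfolding P_def by linarith
  have l0: "0 \<le> log 2 T" using T(7) by simp
  have I1: "3 * log 2 T \<le> real I" "real I \<le> 3 * log 2 T + 1" unfolding I_def using l0 by linarith+
  have "T ^ 3 = 2 powr (3 * log 2 T)"
  proof -
    have "2 powr (3 * log 2 T) = (2 powr log 2 T) powr 3" by (simp add: powr_powr mult.commute)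
    also have "\<dots> = T ^ 3" using T(7) by simp
    finally show ?thesis by simp
  qed
  also have "\<dots> \<le> 2 powr real I" using I1 by (intro powr_mono) auto
  finally have TI: "T ^ 3 \<le> 2 ^ I" by (simp add: powr_realpow)
  have nI: "n \<le> 2 ^ I"
  proof -
    have "real n \<le> 2 ^ I" using n5 TI by (rule order_trans)
    hence "real n \<le> real (2 ^ I)" by (simp only: of_nat_power of_nat_numeral)
    thus ?thesis by (simp only: of_nat_le_iff)
  qed
  have GP1: "1 \<le> G / P" using GP P1 by (simp add: le_divide_eq)
  have lG: "0 \<le> log 2 (G / P)" using GP1 by simp
  have i1: "real i0 \<le> log 2 (G / P)" "log 2 (G / P) < real i0 + 1" unfolding i0_def using lG by linarith+
  have GPe: "2 powr (log 2 (G / P)) = G / P" using GP1 by (intro powr_log_cancel) auto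
  have i2: "2 ^ i0 \<le> G / P"
  proof -
    have "2 ^ i0 = 2 powr real i0" by (simp add: powr_realpow)
    also have "\<dots> \<le> 2 powr (log 2 (G / P))" using i1 by (intro powr_mono) auto
    finally show ?thesis unfolding GPe .
  qed
  have i3: "G / P < 2 * 2 ^ i0"
  proof -
    have "2 powr (log 2 (G / P)) < 2 powr (real i0 + 1)" using i1 by (intro powr_less_mono) auto
    also have "\<dots> = 2 * 2 ^ i0" by (simp add: powr_add powr_realpow)
    finally show ?thesis unfolding GPe .
  qed
  have iI: "i0 \<le> I"
  proof -
    have "G / P \<le> G / 1" using G0 P1 by (intro divide_left_mono) auto
    also have "\<dots> \<le> T ^ 1" using G by simp
    also have "\<dots> \<le> T ^ 3" using T(7) by (intro power_increasing) auto
    finally have "(2::real) ^ i0 \<le> 2 ^ I" using i2 TI by linarith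
    thus ?thesis by simp
  qed
  have T6: "(T ^ 3)\<^sup>2 = T ^ 6" by (simp flip: power_mult)
  have "(real n)\<^sup>2 * exp (- G\<^sup>2 / (16 * (2 ^ i0)\<^sup>2)) \<le> T ^ 6 * exp (- P\<^sup>2 / 16)"
  proof (intro mult_mono)
    show "(real n)\<^sup>2 \<le> T ^ 6" unfolding T6[symmetric] using n5 by (intro power_mono) auto
    have "P * 2 ^ i0 \<le> G" using i2 P1 by (simp add: le_divide_eq mult.commute)
    hence "(P * 2 ^ i0)\<^sup>2 \<le> G\<^sup>2" using P1 by (intro power_mono) auto
    hence "P\<^sup>2 / 16 \<le> G\<^sup>2 / (16 * (2 ^ i0)\<^sup>2)" by (simp add: power_mult_distrib le_divide_eq)
    thus "exp (- G\<^sup>2 / (16 * (2 ^ i0)\<^sup>2)) \<le> exp (- P\<^sup>2 / 16)" by simp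
  qed (use T(7) in auto)
  hence e1: "(real n)\<^sup>2 * exp (- G\<^sup>2 / (16 * (2 ^ i0)\<^sup>2)) \<le> 1" using T(5) unfolding P_def by linarith
  have "G\<^sup>2 * exp (- (real n)\<^sup>2 / (8 * G\<^sup>2)) \<le> T ^ 6 * exp (- P\<^sup>2 / 16)"
  proof (intro mult_mono)
    have "G\<^sup>2 \<le> T\<^sup>2" using G G0 by (intro power_mono) auto
    also have "\<dots> \<le> T ^ 6" using T(7) by (intro power_increasing) auto
    finally show "G\<^sup>2 \<le> T ^ 6" .
    have "1 * (G * P) \<le> 6 * (T * P)" using G G0 P1 by (intro mult_mono) auto
    hence "G * P \<le> real n" using n1 by simp
    hence "(G * P)\<^sup>2 \<le> (real n)\<^sup>2" using G0 P1 by (intro power_mono) auto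
    hence "G\<^sup>2 * P\<^sup>2 \<le> (real n)\<^sup>2" by (simp only: power_mult_distrib)
    moreover have "0 \<le> G\<^sup>2 * P\<^sup>2" by simp
    moreover have "P\<^sup>2 / 16 * (8 * G\<^sup>2) = (G\<^sup>2 * P\<^sup>2) / 2" by simp
    ultimately have "P\<^sup>2 / 16 * (8 * G\<^sup>2) \<le> (real n)\<^sup>2" by linarith
    hence "P\<^sup>2 / 16 \<le> (real n)\<^sup>2 / (8 * G\<^sup>2)" using G0 by (subst pos_le_divide_eq) auto
    thus "exp (- (real n)\<^sup>2 / (8 * G\<^sup>2)) \<le> exp (- P\<^sup>2 / 16)" by simp
  qed (use T(7) in auto)
  hence e2: "G\<^sup>2 * exp (- (real n)\<^sup>2 / (8 * G\<^sup>2)) \<le> 1" using T(5) unfolding P_def by linarith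
  have lnn: "ln (real n + 1) \<le> P"
  proof -
    have "ln (real n + 1) \<le> ln (T ^ 3 + 1)" using n5 by (intro ln_mono) auto
    thus ?thesis using T(3) unfolding P_def by (rule order_trans)
  qed
  have "m = 1 \<or> m = 2 \<or> m = 3 \<and> T \<le> (2 ^ i0) ^ 7 \<or> m = 4 \<and> T \<le> (2 ^ i0) ^ 5"
    using m powr_inverse_le[OF T(7), of 7 \<epsilon> G \<delta> "2 ^ i0"] powr_inverse_le[OF T(7), of 5 \<epsilon> G \<delta> "2 ^ i0"] T(6) i3
    unfolding P_def by auto
  from J_moment[OF T(7) P1 G0 n4 n3 nI iI _ lnn _ e1 e2 this] show ?thesis
    using I1 T(2,4) unfolding P_def by simp
qed

theorem theorem1:
  fixes \<epsilon> :: real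
  assumes "\<epsilon> > 0"
  shows "\<exists>C::real. \<exists>T0::real. \<forall>T \<ge> T0. \<forall>G::real. \<forall>m::nat.
     ((m = 1 \<or> m = 2) \<and> T powr \<epsilon> \<le> G \<and> G \<le> T)
     \<or> (m = 3 \<and> T powr (1/7 + \<epsilon>) \<le> G \<and> G \<le> T)
     \<or> (m = 4 \<and> T powr (1/5 + \<epsilon>) \<le> G \<and> G \<le> T)
     \<longrightarrow> (\<integral>\<^sup>+ t\<in>{T..2*T}. (J 1 t G) ^ m \<partial>lborel) \<le> ennreal (C * T powr (1 + \<epsilon>))"
proof -
  \<comment> \<open>18 \<delta> <= \<epsilon> absorbs the loss (T^\<delta>)^18, and \<delta> <=
    1/100 keeps the length n of the polynomial below T^3.\<close>
  define \<delta> where "\<delta> = min \<epsilon> 1 / 100"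
  have d: "0 < \<delta>" "\<delta> \<le> 1/100" "\<delta> < \<epsilon>" "18 * \<delta> \<le> \<epsilon>" unfolding \<delta>_def using assms by auto
  obtain T0 where T0: "\<And>T. T0 \<le> T \<Longrightarrow> 7 * T * T powr \<delta> \<le> T^3 \<and> 3 * log 2 T + 2 \<le> T powr \<delta> \<and> ln (T^3 + 1) \<le> T powr \<delta> \<and>
    1 + ln (2 * T + 2) \<le> T powr \<delta> \<and> T^6 * exp (- (T powr \<delta>)\<^sup>2 / 16) \<le> 1 \<and> 2 \<le> T powr (\<epsilon> - \<delta>) \<and> 1 \<le> T"
    using eventually_powr_bounds[OF d(1-3)] unfolding eventually_at_top_linorder by blast
  have "(\<integral>\<^sup>+ t\<in>{T..2*T}. (J 1 t G) ^ m \<partial>lborel) \<le> ennreal (10 ^ 26 * T powr (1 + \<epsilon>))"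
    if "T0 \<le> T" and h: "((m = 1 \<or> m = 2) \<and> T powr \<epsilon> \<le> G \<and> G \<le> T)
     \<or> (m = 3 \<and> T powr (1/7 + \<epsilon>) \<le> G \<and> G \<le> T)
     \<or> (m = 4 \<and> T powr (1/5 + \<epsilon>) \<le> G \<and> G \<le> T)" for T G :: real and m :: nat
  proof -
    have T: "7 * T * T powr \<delta> \<le> T^3" "3 * log 2 T + 2 \<le> T powr \<delta>" "ln (T^3 + 1) \<le> T powr \<delta>"
      "1 + ln (2 * T + 2) \<le> T powr \<delta>" "T^6 * exp (- (T powr \<delta>)\<^sup>2 / 16) \<le> 1" "2 \<le> T powr (\<epsilon> - \<delta>)" "1 \<le> T"
      using T0[OF that(1)] by blast+
    have "T powr \<epsilon> \<le> T powr (1/7 + \<epsilon>)" "T powr \<epsilon> \<le> T powr (1/5 + \<epsilon>)" using T(7) by (intro powr_mono; simp)+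
    hence G: "T powr \<epsilon> \<le> G" "G \<le> T" using h by auto
    have "(\<integral>\<^sup>+t\<in>{T..2*T}. J 1 t G ^ m \<partial>lborel) \<le> ennreal (10 ^ 26 * (T powr \<delta>) ^ 18 * T)"
      using h d(3) by (intro J_moment_powr[OF d(1) _ T G]) auto
    also have "\<dots> \<le> ennreal (10 ^ 26 * T powr (1 + \<epsilon>))"
    proof (rule ennreal_leI)
    have "(T powr \<delta>) ^ 18 * T = T powr (18 * \<delta>) * T powr 1"
      using T(7) by (simp add: powr_powr mult.commute flip: powr_realpow)
    also have "\<dots> = T powr (18 * \<delta> + 1)" by (rule powr_add[symmetric])
    also have "\<dots> \<le> T powr (1 + \<epsilon>)" using d(4) T(7) by (intro powr_mono) auto
    finally show "10 ^ 26 * (T powr \<delta>) ^ 18 * T \<le> 10 ^ 26 * T powr (1 + \<epsilon>)" by simp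
    qed
    finally show ?thesis .
  qed
  thus ?thesis by blast
qed

end
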